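(* Let $q\ge 3$ and let $a,b$ be distinct reduced residues modulo $q$. Let $\chi$ be a nonprincipal Dirichlet character modulo $q$ with $\chi(a)\ne\chi(b)$, and put $\xi=\arg(\chi(a)-\chi(b))\in[0,2\pi)$. Let $\tfrac12<\sigma<1$, $0<\delta<\sigma-\tfrac12$ and $A>0$, and let $\mathcal{B}=\mathcal{B}(\xi,\sigma,\delta,A)$ be a multiset of complex numbers constructed as described in the context. Suppose that $L(\rho,\chi)=0$ for all $\rho\in\mathcal{B}$ (with the multiplicities of $\mathcal{B}$), that $L(s,\chi)$ has no other zeros in the region $\{s:\operatorname{Re}(s)\ge\sigma-\delta,\ \operatorname{Im}(s)\ge 0\}$, and that for every other nonprincipal character $\chi'$ modulo $q$, $L(s,\chi')\ne 0$ in the region $\{s:\operatorname{Re}(s)\ge\sigma-\delta,\ \operatorname{Im}(s)\ge0\}$. Then $$\lim_{X\to\infty}\frac{\operatorname{meas}(P_{q;a,b}\cap[2,X])}{X}=0.$$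
   Context: For $(a,q)=1$, $\pi(x;q,a)$ denotes the number of primes $p\le x$ with $p\equiv a\pmod q$. $P_{q;a,b}$ is the set of real $x\ge2$ with $\pi(x;q,a)>\pi(x;q,b)$, and $\operatorname{meas}$ is Lebesgue measure. Construction of $\mathcal{B}(\xi,\sigma,\delta,A)$: for each integer $j\ge1$ choose real numbers $\gamma_j,\delta_j,\theta_j$ with $\exp(j^8)\le\gamma_j\le 2\exp(j^8)$, $|\delta_j-j^{-8}|\le j^{-9}$, and $|\theta_j-(\xi-\pi/2)j^{-16}|\le j^{-17}$. Choose $j_0$ so large that for all $j\ge j_0$ one has $\gamma_j>A$ and $\delta_j\le\delta$. Then $\mathcal{B}$ is the multiset union, over integers $j\ge j_0$ and $1\le k\le j^3$, of $m(k,j)=k(j^3+1-k)$ copies of $\rho_{j,k}=\sigma-\delta_j+i(k\gamma_j+\theta_j)$.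
   Formalization: The formal theorem also requires δ_j > 0 for all j ≥ j_0; this excludes only j_0 = 1 with δ_1 = 0, where a single zero on Re(s) = σ would dominate, the race would oscillate, and the claimed limit would fail. *)

theory Defs
  imports "HOL-Complex_Analysis.Complex_Analysis" "HOL-Number_Theory.Number_Theory"
begin

definition dirichlet_character :: "nat \<Rightarrow> (nat \<Rightarrow> complex) \<Rightarrow> bool" where
  "dirichlet_character q chi \<longleftrightarrow>
     (\<forall>m n. chi (m * n) = chi m * chi n) \<and>
     (\<forall>n. chi (n + q) = chi n) \<and>
     (\<forall>n. chi n \<noteq> 0 \<longleftrightarrow> coprime n q)"

definition principal_character :: "nat \<Rightarrow> nat \<Rightarrow> complex" where
  "principal_character q n = (if coprime n q then 1 else 0)"

definition dirichlet_series :: "(nat \<Rightarrow> complex) \<Rightarrow> complex \<Rightarrow> complex" where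
  "dirichlet_series chi s = (\<Sum>n. chi (Suc n) / of_nat (Suc n) powr s)"

definition continues_to_half_plane ::
  "nat \<Rightarrow> (nat \<Rightarrow> complex) \<Rightarrow> real \<Rightarrow> (complex \<Rightarrow> complex) \<Rightarrow> bool" where
  "continues_to_half_plane q chi c f \<longleftrightarrow>
     f holomorphic_on ({s. c < Re s} - (if chi = principal_character q then {1} else {})) \<and>
     (\<forall>s. 1 < Re s \<longrightarrow> f s = dirichlet_series chi s)"

text \<open>
  L(s, chi) is the analytic continuation of the Dirichlet series from Re s > 1, carried out
  inside half planes Re s > c (punctured at the pole s = 1 of a principal character). By the
  lemma dirichlet_L_eqI below, the value depends neither on the half plane nor on the
  continuation.
\<close>
definition dirichlet_L :: "nat \<Rightarrow> (nat \<Rightarrow> complex) \<Rightarrow> complex \<Rightarrow> complex" where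
  "dirichlet_L q chi s =
     (THE z. \<exists>f c. continues_to_half_plane q chi c f \<and> c < Re s \<and> f s = z)"

lemma continues_to_half_plane_unique:
  assumes f: "continues_to_half_plane q chi c f" "c < Re s"
      and g: "continues_to_half_plane q chi d g" "d < Re s"
      and s: "chi = principal_character q \<Longrightarrow> s \<noteq> 1"
  shows "f s = g s"
proof -
  define P where "P = (if chi = principal_character q then {1::complex} else {})"
  define S where "S = {s. max c d < Re s} - P"
  have half: "open {s. max c d < Re s}" "connected {s. max c d < Re s}"
    by (rule open_halfspace_Re_gt, rule convex_connected, rule convex_halfspace_Re_gt)
  have S: "open S" "connected S"
    using half connected_open_delete[OF half, of 1] by (auto simp: S_def P_def)
  define T where "T = {s. max 1 (max c d) < Re s}"
  have 1: "T \<subseteq> S" by (auto simp: T_def S_def P_def)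
  have 2: "open T" unfolding T_def by (rule open_halfspace_Re_gt)
  have "complex_of_real (max 1 (max c d) + 1) \<in> T" by (simp add: T_def max_def)
  hence 3: "T \<noteq> {}" by blast
  have hf: "f holomorphic_on S" "g holomorphic_on S"
    using f(1) g(1) by (auto simp: continues_to_half_plane_def S_def P_def
        intro: holomorphic_on_subset)
  have sS: "s \<in> S" using f g s by (auto simp: S_def P_def)
  have eq: "f z = g z" if "z \<in> T" for z
    using that f(1) g(1) by (auto simp: continues_to_half_plane_def T_def)
  show ?thesis
    by (rule analytic_continuation_open[OF 2 S(1) 3 S(2) 1 hf eq sS])
qed

lemma dirichlet_L_eqI:
  assumes "continues_to_half_plane q chi c f" "c < Re s"
      and "chi = principal_character q \<Longrightarrow> s \<noteq> 1"
  shows "dirichlet_L q chi s = f s"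
  unfolding dirichlet_L_def
  by (rule the_equality) (use assms continues_to_half_plane_unique in blast)+

definition primes_pi :: "real \<Rightarrow> nat \<Rightarrow> nat \<Rightarrow> nat" where
  "primes_pi x q a = card {p::nat. prime p \<and> real p \<le> x \<and> [p = a] (mod q)}"

definition race_set :: "nat \<Rightarrow> nat \<Rightarrow> nat \<Rightarrow> real set" where
  "race_set q a b = {x. 2 \<le> x \<and> primes_pi x q a > primes_pi x q b}"

definition barrier_point ::
  "real \<Rightarrow> (nat \<Rightarrow> real) \<Rightarrow> (nat \<Rightarrow> real) \<Rightarrow> (nat \<Rightarrow> real) \<Rightarrow> nat \<Rightarrow> nat \<Rightarrow> complex" where
  "barrier_point \<sigma> \<gamma> d \<theta> j k = Complex (\<sigma> - d j) (real k * \<gamma> j + \<theta> j)"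

definition barrier_parameters ::
  "real \<Rightarrow> (nat \<Rightarrow> real) \<Rightarrow> (nat \<Rightarrow> real) \<Rightarrow> (nat \<Rightarrow> real) \<Rightarrow> bool" where
  "barrier_parameters \<xi> \<gamma> d \<theta> \<longleftrightarrow>
     (\<forall>j\<ge>1. exp (real j ^ 8) \<le> \<gamma> j \<and> \<gamma> j \<le> 2 * exp (real j ^ 8) \<and>
            \<bar>d j - 1 / real j ^ 8\<bar> \<le> 1 / real j ^ 9 \<and>
            \<bar>\<theta> j - (\<xi> - pi / 2) / real j ^ 16\<bar> \<le> 1 / real j ^ 17)"

text \<open>
  The multisets of the construction are infinite, so they are represented by their multiplicity
  functions; the multiset union adds the multiplicities of coinciding points.
\<close>
definition barrier_multiplicity ::
  "real \<Rightarrow> (nat \<Rightarrow> real) \<Rightarrow> (nat \<Rightarrow> real) \<Rightarrow> (nat \<Rightarrow> real) \<Rightarrow> nat \<Rightarrow> complex \<Rightarrow> nat" where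
  "barrier_multiplicity \<sigma> \<gamma> d \<theta> j0 s =
     (\<Sum>(j, k) \<in> {(j, k). j0 \<le> j \<and> 1 \<le> k \<and> k \<le> j ^ 3 \<and> barrier_point \<sigma> \<gamma> d \<theta> j k = s}.
        k * (j ^ 3 + 1 - k))"

text \<open>The sum above never runs over an infinite index set.\<close>
lemma finite_barrier_indices:
  assumes "barrier_parameters \<xi> \<gamma> d \<theta>" "1 \<le> j0"
  shows "finite {(j, k). j0 \<le> j \<and> 1 \<le> k \<and> k \<le> j ^ 3 \<and> barrier_point \<sigma> \<gamma> d \<theta> j k = s}"
proof -
  define N where "N = nat \<lceil>Im s + \<bar>\<xi> - pi / 2\<bar> + 1\<rceil>"
  have "j \<le> N" if j: "j0 \<le> j" "1 \<le> k" "barrier_point \<sigma> \<gamma> d \<theta> j k = s" for j k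
  proof -
    have j1: "1 \<le> j" using j assms by simp
    have A: "exp (real j ^ 8) \<le> \<gamma> j" "\<bar>\<theta> j - (\<xi> - pi / 2) / real j ^ 16\<bar> \<le> 1 / real j ^ 17"
      using assms(1) j1 by (auto simp: barrier_parameters_def)
    have "1 / real j ^ 17 \<le> 1" "\<bar>(\<xi> - pi / 2) / real j ^ 16\<bar> \<le> \<bar>\<xi> - pi / 2\<bar>"
      using j1 by (auto simp: abs_divide divide_le_eq mult_left_le one_le_power mult_le_cancel_left1)
    hence th: "- \<theta> j \<le> \<bar>\<xi> - pi / 2\<bar> + 1" using A(2) by linarith
    have "real j \<le> real j ^ 8" using j1 by (intro self_le_power) auto
    also have "\<dots> \<le> exp (real j ^ 8)" using exp_ge_add_one_self[of "real j ^ 8"] by linarith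
    also have "\<dots> \<le> \<gamma> j" by (fact A(1))
    also have "\<dots> \<le> real k * \<gamma> j"
    proof -
      have "0 < \<gamma> j" using A(1) exp_gt_zero[of "real j ^ 8"] by linarith
      thus ?thesis using j(2) by simp
    qed
    finally have "real j \<le> Im s - \<theta> j" using j(3) by (auto simp: barrier_point_def)
    thus ?thesis using th unfolding N_def by linarith
  qed
  moreover have "j ^ 3 \<le> N ^ 3" if "j \<le> N" for j using that by (rule power_mono) simp
  ultimately have "{(j, k). j0 \<le> j \<and> 1 \<le> k \<and> k \<le> j ^ 3 \<and> barrier_point \<sigma> \<gamma> d \<theta> j k = s}
      \<subseteq> {..N} \<times> {..N ^ 3}" by (fastforce intro: order_trans)
  thus ?thesis by (rule finite_subset) simp
qed

text \<open>
  The condition 0 < d j on the used indices is automatic for j at least 2, and says that the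
  points lie strictly to the left of Re s = sigma. It excludes only the degenerate choice
  j0 = 1, d 1 = 0, where a single point on the line Re s = sigma would dominate all others.
\<close>
definition is_barrier ::
  "real \<Rightarrow> real \<Rightarrow> real \<Rightarrow> real \<Rightarrow> (complex \<Rightarrow> nat) \<Rightarrow> bool" where
  "is_barrier \<xi> \<sigma> \<delta> A B \<longleftrightarrow>
     (\<exists>\<gamma> d \<theta> j0. barrier_parameters \<xi> \<gamma> d \<theta> \<and> 1 \<le> j0 \<and>
        (\<forall>j\<ge>j0. A < \<gamma> j \<and> 0 < d j \<and> d j \<le> \<delta>) \<and>
        B = barrier_multiplicity \<sigma> \<gamma> d \<theta> j0)"

end

theory Submission
  imports Defs "HOL-Real_Asymp.Real_Asymp"
begin

text \<open>
  The explicit formula expresses \<open>pi(x; q, a) - pi(x; q, b)\<close>, multiplied by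
  \<open>totient q * ln x\<close>, as \<open>- 2 * Re (cnj (chi a - chi b) * (\<Sum>\<rho>. x\<^sup>\<rho> / \<rho>))\<close> over
  the zeros in the barrier, up to an error \<open>O(x\<^sup>c)\<close> with \<open>c < \<sigma>\<close>. The
  multiplicities \<open>k * (j\<^sup>3 + 1 - k)\<close> and the choice of \<open>\<theta> j\<close> turn the contribution of
  the j-th layer into \<open>2 * \<bar>chi a - chi b\<bar> * x powr (\<sigma> - d j) / \<gamma> j\<close> times the real part of
  \<open>(\<Sum>k. (j\<^sup>3 + 1 - k) * exp (\<i> * k * \<gamma> j * ln x))\<close>, the Fejer kernel without its constant term:
  this is about \<open>- j\<^sup>3 / 2\<close> unless \<open>\<gamma> j * ln x\<close> is close to a multiple of \<open>2 * pi\<close>.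
  Only layers with \<open>j ^ 16\<close> close to \<open>ln x\<close> matter, and outside a set of small density their weighted
  average is negative by Markov's inequality.
\<close>

section \<open>Orthogonality of Dirichlet characters\<close>

text \<open>Put L = ln x. Layer j has size about exp (\<sigma> L - L / j^8 - j^8), so layers with
  j^16 near L dominate, at x^\<sigma> exp (-2 sqrt L); this loss is subexponential in L, so errors
  O(x^c) with c < \<sigma> stay negligible. Setting L = P^64 makes the relevant scales integral
  powers of P: j is near P^4, the optimal exponent is 2 P^32, the tolerance in \<open>d\<close> and
  the rounding of j cost a multiple of P^28, and leaving the window |L / j^16 - 1| <= 1/P costs
  about P^30. Inside the window \<theta> j L is within O(1/P) of \<xi> - pi/2, which cancels the
  argument of \<open>chi a - chi b\<close> and the factor 1/i hidden in 1/\<rho>. The obstacle is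
  the remaining phase error O(1/P): it multiplies the whole kernel, which near a resonance is much
  larger than j^3. The window holds about P^3 layers, so resonances of width 1/P cannot be discarded
  for all of them by adding measures; this is affordable only at width P^-5. The wider ones are
  controlled through the average of 1 / |1 - cis (\<gamma> j ln x)| over layers, weighted by their
  size: its mean is O(ln P), while a value of order P is tolerable.\<close>

lemma character_one:
  assumes "dirichlet_character q chi" shows "chi 1 = 1"
proof -
  have "chi 1 * 1 = chi 1 * chi 1"
    using assms unfolding dirichlet_character_def by (metis mult_1_right)
  moreover have "chi 1 \<noteq> 0"
    using assms unfolding dirichlet_character_def by (metis coprime_1_left)
  ultimately show ?thesis by (simp only: mult_cancel_left) simp
qed

lemma character_mod:
  assumes "dirichlet_character q chi" shows "chi (n mod q) = chi n"
proof -
  have "chi (m + k * q) = chi m" for m k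
  proof (induction k)
    case (Suc k)
    have "chi (m + Suc k * q) = chi ((m + k * q) + q)" by (simp add: algebra_simps)
    also have "\<dots> = chi (m + k * q)" using assms unfolding dirichlet_character_def by blast
    finally show ?case using Suc by simp
  qed simp
  from this[of "n mod q" "n div q"] show ?thesis by (simp add: mod_div_mult_eq)
qed

lemma character_cong:
  assumes "dirichlet_character q chi" "[m = n] (mod q)" shows "chi m = chi n"
  using character_mod[OF assms(1), of m] character_mod[OF assms(1), of n] assms(2)
  by (simp add: cong_def)

lemma character_mult:
  assumes "dirichlet_character q chi" shows "chi (m * n) = chi m * chi n"
  using assms by (simp add: dirichlet_character_def)

lemma character_eq_0_iff:
  assumes "dirichlet_character q chi" shows "chi n = 0 \<longleftrightarrow> \<not> coprime n q"
  using assms unfolding dirichlet_character_def by blast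

lemma character_power:
  assumes "dirichlet_character q chi" shows "chi (n ^ k) = chi n ^ k"
  by (induction k) (use character_one[OF assms] character_mult[OF assms] in auto)

lemma norm_character:
  assumes "dirichlet_character q chi" "0 < q" "coprime n q" shows "norm (chi n) = 1"
proof -
  have "chi n ^ totient q = 1"
    using character_cong[OF assms(1) euler_theorem[OF assms(3)]] character_power[OF assms(1)]
      character_one[OF assms(1)] by simp
  hence "norm (chi n) ^ totient q = 1" by (metis norm_one norm_power)
  thus ?thesis using assms(2)
    by (metis norm_ge_zero power_eq_imp_eq_base power_one totient_gt_0_iff zero_le_one)
qed

lemma norm_character_le_1:
  assumes "dirichlet_character q chi" "0 < q" shows "norm (chi n) \<le> 1"
  using norm_character[OF assms, of n] character_eq_0_iff[OF assms(1), of n]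
  by (cases "coprime n q") auto

lemma dirichlet_character_cnj:
  "dirichlet_character q chi \<Longrightarrow> dirichlet_character q (\<lambda>n. cnj (chi n))"
  by (simp add: dirichlet_character_def)

lemma principal_character_cnj_iff:
  "(\<lambda>n. cnj (chi n)) = principal_character q \<longleftrightarrow> chi = principal_character q"
proof -
  have "cnj (principal_character q n) = principal_character q n" for n
    by (simp add: principal_character_def)
  thus ?thesis unfolding fun_eq_iff by (metis complex_cnj_cnj)
qed

lemma nonprincipal_character_neq_1:
  assumes "dirichlet_character q chi" "chi \<noteq> principal_character q"
  obtains g where "coprime g q" "chi g \<noteq> 1"
proof -
  from assms(2) obtain n where "chi n \<noteq> principal_character q n" by blast
  thus ?thesis using that character_eq_0_iff[OF assms(1), of n]
    by (auto simp: principal_character_def split: if_splits)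
qed

lemma bij_betw_mult_mod:
  fixes g q :: nat
  assumes "coprime g q" "0 < q"
  shows "bij_betw (\<lambda>n. g * n mod q) {..<q} {..<q}"
proof -
  have "inj_on (\<lambda>n. g * n mod q) {..<q}"
  proof (rule inj_onI)
    fix m n assume mn: "m \<in> {..<q}" "n \<in> {..<q}" "g * m mod q = g * n mod q"
    hence "[g * m = g * n] (mod q)" by (simp add: cong_def)
    hence "[m = n] (mod q)" using assms(1) by (simp add: cong_mult_lcancel_nat)
    thus "m = n" using mn by (simp add: cong_def)
  qed
  moreover have "(\<lambda>n. g * n mod q) ` {..<q} \<subseteq> {..<q}" using assms by auto
  ultimately show ?thesis
    unfolding bij_betw_def using endo_inj_surj[of "{..<q}"] by blast
qed

lemma sum_nonprincipal_character:
  assumes "dirichlet_character q chi" "chi \<noteq> principal_character q" "0 < q"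
  shows "(\<Sum>n<q. chi n) = 0"
proof -
  obtain g where g: "coprime g q" "chi g \<noteq> 1"
    using nonprincipal_character_neq_1[OF assms(1,2)] .
  have "chi g * (\<Sum>n<q. chi n) = (\<Sum>n<q. chi (g * n mod q))"
    by (simp add: sum_distrib_left character_mod[OF assms(1)] character_mult[OF assms(1)])
  also have "\<dots> = (\<Sum>n<q. chi n)"
    by (rule sum.reindex_bij_betw[OF bij_betw_mult_mod[OF g(1) assms(3)]])
  finally show ?thesis using g(2) by simp
qed

lemma character_orthogonality:
  assumes "dirichlet_character q chi" "dirichlet_character q psi" "0 < q"
  shows "(\<Sum>n<q. chi n * cnj (psi n)) =
           (if chi = psi then of_nat (card {n. n < q \<and> coprime n q}) else 0)"
proof (cases "chi = psi")
  case True
  have "chi n * cnj (psi n) = (if coprime n q then 1 else 0)" for n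
    using norm_character[OF assms(1,3), of n] character_eq_0_iff[OF assms(1), of n] True
    by (auto simp: complex_norm_square[symmetric])
  hence "(\<Sum>n<q. chi n * cnj (psi n)) = (\<Sum>n\<in>{..<q}. if coprime n q then 1 else 0)"
    by simp
  also have "\<dots> = of_nat (card {n \<in> {..<q}. coprime n q})"
    by (subst sum.inter_filter[symmetric]) auto
  finally show ?thesis using True by simp
next
  case False
  define eta where "eta = (\<lambda>n. chi n * cnj (psi n))"
  have "dirichlet_character q eta"
    using assms(1,2) by (auto simp: dirichlet_character_def eta_def)
  moreover have "eta \<noteq> principal_character q"
  proof
    assume eq: "eta = principal_character q"
    have "chi n = psi n" for n
    proof (cases "coprime n q")
      case True
      have "chi n * cnj (psi n) = 1"
        using fun_cong[OF eq, of n] True by (simp add: eta_def principal_character_def)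
      moreover have "psi n * cnj (psi n) = 1"
        using norm_character[OF assms(2,3) True] by (simp add: complex_norm_square[symmetric])
      ultimately show ?thesis
        by (metis mult_cancel_right zero_neq_one mult_zero_right)
    next
      case False
      thus ?thesis using character_eq_0_iff assms(1,2) by metis
    qed
    thus False using False by blast
  qed
  ultimately show ?thesis
    using sum_nonprincipal_character[of q eta] assms(3) False by (simp add: eta_def)
qed

section \<open>Characters span the functions on the units, by simultaneous diagonalisation\<close>

definition unit_function :: "nat \<Rightarrow> (nat \<Rightarrow> complex) \<Rightarrow> bool" where
  "unit_function q f \<longleftrightarrow> (\<forall>n. f (n mod q) = f n) \<and> (\<forall>n. \<not> coprime n q \<longrightarrow> f n = 0)"

text \<open>A joint eigenvector of all unit translations is a multiple of a character. Diagonalising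
  the translations therefore replaces any structure theory or counting of the character
  group.\<close>

definition translation_eigen :: "nat set \<Rightarrow> (nat \<Rightarrow> complex) \<Rightarrow> bool" where
  "translation_eigen A f \<longleftrightarrow> (\<forall>g\<in>A. \<exists>w. \<forall>n. f (g * n) = w * f n)"

lemma unit_function_cong:
  assumes "unit_function q f" "[m = n] (mod q)" shows "f m = f n"
  using assms by (metis cong_def unit_function_def)

text \<open>Orthogonality of the k-th roots of unity: it makes the projections used in
  \<open>translation_eigen_split\<close> add up to the identity.\<close>

lemma sum_cis_multiples:
  fixes i k :: nat
  assumes "i < k"
  shows "(\<Sum>l<k. cis (- (2 * pi * real l / real k)) ^ i) = (if i = 0 then of_nat k else 0)"
proof (cases "i = 0")
  case False
  define z where "z = cis (- (2 * pi * real i / real k))"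
  have eq: "cis (- (2 * pi * real l / real k)) ^ i = z ^ l" for l
    unfolding z_def Complex.DeMoivre by (rule arg_cong[of _ _ cis]) (simp add: field_simps)
  have z1: "z \<noteq> 1"
  proof
    assume "z = 1"
    hence "cos (2 * pi * real i / real k) = 1" by (auto simp: z_def complex_eq_iff)
    then obtain n :: int where "2 * pi * real i / real k = of_int n * (2 * pi)"
      by (auto simp: cos_one_2pi_int)
    hence "real i = of_int n * real k" using assms by (simp add: field_simps)
    hence "int i = n * int k" by (metis of_int_eq_iff of_int_mult of_int_of_nat_eq)
    hence "int k dvd int i" by simp
    hence "k \<le> i" using False by (simp add: dvd_imp_le)
    thus False using assms by simp
  qed
  have "z ^ k = cis (- (2 * pi * real i))"
    unfolding z_def Complex.DeMoivre by (rule arg_cong[of _ _ cis]) (use assms in \<open>simp add: field_simps\<close>)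
  also have "\<dots> = 1"
    using cos_int_2pin[of "int i"] sin_int_2pin[of "int i"]
    by (simp add: complex_eq_iff)
  finally show ?thesis using False z1 geometric_sum[OF z1, of k] by (simp add: eq)
qed auto

text \<open>
  A translation \<open>n \<mapsto> g * n\<close> of the units has finite order, so averaging against the
  corresponding roots of unity projects onto its eigenspaces.
\<close>
lemma translation_eigen_split:
  assumes f: "unit_function q f" "translation_eigen A f" and g: "coprime g q" and q: "0 < q"
  shows "\<exists>hs. (\<forall>h\<in>set hs. unit_function q h \<and> translation_eigen (insert g A) h) \<and>
              (\<forall>n. f n = (\<Sum>h\<leftarrow>hs. h n))"
proof -
  define k where "k = totient q"
  have k: "0 < k" using q by (simp add: k_def)
  define w where "w = (\<lambda>l::nat. cis (- (2 * pi * real l / real k)))"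
  define h where "h = (\<lambda>l n. (\<Sum>i<k. w l ^ i * f (g ^ i * n)) / of_nat k)"
  have gk: "f (g ^ k * n) = f n" for n
  proof -
    have "[g ^ k * n = 1 * n] (mod q)"
      unfolding k_def by (intro cong_mult euler_theorem g) auto
    thus ?thesis using unit_function_cong[OF f(1)] by fastforce
  qed
  have wk: "w l ^ k = 1" for l
  proof -
    have "w l ^ k = cis (- (2 * pi * real l))"
      unfolding w_def Complex.DeMoivre by (rule arg_cong[of _ _ cis]) (use k in \<open>simp add: field_simps\<close>)
    thus ?thesis using cos_int_2pin[of "int l"] sin_int_2pin[of "int l"]
      by (simp add: complex_eq_iff)
  qed
  have w0: "w l \<noteq> 0" for l by (simp add: w_def)
  have cancel: "x = inverse v * y" if "v * x = y" "v \<noteq> 0" for v x y :: complex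
    using that by (simp add: field_simps)
  have "unit_function q (h l)" for l
    unfolding unit_function_def
  proof (intro conjI allI impI)
    fix n
    have "f (g ^ i * (n mod q)) = f (g ^ i * n)" for i
      by (rule unit_function_cong[OF f(1)]) (simp add: cong_def mod_mult_right_eq)
    thus "h l (n mod q) = h l n" by (simp add: h_def)
  next
    fix n assume "\<not> coprime n q"
    hence "f (g ^ i * n) = 0" for i using f(1) by (simp add: unit_function_def)
    thus "h l n = 0" by (simp add: h_def)
  qed
  moreover have "translation_eigen (insert g A) (h l)" for l
    unfolding translation_eigen_def
  proof (intro ballI)
    fix u assume "u \<in> insert g A"
    moreover have "\<exists>v. \<forall>n. h l (u * n) = v * h l n" if "u \<in> A"
    proof -
      from f(2) that obtain v where v: "\<And>n. f (u * n) = v * f n"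
        unfolding translation_eigen_def by blast
      have "f (g ^ i * (u * n)) = v * f (g ^ i * n)" for i n
        using v[of "g ^ i * n"] by (simp add: mult_ac)
      hence "h l (u * n) = v * h l n" for n
        by (simp add: h_def sum_distrib_left mult_ac)
      thus ?thesis by blast
    qed
    moreover have "h l (g * n) = inverse (w l) * h l n" for n
    proof -
      \<comment> \<open>Multiplication by \<open>w l\<close> shifts the summation index by one. The
        sum then wraps around, because \<open>w l ^ k = 1\<close> and translation by
        \<open>g ^ k\<close> is trivial.\<close>
      have "w l * (\<Sum>i<k. w l ^ i * f (g ^ i * (g * n))) = (\<Sum>i<k. w l ^ Suc i * f (g ^ Suc i * n))"
        by (simp add: sum_distrib_left mult_ac)
      also have "\<dots> = (\<Sum>i<Suc k. w l ^ i * f (g ^ i * n)) - f n"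
        by (subst sum.lessThan_Suc_shift) simp
      also have "\<dots> = (\<Sum>i<k. w l ^ i * f (g ^ i * n))"
        using gk[of n] wk[of l] by simp
      finally have "(\<Sum>i<k. w l ^ i * f (g ^ i * (g * n)))
          = inverse (w l) * (\<Sum>i<k. w l ^ i * f (g ^ i * n))"
        by (rule cancel[OF _ w0])
      thus ?thesis by (simp add: h_def)
    qed
    ultimately show "\<exists>v. \<forall>n. h l (u * n) = v * h l n" by blast
  qed
  moreover have "f n = (\<Sum>h'\<leftarrow>map h [0..<k]. h' n)" for n
  proof -
    have "(\<Sum>h'\<leftarrow>map h [0..<k]. h' n) = (\<Sum>l<k. h l n)"
      by (simp add: sum_list_distinct_conv_sum_set atLeast0LessThan comp_def)
    also have "\<dots> = (\<Sum>l<k. \<Sum>i<k. w l ^ i * f (g ^ i * n)) / of_nat k"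
      by (simp add: h_def sum_divide_distrib)
    also have "(\<Sum>l<k. \<Sum>i<k. w l ^ i * f (g ^ i * n)) = (\<Sum>i<k. (\<Sum>l<k. w l ^ i) * f (g ^ i * n))"
      by (subst sum.swap) (simp add: sum_distrib_right)
    also have "\<dots> = (\<Sum>i<k. (if i = 0 then of_nat k else 0) * f (g ^ i * n))"
      by (rule sum.cong) (use sum_cis_multiples in \<open>auto simp: w_def\<close>)
    also have "\<dots> = (\<Sum>i\<in>{0}. (if i = 0 then of_nat k else 0) * f (g ^ i * n))"
      by (rule sum.mono_neutral_right) (use k in auto)
    finally show ?thesis using k by simp
  qed
  ultimately show ?thesis by (intro exI[of _ "map h [0..<k]"]) auto
qed

text \<open>Each new translation splits the pieces found so far; translations commute, so a piece
  keeps the eigenvalues it already has. Pieces may vanish or coincide, hence a list and not a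
  set.\<close>

lemma translation_eigen_decomposition:
  assumes "finite A" "\<And>g. g \<in> A \<Longrightarrow> coprime g q" "0 < q" "unit_function q f"
  shows "\<exists>hs. (\<forall>h\<in>set hs. unit_function q h \<and> translation_eigen A h) \<and>
              (\<forall>n. f n = (\<Sum>h\<leftarrow>hs. h n))"
  using assms(1,2)
proof (induction A rule: finite_induct)
  case empty
  show ?case using assms(4) by (intro exI[of _ "[f]"]) (auto simp: translation_eigen_def)
next
  case (insert g A)
  then obtain hs where hs: "\<forall>h\<in>set hs. unit_function q h \<and> translation_eigen A h"
    "\<And>n. f n = (\<Sum>h\<leftarrow>hs. h n)" by auto
  have "\<forall>h\<in>set hs. \<exists>ks. (\<forall>h'\<in>set ks. unit_function q h' \<and> translation_eigen (insert g A) h') \<and>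
              (\<forall>n. h n = (\<Sum>h'\<leftarrow>ks. h' n))"
  proof
    fix h assume "h \<in> set hs"
    thus "\<exists>ks. (\<forall>h'\<in>set ks. unit_function q h' \<and> translation_eigen (insert g A) h') \<and>
              (\<forall>n. h n = (\<Sum>h'\<leftarrow>ks. h' n))"
      using translation_eigen_split[of q h A g] hs(1) insert.prems assms(3) by simp
  qed
  from bchoice[OF this] obtain K where "\<forall>h\<in>set hs. (\<forall>h'\<in>set (K h). unit_function q h' \<and>
      translation_eigen (insert g A) h') \<and> (\<forall>n. h n = (\<Sum>h'\<leftarrow>K h. h' n))" by blast
  hence K: "\<And>h h'. h \<in> set hs \<Longrightarrow> h' \<in> set (K h) \<Longrightarrow>
       unit_function q h' \<and> translation_eigen (insert g A) h'"
    "\<And>h n. h \<in> set hs \<Longrightarrow> h n = (\<Sum>h'\<leftarrow>K h. h' n)"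
    by blast+
  have sl: "(\<Sum>h'\<leftarrow>concat (map K hs'). h' n) = (\<Sum>h\<leftarrow>hs'. \<Sum>h'\<leftarrow>K h. h' n)" for n hs'
    by (induction hs') auto
  have "f n = (\<Sum>h'\<leftarrow>concat (map K hs). h' n)" for n
    unfolding sl hs(2) by (rule arg_cong[of _ _ sum_list], rule map_cong[OF refl]) (rule K(2))
  thus ?case using K(1) by (intro exI[of _ "concat (map K hs)"]) auto
qed

text \<open>The eigenvalue at g times \<open>h 1\<close> is \<open>h g\<close>, so the eigenvalue
  equation says that h / h(1) is multiplicative. If \<open>h 1 = 0\<close>, then h vanishes
  identically and any character serves with coefficient 0.\<close>

lemma joint_eigenfunction_character:
  assumes h: "unit_function q h" "translation_eigen {g. g < q \<and> coprime g q} h" and q: "0 < q"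
  shows "\<exists>c chi. dirichlet_character q chi \<and> (\<forall>n. h n = c * chi n)"
proof -
  have "\<exists>v. \<forall>n. h (g * n) = v * h n" if g: "coprime g q" for g
  proof -
    have "coprime (g mod q) q" "g mod q < q" using g q by auto
    then obtain v where v: "\<And>n. h (g mod q * n) = v * h n"
      using h(2) unfolding translation_eigen_def by blast
    have "h (g * n) = v * h n" for n
      using v[of n] unit_function_cong[OF h(1), of "g mod q * n" "g * n"]
      by (simp add: cong_def mod_mult_left_eq)
    thus ?thesis by blast
  qed
  hence "\<forall>g. \<exists>v. coprime g q \<longrightarrow> (\<forall>n. h (g * n) = v * h n)" by blast
  then obtain v where v: "\<And>g n. coprime g q \<Longrightarrow> h (g * n) = v g * h n"
    unfolding choice_iff by blast
  have hg: "h g = v g * h 1" if "coprime g q" for g using v[OF that, of 1] by simp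
  have h0: "h n = 0" if "\<not> coprime n q" for n using h(1) that by (simp add: unit_function_def)
  show ?thesis
  proof (cases "h 1 = 0")
    case True
    have "h n = 0" for n using hg[of n] h0[of n] True by (cases "coprime n q") auto
    moreover have "coprime (n + q) q \<longleftrightarrow> coprime n q" for n
      by (simp only: coprime_iff_gcd_eq_1 gcd_add1)
    hence "dirichlet_character q (principal_character q)"
      by (auto simp: dirichlet_character_def principal_character_def)
    ultimately show ?thesis by (intro exI[of _ 0] exI[of _ "principal_character q"]) auto
  next
    case False
    define chi where "chi = (\<lambda>n. h n / h 1)"
    have vg: "v g \<noteq> 0" if g: "coprime g q" for g
    proof -
      have "[g * g ^ (totient q - 1) = 1] (mod q)"
        using euler_theorem[OF g] q by (simp flip: power_Suc)
      hence "h 1 = v g * h (g ^ (totient q - 1))"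
        using unit_function_cong[OF h(1)] v[OF g] by metis
      thus ?thesis using False by auto
    qed
    have "chi (m * n) = chi m * chi n" for m n
    proof (cases "coprime m q")
      case True
      thus ?thesis using v[OF True, of n] hg[OF True] False by (simp add: chi_def)
    next
      case F: False
      thus ?thesis using h0[of m] h0[of "m * n"] by (simp add: chi_def)
    qed
    moreover have "chi (n + q) = chi n" for n
      using unit_function_cong[OF h(1), of "n + q" n] by (simp add: chi_def cong_def)
    moreover have "chi n \<noteq> 0 \<longleftrightarrow> coprime n q" for n
      using hg[of n] vg[of n] h0[of n] False by (auto simp: chi_def)
    ultimately have "dirichlet_character q chi" by (simp add: dirichlet_character_def)
    thus ?thesis using False by (intro exI[of _ "h 1"] exI[of _ chi]) (auto simp: chi_def)
  qed
qed

lemma unit_function_character_sum: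
  assumes "unit_function q f" "0 < q"
  shows "\<exists>C c. finite C \<and> (\<forall>chi\<in>C. dirichlet_character q chi) \<and>
               (\<forall>n. f n = (\<Sum>chi\<in>C. c chi * chi n))"
proof -
  obtain hs where hs: "\<forall>h\<in>set hs. unit_function q h \<and> translation_eigen {g. g < q \<and> coprime g q} h"
      "\<And>n. f n = (\<Sum>h\<leftarrow>hs. h n)"
    using translation_eigen_decomposition[OF _ _ assms(2,1), of "{g. g < q \<and> coprime g q}"]
    by fastforce
  have "\<exists>C c. finite C \<and> (\<forall>chi\<in>C. dirichlet_character q chi) \<and>
               (\<forall>n. (\<Sum>h\<leftarrow>hs. h n) = (\<Sum>chi\<in>C. c chi * chi n))"
    using hs(1)
  proof (induction hs)
    case Nil
    show ?case by (intro exI[of _ "{}"]) auto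
  next
    case (Cons h hs)
    then obtain C c where C: "finite C" "\<forall>chi\<in>C. dirichlet_character q chi"
      "\<And>n. (\<Sum>h\<leftarrow>hs. h n) = (\<Sum>chi\<in>C. c chi * chi n)" by auto
    obtain c0 chi0 where c0: "dirichlet_character q chi0" "\<And>n. h n = c0 * chi0 n"
      using joint_eigenfunction_character[of q h] Cons.prems assms(2) by auto
    \<comment> \<open>The new character \<open>chi0\<close> may already belong to \<open>C\<close>;
      extending \<open>c\<close> by 0 lets both summands run over \<open>insert chi0 C\<close> in
      either case.\<close>
    define c1 where "c1 = (\<lambda>chi. if chi \<in> C then c chi else 0)"
    have "(\<Sum>chi\<in>C. c chi * chi n) = (\<Sum>chi\<in>insert chi0 C. c1 chi * chi n)" for n
      by (rule sum.mono_neutral_cong_left) (use C(1) in \<open>auto simp: c1_def\<close>)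
    hence "(\<Sum>h\<leftarrow>h # hs. h n) = (\<Sum>chi\<in>insert chi0 C. (if chi = chi0 then c0 else 0) * chi n)
              + (\<Sum>chi\<in>insert chi0 C. c1 chi * chi n)" for n
      using C(1) by (simp add: C(3) c0(2) if_distrib[of "\<lambda>x. x * _"] sum.delta cong: if_cong)
    hence "(\<Sum>h\<leftarrow>h # hs. h n)
        = (\<Sum>chi\<in>insert chi0 C. ((if chi = chi0 then c0 else 0) + c1 chi) * chi n)" for n
      by (simp only: sum.distrib[symmetric] distrib_right)
    thus ?case using C(1,2) c0(1)
      by (intro exI[of _ "insert chi0 C"] exI[of _ "\<lambda>chi. (if chi = chi0 then c0 else 0) + c1 chi"]) auto
  qed
  thus ?thesis using hs(2) by simp
qed

text \<open>The decomposition yields some finite set of characters, not known to contain all of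
  them. Orthogonality computes the coefficients and shows that a character missing from the set
  takes the same value at a and b, so that nothing is lost.\<close>

lemma residue_difference_character_expansion:
  assumes "1 < q" "coprime a q" "coprime b q"
  obtains C where "finite C" "\<And>chi. chi \<in> C \<Longrightarrow> dirichlet_character q chi"
    "\<And>chi. dirichlet_character q chi \<Longrightarrow> chi a \<noteq> chi b \<Longrightarrow> chi \<in> C"
    "\<And>n. of_nat (card {n. n < q \<and> coprime n q}) * (of_bool [n = a] (mod q) - of_bool [n = b] (mod q))
           = (\<Sum>chi\<in>C. cnj (chi a - chi b) * chi n)"
proof -
  define f :: "nat \<Rightarrow> complex" where "f = (\<lambda>n. of_bool [n = a] (mod q) - of_bool [n = b] (mod q))"
  define N :: complex where "N = of_nat (card {n. n < q \<and> coprime n q})"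
  have "1 \<in> {n. n < q \<and> coprime n q}" using assms(1) by simp
  hence N: "N \<noteq> 0" unfolding N_def by (subst of_nat_eq_0_iff, subst card_0_eq) (simp, blast)
  have q0: "0 < q" using assms(1) by simp
  have "unit_function q f"
    unfolding unit_function_def
  proof (intro conjI allI impI)
    fix n assume "\<not> coprime n q"
    hence "\<not> [n = a] (mod q)" "\<not> [n = b] (mod q)"
      using assms(2,3) cong_imp_coprime cong_sym by blast+
    thus "f n = 0" by (simp add: f_def)
  qed (simp add: f_def cong_def)
  then obtain C c where C: "finite C" "\<forall>chi\<in>C. dirichlet_character q chi"
      "\<And>n. f n = (\<Sum>chi\<in>C. c chi * chi n)"
    using unit_function_character_sum[OF _ q0] by metis
  have eval: "(\<Sum>n<q. of_bool [n = e] (mod q) * cnj (psi n)) = cnj (psi e)"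
    if psi: "dirichlet_character q psi" for psi e
  proof -
    have "(\<Sum>n<q. of_bool [n = e] (mod q) * cnj (psi n))
            = (\<Sum>n\<in>{e mod q}. of_bool [n = e] (mod q) * cnj (psi n))"
      by (rule sum.mono_neutral_right) (use q0 in \<open>auto simp: cong_def\<close>)
    thus ?thesis using character_mod[OF psi, of e] by (simp add: cong_def)
  qed
  have coeff: "cnj (psi a - psi b) = (if psi \<in> C then c psi * N else 0)"
    if psi: "dirichlet_character q psi" for psi
  proof -
    have "cnj (psi a - psi b) = (\<Sum>n<q. f n * cnj (psi n))"
      using eval[OF psi, of a] eval[OF psi, of b]
      by (simp add: f_def left_diff_distrib sum_subtractf)
    also have "\<dots> = (\<Sum>chi\<in>C. c chi * (\<Sum>n<q. chi n * cnj (psi n)))"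
      by (simp add: C(3) sum_distrib_left sum_distrib_right mult_ac) (rule sum.swap)
    also have "\<dots> = (\<Sum>chi\<in>C. if chi = psi then c chi * N else 0)"
      by (rule sum.cong) (use C(2) psi q0 character_orthogonality in \<open>auto simp: N_def\<close>)
    also have "\<dots> = (if psi \<in> C then c psi * N else 0)" using C(1) by (simp add: sum.delta)
    finally show ?thesis .
  qed
  show ?thesis
  proof (rule that[of C])
    fix n
    have "N * f n = (\<Sum>chi\<in>C. (c chi * N) * chi n)"
      by (simp add: C(3) sum_distrib_left mult_ac)
    also have "\<dots> = (\<Sum>chi\<in>C. cnj (chi a - chi b) * chi n)"
      by (rule sum.cong) (use C(2) coeff in auto)
    finally show "of_nat (card {n. n < q \<and> coprime n q}) *
        (of_bool [n = a] (mod q) - of_bool [n = b] (mod q)) = (\<Sum>chi\<in>C. cnj (chi a - chi b) * chi n)"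
      by (simp add: N_def f_def)
  next
    fix psi assume "dirichlet_character q psi" "psi a \<noteq> psi b"
    thus "psi \<in> C" using coeff[of psi] by (auto split: if_splits)
  qed (use C in auto)
qed

section \<open>Analytic continuation and bounds for L-functions\<close>

lemma powr_diff_bound:
  fixes x y :: real and s :: complex
  assumes "0 < y" "y \<le> x" "Re s \<le> 1"
  shows "norm (of_real x powr s - of_real y powr s) \<le> norm s * y powr (Re s - 1) * (x - y)"
proof -
  define S where "S = closed_segment (of_real y :: complex) (of_real x)"
  have S: "\<exists>t. z = of_real t \<and> y \<le> t" if "z \<in> S" for z
    using that assms by (auto simp: S_def closed_segment_of_real closed_segment_eq_real_ivl)
  have "norm (of_real x powr s - of_real y powr s)
      \<le> norm s * y powr (Re s - 1) * norm (of_real x - of_real y :: complex)"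
  proof (rule field_differentiable_bound[of S])
    show "convex S" by (simp add: S_def)
    show "of_real x \<in> S" "of_real y \<in> S" by (auto simp: S_def)
  next
    fix z assume "z \<in> S"
    then obtain t where t: "z = of_real t" "y \<le> t" using S by blast
    have "z \<notin> \<real>\<^sub>\<le>\<^sub>0" using t assms by (auto simp: complex_nonpos_Reals_iff)
    thus "((\<lambda>z. z powr s) has_field_derivative s * z powr (s - 1)) (at z within S)"
      by (rule has_field_derivative_at_within[OF has_field_derivative_powr])
    have "norm (z powr (s - 1)) = t powr (Re s - 1)"
      using t assms by (simp add: norm_powr_real_powr)
    also have "\<dots> \<le> y powr (Re s - 1)" using t assms by (intro powr_mono2') auto
    finally show "norm (s * z powr (s - 1)) \<le> norm s * y powr (Re s - 1)"
      by (simp add: norm_mult mult_left_mono)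
  qed
  also have "norm (of_real x - of_real y :: complex) = x - y"
    using assms by (simp flip: of_real_diff)
  finally show ?thesis .
qed

lemma norm_nat_powr: "norm ((of_nat n :: complex) powr s) = real n powr Re s"
  using norm_powr_real_powr[of "of_nat n" s] by simp

lemma norm_character_term_le:
  assumes "dirichlet_character q chi" "0 < q"
  shows "norm (chi n / of_nat n powr s) \<le> real n powr - Re s"
proof -
  have "norm (chi n / of_nat n powr s) = norm (chi n) * real n powr - Re s"
    by (simp add: norm_divide norm_nat_powr powr_minus divide_inverse norm_mult norm_inverse)
  also have "\<dots> \<le> 1 * real n powr - Re s"
    by (intro mult_right_mono norm_character_le_1[OF assms]) auto
  finally show ?thesis by simp
qed

definition dirichlet_block :: "nat \<Rightarrow> (nat \<Rightarrow> complex) \<Rightarrow> nat \<Rightarrow> complex \<Rightarrow> complex" where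
  "dirichlet_block q chi m s = (\<Sum>k\<in>{m*q..<m*q+q}. chi (Suc k) / of_nat (Suc k) powr s)"

text \<open>
  Over a full period a nonprincipal character sums to 0, which gains a factor 1/m in
  the m-th block and makes the sum over blocks converge beyond the line Re s = 1.
\<close>
lemma norm_dirichlet_block_le:
  assumes chi: "dirichlet_character q chi" "chi \<noteq> principal_character q" and q: "0 < q"
    and s: "1/8 < Re s"
  shows "norm (dirichlet_block q chi m s)
           \<le> real q ^ 2 * (1 + norm s) * (if m = 0 then 1 else real m powr (- 9/8))"
proof (cases "m = 0")
  case True
  have "norm (dirichlet_block q chi m s) \<le> (\<Sum>k\<in>{m*q..<m*q+q}. 1)"
    unfolding dirichlet_block_def
  proof (rule order_trans[OF norm_sum], rule sum_mono)
    fix k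
    have "norm (chi (Suc k) / of_nat (Suc k) powr s) \<le> real (Suc k) powr - Re s"
      by (rule norm_character_term_le[OF chi(1) q])
    also have "\<dots> \<le> real (Suc k) powr 0" using s by (intro powr_mono) auto
    finally show "norm (chi (Suc k) / of_nat (Suc k) powr s) \<le> 1" by simp
  qed
  also have "\<dots> = real q * 1" by simp
  also have "\<dots> \<le> real q ^ 2 * (1 + norm s)"
  proof (rule mult_mono)
    show "real q \<le> real q ^ 2" using q by (simp add: power2_eq_square)
  qed auto
  finally show ?thesis using True by simp
next
  case False
  have mq: "1 \<le> m * q" "m \<le> m * q" using False q by auto
  define y where "y = real (m * q)"
  have "real 1 \<le> real (m * q)" "real m \<le> real (m * q)" using mq by (simp_all only: of_nat_le_iff)
  hence y: "1 \<le> y" "real m \<le> y" unfolding y_def by simp_all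
  have "(\<Sum>k\<in>{m*q..<m*q+q}. chi (Suc k)) = (\<Sum>k<q. chi (Suc k))"
  proof (rule sum.reindex_bij_witness[of _ "\<lambda>k. k + m * q" "\<lambda>k. k - m * q"])
    fix k assume k: "k \<in> {m*q..<m*q+q}"
    have "[Suc (k - m * q) = Suc (k - m * q) + m * q] (mod q)" by (simp add: cong_def)
    moreover have "Suc (k - m * q) + m * q = Suc k" using k by auto
    ultimately show "chi (Suc (k - m * q)) = chi (Suc k)"
      using character_cong[OF chi(1)] by metis
  qed auto
  also have "\<dots> = (\<Sum>k<q. chi (1 * k + 1))" by simp
  \<comment> \<open>The block runs over the residues 1 to q instead of 0 to q - 1; since
    \<open>chi q = chi 0\<close>, this is still a full period.\<close>
  also have "\<dots> = (\<Sum>k<Suc q. chi k) - chi 0" by (subst sum.lessThan_Suc_shift) simp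
  also have "\<dots> = (\<Sum>k<q. chi k)"
    using character_cong[OF chi(1), of q 0] by (simp add: cong_def)
  also have "\<dots> = 0" by (rule sum_nonprincipal_character[OF chi q])
  finally have zero: "(\<Sum>k\<in>{m*q..<m*q+q}. chi (Suc k)) = 0" .
  \<comment> \<open>As the character values cancel over the block, the common value y^(-s) may be
    subtracted from every term. Only differences over a length q remain, and these are smaller by a
    factor of order 1/m.\<close>
  have "dirichlet_block q chi m s = (\<Sum>k\<in>{m*q..<m*q+q}. chi (Suc k) / of_nat (Suc k) powr s)
          - (\<Sum>k\<in>{m*q..<m*q+q}. chi (Suc k)) * of_real y powr (- s)"
    by (simp add: zero dirichlet_block_def)
  also have "\<dots> = (\<Sum>k\<in>{m*q..<m*q+q}. chi (Suc k) * (of_real (real (Suc k)) powr (-s) - of_real y powr (-s)))"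
    by (simp only: sum_distrib_right sum_subtractf[symmetric] powr_minus divide_inverse
          right_diff_distrib of_real_of_nat_eq)
  also have "norm \<dots> \<le> (\<Sum>k\<in>{m*q..<m*q+q}. norm s * real m powr (- 9/8) * real q)"
  proof (rule order_trans[OF norm_sum], rule sum_mono)
    fix k assume k: "k \<in> {m*q..<m*q+q}"
    have ky: "y \<le> real (Suc k)" "real (Suc k) - y \<le> real q"
    proof -
      have "m * q \<le> Suc k" "Suc k \<le> m * q + q" using k by auto
      hence "real (m * q) \<le> real (Suc k)" "real (Suc k) \<le> real (m * q + q)"
        by (simp_all only: of_nat_le_iff)
      thus "y \<le> real (Suc k)" "real (Suc k) - y \<le> real q" unfolding y_def of_nat_add by linarith+
    qed
    have "norm (chi (Suc k) * (of_real (real (Suc k)) powr (-s) - of_real y powr (-s)))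
        \<le> 1 * (norm (-s) * y powr (Re (-s) - 1) * (real (Suc k) - y))"
      unfolding norm_mult
      by (intro mult_mono norm_character_le_1[OF chi(1) q] powr_diff_bound) (use y ky s in auto)
    also have "\<dots> \<le> 1 * (norm (-s) * real m powr (- 9/8) * real q)"
    proof -
      have "y powr (Re (-s) - 1) \<le> y powr (- 9/8)" using y s by (intro powr_mono) auto
      also have "\<dots> \<le> real m powr (- 9/8)" using y False by (intro powr_mono2') auto
      finally show ?thesis using ky by (intro mult_mono) auto
    qed
    finally show "norm (chi (Suc k) * (of_real (real (Suc k)) powr (-s) - of_real y powr (-s)))
        \<le> norm s * real m powr (- 9/8) * real q" by simp
  qed
  also have "\<dots> = real q ^ 2 * norm s * real m powr (- 9/8)"
    by (simp add: power2_eq_square)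
  also have "\<dots> \<le> real q ^ 2 * (1 + norm s) * real m powr (- 9/8)"
    by (intro mult_right_mono mult_left_mono) auto
  finally show ?thesis using False by simp
qed

lemma summable_block_weight: "summable (\<lambda>m::nat. if m = 0 then 1 else real m powr (- 9/8))"
proof -
  have "summable (\<lambda>m::nat. real m powr (- 9/8))" using summable_real_powr_iff[of "-9/8"] by simp
  hence "summable (\<lambda>m::nat. real (Suc m) powr (- 9/8))" by (subst summable_Suc_iff)
  thus ?thesis by (subst summable_Suc_iff[symmetric]) simp
qed

lemma summable_character_term:
  assumes "dirichlet_character q chi" "0 < q" "1 < Re s"
  shows "summable (\<lambda>n. norm (chi (Suc n) / of_nat (Suc n) powr s))"
proof (rule summable_comparison_test')
  have "summable (\<lambda>n. real n powr - Re s)" using summable_real_powr_iff[of "- Re s"] assms(3) by simp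
  thus "summable (\<lambda>n. real (Suc n) powr - Re s)" by (subst summable_Suc_iff)
  show "norm (norm (chi (Suc n) / of_nat (Suc n) powr s)) \<le> real (Suc n) powr - Re s" for n
    using norm_character_term_le[OF assms(1,2), of "Suc n" s] by simp
qed

text \<open>The block bounds are locally uniform in s, which gives holomorphy; where the series
  converges, grouping it into blocks does not change its sum. The abscissa 1/8 leaves room for the
  rectangle with left side at real part 1/4 in \<open>quotient_log_deriv_bound\<close>.\<close>

lemma continues_dirichlet_blocks:
  assumes chi: "dirichlet_character q chi" "chi \<noteq> principal_character q" and q: "0 < q"
  shows "continues_to_half_plane q chi (1/8) (\<lambda>s. \<Sum>m. dirichlet_block q chi m s)"
  unfolding continues_to_half_plane_def
proof (intro conjI allI impI)
  define S where "S = {s::complex. 1/8 < Re s}"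
  have S: "open S" unfolding S_def by (rule open_halfspace_Re_gt)
  obtain g where g: "\<forall>s\<in>S. (\<lambda>m. dirichlet_block q chi m s) sums g s \<and> g field_differentiable (at s)"
  proof (rule series_differentiable_comparison_complex[OF S, of "dirichlet_block q chi"])
    fix m and s :: complex assume "s \<in> S"
    show "dirichlet_block q chi m field_differentiable at s"
    proof -
      have "(\<lambda>s. \<Sum>k\<in>{m*q..<m*q+q}. chi (Suc k) / of_nat (Suc k) powr s) holomorphic_on UNIV"
        by (intro holomorphic_intros) (auto simp del: of_nat_Suc)
      hence "dirichlet_block q chi m holomorphic_on UNIV"
        by (simp only: dirichlet_block_def[abs_def])
      thus ?thesis using holomorphic_on_imp_differentiable_at[OF _ open_UNIV] by blast
    qed
  next
    fix s assume s: "s \<in> S"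
    define h where "h = (\<lambda>m. complex_of_real (real q ^ 2 * (2 + norm s) *
                                (if m = 0 then 1 else real m powr (- 9/8))))"
    have "summable h" unfolding h_def
      by (intro summable_of_real summable_mult summable_block_weight)
    moreover have "range h \<subseteq> \<real>\<^sub>\<ge>\<^sub>0" by (auto simp: h_def complex_nonneg_Reals_iff)
    moreover have "cmod (dirichlet_block q chi m y) \<le> cmod (h m)" if "y \<in> ball s 1 \<inter> S" for m y
    proof -
      have "norm y \<le> norm s + norm (y - s)" using norm_triangle_sub[of y s] by simp
      hence ny: "norm y \<le> norm s + 1" using that by (auto simp: dist_norm norm_minus_commute)
      have "cmod (dirichlet_block q chi m y) \<le> real q ^ 2 * (1 + norm y) * (if m = 0 then 1 else real m powr (- 9/8))"
        using that by (intro norm_dirichlet_block_le chi q) (auto simp: S_def)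
      also have "\<dots> \<le> real q ^ 2 * (2 + norm s) * (if m = 0 then 1 else real m powr (- 9/8))"
        using ny by (intro mult_right_mono mult_left_mono) auto
      also have "\<dots> = cmod (h m)" unfolding h_def norm_of_real by (rule abs_of_nonneg[symmetric]) auto
      finally show ?thesis .
    qed
    ultimately show "\<exists>d h. 0 < d \<and> summable h \<and> range h \<subseteq> \<real>\<^sub>\<ge>\<^sub>0 \<and>
        (\<forall>\<^sub>F n in sequentially. \<forall>y\<in>ball s d \<inter> S. cmod (dirichlet_block q chi n y) \<le> cmod (h n))"
      by (intro exI[of _ 1] exI[of _ h]) auto
  qed
  have eq: "(\<Sum>m. dirichlet_block q chi m s) = g s" if "s \<in> S" for s
    using g that sums_unique by fastforce
  have "g holomorphic_on S" using g S by (auto simp: holomorphic_on_open field_differentiable_def)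
  hence "(\<lambda>s. \<Sum>m. dirichlet_block q chi m s) holomorphic_on S"
    by (rule holomorphic_transform) (simp add: eq)
  thus "(\<lambda>s. \<Sum>m. dirichlet_block q chi m s) holomorphic_on
          {s. 1/8 < Re s} - (if chi = principal_character q then {1} else {})"
    using chi(2) by (simp add: S_def)
next
  fix s :: complex assume "1 < Re s"
  hence "summable (\<lambda>n. chi (Suc n) / of_nat (Suc n) powr s)"
    by (rule summable_norm_cancel[OF summable_character_term[OF chi(1) q]])
  hence "(\<lambda>n. chi (Suc n) / of_nat (Suc n) powr s) sums dirichlet_series chi s"
    unfolding dirichlet_series_def by (rule summable_sums)
  from sums_group[OF this q] show "(\<Sum>m. dirichlet_block q chi m s) = dirichlet_series chi s"
    unfolding dirichlet_block_def by (rule sums_unique[symmetric])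
qed

lemma dirichlet_L_eq_blocks:
  assumes "dirichlet_character q chi" "chi \<noteq> principal_character q" "0 < q" "1/8 < Re s"
  shows "dirichlet_L q chi s = (\<Sum>m. dirichlet_block q chi m s)"
  using dirichlet_L_eqI[OF continues_dirichlet_blocks[OF assms(1-3)] assms(4)] assms(2) by blast

lemma holomorphic_dirichlet_L:
  assumes "dirichlet_character q chi" "chi \<noteq> principal_character q" "0 < q"
  shows "dirichlet_L q chi holomorphic_on {s. 1/8 < Re s}"
proof (rule holomorphic_transform)
  show "(\<lambda>s. \<Sum>m. dirichlet_block q chi m s) holomorphic_on {s. 1/8 < Re s}"
    using continues_dirichlet_blocks[OF assms] assms(2) by (simp add: continues_to_half_plane_def)
qed (simp add: dirichlet_L_eq_blocks[OF assms])

lemma summable_norm_dirichlet_block: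
  assumes "dirichlet_character q chi" "chi \<noteq> principal_character q" "0 < q" "1/8 < Re s"
  shows "summable (\<lambda>m. norm (dirichlet_block q chi m s))"
proof (rule summable_comparison_test'[OF summable_mult[OF summable_block_weight], of 0])
  fix m
  show "norm (norm (dirichlet_block q chi m s))
          \<le> real q ^ 2 * (1 + norm s) * (if m = 0 then 1 else real m powr (- 9/8))"
    unfolding real_norm_def abs_norm_cancel by (rule norm_dirichlet_block_le[OF assms])
qed

text \<open>Linear growth is good enough, since it later enters only through its logarithm.\<close>

lemma dirichlet_L_bound:
  assumes "dirichlet_character q chi" "chi \<noteq> principal_character q" "0 < q"
  obtains C where "1 \<le> C" "\<And>s. 1/8 < Re s \<Longrightarrow> norm (dirichlet_L q chi s) \<le> C * (1 + norm s)"
proof -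
  define W where "W = (\<Sum>m::nat. if m = 0 then 1 else real m powr (- 9/8))"
  have "norm (dirichlet_L q chi s) \<le> (1 + real q ^ 2 * W) * (1 + norm s)" if s: "1/8 < Re s" for s
  proof -
    have "norm (dirichlet_L q chi s) \<le> (\<Sum>m. norm (dirichlet_block q chi m s))"
      unfolding dirichlet_L_eq_blocks[OF assms s]
      by (rule summable_norm[OF summable_norm_dirichlet_block[OF assms s]])
    also have "\<dots> \<le> (\<Sum>m::nat. real q ^ 2 * (1 + norm s) * (if m = 0 then 1 else real m powr (- 9/8)))"
      by (intro suminf_le norm_dirichlet_block_le[OF assms s] summable_mult summable_block_weight
            summable_norm_dirichlet_block[OF assms s])
    also have "\<dots> = real q ^ 2 * (1 + norm s) * W"
      unfolding W_def by (rule suminf_mult[OF summable_block_weight])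
    also have "\<dots> \<le> (1 + norm s) + real q ^ 2 * (1 + norm s) * W" by simp
    also have "\<dots> = (1 + real q ^ 2 * W) * (1 + norm s)" by (simp only: algebra_simps)
    finally show ?thesis .
  qed
  moreover have "0 \<le> W" unfolding W_def by (rule suminf_nonneg[OF summable_block_weight]) auto
  ultimately show ?thesis using that[of "1 + real q ^ 2 * W"] by auto
qed

lemma dirichlet_L_sums:
  assumes "dirichlet_character q chi" "chi \<noteq> principal_character q" "0 < q" "1 < Re s"
  shows "(\<lambda>n. chi (Suc n) / of_nat (Suc n) powr s) sums dirichlet_L q chi s"
proof -
  have "dirichlet_L q chi s = dirichlet_series chi s"
    using dirichlet_L_eq_blocks[OF assms(1-3), of s] continues_dirichlet_blocks[OF assms(1-3)] assms(4)
    by (simp add: continues_to_half_plane_def)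
  moreover have "summable (\<lambda>n. chi (Suc n) / of_nat (Suc n) powr s)"
    by (rule summable_norm_cancel[OF summable_character_term[OF assms(1,3,4)]])
  from summable_sums[OF this]
  have "(\<lambda>n. chi (Suc n) / of_nat (Suc n) powr s) sums dirichlet_series chi s"
    by (simp only: dirichlet_series_def)
  ultimately show ?thesis by simp
qed

lemma dirichlet_L_cnj:
  assumes "dirichlet_character q chi" "chi \<noteq> principal_character q" "0 < q" "1/8 < Re s"
  shows "dirichlet_L q (\<lambda>n. cnj (chi n)) (cnj s) = cnj (dirichlet_L q chi s)"
proof -
  have "dirichlet_block q (\<lambda>n. cnj (chi n)) m (cnj s) = cnj (dirichlet_block q chi m s)" for m
    by (simp add: dirichlet_block_def cnj_powr)
  moreover have "(\<lambda>n. cnj (chi n)) \<noteq> principal_character q"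
    using assms(2) by (simp add: principal_character_cnj_iff)
  moreover have "summable (\<lambda>m. dirichlet_block q chi m s)"
    by (rule summable_norm_cancel[OF summable_norm_dirichlet_block[OF assms]])
  ultimately show ?thesis
    using dirichlet_L_eq_blocks[OF assms] assms(3,4)
      dirichlet_L_eq_blocks[OF dirichlet_character_cnj[OF assms(1)], of "cnj s"]
    by (simp add: bounded_linear.suminf[OF bounded_linear_cnj])
qed

text \<open>The leading term is 1, the second at most 1/4, and the others are dominated by a
  telescoping series with sum 1/2. The bound serves at the centres of the discs for the logarithmic
  derivative, on the line of integration, and to see that L is not identically zero.\<close>

lemma norm_dirichlet_L_ge:
  assumes "dirichlet_character q chi" "chi \<noteq> principal_character q" "0 < q" "2 \<le> Re s"
  shows "1/4 \<le> norm (dirichlet_L q chi s)"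
proof -
  define f where "f = (\<lambda>n. chi (Suc n) / of_nat (Suc n) powr s)"
  have sf: "summable (\<lambda>n. norm (f n))" unfolding f_def
    by (rule summable_character_term[OF assms(1,3)]) (use assms in auto)
  have fb: "norm (f n) \<le> 1 / real (Suc n) ^ 2" for n
  proof -
    have "norm (f n) \<le> real (Suc n) powr - Re s"
      unfolding f_def by (rule norm_character_term_le[OF assms(1,3)])
    also have "\<dots> \<le> real (Suc n) powr - 2" using assms(4) by (intro powr_mono) auto
    also have "\<dots> = 1 / real (Suc n) ^ 2" by (simp add: powr_minus powr_numeral divide_inverse)
    finally show ?thesis .
  qed
  have tel: "(\<lambda>n. 1 / real (Suc (Suc n)) - 1 / real (Suc (Suc (Suc n)))) sums (1/2)"
  proof -
    have "(\<lambda>n. 1 / real (Suc (Suc n))) \<longlonglongrightarrow> 0"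
      using LIMSEQ_Suc[OF LIMSEQ_Suc[OF lim_1_over_n]] by simp
    from telescope_sums'[OF this] show ?thesis by simp
  qed
  have s2: "summable (\<lambda>n. norm (f (Suc (Suc n))))"
    using sf summable_iff_shift[of "\<lambda>n. norm (f n)" 2] by simp
  have "(\<Sum>n. norm (f (Suc (Suc n)))) \<le> 1/2"
  proof -
    have "(\<Sum>n. norm (f (Suc (Suc n)))) \<le> (\<Sum>n. 1 / real (Suc (Suc n)) - 1 / real (Suc (Suc (Suc n))))"
    proof (rule suminf_le[OF _ s2 sums_summable[OF tel]])
      fix n
      have "norm (f (Suc (Suc n))) \<le> 1 / real (Suc (Suc (Suc n))) ^ 2" by (rule fb)
      also have "\<dots> \<le> 1 / real (Suc (Suc n)) - 1 / real (Suc (Suc (Suc n)))"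
      proof -
        define x where "x = real n"
        have x: "0 \<le> x" by (simp add: x_def)
        have "1 / (x + 3) ^ 2 \<le> 1 / ((x + 2) * (x + 3))"
          using x by (intro frac_le) (auto simp: power2_eq_square intro: mult_right_mono)
        also have "\<dots> = 1 / (x + 2) - 1 / (x + 3)" using x by (simp add: field_simps)
        finally show ?thesis by (simp add: x_def add.commute)
      qed
      finally show "norm (f (Suc (Suc n))) \<le> 1 / real (Suc (Suc n)) - 1 / real (Suc (Suc (Suc n)))" .
    qed
    thus ?thesis using sums_unique[OF tel] by simp
  qed
  moreover have "norm (\<Sum>n. f (Suc (Suc n))) \<le> (\<Sum>n. norm (f (Suc (Suc n))))"
    by (rule summable_norm[OF s2])
  moreover have "norm (f 1) \<le> 1/4" using fb[of 1] by simp
  moreover have "f 0 = 1" using character_one[OF assms(1)] by (simp add: f_def)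
  moreover have "dirichlet_L q chi s = f 0 + f 1 + (\<Sum>n. f (Suc (Suc n)))"
  proof -
    have "dirichlet_L q chi s = (\<Sum>n. f n)" unfolding f_def
      by (rule sums_unique[OF dirichlet_L_sums[OF assms(1-3)]]) (use assms in auto)
    also have "\<dots> = (\<Sum>n. f (n + 2)) + (\<Sum>n<2. f n)"
      by (rule suminf_split_initial_segment[OF summable_norm_cancel[OF sf]])
    finally show ?thesis by (simp add: numeral_2_eq_2)
  qed
  moreover have "norm (1 :: complex) - norm (f 1) - norm (\<Sum>n. f (Suc (Suc n)))
      \<le> norm (1 + f 1 + (\<Sum>n. f (Suc (Suc n))))"
    using norm_diff_ineq[of "1 :: complex" "f 1"] norm_diff_ineq[of "1 + f 1" "\<Sum>n. f (Suc (Suc n))"]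
    by linarith
  ultimately show ?thesis by simp
qed

section \<open>The logarithmic derivative as a Dirichlet series\<close>

lemma ln_powr_summable:
  assumes "1 < x" shows "summable (\<lambda>n. ln (real n) * real n powr - x)"
proof (rule summable_comparison_test'[of _ 1])
  define e where "e = (x - 1) / 2"
  have e: "0 < e" "e - x < - 1" using assms by (auto simp: e_def field_simps)
  show "summable (\<lambda>n. real n powr (e - x) / e)"
    using summable_real_powr_iff[of "e - x"] e by (intro summable_divide) auto
  fix n :: nat assume n: "1 \<le> n"
  have "ln (real n) * real n powr - x \<le> (real n powr e / e) * real n powr - x"
    using n e by (intro mult_right_mono ln_powr_bound) auto
  thus "norm (ln (real n) * real n powr - x) \<le> real n powr (e - x) / e"
    using n by (simp add: powr_diff powr_minus field_simps)
qed

lemma mangoldt_term_bound: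
  assumes "dirichlet_character q chi" "0 < q"
  shows "norm (chi n * mangoldt n / of_nat n powr s) \<le> mangoldt n * real n powr - Re s"
    and "norm (chi n * mangoldt n / of_nat n powr s) \<le> ln (real n) * real n powr - Re s"
proof -
  have "norm (chi n * mangoldt n / of_nat n powr s) = norm (chi n / of_nat n powr s) * mangoldt n"
    by (simp add: norm_mult norm_divide)
  also have "\<dots> \<le> real n powr - Re s * mangoldt n"
    by (intro mult_right_mono norm_character_term_le[OF assms] mangoldt_nonneg)
  finally show 1: "norm (chi n * mangoldt n / of_nat n powr s) \<le> mangoldt n * real n powr - Re s"
    by (simp add: mult.commute)
  also have "\<dots> \<le> ln (real n) * real n powr - Re s"
    by (cases "n = 0") (auto intro!: mult_right_mono mangoldt_le)
  finally show "norm (chi n * mangoldt n / of_nat n powr s) \<le> ln (real n) * real n powr - Re s" .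
qed

lemma deriv_dirichlet_L_sums:
  assumes "dirichlet_character q chi" "chi \<noteq> principal_character q" "0 < q" "1 < Re s"
  shows "(\<lambda>n. - (chi (Suc n) * of_real (ln (real (Suc n))) / of_nat (Suc n) powr s)) sums
           deriv (dirichlet_L q chi) s"
proof -
  define S where "S = {s::complex. 1 < Re s}"
  have S: "open S" unfolding S_def by (rule open_halfspace_Re_gt)
  obtain g g' where g: "\<forall>s\<in>S. (\<lambda>n. chi (Suc n) / of_nat (Suc n) powr s) sums g s \<and>
     (\<lambda>n. - (chi (Suc n) * of_real (ln (real (Suc n))) / of_nat (Suc n) powr s)) sums g' s \<and>
     (g has_field_derivative g' s) (at s)"
  proof (atomize_elim, rule series_and_derivative_comparison_complex[OF S])
    fix n and s :: complex assume "s \<in> S"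
    have ln: "Ln (of_nat (Suc n)) = of_real (ln (real (Suc n)))"
      by (metis Ln_of_real of_nat_0_less_iff of_real_of_nat_eq zero_less_Suc)
    have nz: "of_nat (Suc n) \<noteq> (0::complex)" by (simp del: of_nat_Suc)
    show "((\<lambda>s. chi (Suc n) / of_nat (Suc n) powr s) has_field_derivative
        - (chi (Suc n) * of_real (ln (real (Suc n))) / of_nat (Suc n) powr s)) (at s)"
    proof -
      have "((\<lambda>s. - s) has_field_derivative - 1) (at s)" by (auto intro!: derivative_eq_intros)
      from DERIV_cmult[OF DERIV_chain2[OF has_field_derivative_powr_right[OF nz] this], of "chi (Suc n)"]
      show ?thesis by (simp add: powr_minus divide_inverse ln mult_ac del: of_nat_Suc)
    qed
  next
    fix s assume s: "s \<in> S"
    define d where "d = (Re s - 1) / 2"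
    have d: "0 < d" "1 < Re s - d" using s by (auto simp: d_def S_def field_simps)
    define h where "h = (\<lambda>n. complex_of_real (real (Suc n) powr - (Re s - d)))"
    have "summable (\<lambda>n. real n powr - (Re s - d))"
      using summable_real_powr_iff[of "- (Re s - d)"] d by simp
    hence "summable h" unfolding h_def by (intro summable_of_real) (subst summable_Suc_iff)
    moreover have "range h \<subseteq> \<real>\<^sub>\<ge>\<^sub>0" by (auto simp: h_def complex_nonneg_Reals_iff)
    moreover have "cmod (chi (Suc n) / of_nat (Suc n) powr y) \<le> cmod (h n)" if "y \<in> ball s d \<inter> S" for n y
    proof -
      have "\<bar>Re (s - y)\<bar> \<le> norm (s - y)" by (rule abs_Re_le_cmod)
      hence "Re s - d \<le> Re y" using that by (auto simp: dist_norm)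
      hence "real (Suc n) powr - Re y \<le> real (Suc n) powr - (Re s - d)" by (intro powr_mono) auto
      thus ?thesis using norm_character_term_le[OF assms(1,3), of "Suc n" y] by (simp add: h_def)
    qed
    ultimately show "\<exists>d h. 0 < d \<and> summable h \<and> range h \<subseteq> \<real>\<^sub>\<ge>\<^sub>0 \<and>
        (\<forall>\<^sub>F n in sequentially. \<forall>y\<in>ball s d \<inter> S. cmod (chi (Suc n) / of_nat (Suc n) powr y) \<le> cmod (h n))"
      using d by (intro exI[of _ d] exI[of _ h]) auto
  qed
  have eq: "dirichlet_L q chi z = g z" if "z \<in> S" for z
    using g that dirichlet_L_sums[OF assms(1-3), of z] sums_unique2 by (fastforce simp: S_def)
  have sS: "s \<in> S" using assms(4) by (simp add: S_def)
  have "(dirichlet_L q chi has_field_derivative g' s) (at s)"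
    by (rule DERIV_cong_ev[THEN iffD2, OF refl _ refl, of _ g])
       (use g sS eq eventually_nhds_in_open[OF S sS] in \<open>auto elim: eventually_mono\<close>)
  hence "deriv (dirichlet_L q chi) s = g' s" by (rule DERIV_imp_deriv)
  thus ?thesis using g sS by auto
qed

text \<open>Multiplied by the Dirichlet series of L, the claim becomes the series of \<open>- L'\<close>, by
  \<open>mangoldt_sum\<close>.\<close>
lemma log_deriv_dirichlet_L_sums:
  assumes "dirichlet_character q chi" "chi \<noteq> principal_character q" "0 < q" "1 < Re s"
    and nz: "dirichlet_L q chi s \<noteq> 0"
  shows "(\<lambda>n. chi n * mangoldt n / of_nat n powr s) sums
           - (deriv (dirichlet_L q chi) s / dirichlet_L q chi s)"
proof -
  define a where "a = (\<lambda>n. chi n / of_nat n powr s)"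
  define b where "b = (\<lambda>n. chi n * mangoldt n / of_nat n powr s)"
  define c where "c = (\<lambda>n. chi n * of_real (ln (real n)) / of_nat n powr s)"
  have a0: "a 0 = 0" "b 0 = 0" "c 0 = 0" by (simp_all add: a_def b_def c_def)
  have "(\<lambda>n. a (Suc n)) sums dirichlet_L q chi s"
    unfolding a_def by (rule dirichlet_L_sums[OF assms(1-4)])
  from sums_Suc[OF this] have a: "a sums dirichlet_L q chi s" using a0 by simp
  have "summable (\<lambda>n. norm (a (Suc n)))"
    unfolding a_def by (rule summable_character_term[OF assms(1,3,4)])
  hence an: "summable (\<lambda>n. norm (a n))" by (subst (asm) summable_Suc_iff)
  have bn: "summable (\<lambda>n. norm (b n))"
    by (rule summable_comparison_test'[OF ln_powr_summable[OF assms(4)], of 0])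
       (use mangoldt_term_bound(2)[OF assms(1,3)] in \<open>auto simp: b_def\<close>)
  have "(\<lambda>n. - c (Suc n)) sums deriv (dirichlet_L q chi) s"
    unfolding c_def by (rule deriv_dirichlet_L_sums[OF assms(1-4)])
  from sums_minus[OF this] have "(\<lambda>n. c (Suc n)) sums - deriv (dirichlet_L q chi) s" by simp
  from sums_Suc[OF this] have c: "c sums - deriv (dirichlet_L q chi) s" using a0 by simp
  \<comment> \<open>Zero is left out so that every \<open>n\<close> in \<open>P\<close> has only
    finitely many divisors; all three coefficient functions vanish at 0.\<close>
  define P where "P = {0<..(0::nat)} \<union> {n. 0 < n}"
  have P: "P = {n. 0 < n}" by (auto simp: P_def)
  have toP: "(f has_sum S) P" if "(f has_sum S) UNIV" "f 0 = 0" for f :: "nat \<Rightarrow> complex" and S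
    using that(1) by (subst has_sum_cong_neutral[where T = UNIV and g = f]) (use that(2) P in auto)
  have aP: "(a has_sum dirichlet_L q chi s) P"
    by (rule toP[OF norm_summable_imp_has_sum[OF an a] a0(1)])
  have bP: "(b has_sum (\<Sum>n. b n)) P"
    by (rule toP[OF norm_summable_imp_has_sum[OF bn summable_sums[OF summable_norm_cancel[OF bn]]] a0(2)])
  have abs: "(\<lambda>n. norm (a n)) summable_on P" "(\<lambda>n. norm (b n)) summable_on P"
    using norm_summable_imp_summable_on[of "\<lambda>n. norm (a n)"] norm_summable_imp_summable_on[of "\<lambda>n. norm (b n)"] an bn
    by (auto intro: summable_on_subset_banach)
  have "(\<lambda>(d, e). a d * b e) summable_on P \<times> P"
  proof (rule abs_summable_summable, rule Infinite_Sum.abs_summable_on_Sigma_iff[THEN iffD2], intro conjI ballI)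
    show "(\<lambda>e. norm (case (d, e) of (d, e) \<Rightarrow> a d * b e)) summable_on P" for d
      using summable_on_cmult_right[OF abs(2), of "norm (a d)"] by (simp add: norm_mult)
    show "(\<lambda>d. norm (\<Sum>\<^sub>\<infinity>e\<in>P. cmod (case (d, e) of (d, e) \<Rightarrow> a d * b e))) summable_on P"
      using summable_on_cmult_left[OF abs(1), of "\<bar>infsum (\<lambda>n. norm (b n)) P\<bar>"]
      by (simp add: norm_mult infsum_cmult_right' abs_mult)
  qed
  hence prod: "((\<lambda>(d, e). a d * b e) has_sum dirichlet_L q chi s * (\<Sum>n. b n)) (P \<times> P)"
    by (intro has_sum_SigmaI[where g = "\<lambda>d. a d * (\<Sum>n. b n)"])
       (use has_sum_cmult_right[OF bP] has_sum_cmult_left[OF aP] in auto)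
  \<comment> \<open>The pair (d, e) is recorded as (d e, e), which turns the product of the two
    series into a sum over n of divisor sums. Absolute summability over pairs permits the
    regrouping.\<close>
  have "((\<lambda>(n, e). a (n div e) * b e) has_sum dirichlet_L q chi s * (\<Sum>n. b n)) (SIGMA n:P. {e. e dvd n})
      \<longleftrightarrow> ((\<lambda>(d, e). a d * b e) has_sum dirichlet_L q chi s * (\<Sum>n. b n)) (P \<times> P)"
  proof (rule has_sum_reindex_bij_witness[where j = "\<lambda>(n, e). (n div e, e)" and i = "\<lambda>(d, e). (d * e, e)"])
    fix x assume "x \<in> (SIGMA n:P. {e. e dvd n})"
    then obtain n e where x: "x = (n, e)" "0 < n" "e dvd n" by (auto simp: P)
    then obtain d where d: "n = e * d" by auto
    have "0 < e" "0 < d" using x(2) d by auto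
    thus "(case case x of (n, e) \<Rightarrow> (n div e, e) of (d, e) \<Rightarrow> (d * e, e)) = x"
      "(case x of (n, e) \<Rightarrow> (n div e, e)) \<in> P \<times> P"
      "(case case x of (n, e) \<Rightarrow> (n div e, e) of (d, e) \<Rightarrow> a d * b e) = (case x of (n, e) \<Rightarrow> a (n div e) * b e)"
      by (simp_all add: x(1) d P)
  next
    fix x assume "x \<in> P \<times> P"
    then obtain d e where x: "x = (d, e)" "0 < d" "0 < e" by (auto simp: P)
    thus "(case case x of (d, e) \<Rightarrow> (d * e, e) of (n, e) \<Rightarrow> (n div e, e)) = x"
      "(case x of (d, e) \<Rightarrow> (d * e, e)) \<in> (SIGMA n:P. {e. e dvd n})" by (simp_all add: P)
  qed simp
  hence "((\<lambda>(n, e). a (n div e) * b e) has_sum dirichlet_L q chi s * (\<Sum>n. b n)) (SIGMA n:P. {e. e dvd n})"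
    using prod by simp
  moreover have "((\<lambda>e. case (n, e) of (n, e) \<Rightarrow> a (n div e) * b e) has_sum c n) {e. e dvd n}" if "n \<in> P" for n
  proof (rule has_sum_finiteI)
    have n: "n \<noteq> 0" using that by (simp add: P)
    show "finite {e. e dvd n}" using n by simp
    have "(\<Sum>e | e dvd n. a (n div e) * b e) = (\<Sum>e | e dvd n. chi n / of_nat n powr s * mangoldt e)"
    proof (rule sum.cong)
      fix e assume "e \<in> {e. e dvd n}"
      then obtain d where d: "n = e * d" by auto
      have "e \<noteq> 0" using n d by auto
      moreover have "of_nat (e * d) powr s = of_nat e powr s * (of_nat d powr s :: complex)"
        using powr_times_real[of "of_nat e" "of_nat d" s] by simp
      ultimately show "a (n div e) * b e = chi n / of_nat n powr s * mangoldt e"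
        by (simp add: a_def b_def d character_mult[OF assms(1)] field_simps)
    qed auto
    also have "\<dots> = chi n / of_nat n powr s * (\<Sum>e | e dvd n. mangoldt e)"
      by (rule sum_distrib_left[symmetric])
    also have "(\<Sum>e | e dvd n. mangoldt e) = complex_of_real (ln (real n))" by (rule mangoldt_sum[OF n])
    finally show "c n = (\<Sum>e\<in>{e. e dvd n}. case (n, e) of (n, e) \<Rightarrow> a (n div e) * b e)"
      by (simp add: c_def)
  qed
  ultimately have "(c has_sum dirichlet_L q chi s * (\<Sum>n. b n)) P" by (rule has_sum_SigmaD)
  hence "(c has_sum dirichlet_L q chi s * (\<Sum>n. b n)) UNIV"
    by (subst has_sum_cong_neutral[where T = P and g = c]) (use a0 P in auto)
  hence "c sums (dirichlet_L q chi s * (\<Sum>n. b n))" by (rule has_sum_imp_sums)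
  hence "dirichlet_L q chi s * (\<Sum>n. b n) = - deriv (dirichlet_L q chi) s"
    using c sums_unique2 by blast
  hence "(\<Sum>n. b n) = - (deriv (dirichlet_L q chi) s / dirichlet_L q chi s)"
    using nz by (simp add: field_simps)
  thus ?thesis using summable_sums[OF summable_norm_cancel[OF bn]] by (simp add: b_def)
qed

section \<open>Perron's formula\<close>

text \<open>A majorant along the path, instead of maximum times length, is what later yields the
  factor 1 / ln y on horizontal segments and ln T instead of T on vertical ones.\<close>

lemma norm_contour_integral_linepath_le:
  assumes "continuous_on (closed_segment a b) f"
    and "(g has_integral G) {0..1}"
    and "\<And>t. t \<in> {0..1} \<Longrightarrow> norm (f (linepath a b t)) * norm (b - a) \<le> g t"
  shows "norm (contour_integral (linepath a b) f) \<le> G"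
proof -
  have "f contour_integrable_on linepath a b"
    by (rule contour_integrable_continuous_linepath[OF assms(1)])
  hence int: "((\<lambda>t. f (linepath a b t) * (b - a)) has_integral contour_integral (linepath a b) f) {0..1}"
    using has_contour_integral_integral has_contour_integral_linepath by blast
  have "norm (integral {0..1} (\<lambda>t. f (linepath a b t) * (b - a))) \<le> integral {0..1} g"
    by (rule integral_norm_bound_integral)
       (use int assms in \<open>auto simp: norm_mult has_integral_iff\<close>)
  thus ?thesis using int assms(2) by (simp add: has_integral_iff)
qed

lemma contour_integral_rectpath_split:
  assumes "Re a < Re b" "Im a < Im b" "continuous_on (path_image (rectpath a b)) f"
  shows "contour_integral (rectpath a b) f
    = contour_integral (linepath a (Complex (Re b) (Im a))) f
    + contour_integral (linepath (Complex (Re b) (Im a)) b) f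
    - contour_integral (linepath (Complex (Re a) (Im b)) b) f
    - contour_integral (linepath a (Complex (Re a) (Im b))) f"
proof -
  let ?a2 = "Complex (Re b) (Im a)" and ?a4 = "Complex (Re a) (Im b)"
  have img: "path_image (rectpath a b) = closed_segment a ?a2 \<union> closed_segment ?a2 b
      \<union> closed_segment b ?a4 \<union> closed_segment ?a4 a"
    by (simp add: rectpath_def Let_def path_image_join Un_assoc)
  have int: "f contour_integrable_on linepath a ?a2" "f contour_integrable_on linepath ?a2 b"
     "f contour_integrable_on linepath b ?a4" "f contour_integrable_on linepath ?a4 a"
    by (intro contour_integrable_continuous_linepath continuous_on_subset[OF assms(3)]; simp add: img; blast)+
  have "contour_integral (rectpath a b) f = contour_integral (linepath a ?a2) f
      + (contour_integral (linepath ?a2 b) f + (contour_integral (linepath b ?a4) f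
      + contour_integral (linepath ?a4 a) f))"
    using int by (simp add: rectpath_def Let_def)
  moreover have "contour_integral (linepath b ?a4) f = - contour_integral (linepath ?a4 b) f"
    "contour_integral (linepath ?a4 a) f = - contour_integral (linepath a ?a4) f"
    using contour_integral_reversepath[of "linepath ?a4 b" f]
      contour_integral_reversepath[of "linepath a ?a4" f] by simp_all
  ultimately show ?thesis by simp
qed

text \<open>The majorant y^t / |h| is integrated exactly. Numerator and \<open>ln y\<close> have the
  same sign, so one statement serves both sides of y = 1.\<close>

lemma horizontal_kernel_bound:
  fixes u v h y :: real
  assumes "u < v" "h \<noteq> 0" "0 < y" "y \<noteq> 1"
  shows "norm (contour_integral (linepath (Complex u h) (Complex v h)) (\<lambda>s. of_real y powr s / s))
           \<le> (y powr v - y powr u) / (\<bar>h\<bar> * ln y)"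
proof (rule norm_contour_integral_linepath_le)
  have nz: "s \<noteq> 0" if "s \<in> closed_segment (Complex u h) (Complex v h)" for s
  proof -
    obtain t where "s = (1 - t) *\<^sub>R Complex u h + t *\<^sub>R Complex v h"
      using \<open>s \<in> _\<close> by (auto simp: closed_segment_def)
    hence "Im s = (1 - t) * h + t * h" by simp
    hence "Im s = h" by (simp add: algebra_simps)
    thus ?thesis using assms(2) by auto
  qed
  thus "continuous_on (closed_segment (Complex u h) (Complex v h)) (\<lambda>s. of_real y powr s / s)"
    using assms by (intro continuous_intros) auto
  define g where "g = (\<lambda>t::real. (v - u) * y powr (u + t * (v - u)) / \<bar>h\<bar>)"
  have ln: "ln y \<noteq> 0" using assms by simp
  have "(g has_integral (y powr (u + 1 * (v - u)) / (\<bar>h\<bar> * ln y) - y powr (u + 0 * (v - u)) / (\<bar>h\<bar> * ln y))) {0..1}"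
  proof (rule fundamental_theorem_of_calculus)
    fix t :: real
    have "((\<lambda>t. y powr (u + t * (v - u)) / (\<bar>h\<bar> * ln y)) has_real_derivative g t) (at t)"
      using assms ln by (auto intro!: derivative_eq_intros simp: g_def field_simps)
    thus "((\<lambda>t. y powr (u + t * (v - u)) / (\<bar>h\<bar> * ln y)) has_vector_derivative g t) (at t within {0..1})"
      by (auto simp: has_real_derivative_iff_has_vector_derivative intro: has_vector_derivative_at_within)
  qed simp
  thus "(g has_integral (y powr v - y powr u) / (\<bar>h\<bar> * ln y)) {0..1}"
    by (simp add: diff_divide_distrib)
  fix t :: real assume t: "t \<in> {0..1}"
  define s where "s = linepath (Complex u h) (Complex v h) t"
  have s: "Re s = u + t * (v - u)" "Im s = h"
    by (simp_all add: s_def linepath_def algebra_simps)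
  have "Complex v h - Complex u h = of_real (v - u)" by (simp add: complex_eq_iff)
  hence d: "norm (Complex v h - Complex u h) = v - u" using assms(1) by (simp only: norm_of_real)
  have "\<bar>h\<bar> \<le> norm s" using abs_Im_le_cmod[of s] s by simp
  hence "norm (of_real y powr s / s) \<le> y powr (Re s) / \<bar>h\<bar>"
    unfolding norm_divide using assms by (intro frac_le) (auto simp: norm_powr_real_powr)
  hence "norm (of_real y powr s / s) * (v - u) \<le> y powr (Re s) / \<bar>h\<bar> * (v - u)"
    using assms by (intro mult_right_mono) auto
  thus "norm (of_real y powr linepath (Complex u h) (Complex v h) t / linepath (Complex u h) (Complex v h) t)
          * norm (Complex v h - Complex u h) \<le> g t"
    unfolding d s_def[symmetric] g_def using s by (simp add: mult_ac)
qed

lemma closed_segment_vertical_Re: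
  assumes "s \<in> closed_segment (Complex c u) (Complex c v)" shows "Re s = c"
proof -
  obtain t where "s = (1 - t) *\<^sub>R Complex c u + t *\<^sub>R Complex c v"
    using assms by (auto simp: closed_segment_def)
  hence "Re s = (1 - t) * c + t * c" by simp
  thus ?thesis by (simp add: algebra_simps)
qed

lemma vertical_kernel_bound:
  fixes u v c y :: real
  assumes "u < v" "c \<noteq> 0" "0 < y"
  shows "norm (contour_integral (linepath (Complex c u) (Complex c v)) (\<lambda>s. of_real y powr s / s))
           \<le> y powr c / \<bar>c\<bar> * (v - u)"
proof -
  note re = closed_segment_vertical_Re
  have "norm (contour_integral (linepath (Complex c u) (Complex c v)) (\<lambda>s. of_real y powr s / s))
          \<le> y powr c / \<bar>c\<bar> * norm (Complex c v - Complex c u)"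
  proof (rule contour_integral_bound_linepath)
    have "s \<noteq> 0" if "s \<in> closed_segment (Complex c u) (Complex c v)" for s
      using re[OF that] assms(2) by auto
    thus "(\<lambda>s. of_real y powr s / s) contour_integrable_on linepath (Complex c u) (Complex c v)"
      using assms by (intro contour_integrable_continuous_linepath continuous_intros) auto
    fix s assume s: "s \<in> closed_segment (Complex c u) (Complex c v)"
    have "\<bar>c\<bar> \<le> norm s" using abs_Re_le_cmod[of s] re[OF s] by simp
    thus "norm (of_real y powr s / s) \<le> y powr c / \<bar>c\<bar>"
      unfolding norm_divide using assms re[OF s] by (intro frac_le) (auto simp: norm_powr_real_powr)
  qed auto
  moreover have "Complex c v - Complex c u = \<i> * of_real (v - u)" by (simp add: complex_eq_iff)
  hence "norm (Complex c v - Complex c u) = v - u" using assms(1) by (simp only: norm_mult norm_of_real) simp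
  ultimately show ?thesis by simp
qed

text \<open>
  The two cases of Perron's formula: for y > 1 the segment is moved to the far left, picking up
  the residue at 0, and for y < 1 to the far right.
\<close>
lemma perron_kernel:
  fixes c y T T1 T2 :: real
  assumes c: "0 < c" and y: "0 < y" "y \<noteq> 1" and T: "0 < T" "T \<le> T1" "T \<le> T2"
  shows "norm (contour_integral (linepath (Complex c (-T1)) (Complex c T2)) (\<lambda>s. of_real y powr s / s)
           - (if 1 < y then 2 * of_real pi * \<i> else 0)) \<le> 2 * y powr c / (T * \<bar>ln y\<bar>)"
proof (rule field_le_epsilon)
  fix e :: real assume e: "0 < e"
  define f where "f = (\<lambda>s::complex. of_real y powr s / s)"
  \<comment> \<open>The side moved far away lies at abscissa -K or K. There the integrand is at most
    1/K, so this side contributes at most (T1 + T2)/K, which is at most \<open>e\<close>; the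
    summand \<open>c + 1\<close> keeps it beyond \<open>c\<close>.\<close>
  define K where "K = (T1 + T2) / e + c + 1"
  have K: "0 < K" "c < K" using T e c by (auto simp: K_def intro!: add_pos_pos divide_pos_pos)
  have Ke: "(T1 + T2) / K \<le> e"
  proof -
    have "(T1 + T2) / e \<le> K" using c by (simp add: K_def)
    thus ?thesis using K e by (simp add: field_simps)
  qed
  have T12: "0 < T1" "0 < T2" using T by auto
  have frac: "z / (h * \<bar>ln y\<bar>) \<le> z / (T * \<bar>ln y\<bar>)" if "T \<le> h" "0 \<le> z" for z h
    using that T y by (intro divide_left_mono mult_right_mono mult_pos_pos) auto
  show "norm (contour_integral (linepath (Complex c (-T1)) (Complex c T2)) (\<lambda>s. of_real y powr s / s)
           - (if 1 < y then 2 * of_real pi * \<i> else 0)) \<le> 2 * y powr c / (T * \<bar>ln y\<bar>) + e"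
  proof (cases "1 < y")
    case True
    define a b where "a = Complex (-K) (-T1)" and "b = Complex c T2"
    have ab: "Re a < Re b" "Im a < Im b" "0 \<in> box a b"
      using T12 K c by (auto simp: a_def b_def in_box_complex_iff)
    have img: "path_image (rectpath a b) \<subseteq> UNIV - {0}"
      using path_image_rectpath_inter_box[of a b] ab by auto
    have "((\<lambda>s. of_real y powr s / (s - 0)) has_contour_integral
              2 * pi * \<i> * winding_number (rectpath a b) 0 * (of_real y powr 0)) (rectpath a b)"
      by (rule Cauchy_integral_formula_convex_simple[of UNIV])
         (use img in \<open>auto intro!: holomorphic_intros\<close>)
    moreover have "winding_number (rectpath a b) 0 = 1" by (rule winding_number_rectpath[OF ab(3)])
    ultimately have "contour_integral (rectpath a b) f = 2 * pi * \<i>"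
      using y by (simp add: f_def contour_integral_unique)
    moreover have "continuous_on (path_image (rectpath a b)) f"
      unfolding f_def using img y by (intro continuous_intros) auto
    ultimately have eq: "2 * pi * \<i> =
        contour_integral (linepath (Complex (-K) (-T1)) (Complex c (-T1))) f
      + contour_integral (linepath (Complex c (-T1)) (Complex c T2)) f
      - contour_integral (linepath (Complex (-K) T2) (Complex c T2)) f
      - contour_integral (linepath (Complex (-K) (-T1)) (Complex (-K) T2)) f"
      using contour_integral_rectpath_split[of a b f] ab by (simp add: a_def b_def)
    have lny: "0 < ln y" "\<bar>ln y\<bar> = ln y" using True by simp_all
    have h: "norm (contour_integral (linepath (Complex (-K) h) (Complex c h)) f) \<le> y powr c / (T * \<bar>ln y\<bar>)"
      if "T \<le> \<bar>h\<bar>" for h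
    proof -
      have "norm (contour_integral (linepath (Complex (-K) h) (Complex c h)) f)
          \<le> (y powr c - y powr (-K)) / (\<bar>h\<bar> * ln y)"
        unfolding f_def by (rule horizontal_kernel_bound) (use K c T that y in auto)
      also have "\<dots> \<le> y powr c / (\<bar>h\<bar> * \<bar>ln y\<bar>)"
        unfolding lny(2) using lny(1) by (intro divide_right_mono) auto
      also have "\<dots> \<le> y powr c / (T * \<bar>ln y\<bar>)" by (rule frac) (use that in auto)
      finally show ?thesis .
    qed
    have "norm (contour_integral (linepath (Complex (-K) (-T1)) (Complex (-K) T2)) f)
        \<le> y powr (-K) / \<bar>-K\<bar> * (T2 - (-T1))"
      unfolding f_def by (rule vertical_kernel_bound) (use K T12 y in auto)
    also have "\<dots> \<le> 1 / K * (T1 + T2)"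
    proof -
      have "y powr (-K) \<le> y powr 0" using True K by (intro powr_mono) auto
      hence "y powr (-K) / \<bar>-K\<bar> \<le> 1 / K" using K y by (simp add: divide_right_mono)
      moreover have "T2 - (-T1) = T1 + T2" by simp
      ultimately show ?thesis using T12 by (metis add_nonneg_nonneg less_imp_le mult_right_mono)
    qed
    also have "\<dots> \<le> e" using Ke by simp
    finally have v: "norm (contour_integral (linepath (Complex (-K) (-T1)) (Complex (-K) T2)) f) \<le> e" .
    have "contour_integral (linepath (Complex c (-T1)) (Complex c T2)) f - 2 * pi * \<i> =
        - contour_integral (linepath (Complex (-K) (-T1)) (Complex c (-T1))) f
        + contour_integral (linepath (Complex (-K) T2) (Complex c T2)) f
        + contour_integral (linepath (Complex (-K) (-T1)) (Complex (-K) T2)) f"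
      unfolding eq by simp
    also have "norm \<dots> \<le> y powr c / (T * \<bar>ln y\<bar>) + y powr c / (T * \<bar>ln y\<bar>) + e"
      by (intro norm_triangle_mono v h, subst norm_minus_cancel, rule h) (use T in auto)
    finally show ?thesis using True by (simp add: f_def)
  next
    case False
    hence y1: "y < 1" using y by simp
    define a b where "a = Complex c (-T1)" and "b = Complex K T2"
    have ab: "Re a < Re b" "Im a < Im b"
      using T12 K c by (auto simp: a_def b_def)
    have "path_image (rectpath a b) \<subseteq> cbox a b"
      using ab by (intro path_image_rectpath_subset_cbox) auto
    hence img: "path_image (rectpath a b) \<subseteq> {s. 0 < Re s}"
      using c by (force simp: in_cbox_complex_iff a_def)
    have "(f has_contour_integral 0) (rectpath a b)"
      by (rule Cauchy_theorem_convex_simple[OF _ convex_halfspace_Re_gt _ img])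
         (auto simp: f_def intro!: holomorphic_intros)
    hence "contour_integral (rectpath a b) f = 0" by (rule contour_integral_unique)
    moreover have "continuous_on (path_image (rectpath a b)) f"
      unfolding f_def using img y by (intro continuous_intros) auto
    ultimately have eq: "0 =
        contour_integral (linepath (Complex c (-T1)) (Complex K (-T1))) f
      + contour_integral (linepath (Complex K (-T1)) (Complex K T2)) f
      - contour_integral (linepath (Complex c T2) (Complex K T2)) f
      - contour_integral (linepath (Complex c (-T1)) (Complex c T2)) f"
      using contour_integral_rectpath_split[of a b f] ab by (simp add: a_def b_def)
    have lny: "ln y < 0" "\<bar>ln y\<bar> = - ln y" using y1 y by simp_all
    have h: "norm (contour_integral (linepath (Complex c h) (Complex K h)) f) \<le> y powr c / (T * \<bar>ln y\<bar>)"
      if "T \<le> \<bar>h\<bar>" for h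
    proof -
      have "norm (contour_integral (linepath (Complex c h) (Complex K h)) f)
          \<le> (y powr K - y powr c) / (\<bar>h\<bar> * ln y)"
        unfolding f_def by (rule horizontal_kernel_bound) (use K c T that y in auto)
      also have "\<dots> = (y powr c - y powr K) / (\<bar>h\<bar> * \<bar>ln y\<bar>)"
        unfolding lny(2) by (metis minus_diff_eq minus_divide_divide mult_minus_right)
      also have "\<dots> \<le> y powr c / (\<bar>h\<bar> * \<bar>ln y\<bar>)"
        by (intro divide_right_mono) auto
      also have "\<dots> \<le> y powr c / (T * \<bar>ln y\<bar>)" by (rule frac) (use that in auto)
      finally show ?thesis .
    qed
    have "norm (contour_integral (linepath (Complex K (-T1)) (Complex K T2)) f)
        \<le> y powr K / \<bar>K\<bar> * (T2 - (-T1))"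
      unfolding f_def by (rule vertical_kernel_bound) (use K T12 y in auto)
    also have "\<dots> \<le> 1 / K * (T1 + T2)"
    proof -
      have "y powr K \<le> y powr 0" using y1 y K by (intro powr_mono') auto
      hence "y powr K / \<bar>K\<bar> \<le> 1 / K" using K y by (simp add: divide_right_mono)
      moreover have "T2 - (-T1) = T1 + T2" by simp
      ultimately show ?thesis using T12 by (metis add_nonneg_nonneg less_imp_le mult_right_mono)
    qed
    also have "\<dots> \<le> e" using Ke by simp
    finally have v: "norm (contour_integral (linepath (Complex K (-T1)) (Complex K T2)) f) \<le> e" .
    have "contour_integral (linepath (Complex c (-T1)) (Complex c T2)) f =
        contour_integral (linepath (Complex c (-T1)) (Complex K (-T1))) f
        - contour_integral (linepath (Complex c T2) (Complex K T2)) f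
        + contour_integral (linepath (Complex K (-T1)) (Complex K T2)) f"
      using eq by (simp add: algebra_simps)
    also have "norm \<dots> \<le> (y powr c / (T * \<bar>ln y\<bar>) + y powr c / (T * \<bar>ln y\<bar>)) + e"
      by (rule order_trans[OF norm_triangle_ineq], intro add_mono v order_trans[OF norm_triangle_ineq4] h)
         (use T in auto)
    finally show ?thesis using False by (simp add: f_def)
  qed
qed

text \<open>The Perron kernel degenerates as its argument approaches 1. A half integer is at
  distance at least 1/2 from every m, which bounds the logarithm of the quotient away from 0
  uniformly in m.\<close>

lemma half_integer_ln_quotient:
  fixes n m :: nat
  assumes "1 \<le> n" "1 \<le> m" "y = real n + 1/2"
  shows "1 / (4 * y) \<le> \<bar>ln (y / real m)\<bar>" "y / real m \<noteq> 1" "1 < y / real m \<longleftrightarrow> m \<le> n"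
proof -
  have y: "3/2 \<le> y" using assms by simp
  consider "m \<le> n" | "n + 1 \<le> m" by linarith
  thus "1 / (4 * y) \<le> \<bar>ln (y / real m)\<bar>"
  proof cases
    case 1
    hence my: "real m + 1/2 \<le> y" using assms by simp
    have "1 - real m / y \<le> ln (y / real m)"
      using ln_le_minus_one[of "real m / y"] assms(2) y by (simp add: ln_div)
    moreover have "1 / (4 * y) \<le> 1 - real m / y"
      using my y by (simp add: field_simps)
    ultimately show ?thesis by linarith
  next
    case 2
    hence my: "y + 1/2 \<le> real m" using assms by simp
    have "1 - y / real m \<le> - ln (y / real m)"
      using ln_le_minus_one[of "y / real m"] assms(2) y by simp
    moreover have "1 / (4 * y) \<le> 1 - y / real m"
    proof -
      have "y / real m \<le> y / (y + 1/2)" using my y assms(2) by (intro divide_left_mono) auto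
      moreover have "1 / (4 * y) \<le> 1 - y / (y + 1/2)" using y by (simp add: field_simps)
      ultimately show ?thesis by linarith
    qed
    ultimately show ?thesis by linarith
  qed
  show "1 < y / real m \<longleftrightarrow> m \<le> n" using assms by (auto simp: field_simps)
  have "real (2 * n + 1) \<noteq> real (2 * m)" by (simp only: of_nat_eq_iff) presburger
  hence "y \<noteq> real m" using assms(3) by auto
  thus "y / real m \<noteq> 1" using assms(2) by simp
qed

lemma of_real_powr_divide:
  assumes "0 < y" "0 < m"
  shows "(of_real (y / m) :: complex) powr s = of_real y powr s / of_real m powr s"
proof -
  have "(of_real (y / m) :: complex) powr s * of_real m powr s = of_real y powr s"
    using powr_times_real[of "of_real (y / m)" "of_real m" s] assms by simp
  thus ?thesis using assms by (simp add: field_simps)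
qed

text \<open>Uniform convergence on the segment allows termwise integration, and each term is a
  Perron kernel. The error 8 y^3 / T consists of the kernel constant 2, the factor (y/m)^2 from the
  line Re s = 2, and 4 y from the distance of a half integer to the integers.\<close>

lemma perron_half_integer:
  fixes a :: "nat \<Rightarrow> complex" and F :: "complex \<Rightarrow> complex" and T y :: real
  assumes a0: "a 0 = 0" and sa: "summable (\<lambda>m. norm (a m) / real m ^ 2)"
    and F: "\<And>s. Re s = 2 \<Longrightarrow> (\<lambda>m. a m / of_nat m powr s) sums F s"
    and y: "y = real n + 1/2" "1 \<le> n" and T: "0 < T"
  shows "(\<lambda>s. F s * (of_real y powr s / s)) contour_integrable_on linepath (Complex 2 (-T)) (Complex 2 T)"
    and "norm (contour_integral (linepath (Complex 2 (-T)) (Complex 2 T)) (\<lambda>s. F s * (of_real y powr s / s))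
           - 2 * of_real pi * \<i> * (\<Sum>m\<le>n. a m)) \<le> 8 * y ^ 3 * (\<Sum>m. norm (a m) / real m ^ 2) / T"
proof -
  define \<gamma> where "\<gamma> = linepath (Complex 2 (-T)) (Complex 2 T)"
  have y0: "0 < y" using y by simp
  have Re2: "Re s = 2" if "s \<in> path_image \<gamma>" for s
    using closed_segment_vertical_Re that by (simp add: \<gamma>_def)
  define g where "g = (\<lambda>m s. a m * (of_real (y / real m) powr s / s))"
  have gb: "norm (g m s) \<le> y ^ 2 * (norm (a m) / real m ^ 2)" if s: "s \<in> path_image \<gamma>" for m s
  proof (cases "m = 0")
    case False
    have "1 \<le> norm s" using abs_Re_le_cmod[of s] Re2[OF s] by simp
    moreover have "norm (of_real (y / real m) powr s) = (y / real m) powr 2"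
      using y0 Re2[OF s] by (subst norm_powr_real_powr) auto
    ultimately have "norm (of_real (y / real m) powr s / s) \<le> (y / real m) powr 2 / 1"
      unfolding norm_divide by (intro frac_le) auto
    also have "\<dots> = y ^ 2 / real m ^ 2" using y0 False by (simp add: powr_numeral power_divide)
    finally have "norm (g m s) \<le> norm (a m) * (y ^ 2 / real m ^ 2)"
      unfolding g_def norm_mult by (rule mult_left_mono) auto
    thus ?thesis by (simp add: mult_ac)
  qed (simp add: g_def a0)
  have ul: "uniform_limit (path_image \<gamma>) (\<lambda>N s. \<Sum>m<N. g m s) (\<lambda>s. \<Sum>m. g m s) sequentially"
    by (rule Weierstrass_m_test[OF gb summable_mult[OF sa]])
  have lim: "(\<Sum>m. g m s) = F s * (of_real y powr s / s)" if s: "s \<in> path_image \<gamma>" for s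
  proof -
    have "(\<lambda>m. a m / of_nat m powr s * (of_real y powr s / s)) sums (F s * (of_real y powr s / s))"
      by (rule sums_mult2[OF F[OF Re2[OF s]]])
    moreover have "g m s = a m / of_nat m powr s * (of_real y powr s / s)" for m
      using of_real_powr_divide[OF y0, of "real m" s] a0
      by (cases "m = 0") (simp_all add: g_def)
    ultimately show ?thesis by (simp add: sums_iff)
  qed
  have gcont: "g m contour_integrable_on \<gamma>" for m
  proof (cases "m = 0")
    case False
    have "s \<noteq> 0" if "s \<in> closed_segment (Complex 2 (-T)) (Complex 2 T)" for s
      using closed_segment_vertical_Re[OF that] by auto
    thus ?thesis unfolding \<gamma>_def g_def using False y0
      by (intro contour_integrable_continuous_linepath continuous_intros) auto
  next
    case True
    hence "g m = (\<lambda>s. 0)" by (simp add: g_def a0 fun_eq_iff)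
    thus ?thesis using has_contour_integral_0 unfolding contour_integrable_on_def by metis
  qed
  have sum_int: "(\<lambda>s. \<Sum>m<N. g m s) contour_integrable_on \<gamma>" for N
    by (intro contour_integrable_sum gcont) auto
  have vd: "norm (vector_derivative \<gamma> (at t)) \<le> norm (Complex 2 T - Complex 2 (-T))" for t
    by (simp add: \<gamma>_def)
  have valid: "valid_path \<gamma>" by (simp add: \<gamma>_def)
  note unif = contour_integral_uniform_limit[OF always_eventually[OF allI[OF sum_int]] ul vd valid sequentially_bot]
  have eqon: "(\<lambda>s. \<Sum>m. g m s) contour_integrable_on \<gamma> \<longleftrightarrow> (\<lambda>s. F s * (of_real y powr s / s)) contour_integrable_on \<gamma>"
    by (rule iffI; erule contour_integrable_eq; simp only: lim)
  have "contour_integral \<gamma> (\<lambda>s. \<Sum>m. g m s) = contour_integral \<gamma> (\<lambda>s. F s * (of_real y powr s / s))"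
    by (rule contour_integral_cong) (use lim in auto)
  hence conv: "(\<lambda>N. contour_integral \<gamma> (\<lambda>s. \<Sum>m<N. g m s) - 2 * of_real pi * \<i> * (\<Sum>m\<le>n. a m))
        \<longlonglongrightarrow> contour_integral \<gamma> (\<lambda>s. F s * (of_real y powr s / s)) - 2 * of_real pi * \<i> * (\<Sum>m\<le>n. a m)"
    using unif(2) by (intro tendsto_intros) simp
  show "(\<lambda>s. F s * (of_real y powr s / s)) contour_integrable_on linepath (Complex 2 (-T)) (Complex 2 T)"
    using unif(1) eqon by (simp add: \<gamma>_def)
  have tm: "norm (contour_integral \<gamma> (g m) - (if m \<le> n then 2 * of_real pi * \<i> * a m else 0))
       \<le> 8 * y ^ 3 * (norm (a m) / real m ^ 2) / T" for m
  proof (cases "m = 0")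
    case False
    hence m: "1 \<le> m" by simp
    note hi = half_integer_ln_quotient[OF y(2) m y(1)]
    define r where "r = y / real m"
    have r: "0 < r" using y0 m by (simp add: r_def)
    have "contour_integral \<gamma> (g m) = a m * contour_integral \<gamma> (\<lambda>s. of_real r powr s / s)"
    proof -
      have "s \<noteq> 0" if "s \<in> closed_segment (Complex 2 (-T)) (Complex 2 T)" for s
        using closed_segment_vertical_Re[OF that] by auto
      hence "(\<lambda>s. of_real r powr s / s) contour_integrable_on \<gamma>"
        unfolding \<gamma>_def using r by (intro contour_integrable_continuous_linepath continuous_intros) auto
      thus ?thesis unfolding g_def r_def[symmetric] by (rule contour_integral_lmul)
    qed
    hence "contour_integral \<gamma> (g m) - (if m \<le> n then 2 * of_real pi * \<i> * a m else 0)
        = a m * (contour_integral \<gamma> (\<lambda>s. of_real r powr s / s) - (if 1 < r then 2 * of_real pi * \<i> else 0))"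
      using hi(3) by (simp add: r_def right_diff_distrib mult_ac)
    also have "norm \<dots> \<le> norm (a m) * (2 * r powr 2 / (T * \<bar>ln r\<bar>))"
      unfolding norm_mult \<gamma>_def
      by (intro mult_left_mono perron_kernel) (use r hi(2) T in \<open>auto simp: r_def\<close>)
    also have "\<dots> \<le> norm (a m) * (2 * r powr 2 / (T * (1 / (4 * y))))"
      using hi(1,2) T y0 r by (intro mult_left_mono divide_left_mono mult_pos_pos) (auto simp: r_def)
    also have "\<dots> = 8 * y ^ 3 * (norm (a m) / real m ^ 2) / T"
      using m y0 T r by (simp add: r_def powr_numeral power_divide field_simps power2_eq_square power3_eq_cube)
    finally show ?thesis .
  qed (simp add: g_def[abs_def] a0)
  have "norm (contour_integral \<gamma> (\<lambda>s. \<Sum>m<N. g m s) - 2 * of_real pi * \<i> * (\<Sum>m\<le>n. a m))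
      \<le> 8 * y ^ 3 * (\<Sum>m. norm (a m) / real m ^ 2) / T" if N: "Suc n \<le> N" for N
  proof -
    have "2 * of_real pi * \<i> * (\<Sum>m\<le>n. a m) = (\<Sum>m<N. if m \<le> n then 2 * of_real pi * \<i> * a m else 0)"
      unfolding sum_distrib_left
      by (rule sum.mono_neutral_cong_left) (use N in auto)
    hence "contour_integral \<gamma> (\<lambda>s. \<Sum>m<N. g m s) - 2 * of_real pi * \<i> * (\<Sum>m\<le>n. a m)
       = (\<Sum>m<N. contour_integral \<gamma> (g m) - (if m \<le> n then 2 * of_real pi * \<i> * a m else 0))"
      by (simp add: contour_integral_sum gcont sum_subtractf)
    also have "norm \<dots> \<le> (\<Sum>m<N. 8 * y ^ 3 * (norm (a m) / real m ^ 2) / T)"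
      by (rule order_trans[OF norm_sum sum_mono[OF tm]])
    also have "\<dots> = 8 * y ^ 3 / T * (\<Sum>m<N. norm (a m) / real m ^ 2)"
      by (simp add: sum_distrib_left mult_ac)
    also have "\<dots> \<le> 8 * y ^ 3 / T * (\<Sum>m. norm (a m) / real m ^ 2)"
      using y0 T by (intro mult_left_mono sum_le_suminf sa) auto
    finally show ?thesis by simp
  qed
  hence "norm (contour_integral \<gamma> (\<lambda>s. F s * (of_real y powr s / s)) - 2 * of_real pi * \<i> * (\<Sum>m\<le>n. a m))
      \<le> 8 * y ^ 3 * (\<Sum>m. norm (a m) / real m ^ 2) / T"
    by (intro Lim_norm_ubound[OF _ conv]) (auto simp: eventually_sequentially intro!: exI[of _ "Suc n"])
  thus "norm (contour_integral (linepath (Complex 2 (-T)) (Complex 2 T)) (\<lambda>s. F s * (of_real y powr s / s))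
           - 2 * of_real pi * \<i> * (\<Sum>m\<le>n. a m)) \<le> 8 * y ^ 3 * (\<Sum>m. norm (a m) / real m ^ 2) / T"
    by (simp add: \<gamma>_def)
qed

text \<open>The Borel--Caratheodory argument: \<open>f / (2A - f)\<close> maps the disc to the unit disc
  and fixes 0.\<close>
lemma borel_caratheodory_deriv:
  assumes hol: "f holomorphic_on ball z0 R" and f0: "f z0 = 0" and A: "0 < A"
    and Re: "\<And>z. z \<in> ball z0 R \<Longrightarrow> Re (f z) < A"
    and rR: "0 \<le> r" "r < R" and z: "dist z0 z \<le> r"
  shows "norm (deriv f z) \<le> 8 * A * R / (R - r) ^ 2"
proof -
  have R: "0 < R" using rR by simp
  define G where "G = (\<lambda>w. f (z0 + of_real R * w) / (2 * of_real A - f (z0 + of_real R * w)))"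
  have inb: "z0 + of_real R * w \<in> ball z0 R" if "norm w < 1" for w
    using that R by (simp add: dist_norm norm_mult)
  have nz: "2 * of_real A - f w \<noteq> 0" if "w \<in> ball z0 R" for w
  proof
    assume "2 * of_real A - f w = 0"
    hence "Re (f w) = Re (2 * of_real A)" by simp
    thus False using Re[OF that] A by simp
  qed
  have Glt: "norm (f w) < norm (2 * of_real A - f w)" if "w \<in> ball z0 R" for w
  proof -
    have "0 < A * (A - Re (f w))" using Re[OF that] A by simp
    hence "(Re (f w))\<^sup>2 + (Im (f w))\<^sup>2 < (2 * A - Re (f w))\<^sup>2 + (Im (f w))\<^sup>2"
      by (simp add: power2_eq_square algebra_simps)
    hence "norm (f w) ^ 2 < norm (2 * of_real A - f w) ^ 2" by (simp add: cmod_power2)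
    thus ?thesis by (rule power_less_imp_less_base) simp
  qed
  have comp: "(\<lambda>w. f (z0 + of_real R * w)) holomorphic_on ball 0 1"
    by (rule holomorphic_on_compose_gen[of "\<lambda>w. z0 + of_real R * w" _ f "ball z0 R", unfolded comp_def])
       (use hol inb in \<open>auto intro!: holomorphic_intros\<close>)
  have holG: "G holomorphic_on ball 0 1"
    unfolding G_def using comp nz inb by (intro holomorphic_intros) auto
  have G1: "norm (G w) < 1" if "norm w < 1" for w
    using Glt[OF inb[OF that]] nz[OF inb[OF that]] by (simp add: G_def norm_divide)
  have fb: "norm (f w) \<le> 2 * A * dist z0 w / (R - dist z0 w)" if w: "w \<in> ball z0 R" for w
  proof -
    define v where "v = (w - z0) / of_real R"
    have v: "z0 + of_real R * v = w" using R by (simp add: v_def)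
    have nv: "norm v = dist z0 w / R" using R by (simp add: v_def norm_divide dist_norm norm_minus_commute)
    have nv1: "norm v < 1" using w R by (simp add: nv)
    have G: "norm (G v) \<le> norm v"
      by (rule Schwarz_Lemma(1)[OF holG _ G1 nv1]) (simp_all add: G_def f0)
    have "f w = G v * (2 * of_real A - f w)" using nz[OF w] by (simp add: G_def v)
    hence "norm (f w) = norm (G v) * norm (2 * of_real A - f w)" by (metis norm_mult)
    also have "\<dots> \<le> norm v * (2 * A + norm (f w))"
      using G A norm_triangle_ineq4[of "2 * of_real A" "f w"]
      by (intro mult_mono) (auto simp: norm_mult)
    finally have "norm (f w) * (1 - norm v) \<le> 2 * A * norm v" by (simp add: algebra_simps)
    hence "R * (norm (f w) * (1 - norm v)) \<le> R * (2 * A * norm v)"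
      using R by (intro mult_left_mono) auto
    moreover have "R * norm v = dist z0 w" using R by (simp add: nv)
    moreover have "R * (norm (f w) * (1 - norm v)) = norm (f w) * (R - R * norm v)"
      "R * (2 * A * norm v) = 2 * A * (R * norm v)" by (simp_all add: algebra_simps)
    ultimately have "norm (f w) * (R - dist z0 w) \<le> 2 * A * dist z0 w" by simp
    thus ?thesis using w by (simp add: field_simps)
  qed
  \<comment> \<open>Half of the gap between the radii is used for Cauchy's inequality: on the circle
    of radius \<open>d\<close> the function is at most 2 A R / d, and differentiation costs another
    1/d.\<close>
  define d where "d = (R - r) / 2"
  have d: "0 < d" using rR by (simp add: d_def)
  have dz: "dist z0 w \<le> R - d" if "dist z w \<le> d" for w
    using that z dist_triangle[of z0 w z] by (simp add: d_def field_simps)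
  have sub: "cball z d \<subseteq> ball z0 R" using dz d by (force simp: dist_commute)
  have "norm ((deriv ^^ 1) f z) \<le> fact 1 * (2 * A * R / d) / d ^ 1"
  proof (rule Cauchy_inequality)
    show "f holomorphic_on ball z d" using hol sub by (meson ball_subset_cball holomorphic_on_subset order_trans)
    show "continuous_on (cball z d) f"
      using hol sub holomorphic_on_imp_continuous_on holomorphic_on_subset by blast
    fix w assume "norm (z - w) = d"
    hence w: "dist z w \<le> d" by (simp add: dist_norm)
    have "norm (f w) \<le> 2 * A * dist z0 w / (R - dist z0 w)" using w sub by (intro fb) auto
    also have "\<dots> \<le> 2 * A * R / d"
      using dz[OF w] d A R by (intro frac_le mult_left_mono) auto
    finally show "norm (f w) \<le> 2 * A * R / d" .
  qed (rule d)
  also have "fact 1 * (2 * A * R / d) / d ^ 1 = 8 * A * R / (R - r) ^ 2"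
    using rR by (simp add: d_def power2_eq_square field_simps)
  finally show ?thesis by simp
qed

text \<open>A zero-free function on a disc has a holomorphic logarithm, whose real part is bounded
  above by the growth of the function relative to the centre. Borel-Caratheodory turns this
  one-sided bound into a bound for the derivative.\<close>

lemma log_deriv_bound:
  assumes hol: "h holomorphic_on ball z0 R" and nz: "\<And>z. z \<in> ball z0 R \<Longrightarrow> h z \<noteq> 0"
    and A: "0 < A" "\<And>z. z \<in> ball z0 R \<Longrightarrow> norm (h z) < exp A * norm (h z0)"
    and rR: "0 \<le> r" "r < R" and z: "dist z0 z \<le> r"
  shows "norm (deriv h z / h z) \<le> 8 * A * R / (R - r) ^ 2"
proof -
  have zb: "z0 \<in> ball z0 R" "z \<in> ball z0 R" using z rR by auto
  obtain g where g: "g holomorphic_on ball z0 R" "\<And>z. z \<in> ball z0 R \<Longrightarrow> h z = exp (g z)"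
    using contractible_imp_holomorphic_log[OF hol convex_imp_contractible[OF convex_ball] nz] by blast
  define f where "f = (\<lambda>z. g z - g z0)"
  have "norm (deriv f z) \<le> 8 * A * R / (R - r) ^ 2"
  proof (rule borel_caratheodory_deriv[of f z0 R A r z])
    show "f holomorphic_on ball z0 R" unfolding f_def by (intro holomorphic_intros g)
    fix w assume w: "w \<in> ball z0 R"
    have "exp (Re (g w)) < exp (A + Re (g z0))"
      using A(2)[OF w] g(2)[OF w] g(2)[OF zb(1)] by (simp add: exp_add)
    thus "Re (f w) < A" by (simp add: f_def)
  qed (use A rR z in \<open>auto simp: f_def\<close>)
  moreover have gd: "(g has_field_derivative deriv g z) (at z)"
    using holomorphic_derivI[OF g(1) open_ball zb(2)] .
  hence "deriv f z = deriv g z"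
    by (intro DERIV_imp_deriv) (auto simp: f_def intro!: derivative_eq_intros)
  moreover have "deriv h z = exp (g z) * deriv g z"
  proof -
    have "deriv h z = deriv (\<lambda>z. exp (g z)) z"
      by (rule deriv_cong_ev) (use eventually_nhds_in_open[OF open_ball zb(2)] g(2) in \<open>auto elim: eventually_mono\<close>)
    also have "((\<lambda>z. exp (g z)) has_field_derivative exp (g z) * deriv g z) (at z)"
      using gd by (auto intro!: derivative_eq_intros)
    hence "deriv (\<lambda>z. exp (g z)) z = exp (g z) * deriv g z" by (rule DERIV_imp_deriv)
    finally show ?thesis .
  qed
  ultimately show ?thesis using g(2)[OF zb(2)] by simp
qed

text \<open>Zeros are removed one at a time. The local factorisations at the other points survive,
  because the factor divided out does not vanish there.\<close>

lemma divide_out_zeros: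
  fixes f :: "complex \<Rightarrow> complex" and n :: "complex \<Rightarrow> nat"
  assumes "finite Z" "open S" "Z \<subseteq> S" "f holomorphic_on S"
    and "\<And>\<rho>. \<rho> \<in> Z \<Longrightarrow> \<exists>g. g analytic_on {\<rho>} \<and> g \<rho> \<noteq> 0 \<and> (\<forall>\<^sub>F w in nhds \<rho>. f w = g w * (w - \<rho>) ^ n \<rho>)"
  shows "\<exists>h. h holomorphic_on S \<and> (\<forall>s\<in>S. f s = h s * (\<Prod>\<rho>\<in>Z. (s - \<rho>) ^ n \<rho>)) \<and> (\<forall>\<rho>\<in>Z. h \<rho> \<noteq> 0)"
  using assms(1,3-)
proof (induction Z arbitrary: f rule: finite_induct)
  case empty
  thus ?case by auto
next
  case (insert \<rho> Z)
  obtain g where g: "g analytic_on {\<rho>}" "g \<rho> \<noteq> 0" "\<forall>\<^sub>F w in nhds \<rho>. f w = g w * (w - \<rho>) ^ n \<rho>"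
    using insert.prems(3)[OF insertI1] by blast
  define f1 where "f1 = (\<lambda>w. if w = \<rho> then g \<rho> else f w / (w - \<rho>) ^ n \<rho>)"
  have ev_f1: "\<forall>\<^sub>F w in nhds z. f1 w = f w / (w - \<rho>) ^ n \<rho>" if "z \<noteq> \<rho>" for z
  proof -
    have "\<forall>\<^sub>F w in nhds z. w \<in> - {\<rho>}" by (rule eventually_nhds_in_open) (use that in auto)
    thus ?thesis by (rule eventually_mono) (simp add: f1_def)
  qed
  have "f1 analytic_on {z}" if z: "z \<in> S" for z
  proof (cases "z = \<rho>")
    case True
    have "\<forall>\<^sub>F w in nhds \<rho>. f1 w = g w"
      using g(3) by eventually_elim (auto simp: f1_def)
    thus ?thesis using g(1) True analytic_at_cong by blast
  next
    case False
    have "f analytic_on {z}"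
      using insert.prems(2) assms(2) z analytic_at by blast
    hence "(\<lambda>w. f w / (w - \<rho>) ^ n \<rho>) analytic_on {z}"
      using False by (intro analytic_intros) auto
    thus ?thesis using analytic_at_cong[OF ev_f1[OF False]] by blast
  qed
  hence "f1 analytic_on S" using analytic_on_analytic_at by blast
  hence "f1 holomorphic_on S" by (rule analytic_imp_holomorphic)
  moreover have "\<exists>g. g analytic_on {\<rho>'} \<and> g \<rho>' \<noteq> 0 \<and> (\<forall>\<^sub>F w in nhds \<rho>'. f1 w = g w * (w - \<rho>') ^ n \<rho>')"
    if \<rho>': "\<rho>' \<in> Z" for \<rho>'
  proof -
    obtain g' where g': "g' analytic_on {\<rho>'}" "g' \<rho>' \<noteq> 0"
        "\<forall>\<^sub>F w in nhds \<rho>'. f w = g' w * (w - \<rho>') ^ n \<rho>'"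
      using insert.prems(3)[OF insertI2[OF \<rho>']] by blast
    have ne: "\<rho>' \<noteq> \<rho>" using \<rho>' insert.hyps by auto
    show ?thesis
    proof (intro exI[of _ "\<lambda>w. g' w / (w - \<rho>) ^ n \<rho>"] conjI)
      show "(\<lambda>w. g' w / (w - \<rho>) ^ n \<rho>) analytic_on {\<rho>'}"
        using g'(1) ne by (intro analytic_intros) auto
      show "g' \<rho>' / (\<rho>' - \<rho>) ^ n \<rho> \<noteq> 0" using g'(2) ne by simp
      show "\<forall>\<^sub>F w in nhds \<rho>'. f1 w = g' w / (w - \<rho>) ^ n \<rho> * (w - \<rho>') ^ n \<rho>'"
        using ev_f1[OF ne] g'(3) by eventually_elim simp
    qed
  qed
  ultimately obtain h where h: "h holomorphic_on S"
      "\<And>s. s \<in> S \<Longrightarrow> f1 s = h s * (\<Prod>\<rho>\<in>Z. (s - \<rho>) ^ n \<rho>)" "\<forall>\<rho>\<in>Z. h \<rho> \<noteq> 0"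
    using insert.IH[of f1] insert.prems(1) by blast
  have f\<rho>: "f \<rho> = g \<rho> * (\<rho> - \<rho>) ^ n \<rho>" using g(3) by (rule eventually_nhds_x_imp_x)
  have "f s = f1 s * (s - \<rho>) ^ n \<rho>" for s
    using f\<rho> by (cases "s = \<rho>") (auto simp: f1_def)
  hence "f s = h s * (\<Prod>\<rho>\<in>insert \<rho> Z. (s - \<rho>) ^ n \<rho>)" if "s \<in> S" for s
    using h(2)[OF that] insert.hyps by (simp add: mult_ac)
  moreover have "h \<rho> \<noteq> 0"
    using h(2)[of \<rho>] g(2) insert.prems(1) by (auto simp: f1_def)
  ultimately show ?case using h by (intro exI[of _ h]) auto
qed

lemma zorder_local_factor:
  assumes "f holomorphic_on S" "open S" "connected S" "\<rho> \<in> S" "\<exists>w\<in>S. f w \<noteq> 0"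
    and "f \<rho> = 0" "zorder f \<rho> = int n"
  shows "\<exists>g. g analytic_on {\<rho>} \<and> g \<rho> \<noteq> 0 \<and> (\<forall>\<^sub>F w in nhds \<rho>. f w = g w * (w - \<rho>) ^ n)"
proof -
  obtain r where r: "0 < r" "zor_poly f \<rho> holomorphic_on cball \<rho> r"
      "\<And>w. w \<in> cball \<rho> r \<Longrightarrow> f w = zor_poly f \<rho> w * (w - \<rho>) ^ n \<and> zor_poly f \<rho> w \<noteq> 0"
    using zorder_exist_zero[OF assms(1-5)] assms(7) by auto
  have "zor_poly f \<rho> analytic_on {\<rho>}"
    using r(1,2) by (metis analytic_at ball_subset_cball centre_in_ball holomorphic_on_subset open_ball)
  moreover have "\<forall>\<^sub>F w in nhds \<rho>. f w = zor_poly f \<rho> w * (w - \<rho>) ^ n"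
    using eventually_nhds_in_open[of "ball \<rho> r" \<rho>] r(1,3) by (auto elim!: eventually_mono)
  ultimately show ?thesis using r(1) r(3)[of \<rho>] by auto
qed

lemma deriv_prod_powers:
  fixes n :: "complex \<Rightarrow> nat"
  assumes "finite Z" "s \<notin> Z"
  shows "((\<lambda>s. \<Prod>\<rho>\<in>Z. (s - \<rho>) ^ n \<rho>) has_field_derivative
           (\<Prod>\<rho>\<in>Z. (s - \<rho>) ^ n \<rho>) * (\<Sum>\<rho>\<in>Z. of_nat (n \<rho>) / (s - \<rho>))) (at s)"
  using assms
proof (induction Z rule: finite_induct)
  case (insert \<rho> Z)
  have ne: "s - \<rho> \<noteq> 0" using insert.prems by auto
  have "((\<lambda>s. (s - \<rho>) ^ n \<rho>) has_field_derivative (s - \<rho>) ^ n \<rho> * (of_nat (n \<rho>) / (s - \<rho>))) (at s)"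
  proof (cases "n \<rho>")
    case (Suc m)
    have "((\<lambda>s. s - \<rho>) has_field_derivative 1) (at s)" by (auto intro!: derivative_eq_intros)
    from DERIV_power[OF this, of "Suc m"] show ?thesis using ne Suc by (simp add: mult_ac)
  qed simp
  from DERIV_mult[OF this insert.IH] insert show ?case by (simp add: algebra_simps)
qed simp

lemma log_deriv_divide_out:
  fixes n :: "complex \<Rightarrow> nat"
  assumes "finite Z" "s \<notin> Z" "open S" "s \<in> S" "h holomorphic_on S" "h s \<noteq> 0"
    and "\<And>s. s \<in> S \<Longrightarrow> f s = h s * (\<Prod>\<rho>\<in>Z. (s - \<rho>) ^ n \<rho>)"
  shows "deriv f s / f s = deriv h s / h s + (\<Sum>\<rho>\<in>Z. of_nat (n \<rho>) / (s - \<rho>))"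
proof -
  define P where "P = (\<lambda>s. \<Prod>\<rho>\<in>Z. (s - \<rho>) ^ n \<rho>)"
  define D where "D = (\<Sum>\<rho>\<in>Z. of_nat (n \<rho>) / (s - \<rho>))"
  have P: "(P has_field_derivative P s * D) (at s)"
    unfolding P_def D_def by (rule deriv_prod_powers[OF assms(1,2)])
  have Ps: "P s \<noteq> 0" using assms(1,2) by (auto simp: P_def)
  have "(h has_field_derivative deriv h s) (at s)" by (rule holomorphic_derivI[OF assms(5,3,4)])
  from DERIV_mult[OF this P]
  have "((\<lambda>s. h s * P s) has_field_derivative deriv h s * P s + P s * D * h s) (at s)" .
  hence "deriv (\<lambda>s. h s * P s) s = deriv h s * P s + P s * D * h s" by (rule DERIV_imp_deriv)
  moreover have "deriv f s = deriv (\<lambda>s. h s * P s) s"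
    by (rule deriv_cong_ev) (use eventually_nhds_in_open[OF assms(3,4)] assms(7) in \<open>auto simp: P_def elim: eventually_mono\<close>)
  moreover have "f s = h s * P s" using assms(7)[OF assms(4)] by (simp add: P_def)
  ultimately show ?thesis unfolding D_def[symmetric] using assms(6) Ps
    by (simp add: field_simps)
qed

section \<open>The explicit formula\<close>

lemma contour_integral_linepath_shift:
  "contour_integral (linepath a b) (\<lambda>s. f (s - r)) = contour_integral (linepath (a - r) (b - r)) f"
proof -
  have "linepath (a - r) (b - r) t = linepath a b t - r" for t
    by (simp add: linepath_def algebra_simps)
  thus ?thesis by (simp add: contour_integral_integral)
qed

text \<open>By partial fractions 1 / (s (s - \<rho>)) is a difference of two Perron kernels divided
  by \<rho>. The shifted kernel has the unequal heights T + Im \<rho> and T - Im \<rho>, both at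
  least T/2; this is why \<open>perron_kernel\<close> allows two heights. The -1 in the main term
  comes from the pole at s = 0.\<close>

lemma zero_kernel:
  fixes T y :: real
  assumes \<rho>: "1/2 \<le> Re \<rho>" "Re \<rho> < 1" "\<bar>Im \<rho>\<bar> \<le> T / 2" and T: "0 < T" and y: "3/2 \<le> y"
  shows "(\<lambda>s. of_real y powr s / s / (s - \<rho>)) contour_integrable_on linepath (Complex 2 (-T)) (Complex 2 T)"
    and "norm (contour_integral (linepath (Complex 2 (-T)) (Complex 2 T)) (\<lambda>s. of_real y powr s / s / (s - \<rho>))
           - 2 * of_real pi * \<i> * ((of_real y powr \<rho> - 1) / \<rho>)) \<le> 36 * y ^ 2 / T"
proof -
  define \<gamma> where "\<gamma> = linepath (Complex 2 (-T)) (Complex 2 T)"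
  define J where "J = contour_integral \<gamma>"
  have Re2: "Re s = 2" if "s \<in> closed_segment (Complex 2 (-T)) (Complex 2 T)" for s
    using closed_segment_vertical_Re that by simp
  have ne: "s \<noteq> 0" "s \<noteq> \<rho>" if "s \<in> closed_segment (Complex 2 (-T)) (Complex 2 T)" for s
    using Re2[OF that] \<rho> by auto
  have \<rho>0: "\<rho> \<noteq> 0" using \<rho> by auto
  show "(\<lambda>s. of_real y powr s / s / (s - \<rho>)) contour_integrable_on linepath (Complex 2 (-T)) (Complex 2 T)"
    using ne y by (intro contour_integrable_continuous_linepath continuous_intros) auto
  have i1: "(\<lambda>s. of_real y powr (s - \<rho>) / (s - \<rho>)) contour_integrable_on \<gamma>"
    unfolding \<gamma>_def using ne y by (intro contour_integrable_continuous_linepath continuous_intros) auto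
  have i2: "(\<lambda>s. of_real y powr s / s) contour_integrable_on \<gamma>"
    unfolding \<gamma>_def using ne y by (intro contour_integrable_continuous_linepath continuous_intros) auto
  have "J (\<lambda>s. of_real y powr s / s / (s - \<rho>))
      = J (\<lambda>s. 1 / \<rho> * (of_real y powr \<rho> * (of_real y powr (s - \<rho>) / (s - \<rho>)) - of_real y powr s / s))"
    unfolding J_def
  proof (rule contour_integral_cong)
    fix s assume "s \<in> path_image \<gamma>"
    hence s: "s \<noteq> 0" "s - \<rho> \<noteq> 0" using ne by (auto simp: \<gamma>_def)
    have "of_real y powr \<rho> * (of_real y powr (s - \<rho>)) = (of_real y powr s :: complex)"
      by (simp flip: powr_add)
    hence "1 / \<rho> * (of_real y powr \<rho> * (of_real y powr (s - \<rho>) / (s - \<rho>)) - of_real y powr s / s)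
        = 1 / \<rho> * (of_real y powr s / (s - \<rho>) - of_real y powr s / s)" by simp
    also have "\<dots> = of_real y powr s * (1 / \<rho> * (1 / (s - \<rho>) - 1 / s))"
      by (simp add: right_diff_distrib mult_ac)
    also have "1 / \<rho> * (1 / (s - \<rho>) - 1 / s) = 1 / (s * (s - \<rho>))"
      using s \<rho>0 by (simp add: divide_simps)
    finally show "of_real y powr s / s / (s - \<rho>) =
        1 / \<rho> * (of_real y powr \<rho> * (of_real y powr (s - \<rho>) / (s - \<rho>)) - of_real y powr s / s)"
      by simp
  qed simp
  also have "\<dots> = 1 / \<rho> * (of_real y powr \<rho> * J (\<lambda>s. of_real y powr (s - \<rho>) / (s - \<rho>)) - J (\<lambda>s. of_real y powr s / s))"
    unfolding J_def using i1 i2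
    by (simp only: contour_integral_lmul contour_integral_diff contour_integrable_lmul contour_integrable_diff)
  finally have eq: "J (\<lambda>s. of_real y powr s / s / (s - \<rho>)) - 2 * of_real pi * \<i> * ((of_real y powr \<rho> - 1) / \<rho>)
     = 1 / \<rho> * (of_real y powr \<rho> * (J (\<lambda>s. of_real y powr (s - \<rho>) / (s - \<rho>)) - 2 * of_real pi * \<i>)
        - (J (\<lambda>s. of_real y powr s / s) - 2 * of_real pi * \<i>))"
    using \<rho>0 by (simp add: field_simps)
  have y1: "1 < y" "0 < ln y" using y by auto
  have lny: "1 / 3 \<le> ln y"
  proof -
    have "ln (1 / y) \<le> 1 / y - 1" by (rule ln_le_minus_one) (use y in auto)
    moreover have "ln (1 / y) = - ln y" using y by (simp add: ln_div)
    moreover have "1 / y \<le> 2 / 3" using y by (simp add: field_simps)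
    ultimately show ?thesis by linarith
  qed
  have "norm (J (\<lambda>s. of_real y powr s / s) - (if 1 < y then 2 * of_real pi * \<i> else 0))
      \<le> 2 * y powr 2 / (T * \<bar>ln y\<bar>)"
    unfolding J_def \<gamma>_def by (rule perron_kernel) (use T y in auto)
  hence b2: "norm (J (\<lambda>s. of_real y powr s / s) - 2 * of_real pi * \<i>) \<le> 2 * y ^ 2 / (T * ln y)"
    using y1 by (simp add: powr_numeral)
  have "J (\<lambda>s. of_real y powr (s - \<rho>) / (s - \<rho>))
     = contour_integral (linepath (Complex (2 - Re \<rho>) (-(T + Im \<rho>))) (Complex (2 - Re \<rho>) (T - Im \<rho>))) (\<lambda>s. of_real y powr s / s)"
  proof -
    have "Complex 2 (-T) - \<rho> = Complex (2 - Re \<rho>) (-(T + Im \<rho>))" "Complex 2 T - \<rho> = Complex (2 - Re \<rho>) (T - Im \<rho>)"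
      by (simp_all add: complex_eq_iff)
    thus ?thesis unfolding J_def \<gamma>_def
      using contour_integral_linepath_shift[of "Complex 2 (-T)" "Complex 2 T" "\<lambda>s. of_real y powr s / s" \<rho>] by simp
  qed
  moreover have "norm (contour_integral (linepath (Complex (2 - Re \<rho>) (-(T + Im \<rho>))) (Complex (2 - Re \<rho>) (T - Im \<rho>)))
      (\<lambda>s. of_real y powr s / s) - (if 1 < y then 2 * of_real pi * \<i> else 0))
      \<le> 2 * y powr (2 - Re \<rho>) / (T / 2 * \<bar>ln y\<bar>)"
    by (rule perron_kernel) (use T y \<rho> in auto)
  ultimately have b1: "norm (J (\<lambda>s. of_real y powr (s - \<rho>) / (s - \<rho>)) - 2 * of_real pi * \<i>)
      \<le> 4 * y powr (2 - Re \<rho>) / (T * ln y)" using y1 by simp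
  have "norm (of_real y powr \<rho> * (J (\<lambda>s. of_real y powr (s - \<rho>) / (s - \<rho>)) - 2 * of_real pi * \<i>))
      \<le> y powr Re \<rho> * (4 * y powr (2 - Re \<rho>) / (T * ln y))"
    unfolding norm_mult using b1 y1 by (intro mult_mono) (auto simp: norm_powr_real_powr)
  also have "\<dots> = 4 * (y powr Re \<rho> * y powr (2 - Re \<rho>)) / (T * ln y)" by (simp add: mult_ac)
  also have "y powr Re \<rho> * y powr (2 - Re \<rho>) = y ^ 2"
    using y1 by (simp add: powr_numeral flip: powr_add)
  finally have b3: "norm (of_real y powr \<rho> * (J (\<lambda>s. of_real y powr (s - \<rho>) / (s - \<rho>)) - 2 * of_real pi * \<i>))
      \<le> 4 * y ^ 2 / (T * ln y)" .
  have "norm (of_real y powr \<rho> * (J (\<lambda>s. of_real y powr (s - \<rho>) / (s - \<rho>)) - 2 * of_real pi * \<i>)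
        - (J (\<lambda>s. of_real y powr s / s) - 2 * of_real pi * \<i>))
      \<le> 4 * y ^ 2 / (T * ln y) + 2 * y ^ 2 / (T * ln y)"
    by (rule order_trans[OF norm_triangle_ineq4 add_mono[OF b3 b2]])
  also have "\<dots> = 6 * (y ^ 2 / (T * ln y))" by simp
  also have "\<dots> \<le> 6 * (y ^ 2 / (T * (1 / 3)))"
    using lny y1 T by (intro mult_left_mono divide_left_mono mult_pos_pos) auto
  finally have "norm (of_real y powr \<rho> * (J (\<lambda>s. of_real y powr (s - \<rho>) / (s - \<rho>)) - 2 * of_real pi * \<i>)
        - (J (\<lambda>s. of_real y powr s / s) - 2 * of_real pi * \<i>)) \<le> 18 * y ^ 2 / T" by simp
  moreover have "norm (1 / \<rho>) \<le> 2"
  proof -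
    have "1/2 \<le> norm \<rho>" using abs_Re_le_cmod[of \<rho>] \<rho> by linarith
    hence "1 / norm \<rho> \<le> 1 / (1/2)" by (intro divide_left_mono) auto
    thus ?thesis by (simp add: norm_divide)
  qed
  ultimately have "norm (J (\<lambda>s. of_real y powr s / s / (s - \<rho>)) - 2 * of_real pi * \<i> * ((of_real y powr \<rho> - 1) / \<rho>))
      \<le> 2 * (18 * y ^ 2 / T)"
    unfolding eq norm_mult by (intro mult_mono) auto
  thus "norm (contour_integral (linepath (Complex 2 (-T)) (Complex 2 T)) (\<lambda>s. of_real y powr s / s / (s - \<rho>))
           - 2 * of_real pi * \<i> * ((of_real y powr \<rho> - 1) / \<rho>)) \<le> 36 * y ^ 2 / T"
    by (simp add: J_def \<gamma>_def)
qed

text \<open>For c at least 1/2 the modulus of s is at least sqrt (1 + (Im s)^2) / 2. The reciprocal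
  of the root integrates to \<open>arsinh\<close>, hence to a logarithm of T.\<close>

lemma vertical_log_bound:
  fixes c T B :: real
  assumes c: "1/2 \<le> c" and T: "4 \<le> T" and B: "0 \<le> B"
    and cont: "continuous_on (closed_segment (Complex c (-T)) (Complex c T)) f"
    and f: "\<And>s. s \<in> closed_segment (Complex c (-T)) (Complex c T) \<Longrightarrow> norm (f s) \<le> B / norm s"
  shows "norm (contour_integral (linepath (Complex c (-T)) (Complex c T)) f) \<le> 8 * B * ln T"
proof -
  define g where "g = (\<lambda>t::real. 2 * B * (2 * T) / sqrt ((T * (2 * t - 1))\<^sup>2 + 1))"
  have "norm (contour_integral (linepath (Complex c (-T)) (Complex c T)) f) \<le> 2 * B * arsinh (T * (2 * 1 - 1)) - 2 * B * arsinh (T * (2 * 0 - 1))"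
  proof (rule norm_contour_integral_linepath_le[OF cont])
    show "(g has_integral (2 * B * arsinh (T * (2 * 1 - 1)) - 2 * B * arsinh (T * (2 * 0 - 1)))) {0..1}"
    proof (rule fundamental_theorem_of_calculus)
      fix t :: real
      have "((\<lambda>t. 2 * B * arsinh (T * (2 * t - 1))) has_real_derivative g t) (at t)"
      proof -
        have "((\<lambda>t. T * (2 * t - 1)) has_real_derivative 2 * T) (at t)"
          by (auto intro!: derivative_eq_intros)
        from DERIV_cmult[OF DERIV_chain2[OF arsinh_real_has_field_derivative this], of "2 * B"]
        show ?thesis by (simp add: g_def mult_ac)
      qed
      thus "((\<lambda>t. 2 * B * arsinh (T * (2 * t - 1))) has_vector_derivative g t) (at t within {0..1})"
        by (auto simp: has_real_derivative_iff_has_vector_derivative intro: has_vector_derivative_at_within)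
    qed simp
    fix t :: real assume t: "t \<in> {0..1}"
    define s where "s = linepath (Complex c (-T)) (Complex c T) t"
    have s: "Re s = c" "Im s = T * (2 * t - 1)"
      by (simp_all add: s_def linepath_def algebra_simps)
    have "Complex c T - Complex c (-T) = \<i> * of_real (2 * T)" by (simp add: complex_eq_iff)
    hence d: "norm (Complex c T - Complex c (-T)) = 2 * T" using T by (simp only: norm_mult norm_of_real) simp
    have "s \<in> closed_segment (Complex c (-T)) (Complex c T)"
      unfolding s_def using t linepath_in_path by blast
    hence "norm (f s) \<le> B / norm s" by (rule f)
    also have "\<dots> \<le> B / (sqrt ((T * (2 * t - 1))\<^sup>2 + 1) / 2)"
    proof -
      have "(1/2) * (1/2) \<le> c * c" using c by (intro mult_mono) auto
      hence c2: "1/4 \<le> c\<^sup>2" by (simp add: power2_eq_square)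
      have "sqrt ((T * (2 * t - 1))\<^sup>2 + 1) \<le> sqrt (4 * (c\<^sup>2 + (T * (2 * t - 1))\<^sup>2))"
      proof (rule real_sqrt_le_mono)
        have "x + 1 \<le> 4 * (u + x)" if "1/4 \<le> u" "0 \<le> x" for x u :: real using that by simp
        from this[OF c2 zero_le_power2] show "(T * (2 * t - 1))\<^sup>2 + 1 \<le> 4 * (c\<^sup>2 + (T * (2 * t - 1))\<^sup>2)" .
      qed
      also have "\<dots> = 2 * norm s" unfolding cmod_def s real_sqrt_mult by simp
      finally have "sqrt ((T * (2 * t - 1))\<^sup>2 + 1) / 2 \<le> norm s" by simp
      moreover have "0 < sqrt ((T * (2 * t - 1))\<^sup>2 + 1)" by (simp add: add_nonneg_pos)
      moreover have "0 < norm s" using s c by auto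
      ultimately show ?thesis using B by (intro divide_left_mono mult_pos_pos) auto
    qed
    finally have "norm (f s) * (2 * T) \<le> B / (sqrt ((T * (2 * t - 1))\<^sup>2 + 1) / 2) * (2 * T)"
      using T by (intro mult_right_mono) auto
    thus "norm (f (linepath (Complex c (-T)) (Complex c T) t)) * norm (Complex c T - Complex c (-T)) \<le> g t"
      unfolding d s_def[symmetric] g_def by (simp add: mult_ac)
  qed
  also have "\<dots> = 4 * B * arsinh T" by (simp add: arsinh_minus_real)
  also have "\<dots> \<le> 4 * B * (2 * ln T)"
  proof (rule mult_left_mono)
    have "sqrt (T\<^sup>2 + 1) \<le> T + 1" using T by (intro real_le_lsqrt) (auto simp: power2_eq_square algebra_simps)
    hence "T + sqrt (T\<^sup>2 + 1) \<le> T * 4" using T by simp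
    also have "\<dots> \<le> T * T" using T by (intro mult_left_mono) auto
    finally have "ln (T + sqrt (T\<^sup>2 + 1)) \<le> ln (T * T)"
      using T by (subst ln_le_cancel_iff) (auto intro!: add_pos_nonneg)
    thus "arsinh T \<le> 2 * ln T" using T by (simp add: arsinh_real_def ln_mult)
  qed (use B in auto)
  finally show ?thesis by simp
qed

lemma prod_const_power:
  "finite Z \<Longrightarrow> (\<Prod>\<rho>\<in>Z. (x::real) ^ n \<rho>) = x ^ (\<Sum>\<rho>\<in>Z. n \<rho>)"
  by (simp add: power_sum)

text \<open>Once the zeros are divided out, the quotient is bounded on the boundary of a large
  rectangle that stays away from them, hence inside by the maximum principle, and it is bounded
  below at 2 + i Im s. \<open>log_deriv_bound\<close> applies on a disc around that point reaching
  to real part \<eta>. The constant must not depend on Z, n or T, as the number of zeros will grow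
  with T.\<close>

lemma quotient_log_deriv_bound:
  assumes chi: "dirichlet_character q chi" "chi \<noteq> principal_character q" and q: "0 < q"
    and \<eta>: "1/2 < \<eta>" "\<eta> < c0" "c0 < 1"
  obtains K :: real where "0 < K"
    "\<And>T Z (n :: complex \<Rightarrow> nat) h s. 4 \<le> T \<Longrightarrow> finite Z \<Longrightarrow>
       (\<And>\<rho>. \<rho> \<in> Z \<Longrightarrow> \<eta> \<le> Re \<rho> \<and> Re \<rho> < 1 \<and> \<bar>Im \<rho>\<bar> \<le> T / 2) \<Longrightarrow>
       h holomorphic_on {s. 1/8 < Re s} \<Longrightarrow>
       (\<And>s. 1/8 < Re s \<Longrightarrow> dirichlet_L q chi s = h s * (\<Prod>\<rho>\<in>Z. (s - \<rho>) ^ n \<rho>)) \<Longrightarrow>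
       (\<And>s. \<eta> < Re s \<Longrightarrow> \<bar>Im s\<bar> < 2 * T \<Longrightarrow> h s \<noteq> 0) \<Longrightarrow>
       c0 \<le> Re s \<Longrightarrow> Re s \<le> 2 \<Longrightarrow> \<bar>Im s\<bar> \<le> T \<Longrightarrow>
       norm (deriv h s / h s) \<le> K * (1 + real (\<Sum>\<rho>\<in>Z. n \<rho>)) * ln T"
proof -
  obtain C where C: "1 \<le> C" "\<And>s. 1/8 < Re s \<Longrightarrow> norm (dirichlet_L q chi s) \<le> C * (1 + norm s)"
    by (rule dirichlet_L_bound[OF chi q]) (rule that)
  define K where "K = 16 * (4 + ln C) / (c0 - \<eta>) ^ 2"
  have lnC: "0 \<le> ln C" using C(1) by simp
  show ?thesis
  proof (rule that[of K])
    show "0 < K" using lnC \<eta> by (auto simp: K_def intro!: divide_pos_pos)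
  next
    fix T :: real and Z and n :: "complex \<Rightarrow> nat" and h s
    assume T: "4 \<le> T" and Z: "finite Z" "\<And>\<rho>. \<rho> \<in> Z \<Longrightarrow> \<eta> \<le> Re \<rho> \<and> Re \<rho> < 1 \<and> \<bar>Im \<rho>\<bar> \<le> T / 2"
      and h: "h holomorphic_on {s. 1/8 < Re s}"
        "\<And>s. 1/8 < Re s \<Longrightarrow> dirichlet_L q chi s = h s * (\<Prod>\<rho>\<in>Z. (s - \<rho>) ^ n \<rho>)"
        "\<And>s. \<eta> < Re s \<Longrightarrow> \<bar>Im s\<bar> < 2 * T \<Longrightarrow> h s \<noteq> 0"
      and s: "c0 \<le> Re s" "Re s \<le> 2" "\<bar>Im s\<bar> \<le> T"
    define M where "M = (\<Sum>\<rho>\<in>Z. n \<rho>)"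
    define P where "P = (\<lambda>s. \<Prod>\<rho>\<in>Z. (s - \<rho>) ^ n \<rho>)"
    \<comment> \<open>The zeros satisfy 1/2 < Re \<rho> < 1 and |Im \<rho>| <= T/2, so every
      boundary point of this box is at distance at least 1/4 from all of them. That is the source of
      the factor \<open>4 ^ M\<close> in \<open>B\<close>.\<close>
    define S where "S = box (Complex (1/4) (-2*T)) (Complex 4 (2*T))"
    define B where "B = 4 * C * T * 4 ^ M"
    have cl: "closure S = cbox (Complex (1/4) (-2*T)) (Complex 4 (2*T))"
      unfolding S_def by (rule closure_box) (use T in \<open>auto simp: box_ne_empty Basis_complex_def\<close>)
    have sub: "closure S \<subseteq> {s. 1/8 < Re s}" unfolding cl by (auto simp: in_cbox_complex_iff)
    have hS: "norm (h z) \<le> B" if z: "z \<in> S" for z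
    proof (rule maximum_modulus_frontier[of h S])
      show "h holomorphic_on interior S"
        by (rule holomorphic_on_subset[OF h(1)]) (use sub interior_subset closure_subset in blast)
      show "continuous_on (closure S) h"
        by (rule holomorphic_on_imp_continuous_on[OF holomorphic_on_subset[OF h(1) sub]])
      show "bounded S" by (simp add: S_def)
    next
      fix w assume w: "w \<in> frontier S"
      hence wb: "w \<in> cbox (Complex (1/4) (-2*T)) (Complex 4 (2*T))" "w \<notin> S"
        using cl by (auto simp: frontier_def S_def interior_open[OF open_box])
      have w8: "1/8 < Re w" using wb(1) by (auto simp: in_cbox_complex_iff)
      have dist: "1/4 \<le> norm (w - \<rho>)" if "\<rho> \<in> Z" for \<rho>
      proof -
        have "1/4 \<le> \<bar>Re (w - \<rho>)\<bar> \<or> 1/4 \<le> \<bar>Im (w - \<rho>)\<bar>"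
          using wb Z(2)[OF that] T \<eta> by (auto simp: S_def in_cbox_complex_iff in_box_complex_iff)
        thus ?thesis using abs_Re_le_cmod[of "w - \<rho>"] abs_Im_le_cmod[of "w - \<rho>"] by linarith
      qed
      have "(1/4) ^ M = (\<Prod>\<rho>\<in>Z. (1/4::real) ^ n \<rho>)" unfolding M_def by (rule prod_const_power[OF Z(1), symmetric])
      also have "\<dots> \<le> norm (P w)" unfolding P_def prod_norm[symmetric] norm_power
        by (intro prod_mono conjI power_mono dist) auto
      finally have Pw: "(1/4) ^ M \<le> norm (P w)" .
      have "norm w \<le> \<bar>Re w\<bar> + \<bar>Im w\<bar>" by (rule cmod_le)
      hence "1 + norm w \<le> 4 * T" using wb(1) T by (auto simp: in_cbox_complex_iff)
      hence "norm (dirichlet_L q chi w) \<le> C * (4 * T)"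
        using C(1) by (intro order_trans[OF C(2)[OF w8]] mult_left_mono) auto
      hence "norm (h w) * norm (P w) \<le> C * (4 * T)" using h(2)[OF w8] by (simp add: P_def norm_mult)
      hence "norm (h w) * (1/4) ^ M \<le> C * (4 * T)"
        using mult_left_mono[OF Pw norm_ge_zero[of "h w"]] by linarith
      hence "norm (h w) * (1/4) ^ M * 4 ^ M \<le> C * (4 * T) * 4 ^ M" by (intro mult_right_mono) auto
      moreover have "(1/4::real) ^ M * 4 ^ M = 1" by (simp flip: power_mult_distrib)
      ultimately show "norm (h w) \<le> B" unfolding B_def mult.assoc by (simp only: mult_1_right mult_ac)
    qed (use z in auto)
    define z0 where "z0 = Complex 2 (Im s)"
    define R where "R = 2 - \<eta>"
    \<comment> \<open>The bound \<open>B\<close> is 4 C T 4^M, and the modulus of h at the centre is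
      at least 1 / (4 (2 T)^M); their quotient is the argument of the logarithm. The summand 1 makes
      the inequality strict.\<close>
    define A where "A = ln (16 * C * T * (8 * T) ^ M) + 1"
    have pos: "0 < 16 * C * T * (8 * T) ^ M" using C(1) T by (auto intro!: mult_pos_pos)
    have inS: "z \<in> S" "\<eta> < Re z" "\<bar>Im z\<bar> < 2 * T" if "z \<in> ball z0 R" for z
    proof -
      have "\<bar>Re (z0 - z)\<bar> < R" "\<bar>Im (z0 - z)\<bar> < R"
        using that abs_Re_le_cmod[of "z0 - z"] abs_Im_le_cmod[of "z0 - z"] by (auto simp: dist_norm)
      hence "\<eta> < Re z" "Re z < 4" "\<bar>Im z\<bar> < T + 2" using s \<eta> by (auto simp: z0_def R_def)
      thus "z \<in> S" "\<eta> < Re z" "\<bar>Im z\<bar> < 2 * T" using T \<eta> by (auto simp: S_def in_box_complex_iff)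
    qed
    have hz0: "1 / 4 \<le> norm (h z0) * (2 * T) ^ M"
    proof -
      have z8: "1/8 < Re z0" by (simp add: z0_def)
      have "norm (P z0) \<le> (\<Prod>\<rho>\<in>Z. (2 * T) ^ n \<rho>)"
        unfolding P_def prod_norm[symmetric] norm_power
      proof (intro prod_mono conjI power_mono)
        fix \<rho> assume "\<rho> \<in> Z"
        have "norm (z0 - \<rho>) \<le> \<bar>Re (z0 - \<rho>)\<bar> + \<bar>Im (z0 - \<rho>)\<bar>" by (rule cmod_le)
        also have "\<dots> \<le> 2 * T" using Z(2)[OF \<open>\<rho> \<in> Z\<close>] s(3) T \<eta> by (auto simp: z0_def)
        finally show "norm (z0 - \<rho>) \<le> 2 * T" .
      qed auto
      also have "\<dots> = (2 * T) ^ M" unfolding M_def by (rule prod_const_power[OF Z(1)])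
      finally have "norm (h z0) * norm (P z0) \<le> norm (h z0) * (2 * T) ^ M" by (intro mult_left_mono) auto
      moreover have "1/4 \<le> norm (h z0) * norm (P z0)"
        using norm_dirichlet_L_ge[OF chi q, of z0] h(2)[OF z8] by (simp add: z0_def P_def norm_mult)
      ultimately show ?thesis by linarith
    qed
    have "1 \<le> 16 * C * T * (8 * T) ^ M"
      using C(1) T by (intro mult_ge1_I one_le_power) auto
    hence A0: "0 < A" by (simp add: A_def add_nonneg_pos)
    have "norm (deriv h s / h s) \<le> 8 * A * R / (R - (2 - c0)) ^ 2"
    proof (rule log_deriv_bound[of h z0])
      show "h holomorphic_on ball z0 R"
        by (rule holomorphic_on_subset[OF h(1)]) (use inS(2) \<eta> in force)
      show "h z \<noteq> 0" if "z \<in> ball z0 R" for z using inS[OF that] h(3) by blast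
      show "0 < A" by (rule A0)
      show "norm (h z) < exp A * norm (h z0)" if "z \<in> ball z0 R" for z
      proof -
        have nz0: "0 < norm (h z0)"         proof (rule ccontr)
          assume "\<not> 0 < norm (h z0)"
          hence "norm (h z0) = 0" by simp
          thus False using hz0 by simp
        qed
        have "norm (h z) \<le> B" by (rule hS[OF inS(1)[OF that]])
        also have "B = 16 * C * T * 4 ^ M * (1 / 4)" by (simp add: B_def)
        also have "\<dots> \<le> 16 * C * T * 4 ^ M * (norm (h z0) * (2 * T) ^ M)"
          using hz0 C(1) T by (intro mult_left_mono) auto
        also have "\<dots> = 16 * C * T * (4 ^ M * (2 * T) ^ M) * norm (h z0)" by (simp add: mult_ac)
        also have "4 ^ M * (2 * T) ^ M = (8 * T) ^ M" by (subst power_mult_distrib[symmetric]) simp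
        also have "16 * C * T * (8 * T) ^ M * norm (h z0) < exp A * norm (h z0)"
        proof (rule mult_strict_right_mono[OF _ nz0])
          have "16 * C * T * (8 * T) ^ M = exp (ln (16 * C * T * (8 * T) ^ M))" using pos by simp
          also have "\<dots> < exp A" unfolding A_def by simp
          finally show "16 * C * T * (8 * T) ^ M < exp A" .
        qed
        finally show ?thesis .
      qed
      have "z0 - s = of_real (2 - Re s)" by (simp add: z0_def complex_eq_iff)
      thus "dist z0 s \<le> 2 - c0" using s by (simp add: dist_norm del: of_real_diff)
    qed (use \<eta> in \<open>auto simp: R_def\<close>)
    also have "\<dots> \<le> 8 * ((4 + ln C) * (1 + real M) * ln T) * 2 / (c0 - \<eta>) ^ 2"
    proof -
      have T3: "16 * T \<le> T ^ 3"
      proof -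
        have "4 * 4 \<le> T * T" using T by (intro mult_mono) auto
        thus ?thesis using T by (simp add: power3_eq_cube)
      qed
      have lnT: "1 \<le> ln T"
      proof -
        have "exp 1 \<le> T" using T exp_le by linarith
        thus ?thesis using T by (subst ln_ge_iff) auto
      qed
      have "16 * C * T * (8 * T) ^ M \<le> C * (T ^ 3) * (T ^ 3) ^ M"
      proof (rule mult_mono)
        show "16 * C * T \<le> C * T ^ 3" using mult_left_mono[OF T3, of C] C(1) by (simp add: mult_ac)
        show "(8 * T) ^ M \<le> (T ^ 3) ^ M" using T3 T by (intro power_mono) linarith+
      qed (use T C in auto)
      have "ln (16 * C * T * (8 * T) ^ M) \<le> ln (C * (T ^ 3) * (T ^ 3) ^ M)"
      proof -
        have "0 < C * (T ^ 3) * (T ^ 3) ^ M" using C(1) T by simp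
        with pos \<open>16 * C * T * (8 * T) ^ M \<le> _\<close> show ?thesis by (simp only: ln_le_cancel_iff)
      qed
      also have "\<dots> = ln C + 3 * ln T + real M * (3 * ln T)"
        using C(1) T by (simp add: ln_mult ln_realpow)
      finally have "A \<le> ln C + 3 * ln T + real M * (3 * ln T) + 1" by (simp add: A_def)
      also have "\<dots> \<le> (4 + ln C) * (1 + real M) * ln T"
      proof -
        have "ln C * 1 \<le> ln C * ln T" using lnC lnT by (intro mult_left_mono) auto
        moreover have "0 \<le> ln C * (real M * ln T)" "0 \<le> real M * ln T" using lnC lnT by auto
        moreover have "(4 + ln C) * (1 + real M) * ln T
            = 4 * ln T + ln C * ln T + 4 * (real M * ln T) + ln C * (real M * ln T)"
          "real M * (3 * ln T) = 3 * (real M * ln T)" by (simp_all add: algebra_simps)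
        ultimately show ?thesis using lnT by linarith
      qed
      finally have "A \<le> (4 + ln C) * (1 + real M) * ln T" .
      moreover have "R \<le> 2" "0 \<le> R" using \<eta> by (auto simp: R_def)
      ultimately have "8 * A * R \<le> 8 * ((4 + ln C) * (1 + real M) * ln T) * 2"
        using lnC lnT A0 by (intro mult_mono) auto
      moreover have eq: "R - (2 - c0) = c0 - \<eta>" by (simp add: R_def)
      ultimately show ?thesis unfolding eq by (intro divide_right_mono) auto
    qed
    also have "\<dots> = K * (1 + real M) * ln T" by (simp add: K_def)
    finally show "norm (deriv h s / h s) \<le> K * (1 + real (\<Sum>\<rho>\<in>Z. n \<rho>)) * ln T" by (simp add: M_def)
  qed
qed

lemma nonprincipal_L_local_factor:
  assumes chi: "dirichlet_character q chi" "chi \<noteq> principal_character q" and q: "0 < q"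
    and \<rho>: "1/8 < Re \<rho>" "dirichlet_L q chi \<rho> = 0" "zorder (dirichlet_L q chi) \<rho> = int n"
  shows "\<exists>g. g analytic_on {\<rho>} \<and> g \<rho> \<noteq> 0 \<and> (\<forall>\<^sub>F w in nhds \<rho>. dirichlet_L q chi w = g w * (w - \<rho>) ^ n)"
proof (rule zorder_local_factor[OF holomorphic_dirichlet_L[OF chi q] open_halfspace_Re_gt])
  show "connected {s::complex. 1/8 < Re s}" by (intro convex_connected convex_halfspace_Re_gt)
  have "dirichlet_L q chi 2 \<noteq> 0" using norm_dirichlet_L_ge[OF chi q, of 2] by auto
  thus "\<exists>w\<in>{s. 1/8 < Re s}. dirichlet_L q chi w \<noteq> 0" by (intro bexI[of _ 2]) auto
qed (use \<rho> in auto)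

text \<open>
  The zero set is described by local factorisations, which unlike \<open>zorder\<close>
  pass directly to the conjugate character.
\<close>
lemma explicit_formula:
  assumes chi: "dirichlet_character q chi" "chi \<noteq> principal_character q" and q: "0 < q"
    and \<eta>: "1/2 < \<eta>" "\<eta> < c0" "c0 < 1"
  obtains C :: real where "0 < C"
    "\<And>T Z (n :: complex \<Rightarrow> nat) t. 4 \<le> T \<Longrightarrow> finite Z \<Longrightarrow>
       (\<And>\<rho>. \<rho> \<in> Z \<Longrightarrow> \<eta> \<le> Re \<rho> \<and> Re \<rho> < 1 \<and> \<bar>Im \<rho>\<bar> \<le> T / 2) \<Longrightarrow>
       (\<And>\<rho>. \<rho> \<in> Z \<Longrightarrow> \<exists>g. g analytic_on {\<rho>} \<and> g \<rho> \<noteq> 0 \<and>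
            (\<forall>\<^sub>F w in nhds \<rho>. dirichlet_L q chi w = g w * (w - \<rho>) ^ n \<rho>)) \<Longrightarrow>
       (\<And>s. \<eta> \<le> Re s \<Longrightarrow> \<bar>Im s\<bar> \<le> 2 * T \<Longrightarrow> s \<notin> Z \<Longrightarrow> dirichlet_L q chi s \<noteq> 0) \<Longrightarrow>
       2 \<le> t \<Longrightarrow> (t + 1) ^ 3 \<le> T \<Longrightarrow>
       norm ((\<Sum>m\<le>nat \<lfloor>t\<rfloor>. chi m * mangoldt m) + (\<Sum>\<rho>\<in>Z. of_nat (n \<rho>) * (of_real t powr \<rho> / \<rho>)))
         \<le> C * (1 + real (\<Sum>\<rho>\<in>Z. n \<rho>)) * (ln T) ^ 2 * t powr c0"
proof (rule quotient_log_deriv_bound[OF chi q \<eta>])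
  fix K :: real assume K: "0 < K"
    "\<And>T Z (n :: complex \<Rightarrow> nat) h s. 4 \<le> T \<Longrightarrow> finite Z \<Longrightarrow>
       (\<And>\<rho>. \<rho> \<in> Z \<Longrightarrow> \<eta> \<le> Re \<rho> \<and> Re \<rho> < 1 \<and> \<bar>Im \<rho>\<bar> \<le> T / 2) \<Longrightarrow>
       h holomorphic_on {s. 1/8 < Re s} \<Longrightarrow>
       (\<And>s. 1/8 < Re s \<Longrightarrow> dirichlet_L q chi s = h s * (\<Prod>\<rho>\<in>Z. (s - \<rho>) ^ n \<rho>)) \<Longrightarrow>
       (\<And>s. \<eta> < Re s \<Longrightarrow> \<bar>Im s\<bar> < 2 * T \<Longrightarrow> h s \<noteq> 0) \<Longrightarrow>
       c0 \<le> Re s \<Longrightarrow> Re s \<le> 2 \<Longrightarrow> \<bar>Im s\<bar> \<le> T \<Longrightarrow>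
       norm (deriv h s / h s) \<le> K * (1 + real (\<Sum>\<rho>\<in>Z. n \<rho>)) * ln T"
  define a where "a = (\<lambda>m. chi m * mangoldt m)"
  define W where "W = (\<Sum>m. norm (a m) / real m ^ 2)"
  have aW: "summable (\<lambda>m. norm (a m) / real m ^ 2)"
  proof (rule summable_comparison_test'[OF ln_powr_summable[of 2], of 0])
    fix m :: nat
    have "norm (a m) / real m ^ 2 = norm (chi m * mangoldt m / of_nat m powr 2)"
      by (simp add: a_def norm_divide norm_nat_powr powr_numeral norm_power)
    also have "\<dots> \<le> ln (real m) * real m powr - Re 2" by (rule mangoldt_term_bound(2)[OF chi(1) q])
    finally show "norm (norm (a m) / real m ^ 2) \<le> ln (real m) * real m powr - 2" by simp
  qed simp
  have W: "0 \<le> W" unfolding W_def by (rule suminf_nonneg[OF aW]) auto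
  \<comment> \<open>The error budget: 8 W for the truncation in Perron's formula, (16 + 8) K for the
    left and the two horizontal sides of the contour, and 36 + 3 for the kernels of the zeros and
    the passage from y back to t.\<close>
  define C where "C = 8 * W + 24 * K + 39"
  show ?thesis
  proof (rule that[of C])
    show "0 < C" using W K by (simp add: C_def)
  next
    fix T :: real and Z and n :: "complex \<Rightarrow> nat" and t :: real
    assume T: "4 \<le> T" and Z: "finite Z" "\<And>\<rho>. \<rho> \<in> Z \<Longrightarrow> \<eta> \<le> Re \<rho> \<and> Re \<rho> < 1 \<and> \<bar>Im \<rho>\<bar> \<le> T / 2"
      and loc: "\<And>\<rho>. \<rho> \<in> Z \<Longrightarrow> \<exists>g. g analytic_on {\<rho>} \<and> g \<rho> \<noteq> 0 \<and>
            (\<forall>\<^sub>F w in nhds \<rho>. dirichlet_L q chi w = g w * (w - \<rho>) ^ n \<rho>)"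
      and nz: "\<And>s. \<eta> \<le> Re s \<Longrightarrow> \<bar>Im s\<bar> \<le> 2 * T \<Longrightarrow> s \<notin> Z \<Longrightarrow> dirichlet_L q chi s \<noteq> 0"
      and t: "2 \<le> t" "(t + 1) ^ 3 \<le> T"
    define S where "S = {s::complex. 1/8 < Re s}"
    have S: "open S" unfolding S_def by (rule open_halfspace_Re_gt)
    have ZS: "Z \<subseteq> S" using Z(2) \<eta> by (force simp: S_def)
    obtain h where h: "h holomorphic_on S"
        "\<And>s. s \<in> S \<Longrightarrow> dirichlet_L q chi s = h s * (\<Prod>\<rho>\<in>Z. (s - \<rho>) ^ n \<rho>)" "\<forall>\<rho>\<in>Z. h \<rho> \<noteq> 0"
      using divide_out_zeros[OF Z(1) S ZS holomorphic_dirichlet_L[OF chi q, folded S_def] loc] by blast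
    have hnz: "h s \<noteq> 0" if s: "\<eta> < Re s" "\<bar>Im s\<bar> < 2 * T" for s
    proof (cases "s \<in> Z")
      case False
      have "s \<in> S" using s \<eta> by (simp add: S_def)
      thus ?thesis using nz[of s] h(2)[of s] s False by auto
    qed (use h in auto)
    define M where "M = (\<Sum>\<rho>\<in>Z. n \<rho>)"
    define H where "H = K * (1 + real M) * ln T"
    have hb: "norm (deriv h s / h s) \<le> H" if "c0 \<le> Re s" "Re s \<le> 2" "\<bar>Im s\<bar> \<le> T" for s
      unfolding H_def M_def
      by (rule K(2)[OF T Z(1) Z(2) h(1)[unfolded S_def] _ hnz that]) (use h(2) in \<open>auto simp: S_def\<close>)
    have lnT: "1 \<le> ln T"
    proof -
      have "exp 1 \<le> T" using T exp_le by linarith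
      thus ?thesis using T by (subst ln_ge_iff) auto
    qed
    have H0: "0 \<le> H" unfolding H_def using K(1) lnT by simp
    define N where "N = nat \<lfloor>t\<rfloor>"
    \<comment> \<open>Perron's formula is applied at a half integer; the sum up to \<open>N\<close>
      is the same for \<open>y\<close> as for \<open>t\<close>.\<close>
    define y where "y = real N + 1/2"
    have N: "1 \<le> N" "real N \<le> t" "t < real N + 1"
      using t by (simp_all add: N_def le_nat_iff le_floor_iff)
    have y: "3/2 \<le> y" "y \<le> t + 1" "y \<le> 2 * t" "\<bar>y - t\<bar> \<le> 1/2" "1 \<le> y"
    proof -
      have "1 \<le> real N" using N(1) by simp
      thus "3/2 \<le> y" "y \<le> t + 1" "y \<le> 2 * t" "\<bar>y - t\<bar> \<le> 1/2" "1 \<le> y"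
        unfolding y_def using N(2,3) t(1) by linarith+
    qed
    have y3: "y ^ 3 \<le> T"
    proof -
      have "y ^ 3 \<le> (t + 1) ^ 3" using y by (intro power_mono) auto
      thus ?thesis using t(2) by linarith
    qed
    have y2: "y ^ 2 \<le> T"
    proof -
      have "y ^ 2 \<le> y ^ 3" using y by (intro power_increasing) auto
      thus ?thesis using y3 by linarith
    qed
    define \<gamma> where "\<gamma> = linepath (Complex 2 (-T)) (Complex 2 T)"
    define F where "F = (\<lambda>s. - (deriv (dirichlet_L q chi) s / dirichlet_L q chi s))"
    define k where "k = (\<lambda>s. of_real y powr s / s :: complex)"
    define f where "f = (\<lambda>s. deriv h s / h s * k s)"
    have Fsums: "(\<lambda>m. a m / of_nat m powr s) sums F s" if "Re s = 2" for s
    proof -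
      have "dirichlet_L q chi s \<noteq> 0" using norm_dirichlet_L_ge[OF chi q, of s] that by auto
      thus ?thesis unfolding F_def a_def
        by (intro log_deriv_dirichlet_L_sums[OF chi q]) (use that in auto)
    qed
    have T0: "0 < T" using T by simp
    have IF: "norm (contour_integral \<gamma> (\<lambda>s. F s * k s) - 2 * of_real pi * \<i> * (\<Sum>m\<le>N. a m)) \<le> 8 * y ^ 3 * W / T"
      unfolding \<gamma>_def k_def W_def
      by (rule perron_half_integer(2)[OF _ aW Fsums y_def N(1) T0]) (auto simp: a_def)
    \<comment> \<open>A convex open neighbourhood of the rectangle on which \<open>h\<close> has no
      zeros, so Cauchy's theorem gives 0 for \<open>f\<close> around the rectangle. The zeros of L
      enter separately, through \<open>zero_kernel\<close>.\<close>
    define D where "D = {s::complex. \<eta> < Re s} \<inter> ({s. - (2 * T) < Im s} \<inter> {s. Im s < 2 * T})"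
    have D: "open D" "convex D" unfolding D_def
      by (intro open_Int open_halfspace_Re_gt open_halfspace_Im_gt open_halfspace_Im_lt
          convex_Int convex_halfspace_Re_gt convex_halfspace_Im_gt convex_halfspace_Im_lt)+
    have DS: "D \<subseteq> S" using \<eta> by (auto simp: D_def S_def)
    have fD: "f holomorphic_on D"
    proof -
      have "h holomorphic_on D" using h(1) DS holomorphic_on_subset by blast
      moreover have "deriv h holomorphic_on D" using calculation D(1) by (rule holomorphic_deriv)
      ultimately show ?thesis unfolding f_def k_def
        using hnz \<eta> y D(1)[unfolded D_def] by (intro holomorphic_intros) (auto simp: D_def)
    qed
    define ca cb where "ca = Complex c0 (-T)" and "cb = Complex 2 T"
    have cab: "Re ca < Re cb" "Im ca < Im cb" using T \<eta> by (auto simp: ca_def cb_def)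
    have boxD: "cbox ca cb \<subseteq> D"
      using T \<eta> by (auto simp: D_def in_cbox_complex_iff ca_def cb_def)
    have img: "path_image (rectpath ca cb) \<subseteq> D"
      using path_image_rectpath_subset_cbox[of ca cb] cab boxD by auto
    have "(f has_contour_integral 0) (rectpath ca cb)"
      by (rule Cauchy_theorem_convex_simple[OF fD D(2) _ img]) auto
    hence "contour_integral (rectpath ca cb) f = 0" by (rule contour_integral_unique)
    moreover have "continuous_on (path_image (rectpath ca cb)) f"
      by (rule holomorphic_on_imp_continuous_on[OF holomorphic_on_subset[OF fD img]])
    ultimately have rect: "0 = contour_integral (linepath (Complex c0 (-T)) (Complex 2 (-T))) f
        + contour_integral \<gamma> f - contour_integral (linepath (Complex c0 T) (Complex 2 T)) f
        - contour_integral (linepath (Complex c0 (-T)) (Complex c0 T)) f"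
      using contour_integral_rectpath_split[OF cab, of f] by (simp add: ca_def cb_def \<gamma>_def)
    have fb: "norm (f s) \<le> H * y powr (Re s) / norm s" if "s \<in> cbox ca cb" for s
    proof -
      have "norm (f s) = norm (deriv h s / h s) * (y powr Re s / norm s)"
        using y unfolding f_def k_def norm_mult norm_divide[of "of_real y powr s"] 
        by (simp add: norm_powr_real_powr)
      also have "\<dots> \<le> H * (y powr Re s / norm s)"
        by (rule mult_right_mono[OF hb]) (use that in \<open>auto simp: in_cbox_complex_iff ca_def cb_def\<close>)
      finally show ?thesis by simp
    qed
    have segc: "closed_segment u v \<subseteq> cbox ca cb" if "u \<in> cbox ca cb" "v \<in> cbox ca cb" for u v
      using that by (intro closed_segment_subset convex_box)
    have fcont: "continuous_on (closed_segment u v) f" if "u \<in> cbox ca cb" "v \<in> cbox ca cb" for u v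
      by (rule holomorphic_on_imp_continuous_on[OF holomorphic_on_subset[OF fD]])
         (use segc[OF that] boxD in blast)
    have hor: "norm (contour_integral (linepath (Complex c0 v) (Complex 2 v)) f) \<le> 2 * H" if v: "\<bar>v\<bar> = T" for v
    proof -
      have inb: "Complex c0 v \<in> cbox ca cb" "Complex 2 v \<in> cbox ca cb"
        using v T \<eta> by (auto simp: in_cbox_complex_iff ca_def cb_def)
      have "norm (contour_integral (linepath (Complex c0 v) (Complex 2 v)) f) \<le> H * norm (Complex 2 v - Complex c0 v)"
      proof (rule contour_integral_bound_linepath)
        show "f contour_integrable_on linepath (Complex c0 v) (Complex 2 v)"
          by (rule contour_integrable_continuous_linepath[OF fcont[OF inb]])
        fix s assume s: "s \<in> closed_segment (Complex c0 v) (Complex 2 v)"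
        hence sb: "s \<in> cbox ca cb" using segc[OF inb] by blast
        have "Im s = v" using s by (simp add: closed_segment_same_Im)
        hence "T \<le> norm s" using abs_Im_le_cmod[of s] v by simp
        hence "H * y powr (Re s) / norm s \<le> H * y powr 2 / T"
          using H0 T y sb by (intro frac_le mult_left_mono powr_mono) (auto simp: in_cbox_complex_iff cb_def)
        also have "\<dots> = H * (y ^ 2 / T)" using y by (simp add: powr_numeral)
        also have "\<dots> \<le> H * 1" using H0 y2 T by (intro mult_left_mono) auto
        finally show "norm (f s) \<le> H" using fb[OF sb] by simp
      qed (rule H0)
      also have "Complex 2 v - Complex c0 v = of_real (2 - c0)" by (simp add: complex_eq_iff)
      also have "H * norm (of_real (2 - c0) :: complex) \<le> H * 2"
        using H0 \<eta> by (intro mult_left_mono) (auto simp del: of_real_diff)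
      finally show ?thesis by simp
    qed
    have vert: "norm (contour_integral (linepath (Complex c0 (-T)) (Complex c0 T)) f) \<le> 8 * (H * y powr c0) * ln T"
    proof (rule vertical_log_bound)
      have inb: "Complex c0 (-T) \<in> cbox ca cb" "Complex c0 T \<in> cbox ca cb"
        using T \<eta> by (auto simp: in_cbox_complex_iff ca_def cb_def)
      show "continuous_on (closed_segment (Complex c0 (-T)) (Complex c0 T)) f" by (rule fcont[OF inb])
      fix s assume s: "s \<in> closed_segment (Complex c0 (-T)) (Complex c0 T)"
      have "Re s = c0" by (rule closed_segment_vertical_Re[OF s])
      thus "norm (f s) \<le> H * y powr c0 / norm s" using fb[of s] s segc[OF inb] by auto
    qed (use \<eta> T H0 in auto)
    have "contour_integral \<gamma> f = contour_integral (linepath (Complex c0 (-T)) (Complex c0 T)) f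
        + contour_integral (linepath (Complex c0 T) (Complex 2 T)) f
        - contour_integral (linepath (Complex c0 (-T)) (Complex 2 (-T))) f"
      using rect by (simp add: algebra_simps)
    also have "norm \<dots> \<le> 8 * (H * y powr c0) * ln T + 2 * H + 2 * H"
      by (intro order_trans[OF norm_triangle_ineq4] order_trans[OF norm_triangle_ineq] add_mono vert hor)
         (use T in auto)
    finally have If: "norm (contour_integral \<gamma> f) \<le> 8 * (H * y powr c0) * ln T + 4 * H" by simp
    define Ir where "Ir = (\<lambda>\<rho>. contour_integral \<gamma> (\<lambda>s. k s / (s - \<rho>)))"
    have kr: "(\<lambda>s. k s / (s - \<rho>)) contour_integrable_on \<gamma>"
        "norm (Ir \<rho> - 2 * of_real pi * \<i> * ((of_real y powr \<rho> - 1) / \<rho>)) \<le> 36 * y ^ 2 / T" if "\<rho> \<in> Z" for \<rho>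
      using zero_kernel[of \<rho> T y] Z(2)[OF that] \<eta> T y by (auto simp: Ir_def k_def \<gamma>_def)
    have segR: "s \<in> cbox ca cb" "Re s = 2" if "s \<in> path_image \<gamma>" for s
      using that segc[of "Complex 2 (-T)" "Complex 2 T"] closed_segment_vertical_Re T \<eta>
      by (auto simp: \<gamma>_def in_cbox_complex_iff ca_def cb_def)
    have f\<gamma>: "f contour_integrable_on \<gamma>"
      unfolding \<gamma>_def by (rule contour_integrable_continuous_linepath[OF fcont])
        (use T \<eta> in \<open>auto simp: in_cbox_complex_iff ca_def cb_def\<close>)
    have "contour_integral \<gamma> (\<lambda>s. F s * k s)
        = contour_integral \<gamma> (\<lambda>s. - (f s) - (\<Sum>\<rho>\<in>Z. of_nat (n \<rho>) * (k s / (s - \<rho>))))"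
    proof (rule contour_integral_cong)
      fix s assume s: "s \<in> path_image \<gamma>"
      have sD: "s \<in> D" using segR(1)[OF s] boxD by blast
      have sZ: "s \<notin> Z" using segR(2)[OF s] Z(2) by force
      have "F s = - (deriv h s / h s) - (\<Sum>\<rho>\<in>Z. of_nat (n \<rho>) / (s - \<rho>))"
        unfolding F_def
        by (subst log_deriv_divide_out[OF Z(1) sZ S _ h(1) _ h(2)]) (use sD DS hnz in \<open>auto simp: D_def\<close>)
      thus "F s * k s = - (f s) - (\<Sum>\<rho>\<in>Z. of_nat (n \<rho>) * (k s / (s - \<rho>)))"
        by (simp add: f_def left_diff_distrib sum_distrib_right)
    qed simp
    also have "\<dots> = - contour_integral \<gamma> f - (\<Sum>\<rho>\<in>Z. of_nat (n \<rho>) * Ir \<rho>)"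
    proof -
      have "(\<lambda>s. \<Sum>\<rho>\<in>Z. of_nat (n \<rho>) * (k s / (s - \<rho>))) contour_integrable_on \<gamma>"
        by (intro contour_integrable_sum contour_integrable_lmul kr Z(1))
      hence "contour_integral \<gamma> (\<lambda>s. - (f s) - (\<Sum>\<rho>\<in>Z. of_nat (n \<rho>) * (k s / (s - \<rho>))))
          = contour_integral \<gamma> (\<lambda>s. - f s) - contour_integral \<gamma> (\<lambda>s. \<Sum>\<rho>\<in>Z. of_nat (n \<rho>) * (k s / (s - \<rho>)))"
        using f\<gamma> by (intro contour_integral_diff contour_integrable_neg)
      also have "contour_integral \<gamma> (\<lambda>s. \<Sum>\<rho>\<in>Z. of_nat (n \<rho>) * (k s / (s - \<rho>)))
          = (\<Sum>\<rho>\<in>Z. contour_integral \<gamma> (\<lambda>s. of_nat (n \<rho>) * (k s / (s - \<rho>))))"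
        by (intro contour_integral_sum contour_integrable_lmul kr Z(1))
      also have "\<dots> = (\<Sum>\<rho>\<in>Z. of_nat (n \<rho>) * Ir \<rho>)"
        unfolding Ir_def by (intro sum.cong refl contour_integral_lmul kr)
      finally show ?thesis using f\<gamma> by (simp add: contour_integral_neg)
    qed
    finally have IFeq: "contour_integral \<gamma> (\<lambda>s. F s * k s) = - contour_integral \<gamma> f - (\<Sum>\<rho>\<in>Z. of_nat (n \<rho>) * Ir \<rho>)" .
    define \<psi> where "\<psi> = (\<Sum>m\<le>N. a m)"
    define U where "U = (\<Sum>\<rho>\<in>Z. of_nat (n \<rho>) * ((of_real y powr \<rho> - 1) / \<rho>))"
    define V where "V = (\<Sum>\<rho>\<in>Z. of_nat (n \<rho>) * (of_real t powr \<rho> / \<rho>))"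
    have "2 * of_real pi * \<i> * (\<psi> + U) = - (contour_integral \<gamma> (\<lambda>s. F s * k s) - 2 * of_real pi * \<i> * \<psi>)
        - contour_integral \<gamma> f
        - (\<Sum>\<rho>\<in>Z. of_nat (n \<rho>) * (Ir \<rho> - 2 * of_real pi * \<i> * ((of_real y powr \<rho> - 1) / \<rho>)))"
      unfolding IFeq U_def by (simp add: algebra_simps sum_subtractf sum_distrib_left)
    also have "norm \<dots> \<le> 8 * y ^ 3 * W / T + (8 * (H * y powr c0) * ln T + 4 * H) + (\<Sum>\<rho>\<in>Z. real (n \<rho>) * (36 * y ^ 2 / T))"
    proof (intro order_trans[OF norm_triangle_ineq4] add_mono If)
      show "norm (- (contour_integral \<gamma> (\<lambda>s. F s * k s) - 2 * of_real pi * \<i> * \<psi>)) \<le> 8 * y ^ 3 * W / T"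
        unfolding norm_minus_cancel \<psi>_def by (rule IF)
      show "norm (\<Sum>\<rho>\<in>Z. of_nat (n \<rho>) * (Ir \<rho> - 2 * of_real pi * \<i> * ((of_real y powr \<rho> - 1) / \<rho>)))
          \<le> (\<Sum>\<rho>\<in>Z. real (n \<rho>) * (36 * y ^ 2 / T))"
      proof (rule order_trans[OF norm_sum], rule sum_mono)
        fix \<rho> assume "\<rho> \<in> Z"
        show "norm (of_nat (n \<rho>) * (Ir \<rho> - 2 * of_real pi * \<i> * ((of_real y powr \<rho> - 1) / \<rho>))) \<le> real (n \<rho>) * (36 * y ^ 2 / T)"
          unfolding norm_mult norm_of_nat by (rule mult_left_mono[OF kr(2)[OF \<open>\<rho> \<in> Z\<close>]]) simp
      qed
    qed
    also have "\<dots> \<le> 8 * W + (8 * (H * y powr c0) * ln T + 4 * H) + 36 * real M"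
    proof (intro add_mono order_refl)
      have "8 * y ^ 3 * W / T = 8 * W * (y ^ 3 / T)" by simp
      also have "\<dots> \<le> 8 * W * 1" using W y3 T by (intro mult_left_mono) auto
      finally show "8 * y ^ 3 * W / T \<le> 8 * W" by simp
      have "(\<Sum>\<rho>\<in>Z. real (n \<rho>) * (36 * y ^ 2 / T)) \<le> (\<Sum>\<rho>\<in>Z. real (n \<rho>) * 36)"
        using y2 T by (intro sum_mono mult_left_mono) (auto simp: field_simps)
      also have "\<dots> = 36 * real M"
        unfolding M_def of_nat_sum sum_distrib_left by (simp add: mult.commute)
      finally show "(\<Sum>\<rho>\<in>Z. real (n \<rho>) * (36 * y ^ 2 / T)) \<le> 36 * real M" .
    qed
    finally have "2 * pi * norm (\<psi> + U) \<le> 8 * W + (8 * (H * y powr c0) * ln T + 4 * H) + 36 * real M"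
      by (simp add: norm_mult)
    moreover have "1 * norm (\<psi> + U) \<le> 2 * pi * norm (\<psi> + U)"
      using pi_gt3 by (intro mult_right_mono) auto
    ultimately have b1: "norm (\<psi> + U) \<le> 8 * W + (8 * (H * y powr c0) * ln T + 4 * H) + 36 * real M" by linarith
    \<comment> \<open>Replacing y by t moves y^\<rho> by at most |\<rho>| / 2, and removing the -1
      costs 1. Division by \<rho>, of modulus at least 1/2, leaves at most 1/2 + 2 per zero.\<close>
    have "norm (V - U) \<le> (\<Sum>\<rho>\<in>Z. real (n \<rho>) * 3)"
      unfolding V_def U_def sum_subtractf[symmetric]
    proof (rule order_trans[OF norm_sum], rule sum_mono)
      fix \<rho> assume "\<rho> \<in> Z"
      note z = Z(2)[OF this]
      have n\<rho>: "1/2 \<le> norm \<rho>" using abs_Re_le_cmod[of \<rho>] z \<eta> by linarith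
      have pd: "norm (of_real v powr \<rho> - of_real u powr \<rho>) \<le> norm \<rho> * (1/2)" if "1 \<le> u" "u \<le> v" "v \<le> u + 1/2" for u v
      proof -
        have "norm (of_real v powr \<rho> - of_real u powr \<rho>) \<le> norm \<rho> * u powr (Re \<rho> - 1) * (v - u)"
          using that z by (intro powr_diff_bound) auto
        also have "\<dots> \<le> norm \<rho> * 1 * (1/2)"
        proof (intro mult_mono)
          have "u powr (Re \<rho> - 1) \<le> u powr 0" using that z by (intro powr_mono) auto
          thus "u powr (Re \<rho> - 1) \<le> 1" using that by simp
        qed (use that in auto)
        finally show ?thesis by simp
      qed
      have "norm (of_real t powr \<rho> - of_real y powr \<rho>) \<le> norm \<rho> * (1/2)"
      proof (cases "y \<le> t")
        case True thus ?thesis using y by (intro pd) auto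
      next
        case False thus ?thesis using y t pd[of t y] by (simp add: norm_minus_commute)
      qed
      hence "norm (of_real t powr \<rho> - of_real y powr \<rho> + 1) \<le> norm \<rho> * (1/2) + 1"
        by (intro order_trans[OF norm_triangle_ineq]) auto
      hence "norm ((of_real t powr \<rho> - of_real y powr \<rho> + 1) / \<rho>) \<le> 3"
        using n\<rho> by (simp add: norm_divide divide_le_eq)
      hence "real (n \<rho>) * norm ((of_real t powr \<rho> - of_real y powr \<rho> + 1) / \<rho>) \<le> real (n \<rho>) * 3"
        by (intro mult_left_mono) auto
      moreover have "of_nat (n \<rho>) * (of_real t powr \<rho> / \<rho>) - of_nat (n \<rho>) * ((of_real y powr \<rho> - 1) / \<rho>)
          = of_nat (n \<rho>) * ((of_real t powr \<rho> - of_real y powr \<rho> + 1) / \<rho>)"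
        by (simp add: diff_divide_distrib add_divide_distrib right_diff_distrib distrib_left)
      ultimately show "norm (of_nat (n \<rho>) * (of_real t powr \<rho> / \<rho>) - of_nat (n \<rho>) * ((of_real y powr \<rho> - 1) / \<rho>))
          \<le> real (n \<rho>) * 3" by (simp only: norm_mult norm_of_nat)
    qed
    also have "\<dots> = 3 * real M"
      unfolding M_def of_nat_sum sum_distrib_left by (simp add: mult.commute)
    finally have b2: "norm (V - U) \<le> 3 * real M" .
    have "norm (\<psi> + V) \<le> norm (\<psi> + U) + norm (V - U)"
      using norm_triangle_ineq[of "\<psi> + U" "V - U"] by simp
    also have "\<dots> \<le> 8 * W + (8 * (H * y powr c0) * ln T + 4 * H) + 39 * real M" using b1 b2 by simp
    also have "\<dots> \<le> 8 * W + 24 * (K * Q) + 39 * real M"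
      if Q: "Q = (1 + real M) * (ln T) ^ 2 * t powr c0" for Q
    proof -
      have yc: "y powr c0 \<le> 2 * t powr c0"
      proof -
        have "y powr c0 \<le> (2 * t) powr c0" using y \<eta> by (intro powr_mono2) auto
        also have "\<dots> = 2 powr c0 * t powr c0" using t by (simp add: powr_mult)
        also have "\<dots> \<le> 2 powr 1 * t powr c0" using \<eta> by (intro mult_right_mono powr_mono) auto
        finally show ?thesis by simp
      qed
      have tc: "1 \<le> t powr c0" using t \<eta> by (intro ge_one_powr_ge_zero) auto
      have "8 * (H * y powr c0) * ln T \<le> 8 * (H * (2 * t powr c0)) * ln T"
        using H0 yc lnT by (intro mult_right_mono mult_left_mono) auto
      also have "\<dots> = 16 * (K * Q)" by (simp add: H_def Q power2_eq_square mult_ac)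
      finally have 1: "8 * (H * y powr c0) * ln T \<le> 16 * (K * Q)" .
      have "H * 1 * 1 \<le> H * ln T * t powr c0" using H0 lnT tc by (intro mult_mono) auto
      also have "\<dots> = K * Q" by (simp add: H_def Q power2_eq_square mult_ac)
      finally have "4 * H \<le> 8 * (K * Q)" using H0 by simp
      with 1 show ?thesis by linarith
    qed
    finally have fin: "norm (\<psi> + V) \<le> 8 * W + 24 * (K * Q) + 39 * real M"
      if Q: "Q = (1 + real M) * (ln T) ^ 2 * t powr c0" for Q using that by blast
    define Q where "Q = (1 + real M) * (ln T) ^ 2 * t powr c0"
    have Q1: "1 + real M \<le> Q"
    proof -
      have "1 \<le> t powr c0" using t \<eta> by (intro ge_one_powr_ge_zero) auto
      moreover have "1 \<le> (ln T) ^ 2" using lnT by (rule one_le_power)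
      ultimately have "(1 + real M) * 1 * 1 \<le> Q" unfolding Q_def by (intro mult_mono) auto
      thus ?thesis by simp
    qed
    have "norm (\<psi> + V) \<le> 8 * W + 24 * (K * Q) + 39 * real M" by (rule fin[OF Q_def])
    also have "\<dots> \<le> 8 * (W * Q) + 24 * (K * Q) + 39 * Q"
      using Q1 W mult_left_mono[of 1 Q W] by simp
    also have "\<dots> = C * Q" by (simp add: C_def algebra_simps)
    finally show "norm ((\<Sum>m\<le>nat \<lfloor>t\<rfloor>. chi m * mangoldt m) + (\<Sum>\<rho>\<in>Z. of_nat (n \<rho>) * (of_real t powr \<rho> / \<rho>)))
         \<le> C * (1 + real (\<Sum>\<rho>\<in>Z. n \<rho>)) * (ln T) ^ 2 * t powr c0"
      by (simp add: \<psi>_def V_def a_def N_def M_def Q_def mult_ac)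
  qed
qed

section \<open>The zeros of the barrier\<close>

lemma abs_divide_le: "(1::real) \<le> X \<Longrightarrow> \<bar>y / X\<bar> \<le> \<bar>y\<bar>"
  using mult_left_mono[of 1 X "\<bar>y\<bar>"] by (simp add: abs_divide divide_le_eq)

lemma pi_less_16_5: "pi < 16/5"
  using pi_approx(2) by simp

locale barrier =
  fixes \<xi> \<sigma> \<delta> :: real and \<gamma> d \<theta> :: "nat \<Rightarrow> real" and j0 :: nat
  assumes parameters: "barrier_parameters \<xi> \<gamma> d \<theta>"
    and j0: "1 \<le> j0"
    and d_range: "\<And>j. j0 \<le> j \<Longrightarrow> 0 < d j \<and> d j \<le> \<delta>"
    and xi_range: "0 \<le> \<xi>" "\<xi> < 2 * pi"
    and sigma_range: "1/2 < \<sigma>" "\<sigma> < 1"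
    and delta_range: "0 < \<delta>" "\<delta> < \<sigma> - 1/2"
begin

abbreviation pt :: "nat \<Rightarrow> nat \<Rightarrow> complex" where "pt \<equiv> barrier_point \<sigma> \<gamma> d \<theta>"

abbreviation B :: "complex \<Rightarrow> nat" where "B \<equiv> barrier_multiplicity \<sigma> \<gamma> d \<theta> j0"

definition idx :: "nat \<Rightarrow> (nat \<times> nat) set" where
  "idx J = (SIGMA j:{j0..J}. {1..j ^ 3})"

definition Z :: "nat \<Rightarrow> complex set" where "Z J = (\<lambda>(j, k). pt j k) ` idx J"

text \<open>The truncation height T for the explicit formula, which needs the zeros used to lie
  below T/2 and no others up to 2T. Ordinates in the first J layers are at most 2 J^3 exp (J^8) + 6,
  and this is at most half of the chosen value.\<close>

definition height :: "nat \<Rightarrow> real" where "height J = 16 * real J ^ 3 * exp (real J ^ 8)"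

lemma finite_idx: "finite (idx J)"
  by (simp add: idx_def)

lemma finite_Z: "finite (Z J)"
  by (simp add: Z_def finite_idx)

lemma gamma_bounds: "1 \<le> j \<Longrightarrow> exp (real j ^ 8) \<le> \<gamma> j" "1 \<le> j \<Longrightarrow> \<gamma> j \<le> 2 * exp (real j ^ 8)"
  and d_bound: "1 \<le> j \<Longrightarrow> \<bar>d j - 1 / real j ^ 8\<bar> \<le> 1 / real j ^ 9"
  and theta_bound: "1 \<le> j \<Longrightarrow> \<bar>\<theta> j - (\<xi> - pi / 2) / real j ^ 16\<bar> \<le> 1 / real j ^ 17"
  using parameters by (auto simp: barrier_parameters_def)

text \<open>The value 13/5 is 1 + (16/5)/2, which exceeds 1 + pi/2 and so the largest possible
  negative shift by \<theta> j. Hence all ordinates are positive, even for j = 1.\<close>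

lemma exp_1_gt: "13/5 < exp (1::real)"
proof -
  have "13/8 \<le> exp (1/2::real)" using exp_lower_Taylor_quadratic[of "1/2::real"] by (simp add: power2_eq_square)
  hence "13/8 * (13/8) \<le> exp (1/2::real) * exp (1/2)" by (intro mult_mono) auto
  thus ?thesis by (simp flip: exp_add)
qed

lemma theta_ge: assumes "1 \<le> j" shows "- (pi / 2) - 1 \<le> \<theta> j" and theta_abs: "\<bar>\<theta> j\<bar> \<le> 6"
proof -
  have j: "1 \<le> real j ^ 16" "1 \<le> real j ^ 17" using assms by (auto intro: one_le_power)
  have 1: "1 / real j ^ 17 \<le> 1" using abs_divide_le[OF j(2), of 1] by simp
  have "\<bar>(\<xi> - pi / 2) / real j ^ 16\<bar> \<le> \<bar>\<xi> - pi / 2\<bar>"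
    by (rule abs_divide_le[OF j(1)])
  moreover have "\<bar>\<xi> - pi / 2\<bar> \<le> 3 * pi / 2" using xi_range by linarith
  ultimately have 2: "\<bar>(\<xi> - pi / 2) / real j ^ 16\<bar> \<le> 3 * pi / 2" by linarith
  have "- (pi / 2) / real j ^ 16 \<le> (\<xi> - pi / 2) / real j ^ 16"
    using xi_range j by (intro divide_right_mono) auto
  moreover have "pi / 2 / real j ^ 16 \<le> pi / 2" using abs_divide_le[OF j(1), of "pi / 2"] by simp
  moreover have "- (pi / 2) / real j ^ 16 = - (pi / 2 / real j ^ 16)" by simp
  ultimately have 3: "- (pi / 2) \<le> (\<xi> - pi / 2) / real j ^ 16" by linarith
  show "- (pi / 2) - 1 \<le> \<theta> j" using theta_bound[OF assms] 1 3 by linarith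
  show "\<bar>\<theta> j\<bar> \<le> 6" using theta_bound[OF assms] 1 2 pi_less_16_5 by linarith
qed

lemma gamma_ge: assumes "1 \<le> j" shows "13/5 < \<gamma> j"
proof -
  have "exp 1 \<le> exp (real j ^ 8)" using assms by (auto intro: one_le_power)
  thus ?thesis using gamma_bounds(1)[OF assms] exp_1_gt by linarith
qed

lemma Re_pt: "Re (pt j k) = \<sigma> - d j" and Im_pt: "Im (pt j k) = real k * \<gamma> j + \<theta> j"
  by (simp_all add: barrier_point_def)

lemma Re_pt_range:
  assumes "j0 \<le> j" shows "1/2 < Re (pt j k)" "\<sigma> - \<delta> \<le> Re (pt j k)" "Re (pt j k) < \<sigma>"
  using d_range[OF assms] delta_range by (auto simp: Re_pt)

lemma k_gamma_ge: assumes "1 \<le> j" "1 \<le> k" shows "\<gamma> j \<le> real k * \<gamma> j"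
  using gamma_ge[OF assms(1)] assms(2) by simp

lemma Im_pt_pos: assumes "1 \<le> j" "1 \<le> k" shows "0 < Im (pt j k)"
  using k_gamma_ge[OF assms] gamma_ge[OF assms(1)] theta_ge[OF assms(1)] pi_less_16_5
  unfolding Im_pt by linarith

lemma Im_pt_le:
  assumes "1 \<le> j" "j \<le> J" "k \<le> j ^ 3" shows "Im (pt j k) \<le> height J / 2"
proof -
  have "real k \<le> real (j ^ 3)" using assms(3) by (simp only: of_nat_le_iff)
  also have "\<dots> \<le> real J ^ 3" using assms(2) by (simp add: power_mono)
  finally have k: "real k \<le> real J ^ 3" .
  have e: "exp (real j ^ 8) \<le> exp (real J ^ 8)" using assms(2) by (simp add: power_mono)
  have "real k * \<gamma> j \<le> real J ^ 3 * (2 * exp (real J ^ 8))"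
  proof (rule mult_mono[OF k])
    show "\<gamma> j \<le> 2 * exp (real J ^ 8)" using gamma_bounds(2)[OF assms(1)] e by linarith
  qed (use gamma_ge[OF assms(1)] in auto)
  moreover have "6 \<le> 6 * (real J ^ 3 * exp (real J ^ 8))"
  proof -
    have "1 \<le> real J ^ 3" using assms by (intro one_le_power) auto
    hence "1 * 1 \<le> real J ^ 3 * exp (real J ^ 8)" by (intro mult_mono) auto
    thus ?thesis by simp
  qed
  ultimately show ?thesis using theta_abs[OF assms(1)] unfolding Im_pt height_def by linarith
qed

text \<open>The heights of consecutive layers are so far apart that \<open>height J\<close> separates
  the first J layers from the others with room to spare.\<close>
lemma Im_pt_gt:
  assumes "1 \<le> J" "J < j" "1 \<le> k" shows "2 * height J < Im (pt j k)"
proof -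
  define x where "x = real J"
  have x: "1 \<le> x" using assms(1) by (simp add: x_def)
  have xp: "1 \<le> x ^ n" for n using x by (rule one_le_power)
  have j1: "1 \<le> j" using assms by simp
  have "x ^ 8 + 36 * x ^ 3 \<le> (x + 1) ^ 8"
  proof -
    have "(x + 1) ^ 8 = x ^ 8 + 8 * x ^ 7 + 28 * x ^ 6 + 56 * x ^ 5 + 70 * x ^ 4 + 56 * x ^ 3 + 28 * x ^ 2 + 8 * x + 1"
      by (simp add: eval_nat_numeral algebra_simps)
    thus ?thesis using xp[of 7] xp[of 6] xp[of 5] xp[of 4] xp[of 3] xp[of 2] x by linarith
  qed
  moreover have "(x + 1) ^ 8 \<le> real j ^ 8" using assms(2) x by (intro power_mono) (auto simp: x_def)
  ultimately have "exp (x ^ 8 + 36 * x ^ 3) \<le> exp (real j ^ 8)" by simp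
  hence "exp (x ^ 8) * exp (36 * x ^ 3) \<le> \<gamma> j" using gamma_bounds(1)[OF j1] by (simp add: exp_add)
  moreover have "exp (x ^ 8) * (32 * x ^ 3 + 7) \<le> exp (x ^ 8) * exp (36 * x ^ 3)"
  proof (rule mult_left_mono)
    have "1 + 36 * x ^ 3 + (36 * x ^ 3)\<^sup>2 / 2 \<le> exp (36 * x ^ 3)"
      using x by (intro exp_lower_Taylor_quadratic) auto
    moreover have h: "36 \<le> 36 * x ^ 3" using xp[of 3] by simp
    have "36 * 1 \<le> (36 * x ^ 3) * (36 * x ^ 3)" by (rule mult_mono[OF h]) (use h in linarith)+
    ultimately show "32 * x ^ 3 + 7 \<le> exp (36 * x ^ 3)" using xp[of 3] by (simp add: power2_eq_square)
  qed simp
  moreover have "7 * 1 \<le> 7 * exp (x ^ 8)" using x by (intro mult_left_mono) auto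
  moreover have "exp (x ^ 8) * (32 * x ^ 3 + 7) = 2 * height J + 7 * exp (x ^ 8)"
    by (simp add: height_def x_def algebra_simps)
  ultimately show ?thesis using theta_abs[OF j1] k_gamma_ge[OF j1 assms(3)]
    unfolding Im_pt by linarith
qed

text \<open>The imaginary part gives k \<gamma> - 6, which is useless for small ordinates; there the
  real part gives 1/2. The divisor 32 makes one bound cover both ranges.\<close>

lemma norm_pt_ge:
  assumes "j0 \<le> j" "1 \<le> k" shows "real k * \<gamma> j / 32 \<le> norm (pt j k)" "1/2 \<le> norm (pt j k)"
proof -
  have j: "1 \<le> j" using assms j0 by simp
  show h: "1/2 \<le> norm (pt j k)" using abs_Re_le_cmod[of "pt j k"] Re_pt_range[OF assms(1), of k] by linarith
  have "real k * \<gamma> j - 6 \<le> norm (pt j k)"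
    using abs_Im_le_cmod[of "pt j k"] theta_abs[OF j] unfolding Im_pt by linarith
  thus "real k * \<gamma> j / 32 \<le> norm (pt j k)" using h by linarith
qed

text \<open>The purely imaginary number i k \<gamma> replaces \<rho> in the denominator at the price
  of a quadratically small error. The factor k of the multiplicity can then be cancelled
  exactly.\<close>

lemma norm_inverse_pt:
  assumes "j0 \<le> j" "1 \<le> k"
  shows "norm (1 / pt j k - 1 / (\<i> * of_real (real k * \<gamma> j))) \<le> 256 / (real k * \<gamma> j) ^ 2"
proof -
  define g where "g = real k * \<gamma> j"
  have j: "1 \<le> j" using assms j0 by simp
  have g: "0 < g" using gamma_ge[OF j] k_gamma_ge[OF j assms(2)] by (simp add: g_def)
  have \<rho>: "pt j k \<noteq> 0" using norm_pt_ge[OF assms] by auto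
  have "\<i> * of_real g - pt j k = Complex (- Re (pt j k)) (- \<theta> j)"
    by (simp add: complex_eq_iff Im_pt g_def)
  hence "norm (\<i> * of_real g - pt j k) \<le> \<bar>Re (pt j k)\<bar> + \<bar>\<theta> j\<bar>"
    using cmod_le[of "Complex (- Re (pt j k)) (- \<theta> j)"] by simp
  also have "\<dots> \<le> 8" using Re_pt_range[OF assms(1), of k] sigma_range theta_abs[OF j] by linarith
  finally have n: "norm (\<i> * of_real g - pt j k) \<le> 8" .
  have "1 / pt j k - 1 / (\<i> * of_real g) = (\<i> * of_real g - pt j k) / (pt j k * (\<i> * of_real g))"
    using \<rho> g by (simp add: diff_frac_eq mult_ac)
  hence "norm (1 / pt j k - 1 / (\<i> * of_real g)) = norm (\<i> * of_real g - pt j k) / (norm (pt j k) * g)"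
    using g by (simp add: norm_divide norm_mult)
  also have "\<dots> \<le> 8 / (g / 32 * g)"
    using n norm_pt_ge(1)[OF assms] g by (intro frac_le mult_right_mono) (auto simp: g_def)
  also have "\<dots> = 256 / g ^ 2" using g by (simp add: power2_eq_square)
  finally show ?thesis by (simp add: g_def)
qed

lemma pt_multiplicity_indices:
  "finite {(j, k). j0 \<le> j \<and> 1 \<le> k \<and> k \<le> j ^ 3 \<and> pt j k = s}"
  by (rule finite_barrier_indices[OF parameters j0])

lemma B_pos_iff: "0 < B s \<longleftrightarrow> (\<exists>j k. j0 \<le> j \<and> 1 \<le> k \<and> k \<le> j ^ 3 \<and> pt j k = s)"
proof
  assume "0 < B s"
  hence "{(j, k). j0 \<le> j \<and> 1 \<le> k \<and> k \<le> j ^ 3 \<and> pt j k = s} \<noteq> {}"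
  proof (rule contrapos_pn)
    assume "{(j, k). j0 \<le> j \<and> 1 \<le> k \<and> k \<le> j ^ 3 \<and> pt j k = s} = {}"
    thus "\<not> 0 < B s" unfolding barrier_multiplicity_def by (simp only: sum.empty)
  qed
  thus "\<exists>j k. j0 \<le> j \<and> 1 \<le> k \<and> k \<le> j ^ 3 \<and> pt j k = s" by auto
next
  assume "\<exists>j k. j0 \<le> j \<and> 1 \<le> k \<and> k \<le> j ^ 3 \<and> pt j k = s"
  then obtain j k where jk: "j0 \<le> j" "1 \<le> k" "k \<le> j ^ 3" "pt j k = s" by blast
  have le: "(case (j, k) of (j, k) \<Rightarrow> k * (j ^ 3 + 1 - k)) \<le> B s"
    unfolding barrier_multiplicity_def
  proof (rule member_le_sum)
    show "(j, k) \<in> {(j, k). j0 \<le> j \<and> 1 \<le> k \<and> k \<le> j ^ 3 \<and> pt j k = s}" using jk by simp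
  qed (simp, rule pt_multiplicity_indices)
  have "0 < (case (j, k) of (j, k) \<Rightarrow> k * (j ^ 3 + 1 - k))" using jk by simp
  thus "0 < B s" using le by (rule less_le_trans)
qed

lemma Z_iff: "s \<in> Z J \<longleftrightarrow> (\<exists>j k. j0 \<le> j \<and> j \<le> J \<and> 1 \<le> k \<and> k \<le> j ^ 3 \<and> pt j k = s)"
proof
  assume "s \<in> Z J"
  then obtain j k where "(j, k) \<in> idx J" "s = pt j k" unfolding Z_def by auto
  thus "\<exists>j k. j0 \<le> j \<and> j \<le> J \<and> 1 \<le> k \<and> k \<le> j ^ 3 \<and> pt j k = s"
    by (intro exI[of _ j] exI[of _ k]) (simp add: idx_def)
next
  assume "\<exists>j k. j0 \<le> j \<and> j \<le> J \<and> 1 \<le> k \<and> k \<le> j ^ 3 \<and> pt j k = s"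
  then obtain j k where jk: "j0 \<le> j" "j \<le> J" "1 \<le> k" "k \<le> j ^ 3" "pt j k = s" by blast
  hence "(j, k) \<in> idx J" by (simp add: idx_def)
  hence "(\<lambda>(j, k). pt j k) (j, k) \<in> Z J" unfolding Z_def by (rule imageI)
  thus "s \<in> Z J" using jk(5) by simp
qed

lemma Z_D:
  assumes "s \<in> Z J"
  shows "\<sigma> - \<delta> \<le> Re s" "Re s < \<sigma>" "0 < Im s" "Im s \<le> height J / 2" "0 < B s" "1/2 \<le> norm s"
proof -
  from assms obtain j k where jk: "j0 \<le> j" "j \<le> J" "1 \<le> k" "k \<le> j ^ 3" "pt j k = s"
    unfolding Z_iff by blast
  have j: "1 \<le> j" using jk j0 by simp
  show "\<sigma> - \<delta> \<le> Re s" "Re s < \<sigma>" using Re_pt_range[OF jk(1)] jk(5) by auto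
  show "0 < Im s" "Im s \<le> height J / 2" using Im_pt_pos[OF j jk(3)] Im_pt_le[OF j jk(2,4)] jk(5) by auto
  show "0 < B s" unfolding B_pos_iff using jk by blast
  show "1/2 \<le> norm s" using norm_pt_ge[OF jk(1,3)] jk(5) by simp
qed

lemma B_pos_low:
  assumes "0 < B s" "Im s \<le> 2 * height J" "1 \<le> J" shows "s \<in> Z J"
proof -
  from assms(1) obtain j k where jk: "j0 \<le> j" "1 \<le> k" "k \<le> j ^ 3" "pt j k = s"
    unfolding B_pos_iff by blast
  have "j \<le> J"
  proof (rule ccontr)
    assume "\<not> j \<le> J"
    thus False using Im_pt_gt[OF assms(3), of j k] jk assms(2) by auto
  qed
  thus ?thesis unfolding Z_iff using jk by blast
qed

text \<open>Different index pairs may give the same point; grouping the indices by their point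
  mirrors the way \<open>B\<close> adds multiplicities. The separation of heights ensures that all
  indices of a point of \<open>Z J\<close> lie in the first J layers.\<close>

lemma sum_Z:
  fixes G :: "complex \<Rightarrow> 'a :: comm_semiring_1"
  assumes "1 \<le> J"
  shows "(\<Sum>\<rho>\<in>Z J. of_nat (B \<rho>) * G \<rho>) = (\<Sum>(j, k)\<in>idx J. of_nat (k * (j ^ 3 + 1 - k)) * G (pt j k))"
proof -
  have B: "B \<rho> = (\<Sum>x\<in>{x \<in> idx J. (\<lambda>(j, k). pt j k) x = \<rho>}. case x of (j, k) \<Rightarrow> k * (j ^ 3 + 1 - k))"
    if \<rho>: "\<rho> \<in> Z J" for \<rho>
  proof -
    have "{(j, k). j0 \<le> j \<and> 1 \<le> k \<and> k \<le> j ^ 3 \<and> pt j k = \<rho>} = {x \<in> idx J. (\<lambda>(j, k). pt j k) x = \<rho>}"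
    proof -
      have "j \<le> J" if "1 \<le> k" "pt j k = \<rho>" for j k
      proof (rule ccontr)
        assume "\<not> j \<le> J"
        hence "2 * height J < Im \<rho>" using Im_pt_gt[OF assms, of j k] that by simp
        thus False using Z_D(3,4)[OF \<rho>] by linarith
      qed
      thus ?thesis by (auto simp: idx_def)
    qed
    thus ?thesis by (simp add: barrier_multiplicity_def)
  qed
  have "(\<Sum>\<rho>\<in>Z J. of_nat (B \<rho>) * G \<rho>) = (\<Sum>\<rho>\<in>Z J. \<Sum>x\<in>{x \<in> idx J. (\<lambda>(j, k). pt j k) x = \<rho>}.
      case x of (j, k) \<Rightarrow> of_nat (k * (j ^ 3 + 1 - k)) * G (pt j k))"
  proof (rule sum.cong[OF refl])
    fix \<rho> assume "\<rho> \<in> Z J"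
    show "of_nat (B \<rho>) * G \<rho> = (\<Sum>x\<in>{x \<in> idx J. (\<lambda>(j, k). pt j k) x = \<rho>}.
      case x of (j, k) \<Rightarrow> of_nat (k * (j ^ 3 + 1 - k)) * G (pt j k))"
      unfolding B[OF \<open>\<rho> \<in> Z J\<close>] of_nat_sum sum_distrib_right
      by (rule sum.cong[OF refl]) auto
  qed
  also have "\<dots> = (\<Sum>x\<in>idx J. case x of (j, k) \<Rightarrow> of_nat (k * (j ^ 3 + 1 - k)) * G (pt j k))"
    by (rule sum.group) (auto simp: finite_idx finite_Z Z_def)
  finally show ?thesis .
qed

lemma multiplicity_le: "k \<le> j ^ 3 \<Longrightarrow> k * (j ^ 3 + 1 - k) \<le> j ^ 6" for j k :: nat
proof -
  assume k: "k \<le> j ^ 3"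
  show ?thesis
  proof (cases "k = 0")
    case False
    hence "k * (j ^ 3 + 1 - k) \<le> j ^ 3 * j ^ 3" using k by (intro mult_le_mono) auto
    thus ?thesis by (simp flip: power_add)
  qed simp
qed

lemma sum_B_le:
  assumes "1 \<le> J" shows "real (\<Sum>\<rho>\<in>Z J. B \<rho>) \<le> real J ^ 10"
proof -
  have "(\<Sum>\<rho>\<in>Z J. B \<rho>) = (\<Sum>(j, k)\<in>idx J. k * (j ^ 3 + 1 - k))"
    using sum_Z[OF assms, of "\<lambda>_. 1 :: nat"] by simp
  also have "\<dots> = (\<Sum>j\<in>{j0..J}. \<Sum>k\<in>{1..j ^ 3}. k * (j ^ 3 + 1 - k))"
    unfolding idx_def by (rule sum.Sigma[symmetric]) auto
  also have "\<dots> \<le> (\<Sum>j\<in>{j0..J}. \<Sum>k\<in>{1..j ^ 3}. J ^ 6)"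
    by (intro sum_mono) (use multiplicity_le power_mono in \<open>fastforce intro: order_trans\<close>)
  also have "\<dots> \<le> (\<Sum>j\<in>{j0..J}. J ^ 3 * J ^ 6)"
  proof (rule sum_mono)
    fix j assume "j \<in> {j0..J}"
    hence "j ^ 3 \<le> J ^ 3" by (intro power_mono) auto
    hence "j ^ 3 * J ^ 6 \<le> J ^ 3 * J ^ 6" by (rule mult_right_mono) simp
    thus "(\<Sum>k\<in>{1..j ^ 3}. J ^ 6) \<le> J ^ 3 * J ^ 6" by (simp only: sum_constant card_atLeastAtMost) simp
  qed
  also have "\<dots> \<le> J * (J ^ 3 * J ^ 6)" using j0 by (auto intro!: mult_right_mono)
  also have "\<dots> = J ^ 10" by (simp flip: power_add power_Suc)
  finally have "(\<Sum>\<rho>\<in>Z J. B \<rho>) \<le> J ^ 10" .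
  thus ?thesis by (metis of_nat_le_iff of_nat_power)
qed

definition zsum :: "nat \<Rightarrow> real \<Rightarrow> complex" where
  "zsum J t = (\<Sum>\<rho>\<in>Z J. of_nat (B \<rho>) * (of_real t powr \<rho> / \<rho>))"

end

section \<open>Symmetry of the zeros under complex conjugation\<close>

lemma analytic_cnj_reflect:
  assumes "g analytic_on {cnj z}" shows "(\<lambda>s. cnj (g (cnj s))) analytic_on {z}"
proof -
  obtain e where e: "0 < e" "g holomorphic_on ball (cnj z) e"
    using assms by (auto simp: analytic_on_def)
  have "(\<lambda>s. cnj (g (cnj s))) holomorphic_on ball z e"
    unfolding holomorphic_on_open[OF open_ball]
  proof
    fix s assume "s \<in> ball z e"
    hence "cnj s \<in> ball (cnj z) e" by (simp add: dist_norm flip: complex_cnj_diff)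
    hence "(g has_field_derivative deriv g (cnj s)) (at (cnj s))"
      using e(2) holomorphic_derivI open_ball by blast
    hence "((cnj \<circ> g \<circ> cnj) has_field_derivative cnj (deriv g (cnj s))) (at s)"
      using has_field_derivative_cnj_cnj[of g "deriv g (cnj s)" s] by simp
    thus "\<exists>f'. ((\<lambda>s. cnj (g (cnj s))) has_field_derivative f') (at s)"
      by (auto simp: comp_def)
  qed
  thus ?thesis using e(1) by (auto simp: analytic_on_def)
qed

locale barrier_race = barrier +
  fixes q a b :: nat and chi :: "nat \<Rightarrow> complex"
  assumes q: "3 \<le> q" and ab: "coprime a q" "coprime b q"
    and chi: "dirichlet_character q chi" "chi \<noteq> principal_character q" "chi a \<noteq> chi b"
    and xi: "\<xi> = Arg2pi (chi a - chi b)"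
    and zeros: "\<And>\<rho>. 0 < B \<rho> \<Longrightarrow> dirichlet_L q chi \<rho> = 0 \<and> zorder (dirichlet_L q chi) \<rho> = int (B \<rho>)"
    and no_other_zeros: "\<And>s. \<lbrakk>\<sigma> - \<delta> \<le> Re s; 0 \<le> Im s; B s = 0\<rbrakk> \<Longrightarrow> dirichlet_L q chi s \<noteq> 0"
    and other_characters: "\<And>chi' s. \<lbrakk>dirichlet_character q chi'; chi' \<noteq> principal_character q; chi' \<noteq> chi;
                 \<sigma> - \<delta> \<le> Re s; 0 \<le> Im s\<rbrakk> \<Longrightarrow> dirichlet_L q chi' s \<noteq> 0"
begin

abbreviation chi_cnj :: "nat \<Rightarrow> complex" where "chi_cnj \<equiv> \<lambda>n. cnj (chi n)"

lemma q0: "0 < q" and q1: "1 < q" using q by simp_all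

lemma nonvanishing_upper:
  assumes psi: "dirichlet_character q psi" "psi \<noteq> principal_character q"
    and s: "\<sigma> - \<delta> \<le> Re s" "0 \<le> Im s" "Im s \<le> 2 * height J" "1 \<le> J" "psi = chi \<Longrightarrow> s \<notin> Z J"
  shows "dirichlet_L q psi s \<noteq> 0"
proof (cases "psi = chi")
  case True
  have "B s = 0" using B_pos_low[of s J] s True by auto
  thus ?thesis using no_other_zeros s True by blast
qed (use other_characters psi s in blast)

text \<open>The hypotheses concern the upper half plane only. Zeros of psi below the real axis are
  the conjugates of those of the conjugate character above it, so barrier zeros occur upright for
  chi and reflected for its conjugate. Both cases apply if chi is real, hence a union and not a case
  distinction.\<close>

definition Zc :: "(nat \<Rightarrow> complex) \<Rightarrow> nat \<Rightarrow> complex set" where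
  "Zc psi J = (if psi = chi then Z J else {}) \<union> (if psi = chi_cnj then cnj ` Z J else {})"

definition nc :: "(nat \<Rightarrow> complex) \<Rightarrow> complex \<Rightarrow> nat" where
  "nc psi s = (if psi = chi then B s else 0) + (if psi = chi_cnj then B (cnj s) else 0)"

lemma B_lower_half_plane: assumes "Im s \<le> 0" shows "B s = 0"
proof (rule ccontr)
  assume "B s \<noteq> 0"
  hence "0 < B s" by simp
  then obtain j k where "j0 \<le> j" "1 \<le> k" "pt j k = s" unfolding B_pos_iff by blast
  thus False using Im_pt_pos[of j k] j0 assms by auto
qed

lemma nonvanishing:
  assumes psi: "dirichlet_character q psi" "psi \<noteq> principal_character q"
    and s: "\<sigma> - \<delta> \<le> Re s" "\<bar>Im s\<bar> \<le> 2 * height J" "1 \<le> J" "s \<notin> Zc psi J"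
  shows "dirichlet_L q psi s \<noteq> 0"
proof (cases "0 \<le> Im s")
  case True
  moreover have "psi = chi \<Longrightarrow> s \<notin> Z J" using s(4) by (simp add: Zc_def)
  ultimately show ?thesis using s(1-3) by (intro nonvanishing_upper[OF psi, of s J]) auto
next
  case False
  have psi': "dirichlet_character q (\<lambda>n. cnj (psi n))" "(\<lambda>n. cnj (psi n)) \<noteq> principal_character q"
    using psi by (simp_all add: dirichlet_character_cnj principal_character_cnj_iff)
  have eq: "(\<lambda>n. cnj (psi n)) = chi \<Longrightarrow> psi = chi_cnj" by auto
  have "cnj s \<notin> Z J" if "(\<lambda>n. cnj (psi n)) = chi"
  proof
    assume "cnj s \<in> Z J"
    hence "cnj (cnj s) \<in> cnj ` Z J" by (rule imageI)
    thus False using s(4) eq[OF that] by (simp add: Zc_def)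
  qed
  hence "dirichlet_L q (\<lambda>n. cnj (psi n)) (cnj s) \<noteq> 0"
    using nonvanishing_upper[OF psi', of "cnj s" J] s False by simp
  thus ?thesis using dirichlet_L_cnj[OF psi q0, of s] s(1) sigma_range delta_range by auto
qed

lemma Zc_local_factor:
  assumes psi: "dirichlet_character q psi" and \<rho>: "\<rho> \<in> Zc psi J"
  shows "\<exists>g. g analytic_on {\<rho>} \<and> g \<rho> \<noteq> 0 \<and>
           (\<forall>\<^sub>F w in nhds \<rho>. dirichlet_L q psi w = g w * (w - \<rho>) ^ nc psi \<rho>)"
proof -
  have chi_loc: "\<exists>g. g analytic_on {s} \<and> g s \<noteq> 0 \<and>
       (\<forall>\<^sub>F w in nhds s. dirichlet_L q chi w = g w * (w - s) ^ B s)" if "s \<in> Z J" for s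
    by (rule nonprincipal_L_local_factor[OF chi(1,2) q0])
       (use Z_D[OF that] zeros[of s] sigma_range delta_range in auto)
  consider "psi = chi" "\<rho> \<in> Z J" | s where "psi = chi_cnj" "s \<in> Z J" "\<rho> = cnj s"
    using \<rho> by (auto simp: Zc_def split: if_splits)
  thus ?thesis
  proof cases
    case 1
    have "nc psi \<rho> = B \<rho>"
      using 1 B_lower_half_plane[of "cnj \<rho>"] Z_D(3)[OF 1(2)] by (simp add: nc_def)
    thus ?thesis using chi_loc[OF 1(2)] 1 by simp
  next
    case 2
    obtain g where g: "g analytic_on {s}" "g s \<noteq> 0"
      "\<forall>\<^sub>F w in nhds s. dirichlet_L q chi w = g w * (w - s) ^ B s" using chi_loc[OF 2(2)] by blast
    have n: "nc psi \<rho> = B s"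
      using 2 B_lower_half_plane[of \<rho>] Z_D(3)[OF 2(2)] by (simp add: nc_def)
    have fl: "filterlim cnj (nhds s) (nhds \<rho>)"
      using tendsto_cnj[OF filterlim_ident, of \<rho>] 2(3) by simp
    from fl have ev1: "\<forall>\<^sub>F w in nhds \<rho>. dirichlet_L q chi (cnj w) = g (cnj w) * (cnj w - s) ^ B s"
      by (rule eventually_compose_filterlim[OF g(3)])
    have "\<forall>\<^sub>F w in nhds \<rho>. w \<in> {w. 1/8 < Re w}"
      by (rule eventually_nhds_in_open[OF open_halfspace_Re_gt])
         (use Z_D(1)[OF 2(2)] 2(3) sigma_range delta_range in auto)
    with ev1 have "\<forall>\<^sub>F w in nhds \<rho>. dirichlet_L q psi w = cnj (g (cnj w)) * (w - \<rho>) ^ nc psi \<rho>"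
    proof eventually_elim
      case (elim w)
      have "dirichlet_L q psi w = cnj (dirichlet_L q chi (cnj w))"
        using dirichlet_L_cnj[OF chi(1,2) q0, of "cnj w"] elim(2) 2(1) by simp
      thus ?case using elim(1) n 2(3) by simp
    qed
    moreover have "(\<lambda>w. cnj (g (cnj w))) analytic_on {\<rho>}"
      by (rule analytic_cnj_reflect) (use g(1) 2(3) in simp)
    ultimately show ?thesis using g(2) 2(3) by (intro exI[of _ "\<lambda>w. cnj (g (cnj w))"]) auto
  qed
qed

lemma sum_Zc:
  fixes G :: "complex \<Rightarrow> 'a :: comm_semiring_1"
  shows "(\<Sum>\<rho>\<in>Zc psi J. of_nat (nc psi \<rho>) * G \<rho>) =
     (if psi = chi then \<Sum>\<rho>\<in>Z J. of_nat (B \<rho>) * G \<rho> else 0)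
   + (if psi = chi_cnj then \<Sum>\<rho>\<in>Z J. of_nat (B \<rho>) * G (cnj \<rho>) else 0)"
proof -
  have n1: "nc psi \<rho> = (if psi = chi then B \<rho> else 0)" if "\<rho> \<in> Z J" for \<rho>
    using B_lower_half_plane[of "cnj \<rho>"] Z_D(3)[OF that] by (simp add: nc_def)
  have n2: "nc psi (cnj \<rho>) = (if psi = chi_cnj then B \<rho> else 0)" if "\<rho> \<in> Z J" for \<rho>
    using B_lower_half_plane[of "cnj \<rho>"] Z_D(3)[OF that] by (simp add: nc_def)
  have disj: "Z J \<inter> cnj ` Z J = {}"
  proof (rule ccontr)
    assume "Z J \<inter> cnj ` Z J \<noteq> {}"
    then obtain z where "z \<in> Z J" "cnj z \<in> Z J" by auto
    thus False using Z_D(3)[of z J] Z_D(3)[of "cnj z" J] by simp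
  qed
  have "(\<Sum>\<rho>\<in>Zc psi J. of_nat (nc psi \<rho>) * G \<rho>) = (\<Sum>\<rho>\<in>Z J \<union> cnj ` Z J. of_nat (nc psi \<rho>) * G \<rho>)"
    by (rule sum.mono_neutral_left) (use n1 n2 in \<open>auto simp: Zc_def finite_Z\<close>)
  also have "\<dots> = (\<Sum>\<rho>\<in>Z J. of_nat (nc psi \<rho>) * G \<rho>) + (\<Sum>\<rho>\<in>cnj ` Z J. of_nat (nc psi \<rho>) * G \<rho>)"
    by (rule sum.union_disjoint) (use disj in \<open>auto simp: finite_Z\<close>)
  also have "(\<Sum>\<rho>\<in>cnj ` Z J. of_nat (nc psi \<rho>) * G \<rho>) = (\<Sum>\<rho>\<in>Z J. of_nat (nc psi (cnj \<rho>)) * G (cnj \<rho>))"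
    by (subst sum.reindex) (auto simp: inj_on_def)
  also have "(\<Sum>\<rho>\<in>Z J. of_nat (nc psi \<rho>) * G \<rho>) = (if psi = chi then \<Sum>\<rho>\<in>Z J. of_nat (B \<rho>) * G \<rho> else 0)"
    by (auto simp: n1 intro!: sum.neutral)
  also have "(\<Sum>\<rho>\<in>Z J. of_nat (nc psi (cnj \<rho>)) * G (cnj \<rho>)) = (if psi = chi_cnj then \<Sum>\<rho>\<in>Z J. of_nat (B \<rho>) * G (cnj \<rho>) else 0)"
    by (auto simp: n2 intro!: sum.neutral)
  finally show ?thesis .
qed

section \<open>The explicit formula for the weighted race\<close>

definition psi_race :: "nat \<Rightarrow> complex" where
  "psi_race N = (\<Sum>m\<le>N. (of_bool [m = a] (mod q) - of_bool [m = b] (mod q)) * mangoldt m)"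

definition unit_count :: nat where "unit_count = card {n. n < q \<and> coprime n q}"

lemma unit_count_pos: "0 < unit_count"
proof -
  have "1 \<in> {n. n < q \<and> coprime n q}" using q by simp
  thus ?thesis unfolding unit_count_def by (subst card_gt_0_iff) auto
qed

lemma height_ge: assumes "1 \<le> J" shows "4 \<le> height J"
proof -
  have "1 * 1 \<le> real J ^ 3 * exp (real J ^ 8)"
    using assms by (intro mult_mono one_le_power) auto
  thus ?thesis by (simp add: height_def)
qed

text \<open>The principal character takes the same value at a and b and drops out. Of the others
  only chi and its conjugate have zeros in the region, and their contributions are conjugate to each
  other, hence twice a real part; this also holds when the two characters coincide.\<close>

lemma race_explicit_formula:
  assumes c0: "\<sigma> - \<delta> < c0" "c0 < 1"
  obtains C where "0 < C" "\<And>J t. 1 \<le> J \<Longrightarrow> 2 \<le> t \<Longrightarrow> (t + 1) ^ 3 \<le> height J \<Longrightarrow>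
     norm (of_nat unit_count * psi_race (nat \<lfloor>t\<rfloor>) + of_real (2 * Re (cnj (chi a - chi b) * zsum J t)))
       \<le> C * (1 + real J ^ 10) * (ln (height J)) ^ 2 * t powr c0"
proof (rule residue_difference_character_expansion[OF q1 ab])
  fix CC assume CC: "finite CC" "\<And>psi. psi \<in> CC \<Longrightarrow> dirichlet_character q psi"
    "\<And>psi. dirichlet_character q psi \<Longrightarrow> psi a \<noteq> psi b \<Longrightarrow> psi \<in> CC"
    "\<And>n. of_nat (card {n. n < q \<and> coprime n q}) * (of_bool [n = a] (mod q) - of_bool [n = b] (mod q))
           = (\<Sum>psi\<in>CC. cnj (psi a - psi b) * psi n)"
  define D where "D = CC - {principal_character q}"
  have \<eta>: "1/2 < \<sigma> - \<delta>" using delta_range by simp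
  have "\<exists>C>0. \<forall>J t. 1 \<le> J \<longrightarrow> 2 \<le> t \<longrightarrow> (t + 1) ^ 3 \<le> height J \<longrightarrow>
     norm ((\<Sum>m\<le>nat \<lfloor>t\<rfloor>. psi m * mangoldt m)
         + ((if psi = chi then zsum J t else 0) + (if psi = chi_cnj then cnj (zsum J t) else 0)))
       \<le> C * (1 + real J ^ 10) * (ln (height J)) ^ 2 * t powr c0" if "psi \<in> D" for psi
  proof -
    have psi: "dirichlet_character q psi" "psi \<noteq> principal_character q" using that CC(2) by (auto simp: D_def)
    show ?thesis
    proof (rule explicit_formula[OF psi q0 \<eta> c0])
      fix C :: real assume C: "0 < C"
        "\<And>T Z (n :: complex \<Rightarrow> nat) t. 4 \<le> T \<Longrightarrow> finite Z \<Longrightarrow>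
       (\<And>\<rho>. \<rho> \<in> Z \<Longrightarrow> \<sigma> - \<delta> \<le> Re \<rho> \<and> Re \<rho> < 1 \<and> \<bar>Im \<rho>\<bar> \<le> T / 2) \<Longrightarrow>
       (\<And>\<rho>. \<rho> \<in> Z \<Longrightarrow> \<exists>g. g analytic_on {\<rho>} \<and> g \<rho> \<noteq> 0 \<and>
            (\<forall>\<^sub>F w in nhds \<rho>. dirichlet_L q psi w = g w * (w - \<rho>) ^ n \<rho>)) \<Longrightarrow>
       (\<And>s. \<sigma> - \<delta> \<le> Re s \<Longrightarrow> \<bar>Im s\<bar> \<le> 2 * T \<Longrightarrow> s \<notin> Z \<Longrightarrow> dirichlet_L q psi s \<noteq> 0) \<Longrightarrow>
       2 \<le> t \<Longrightarrow> (t + 1) ^ 3 \<le> T \<Longrightarrow>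
       norm ((\<Sum>m\<le>nat \<lfloor>t\<rfloor>. psi m * mangoldt m) + (\<Sum>\<rho>\<in>Z. of_nat (n \<rho>) * (of_real t powr \<rho> / \<rho>)))
         \<le> C * (1 + real (\<Sum>\<rho>\<in>Z. n \<rho>)) * (ln T) ^ 2 * t powr c0"
      show ?thesis
      proof (intro exI[of _ "2 * C"] conjI allI impI)
        fix J :: nat and t :: real assume J: "1 \<le> J" and t: "2 \<le> t" "(t + 1) ^ 3 \<le> height J"
        have fin: "finite (Zc psi J)" by (simp add: Zc_def finite_Z)
        have range: "\<sigma> - \<delta> \<le> Re \<rho> \<and> Re \<rho> < 1 \<and> \<bar>Im \<rho>\<bar> \<le> height J / 2" if "\<rho> \<in> Zc psi J" for \<rho>
          using that Z_D(1-4) sigma_range by (fastforce simp: Zc_def split: if_splits)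
        have e: "norm ((\<Sum>m\<le>nat \<lfloor>t\<rfloor>. psi m * mangoldt m) + (\<Sum>\<rho>\<in>Zc psi J. of_nat (nc psi \<rho>) * (of_real t powr \<rho> / \<rho>)))
            \<le> C * (1 + real (\<Sum>\<rho>\<in>Zc psi J. nc psi \<rho>)) * (ln (height J)) ^ 2 * t powr c0"
          by (rule C(2)[OF height_ge[OF J] fin range Zc_local_factor[OF psi(1)] nonvanishing[OF psi _ _ J] t])
        have z: "(\<Sum>\<rho>\<in>Zc psi J. of_nat (nc psi \<rho>) * (of_real t powr \<rho> / \<rho>))
            = (if psi = chi then zsum J t else 0) + (if psi = chi_cnj then cnj (zsum J t) else 0)"
          unfolding sum_Zc zsum_def using t by (simp add: cnj_powr)
        \<comment> \<open>The factor 2 is reached for a real chi, which carries both the upright and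
          the reflected zeros.\<close>
        have "(\<Sum>\<rho>\<in>Zc psi J. nc psi \<rho>) \<le> 2 * (\<Sum>\<rho>\<in>Z J. B \<rho>)"
          using sum_Zc[where G = "\<lambda>_. 1 :: nat", of psi J] by simp
        hence "real (\<Sum>\<rho>\<in>Zc psi J. nc psi \<rho>) \<le> real (2 * (\<Sum>\<rho>\<in>Z J. B \<rho>))" by (simp only: of_nat_le_iff)
        also have "\<dots> \<le> 2 * real J ^ 10" using sum_B_le[OF J] by simp
        finally have M: "1 + real (\<Sum>\<rho>\<in>Zc psi J. nc psi \<rho>) \<le> 2 * (1 + real J ^ 10)" by simp
        have "C * (1 + real (\<Sum>\<rho>\<in>Zc psi J. nc psi \<rho>)) * (ln (height J)) ^ 2 * t powr c0
            \<le> C * (2 * (1 + real J ^ 10)) * (ln (height J)) ^ 2 * t powr c0"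
          using C(1) M by (intro mult_right_mono mult_left_mono) auto
        with e show "norm ((\<Sum>m\<le>nat \<lfloor>t\<rfloor>. psi m * mangoldt m)
            + ((if psi = chi then zsum J t else 0) + (if psi = chi_cnj then cnj (zsum J t) else 0)))
            \<le> 2 * C * (1 + real J ^ 10) * (ln (height J)) ^ 2 * t powr c0"
          unfolding z by (simp add: mult_ac)
      qed (use C in simp)
    qed
  qed
  hence "\<exists>K. \<forall>psi\<in>D. 0 < K psi \<and> (\<forall>J t. 1 \<le> J \<longrightarrow> 2 \<le> t \<longrightarrow> (t + 1) ^ 3 \<le> height J \<longrightarrow>
     norm ((\<Sum>m\<le>nat \<lfloor>t\<rfloor>. psi m * mangoldt m)
         + ((if psi = chi then zsum J t else 0) + (if psi = chi_cnj then cnj (zsum J t) else 0)))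
       \<le> K psi * (1 + real J ^ 10) * (ln (height J)) ^ 2 * t powr c0)"
    by (intro bchoice) blast
  then obtain K where K: "\<And>psi. psi \<in> D \<Longrightarrow> 0 < K psi"
    "\<And>psi J t. psi \<in> D \<Longrightarrow> 1 \<le> J \<Longrightarrow> 2 \<le> t \<Longrightarrow> (t + 1) ^ 3 \<le> height J \<Longrightarrow>
     norm ((\<Sum>m\<le>nat \<lfloor>t\<rfloor>. psi m * mangoldt m)
         + ((if psi = chi then zsum J t else 0) + (if psi = chi_cnj then cnj (zsum J t) else 0)))
       \<le> K psi * (1 + real J ^ 10) * (ln (height J)) ^ 2 * t powr c0" by blast
  define c where "c = (\<lambda>psi :: nat \<Rightarrow> complex. cnj (psi a - psi b))"
  have inD: "chi \<in> D" "chi_cnj \<in> D"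
    using CC(3)[OF chi(1)] CC(3)[OF dirichlet_character_cnj[OF chi(1)]] chi principal_character_cnj_iff[of chi q]
    by (auto simp: D_def)
  have finD: "finite D" using CC(1) by (simp add: D_def)
  have pc: "principal_character q a = principal_character q b" using ab by (simp add: principal_character_def)
  have exp: "of_nat unit_count * (of_bool [n = a] (mod q) - of_bool [n = b] (mod q)) = (\<Sum>psi\<in>D. c psi * psi n)" for n
    unfolding unit_count_def CC(4) c_def
    by (intro sum.mono_neutral_right) (use CC(1) pc in \<open>auto simp: D_def\<close>)
  show ?thesis
  proof (rule that[of "1 + (\<Sum>psi\<in>D. norm (c psi) * K psi)"])
    have "0 \<le> (\<Sum>psi\<in>D. norm (c psi) * K psi)"
      using K(1) by (intro sum_nonneg mult_nonneg_nonneg) (auto intro: less_imp_le)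
    thus "0 < 1 + (\<Sum>psi\<in>D. norm (c psi) * K psi)" by simp
    fix J :: nat and t :: real assume J: "1 \<le> J" and t: "2 \<le> t" "(t + 1) ^ 3 \<le> height J"
    define E where "E = (1 + real J ^ 10) * (ln (height J)) ^ 2 * t powr c0"
    define W where "W = (\<lambda>psi. (if psi = chi then zsum J t else 0) + (if psi = chi_cnj then cnj (zsum J t) else 0))"
    have "(\<Sum>psi\<in>D. c psi * W psi) = c chi * zsum J t + c chi_cnj * cnj (zsum J t)"
      using inD finD by (simp add: W_def distrib_left sum.distrib if_distrib[of "\<lambda>x. _ * x"] sum.delta cong: if_cong)
    also have "c chi_cnj * cnj (zsum J t) = cnj (c chi * zsum J t)" by (simp add: c_def)
    also have "c chi * zsum J t + cnj (c chi * zsum J t) = of_real (2 * Re (c chi * zsum J t))"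
      by (rule complex_add_cnj)
    finally have W: "(\<Sum>psi\<in>D. c psi * W psi) = of_real (2 * Re (cnj (chi a - chi b) * zsum J t))" by (simp add: c_def)
    have "of_nat unit_count * psi_race (nat \<lfloor>t\<rfloor>) = (\<Sum>m\<le>nat \<lfloor>t\<rfloor>. (\<Sum>psi\<in>D. c psi * psi m) * mangoldt m)"
      unfolding psi_race_def exp[symmetric] by (simp add: sum_distrib_left mult_ac)
    also have "\<dots> = (\<Sum>psi\<in>D. c psi * (\<Sum>m\<le>nat \<lfloor>t\<rfloor>. psi m * mangoldt m))"
      unfolding sum_distrib_right sum_distrib_left by (subst sum.swap) (simp add: mult_ac)
    finally have "of_nat unit_count * psi_race (nat \<lfloor>t\<rfloor>) + of_real (2 * Re (cnj (chi a - chi b) * zsum J t))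
       = (\<Sum>psi\<in>D. c psi * ((\<Sum>m\<le>nat \<lfloor>t\<rfloor>. psi m * mangoldt m) + W psi))"
      by (simp only: W[symmetric] sum.distrib distrib_left)
    also have "norm \<dots> \<le> (\<Sum>psi\<in>D. norm (c psi) * (K psi * E))"
    proof (rule order_trans[OF norm_sum], rule sum_mono)
      fix psi assume "psi \<in> D"
      from K(2)[OF this J t] show "norm (c psi * ((\<Sum>m\<le>nat \<lfloor>t\<rfloor>. psi m * mangoldt m) + W psi)) \<le> norm (c psi) * (K psi * E)"
        unfolding norm_mult W_def E_def by (intro mult_left_mono) (simp_all add: mult_ac)
    qed
    also have "\<dots> = (\<Sum>psi\<in>D. norm (c psi) * K psi) * E" by (simp add: sum_distrib_left mult_ac)
    also have "\<dots> \<le> (1 + (\<Sum>psi\<in>D. norm (c psi) * K psi)) * E"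
      by (intro mult_right_mono) (auto simp: E_def)
    finally show "norm (of_nat unit_count * psi_race (nat \<lfloor>t\<rfloor>) + of_real (2 * Re (cnj (chi a - chi b) * zsum J t)))
       \<le> (1 + (\<Sum>psi\<in>D. norm (c psi) * K psi)) * (1 + real J ^ 10) * (ln (height J)) ^ 2 * t powr c0"
      by (simp add: E_def mult_ac)
  qed
qed

end

section \<open>From prime powers to primes\<close>

text \<open>A proper prime power p^k up to x has p at most sqrt x and k at most log 2 x. The total
  is sqrt x up to logarithms, which is harmless because \<sigma> exceeds 1/2.\<close>

lemma nonprime_primepow_sum:
  assumes "2 \<le> x"
  shows "(\<Sum>m | m \<le> nat \<lfloor>x\<rfloor> \<and> primepow m \<and> \<not> prime m. mangoldt m)
           \<le> (sqrt x + 1) * (log 2 x + 1) * ln x"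
proof -
  define S where "S = {m. m \<le> nat \<lfloor>x\<rfloor> \<and> primepow m \<and> \<not> prime m}"
  define P where "P = {..nat \<lfloor>sqrt x\<rfloor>} \<times> {..nat \<lfloor>log 2 x\<rfloor>}"
  have lx: "0 \<le> log 2 x" "0 \<le> sqrt x" using assms by simp_all
  have le_x: "real m \<le> x" if "m \<in> S" for m
    using that assms by (simp add: S_def le_nat_iff le_floor_iff)
  have "S \<subseteq> (\<lambda>(p, k). p ^ k) ` P"
  proof
    fix m assume m: "m \<in> S"
    then obtain p k where pk: "prime p" "0 < k" "m = p ^ k" by (auto simp: S_def primepow_def)
    have "k \<noteq> 1" using m pk by (auto simp: S_def)
    hence k: "2 \<le> k" using pk by simp
    have p: "2 \<le> p" using pk(1) by (rule prime_ge_2_nat)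
    have px: "real (p ^ k) \<le> x" using le_x[OF m] pk by simp
    have "p ^ 2 \<le> p ^ k" using k p by (intro power_increasing) auto
    hence "real (p ^ 2) \<le> real (p ^ k)" by (simp only: of_nat_le_iff)
    hence "real p ^ 2 \<le> x" using px by simp
    hence "real p \<le> sqrt x" by (rule real_le_rsqrt)
    moreover have "2 ^ k \<le> p ^ k" using p by (rule power_mono) simp
    hence "real (2 ^ k) \<le> real (p ^ k)" by (simp only: of_nat_le_iff)
    hence "2 ^ k \<le> x" using px by simp
    hence "2 powr real k \<le> x" by (simp add: powr_realpow)
    hence "real k \<le> log 2 x" using assms by (subst le_log_iff) auto
    ultimately have "(p, k) \<in> P" by (simp add: P_def le_nat_floor)
    hence "(\<lambda>(p, k). p ^ k) (p, k) \<in> (\<lambda>(p, k). p ^ k) ` P" by (rule imageI)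
    thus "m \<in> (\<lambda>(p, k). p ^ k) ` P" using pk by simp
  qed
  hence "card S \<le> card P" by (rule surj_card_le[rotated]) (simp add: P_def)
  hence "real (card S) \<le> real (card P)" by simp
  also have "\<dots> = (1 + real (nat \<lfloor>sqrt x\<rfloor>)) * (1 + real (nat \<lfloor>log 2 x\<rfloor>))"
    by (simp add: P_def algebra_simps)
  also have "\<dots> \<le> (sqrt x + 1) * (log 2 x + 1)" using lx by (intro mult_mono) auto
  finally have card: "real (card S) \<le> (sqrt x + 1) * (log 2 x + 1)" .
  have "(\<Sum>m\<in>S. mangoldt m) \<le> (\<Sum>m\<in>S. ln x)"
  proof (rule sum_mono)
    fix m assume m: "m \<in> S"
    hence "0 < m" using primepow_gt_0_nat by (auto simp: S_def)
    hence "mangoldt m \<le> ln (real m)" by (rule mangoldt_le)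
    also have "\<dots> \<le> ln x" using le_x[OF m] \<open>0 < m\<close> by simp
    finally show "mangoldt m \<le> ln x" .
  qed
  also have "\<dots> = real (card S) * ln x" by simp
  also have "\<dots> \<le> (sqrt x + 1) * (log 2 x + 1) * ln x" using assms by (intro mult_right_mono card) auto
  finally show ?thesis by (simp add: S_def)
qed

section \<open>Partial summation and the integrals it produces\<close>

lemma abel_log_summation:
  fixes a :: "nat \<Rightarrow> real"
  defines "A \<equiv> \<lambda>m. \<Sum>i=2..m. a i * ln (real i)"
  assumes "2 \<le> N"
  shows "(\<Sum>i=2..N. a i) = A N / ln (real N)
           + (\<Sum>m=2..<N. A m * (1 / ln (real m) - 1 / ln (real (Suc m))))"
  using assms(2)
proof (induction N rule: dec_induct)
  case base
  thus ?case by (simp add: A_def)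
next
  case (step N)
  have "A (Suc N) = A N + a (Suc N) * ln (real (Suc N))" using step by (simp add: A_def)
  moreover have "ln (real (Suc N)) \<noteq> 0" using step by simp
  ultimately have "A (Suc N) / ln (real (Suc N)) = A N / ln (real (Suc N)) + a (Suc N)"
    by (simp add: add_divide_distrib)
  thus ?case using step by (simp add: algebra_simps)
qed

lemma integral_inverse_ln_square:
  fixes u v :: real
  assumes "2 \<le> u" "u \<le> v"
  shows "((\<lambda>t. 1 / (t * (ln t)\<^sup>2)) has_integral (1 / ln u - 1 / ln v)) {u..v}"
proof -
  have "((\<lambda>t. 1 / (t * (ln t)\<^sup>2)) has_integral (- (1 / ln v) - (- (1 / ln u)))) {u..v}"
  proof (rule fundamental_theorem_of_calculus[OF assms(2)])
    fix t assume "t \<in> {u..v}"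
    hence t: "0 < t" "ln t \<noteq> 0" using assms by auto
    have "((\<lambda>t. - (1 / ln t)) has_real_derivative 1 / (t * (ln t)\<^sup>2)) (at t)"
      using t by (auto intro!: derivative_eq_intros simp: field_simps power2_eq_square)
    thus "((\<lambda>t. - (1 / ln t)) has_vector_derivative 1 / (t * (ln t)\<^sup>2)) (at t within {u..v})"
      by (auto simp: has_real_derivative_iff_has_vector_derivative intro: has_vector_derivative_at_within)
  qed
  thus ?thesis by simp
qed

text \<open>The weight of \<open>A m\<close> is the integral of 1 / (u (ln u)^2) over [m, m + 1], so
  the step function A can be replaced by the smooth M with an error that telescopes. The integral of
  M can then exploit the oscillation of the powers, which the sum hides.\<close>

lemma sum_integral_comparison:
  fixes A :: "nat \<Rightarrow> real" and M :: "real \<Rightarrow> real"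
  assumes cont: "continuous_on {2..} M" and N: "2 \<le> N"
    and close: "\<And>m u. 2 \<le> m \<Longrightarrow> m < N \<Longrightarrow> real m \<le> u \<Longrightarrow> u \<le> real m + 1 \<Longrightarrow> \<bar>A m - M u\<bar> \<le> E"
  shows "\<bar>(\<Sum>m=2..<N. A m * (1 / ln (real m) - 1 / ln (real (Suc m))))
           - integral {2..real N} (\<lambda>u. M u / (u * (ln u)\<^sup>2))\<bar> \<le> E * (1 / ln 2 - 1 / ln (real N))"
  using N close
proof (induction N rule: dec_induct)
  case base
  show ?case by simp
next
  case (step N)
  let ?b = "1 / ln (real N) - 1 / ln (real (Suc N))"
  define w where "w = (\<lambda>u::real. 1 / (u * (ln u)\<^sup>2))"
  have wpos: "0 \<le> w u" if "2 \<le> u" for u using that by (simp add: w_def)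
  have contw: "continuous_on {2..} (\<lambda>u. M u * w u)"
    unfolding w_def using cont by (intro continuous_intros) auto
  have N2: "2 \<le> real N" using step by simp
  have int: "(\<lambda>u. M u * w u) integrable_on {u..v}" if "2 \<le> u" for u v
    by (rule integrable_continuous_real[OF continuous_on_subset[OF contw]]) (use that in auto)
  have comb: "integral {2..real (Suc N)} (\<lambda>u. M u * w u)
      = integral {2..real N} (\<lambda>u. M u * w u) + integral {real N..real (Suc N)} (\<lambda>u. M u * w u)"
    using N2 int[of 2 "real (Suc N)"] by (intro Henstock_Kurzweil_Integration.integral_combine[symmetric]) auto
  have wi: "(w has_integral ?b) {real N..real (Suc N)}"
    unfolding w_def by (rule integral_inverse_ln_square) (use N2 in auto)
  have "((\<lambda>u. A N * w u - M u * w u) has_integral (A N * ?b - integral {real N..real (Suc N)} (\<lambda>u. M u * w u))) {real N..real (Suc N)}"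
    using has_integral_mult_right[OF wi] int[of "real N" "real (Suc N)"] N2
    by (intro has_integral_diff) (auto simp: has_integral_iff)
  moreover have "((\<lambda>u. E * w u) has_integral E * ?b) {real N..real (Suc N)}"
    by (rule has_integral_mult_right[OF wi])
  moreover have "norm (A N * w u - M u * w u) \<le> E * w u" if "u \<in> {real N..real (Suc N)}" for u
  proof -
    have "\<bar>A N - M u\<bar> \<le> E" using step that by (intro step.prems) auto
    hence "\<bar>A N - M u\<bar> * w u \<le> E * w u" using wpos[of u] N2 that by (intro mult_right_mono) auto
    moreover have "\<bar>A N * w u - M u * w u\<bar> = \<bar>A N - M u\<bar> * w u"
      using wpos[of u] N2 that by (simp add: abs_mult flip: left_diff_distrib)
    ultimately show ?thesis by simp
  qed
  ultimately have last: "\<bar>A N * ?b - integral {real N..real (Suc N)} (\<lambda>u. M u * w u)\<bar> \<le> E * ?b"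
    using integral_norm_bound_integral[of "\<lambda>u. A N * w u - M u * w u" "{real N..real (Suc N)}" "\<lambda>u. E * w u"]
    by (auto simp: has_integral_iff)
  have IH: "\<bar>(\<Sum>m=2..<N. A m * (1 / ln (real m) - 1 / ln (real (Suc m))))
           - integral {2..real N} (\<lambda>u. M u * w u)\<bar> \<le> E * (1 / ln 2 - 1 / ln (real N))"
    using step.IH step.prems by (simp add: w_def)
  have "E * (1 / ln 2 - 1 / ln (real N)) + E * ?b = E * (1 / ln 2 - 1 / ln (real (Suc N)))"
    by (simp add: algebra_simps)
  moreover have "(\<Sum>m=2..<Suc N. A m * (1 / ln (real m) - 1 / ln (real (Suc m))))
     = (\<Sum>m=2..<N. A m * (1 / ln (real m) - 1 / ln (real (Suc m)))) + A N * ?b"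
    using step by (subst sum.atLeastLessThan_Suc) auto
  ultimately have "\<bar>(\<Sum>m=2..<Suc N. A m * (1 / ln (real m) - 1 / ln (real (Suc m))))
      - integral {2..real (Suc N)} (\<lambda>u. M u * w u)\<bar> \<le> E * (1 / ln 2 - 1 / ln (real (Suc N)))"
    unfolding comb using IH last by linarith
  thus ?case by (simp add: w_def)
qed

text \<open>Integration by parts, which gains the factor \<open>1 / \<rho>\<close>.\<close>
lemma powr_ln_square_integral_bound:
  fixes \<rho> :: complex
  assumes \<rho>: "1/2 \<le> Re \<rho>" and x: "2 \<le> x"
  shows "norm (integral {2..x} (\<lambda>u. of_real u powr \<rho> / of_real (u * (ln u)\<^sup>2))) \<le> 18 * x powr Re \<rho> / norm \<rho>"
proof -
  have \<rho>0: "\<rho> \<noteq> 0" using \<rho> by auto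
  define f where "f = (\<lambda>u. of_real u powr \<rho> / of_real (u * (ln u)\<^sup>2) :: complex)"
  define g where "g = (\<lambda>u. 2 / \<rho> * (of_real u powr \<rho> / of_real (u * (ln u) ^ 3)) :: complex)"
  define H where "H = (\<lambda>u. of_real u powr \<rho> / (\<rho> * of_real ((ln u)\<^sup>2)) :: complex)"
  have ln2: "2/3 \<le> ln (2::real)" using ln2_ge_two_thirds by simp
  have lnu: "2/3 \<le> ln u" if "2 \<le> u" for u :: real using that ln2 ln_le_cancel_iff[of 2 u] by linarith
  have l2: "1 / (ln u)\<^sup>2 \<le> 9/4" if "2 \<le> u" for u :: real
  proof -
    have "(2/3)\<^sup>2 \<le> (ln u)\<^sup>2" using lnu[OF that] by (intro power_mono) auto
    hence "1 / (ln u)\<^sup>2 \<le> 1 / (2/3)\<^sup>2" by (intro frac_le) auto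
    thus ?thesis by (simp add: power2_eq_square)
  qed
  have l3: "1 / (ln u) ^ 3 \<le> 27/8" if "2 \<le> u" for u :: real
  proof -
    have "(2/3) ^ 3 \<le> (ln u) ^ 3" using lnu[OF that] by (intro power_mono) auto
    hence "1 / (ln u) ^ 3 \<le> 1 / (2/3) ^ 3" by (intro frac_le) auto
    thus ?thesis by (simp add: power3_eq_cube)
  qed
  have HI: "((\<lambda>u. f u - g u) has_integral (H x - H 2)) {2..x}"
  proof (rule fundamental_theorem_of_calculus[OF x])
    fix u assume "u \<in> {2..x}"
    hence u: "0 < u" "0 < ln u" using x by auto
    have p: "((\<lambda>u. of_real u powr \<rho>) has_vector_derivative \<rho> * of_real u powr \<rho> / of_real u) (at u)"
    proof -
      have "((\<lambda>z. z powr \<rho>) has_field_derivative \<rho> * of_real u powr (\<rho> - 1)) (at (of_real u))"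
        using u by (intro has_field_derivative_powr) (auto simp: complex_nonpos_Reals_iff)
      from field_vector_diff_chain_at[OF has_vector_derivative_of_real[OF DERIV_ident] this]
      show ?thesis using u by (simp add: comp_def powr_diff)
    qed
    have q: "((\<lambda>u. 1 / (ln u)\<^sup>2) has_real_derivative - 2 / (u * (ln u) ^ 3)) (at u)"
      using u by (auto intro!: derivative_eq_intros simp: field_simps eval_nat_numeral)
    have "((\<lambda>u. of_real (1 / (ln u)\<^sup>2) :: complex) has_vector_derivative of_real (- 2 / (u * (ln u) ^ 3))) (at u)"
      by (rule has_vector_derivative_of_real[OF q])
    from has_vector_derivative_mult[OF p this]
    have "((\<lambda>u. of_real u powr \<rho> * of_real (1 / (ln u)\<^sup>2)) has_vector_derivative
        of_real u powr \<rho> * of_real (- 2 / (u * (ln u) ^ 3)) + \<rho> * of_real u powr \<rho> / of_real u * of_real (1 / (ln u)\<^sup>2)) (at u)" .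
    from has_vector_derivative_mult_right[OF this, of "1 / \<rho>"]
    have "(H has_vector_derivative f u - g u) (at u)"
      using \<rho>0 u by (simp add: H_def f_def g_def field_simps)
    thus "(H has_vector_derivative f u - g u) (at u within {2..x})" by (rule has_vector_derivative_at_within)
  qed
  have contg: "continuous_on {2..x} g" unfolding g_def
    by (intro continuous_intros) auto
  have gi: "g integrable_on {2..x}" by (rule integrable_continuous_real[OF contg])
  have "(f has_integral (H x - H 2 + integral {2..x} g)) {2..x}"
    using has_integral_add[OF HI integrable_integral[OF gi]] by simp
  hence eqf: "integral {2..x} f = H x - H 2 + integral {2..x} g" by (rule integral_unique)
  have Hb: "norm (H u) \<le> 9/4 * (x powr Re \<rho> / norm \<rho>)" if "2 \<le> u" "u \<le> x" for u
  proof -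
    have "norm (H u) = (1 / (ln u)\<^sup>2) * (u powr Re \<rho> / norm \<rho>)"
      using that by (simp add: H_def norm_divide norm_mult norm_powr_real_powr norm_power)
    also have "\<dots> \<le> 9/4 * (x powr Re \<rho> / norm \<rho>)"
      using that \<rho> by (intro mult_mono l2 divide_right_mono powr_mono2) auto
    finally show ?thesis .
  qed
  have gb: "norm (integral {2..x} g) \<le> 27/2 * (x powr Re \<rho> / norm \<rho>)"
  proof -
    define G where "G = (\<lambda>u. 27/4 / norm \<rho> * u powr (Re \<rho> - 1))"
    have G: "(G has_integral (27/4 / norm \<rho> * (x powr Re \<rho> / Re \<rho>) - 27/4 / norm \<rho> * (2 powr Re \<rho> / Re \<rho>))) {2..x}"
    proof (rule fundamental_theorem_of_calculus[OF x])
      fix u assume "u \<in> {2..x}"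
      hence "((\<lambda>u. 27/4 / norm \<rho> * (u powr Re \<rho> / Re \<rho>)) has_real_derivative G u) (at u)"
        using \<rho> by (auto intro!: derivative_eq_intros simp: G_def)
      thus "((\<lambda>u. 27/4 / norm \<rho> * (u powr Re \<rho> / Re \<rho>)) has_vector_derivative G u) (at u within {2..x})"
        by (auto simp: has_real_derivative_iff_has_vector_derivative intro: has_vector_derivative_at_within)
    qed
    have "norm (integral {2..x} g) \<le> integral {2..x} G"
    proof (rule integral_norm_bound_integral[OF gi])
      show "G integrable_on {2..x}" using G by blast
      fix u assume u: "u \<in> {2..x}"
      hence u0: "0 < u" "0 < ln u" by auto
      have "norm (g u) = 2 / norm \<rho> * (u powr Re \<rho> / u * (1 / (ln u) ^ 3))"
        using u0 by (simp add: g_def norm_divide norm_mult norm_powr_real_powr norm_power abs_mult)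
      also have "\<dots> \<le> 2 / norm \<rho> * (u powr Re \<rho> / u * (27/8))"
        using u l3[of u] by (intro mult_left_mono) auto
      also have "\<dots> = G u" using u0 by (simp add: G_def powr_diff)
      finally show "norm (g u) \<le> G u" .
    qed
    also have "\<dots> = 27/4 / norm \<rho> * (x powr Re \<rho> / Re \<rho>) - 27/4 / norm \<rho> * (2 powr Re \<rho> / Re \<rho>)"
      by (rule integral_unique[OF G])
    also have "\<dots> \<le> 27/4 / norm \<rho> * (x powr Re \<rho> / Re \<rho>)" using \<rho> by simp
    also have "\<dots> \<le> 27/4 / norm \<rho> * (x powr Re \<rho> / (1/2))"
      using \<rho> by (intro mult_left_mono divide_left_mono) auto
    finally show ?thesis by simp
  qed
  have "norm (H x) \<le> 9/4 * (x powr Re \<rho> / norm \<rho>)" "norm (H 2) \<le> 9/4 * (x powr Re \<rho> / norm \<rho>)"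
    using Hb[of x] Hb[of 2] x by simp_all
  with gb have "norm (integral {2..x} f) \<le> 9/4 * (x powr Re \<rho> / norm \<rho>) + 9/4 * (x powr Re \<rho> / norm \<rho>) + 27/2 * (x powr Re \<rho> / norm \<rho>)"
    unfolding eqf using norm_triangle_ineq[of "H x - H 2" "integral {2..x} g"] norm_triangle_ineq4[of "H x" "H 2"]
    by linarith
  thus ?thesis by (simp add: f_def)
qed

section \<open>The one-sided Fejer kernel\<close>

definition fejer_kernel :: "nat \<Rightarrow> complex \<Rightarrow> complex" where
  "fejer_kernel N z = (\<Sum>k=1..N. of_nat (N + 1 - k) * z ^ k)"

lemma fejer_kernel_Suc: "fejer_kernel (Suc N) z = fejer_kernel N z + (\<Sum>k=1..Suc N. z ^ k)"
proof -
  have "fejer_kernel (Suc N) z = (\<Sum>k=1..Suc N. (of_nat (N + 1 - k) + 1) * z ^ k)"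
    unfolding fejer_kernel_def
  proof (rule sum.cong[OF refl])
    fix k assume "k \<in> {1..Suc N}"
    hence "Suc N + 1 - k = Suc (N + 1 - k)" by auto
    thus "of_nat (Suc N + 1 - k) * z ^ k = (of_nat (N + 1 - k) + 1) * z ^ k" by (simp add: add.commute)
  qed
  also have "\<dots> = (\<Sum>k=1..Suc N. of_nat (N + 1 - k) * z ^ k) + (\<Sum>k=1..Suc N. z ^ k)"
    by (simp only: distrib_right sum.distrib mult_1)
  finally show ?thesis by (simp add: fejer_kernel_def)
qed

lemma norm_geometric_le:
  fixes z :: complex
  assumes "norm z = 1" "z \<noteq> 1"
  shows "norm (\<Sum>k\<le>n. z ^ k) \<le> 2 / norm (1 - z)" "norm (\<Sum>k=1..n. z ^ k) \<le> 2 / norm (1 - z)"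
proof -
  have g: "norm (\<Sum>k<m. z ^ k) \<le> 2 / norm (1 - z)" for m
  proof -
    have "norm (1 - z ^ m) \<le> 2" using norm_triangle_ineq4[of 1 "z ^ m"] assms by (simp add: norm_power)
    moreover have "(\<Sum>k<m. z ^ k) = (1 - z ^ m) / (1 - z)"
      using geometric_sum[OF assms(2), of m] by (metis minus_diff_eq minus_divide_divide)
    ultimately show ?thesis by (simp add: norm_divide divide_right_mono)
  qed
  show "norm (\<Sum>k\<le>n. z ^ k) \<le> 2 / norm (1 - z)" using g[of "Suc n"] by (simp add: lessThan_Suc_atMost)
  have "(\<Sum>k=1..n. z ^ k) = (\<Sum>k<n. z ^ Suc k)"
    by (rule sum.reindex_bij_witness[of _ Suc "\<lambda>k. k - 1"]) auto
  also have "\<dots> = z * (\<Sum>k<n. z ^ k)" by (simp add: sum_distrib_left)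
  finally show "norm (\<Sum>k=1..n. z ^ k) \<le> 2 / norm (1 - z)" using g[of n] assms by (simp add: norm_mult)
qed

text \<open>Summing the geometric bound over the recursion keeps the bound linear in N. It is needed
  for the kernel multiplied by a small phase error, where the sign of the real part is of no
  help.\<close>

lemma norm_fejer_kernel_le:
  assumes "norm z = 1" "z \<noteq> 1" shows "norm (fejer_kernel N z) \<le> 2 * real N / norm (1 - z)"
proof (induction N)
  case (Suc N)
  have "norm (fejer_kernel (Suc N) z) \<le> 2 * real N / norm (1 - z) + 2 / norm (1 - z)"
    unfolding fejer_kernel_Suc
    by (rule order_trans[OF norm_triangle_ineq add_mono[OF Suc norm_geometric_le(2)[OF assms]]])
  thus ?case by (simp add: add_divide_distrib algebra_simps)
qed (simp add: fejer_kernel_def)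

lemma fejer_kernel_trivial_bound: assumes "norm z = 1" shows "norm (fejer_kernel N z) \<le> real N ^ 2"
proof -
  have "norm (fejer_kernel N z) \<le> (\<Sum>k=1..N. real N)"
    unfolding fejer_kernel_def
  proof (rule order_trans[OF norm_sum sum_mono])
    fix k assume k: "k \<in> {1..N}"
    have "norm (of_nat (N + 1 - k) * z ^ k) = real (N + 1 - k)"
      by (simp only: norm_mult norm_of_nat norm_power assms power_one mult_1_right)
    thus "norm (of_nat (N + 1 - k) * z ^ k) \<le> real N" using k by simp
  qed
  thus ?thesis by (simp add: power2_eq_square)
qed

text \<open>The left side is the full Fejer kernel, the sum of (N + 1 - |k|) z^k over |k| <= N,
  which is the square of the modulus of a geometric sum. In the induction the cross term of the
  square supplies exactly the new sum in \<open>fejer_kernel_Suc\<close>.\<close>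

lemma Re_fejer_kernel:
  assumes "norm z = 1" shows "2 * Re (fejer_kernel N z) + real (N + 1) = norm (\<Sum>k\<le>N. z ^ k) ^ 2"
proof (induction N)
  case (Suc N)
  define S where "S = (\<Sum>k\<le>N. z ^ k)"
  have zz: "z * cnj z = 1" using assms by (simp add: complex_norm_square[symmetric])
  have "cnj S * z ^ Suc N = (\<Sum>k\<le>N. cnj z ^ k * z ^ Suc N)" by (simp add: S_def sum_distrib_right)
  also have "\<dots> = (\<Sum>k\<le>N. z ^ (Suc N - k))"
  proof (rule sum.cong[OF refl])
    fix k assume "k \<in> {..N}"
    hence "z ^ Suc N = z ^ k * z ^ (Suc N - k)" by (simp flip: power_add power_Suc)
    hence "cnj z ^ k * z ^ Suc N = (z * cnj z) ^ k * z ^ (Suc N - k)" by (simp add: power_mult_distrib mult_ac)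
    thus "cnj z ^ k * z ^ Suc N = z ^ (Suc N - k)" by (simp add: zz)
  qed
  also have "\<dots> = (\<Sum>k=1..Suc N. z ^ k)"
    by (rule sum.reindex_bij_witness[of _ "\<lambda>k. Suc N - k" "\<lambda>k. Suc N - k"]) auto
  finally have cross: "cnj S * z ^ Suc N = (\<Sum>k=1..Suc N. z ^ k)" .
  have "norm (\<Sum>k\<le>Suc N. z ^ k) ^ 2 = norm (S + z ^ Suc N) ^ 2" by (simp add: S_def)
  also have "\<dots> = norm S ^ 2 + norm (z ^ Suc N) ^ 2 + 2 * Re (cnj S * z ^ Suc N)"
    unfolding cmod_power2 by (simp add: power2_eq_square algebra_simps del: power_Suc)
  also have "norm (z ^ Suc N) = 1" using assms by (simp add: norm_power del: power_Suc)
  also have "norm S ^ 2 = 2 * Re (fejer_kernel N z) + real (N + 1)" using Suc by (simp add: S_def)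
  finally show ?case unfolding cross fejer_kernel_Suc by simp
qed (simp add: fejer_kernel_def)

text \<open>This is where the bias comes from: the missing constant term of the nonnegative kernel
  leaves -N, up to a quantity that is large only near z = 1.\<close>

lemma Re_fejer_kernel_le:
  assumes "norm z = 1" "z \<noteq> 1" shows "2 * Re (fejer_kernel N z) \<le> 4 / norm (1 - z) ^ 2 - real N"
proof -
  have "norm (\<Sum>k\<le>N. z ^ k) ^ 2 \<le> (2 / norm (1 - z)) ^ 2"
    by (intro power_mono norm_geometric_le assms) auto
  thus ?thesis using Re_fejer_kernel[OF assms(1), of N] by (simp add: power_divide)
qed

section \<open>The race between the prime counting functions\<close>

context barrier_race
begin

definition race_sign :: "nat \<Rightarrow> real" where
  "race_sign m = of_bool [m = a] (mod q) - of_bool [m = b] (mod q)"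

definition race_diff :: "real \<Rightarrow> real" where
  "race_diff x = real (primes_pi x q a) - real (primes_pi x q b)"

text \<open>The three terms are the error of the explicit formula, the proper prime powers, and the
  variation of \<open>zsum\<close> over an interval of length 1.\<close>

definition error_bound :: "nat \<Rightarrow> real \<Rightarrow> real \<Rightarrow> real" where
  "error_bound J c0 x = (1 + real J ^ 10) * (ln (height J)) ^ 2 * x powr c0
      + (sqrt x + 1) * (log 2 x + 1) * ln x + real J ^ 10"

lemma abs_race_sign_le: "\<bar>race_sign m\<bar> \<le> 1"
  by (simp add: race_sign_def)

lemma primes_pi_eq:
  assumes "2 \<le> x"
  shows "real (primes_pi x q e) = (\<Sum>m=2..nat \<lfloor>x\<rfloor>. if prime m then of_bool [m = e] (mod q) else 0)"
proof -
  have "{p::nat. prime p \<and> real p \<le> x \<and> [p = e] (mod q)} = {m \<in> {2..nat \<lfloor>x\<rfloor>}. prime m \<and> [m = e] (mod q)}"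
    using assms by (auto simp: le_nat_iff le_floor_iff prime_ge_2_nat)
  hence "real (primes_pi x q e) = (\<Sum>m\<in>{m \<in> {2..nat \<lfloor>x\<rfloor>}. prime m \<and> [m = e] (mod q)}. 1)"
    by (simp add: primes_pi_def)
  also have "\<dots> = (\<Sum>m=2..nat \<lfloor>x\<rfloor>. if prime m \<and> [m = e] (mod q) then 1 else 0)"
    by (rule sum.inter_filter) simp
  also have "\<dots> = (\<Sum>m=2..nat \<lfloor>x\<rfloor>. if prime m then of_bool [m = e] (mod q) else 0)"
    by (rule sum.cong) auto
  finally show ?thesis .
qed

lemma race_diff_eq:
  assumes "2 \<le> x"
  shows "race_diff x = (\<Sum>m=2..nat \<lfloor>x\<rfloor>. if prime m then race_sign m else 0)"
  unfolding race_diff_def primes_pi_eq[OF assms] sum_subtractf[symmetric]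
  by (rule sum.cong) (auto simp: race_sign_def)

lemma theta_race_approx:
  assumes "2 \<le> x"
  shows "norm (psi_race (nat \<lfloor>x\<rfloor>)
           - of_real (\<Sum>m=2..nat \<lfloor>x\<rfloor>. (if prime m then race_sign m else 0) * ln (real m)))
         \<le> (sqrt x + 1) * (log 2 x + 1) * ln x"
proof -
  define N where "N = nat \<lfloor>x\<rfloor>"
  define S where "S = {m. m \<le> N \<and> primepow m \<and> \<not> prime m}"
  have sub: "S \<subseteq> {..N}" by (auto simp: S_def)
  have "psi_race N = of_real (\<Sum>m\<le>N. race_sign m * mangoldt m)"
    unfolding psi_race_def of_real_sum by (rule sum.cong) (auto simp: race_sign_def of_bool_def)
  also have "(\<Sum>m\<le>N. race_sign m * mangoldt m)
      = (\<Sum>m\<le>N. (if prime m then race_sign m else 0) * ln (real m))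
        + (\<Sum>m\<le>N. if m \<in> S then race_sign m * mangoldt m else 0)"
    unfolding sum.distrib[symmetric]
  proof (rule sum.cong[OF refl])
    fix m assume m: "m \<in> {..N}"
    have "\<not> primepow m \<Longrightarrow> mangoldt m = (0::real)" by (simp add: mangoldt_def)
    thus "race_sign m * mangoldt m = (if prime m then race_sign m else 0) * ln (real m)
        + (if m \<in> S then race_sign m * mangoldt m else 0)"
      using m by (cases "prime m"; cases "primepow m") (simp_all add: S_def)
  qed
  also have "(\<Sum>m\<le>N. (if prime m then race_sign m else 0) * ln (real m))
      = (\<Sum>m=2..N. (if prime m then race_sign m else 0) * ln (real m))"
    by (rule sum.mono_neutral_right) (auto dest: prime_ge_2_nat)
  also have "(\<Sum>m\<le>N. if m \<in> S then race_sign m * mangoldt m else 0) = (\<Sum>m\<in>S. race_sign m * mangoldt m)"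
    using sub by (subst sum.inter_filter[symmetric]) (auto intro!: sum.cong)
  finally have "psi_race N - of_real (\<Sum>m=2..N. (if prime m then race_sign m else 0) * ln (real m))
      = of_real (\<Sum>m\<in>S. race_sign m * mangoldt m)" by simp
  hence "norm (psi_race N - of_real (\<Sum>m=2..N. (if prime m then race_sign m else 0) * ln (real m)))
      = \<bar>\<Sum>m\<in>S. race_sign m * mangoldt m\<bar>" by (simp only: norm_of_real)
  also have "\<dots> \<le> (\<Sum>m\<in>S. mangoldt m)"
  proof (rule order_trans[OF sum_abs sum_mono])
    fix m
    have "\<bar>race_sign m\<bar> * mangoldt m \<le> 1 * mangoldt m"
      by (intro mult_right_mono abs_race_sign_le mangoldt_nonneg)
    thus "\<bar>race_sign m * mangoldt m\<bar> \<le> mangoldt m" by (simp add: abs_mult)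
  qed
  also have "\<dots> \<le> (sqrt x + 1) * (log 2 x + 1) * ln x"
    unfolding S_def N_def by (rule nonprime_primepow_sum[OF assms])
  finally show ?thesis by (simp add: N_def)
qed

text \<open>The derivative of u^\<rho> / \<rho> has modulus at most 1, so over a unit interval each
  zero contributes at most its multiplicity.\<close>

lemma zsum_diff_le:
  assumes "1 \<le> J" "1 \<le> v" "v \<le> u" "u \<le> v + 1"
  shows "norm (zsum J u - zsum J v) \<le> real J ^ 10"
proof -
  have "norm (zsum J u - zsum J v) \<le> (\<Sum>\<rho>\<in>Z J. real (B \<rho>) * 1)"
    unfolding zsum_def sum_subtractf[symmetric]
  proof (rule order_trans[OF norm_sum sum_mono])
    fix \<rho> assume \<rho>: "\<rho> \<in> Z J"
    note z = Z_D[OF \<rho>]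
    have "norm (of_real u powr \<rho> - of_real v powr \<rho>) \<le> norm \<rho> * v powr (Re \<rho> - 1) * (u - v)"
      using assms z sigma_range by (intro powr_diff_bound) auto
    also have "\<dots> \<le> norm \<rho> * 1 * 1"
    proof (intro mult_mono)
      have "v powr (Re \<rho> - 1) \<le> v powr 0" using assms z sigma_range by (intro powr_mono) auto
      thus "v powr (Re \<rho> - 1) \<le> 1" using assms by simp
    qed (use assms in auto)
    finally have "norm ((of_real u powr \<rho> - of_real v powr \<rho>) / \<rho>) \<le> 1"
      using z(6) by (simp add: norm_divide divide_le_eq)
    hence "real (B \<rho>) * norm ((of_real u powr \<rho> - of_real v powr \<rho>) / \<rho>) \<le> real (B \<rho>) * 1"
      by (intro mult_left_mono) auto
    moreover have "of_nat (B \<rho>) * (of_real u powr \<rho> / \<rho>) - of_nat (B \<rho>) * (of_real v powr \<rho> / \<rho>)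
        = of_nat (B \<rho>) * ((of_real u powr \<rho> - of_real v powr \<rho>) / \<rho>)"
      by (simp add: right_diff_distrib diff_divide_distrib)
    ultimately show "norm (of_nat (B \<rho>) * (of_real u powr \<rho> / \<rho>) - of_nat (B \<rho>) * (of_real v powr \<rho> / \<rho>))
        \<le> real (B \<rho>) * 1" by (simp only: norm_mult norm_of_nat)
  qed
  also have "\<dots> = real (\<Sum>\<rho>\<in>Z J. B \<rho>)" by simp
  also have "\<dots> \<le> real J ^ 10" by (rule sum_B_le[OF assms(1)])
  finally show ?thesis .
qed

text \<open>Integration gains a second factor 1/\<rho>, so a layer contributes its amplitude times
  j^6 / \<gamma> j, negligible against the layer itself. The constant is 18 * 32^2, from
  \<open>powr_ln_square_integral_bound\<close> and \<open>norm_pt_ge\<close>.\<close>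

lemma zsum_integral_bound:
  assumes J: "1 \<le> J" and x: "2 \<le> x"
  shows "norm (integral {2..x} (\<lambda>u. zsum J u / of_real (u * (ln u)\<^sup>2)))
           \<le> 18432 * (\<Sum>j=j0..J. real j ^ 6 * x powr (\<sigma> - d j) / \<gamma> j ^ 2)"
proof -
  define h where "h = (\<lambda>\<rho> u. of_real u powr \<rho> / of_real (u * (ln u)\<^sup>2) :: complex)"
  have hi: "h \<rho> integrable_on {2..x}" for \<rho>
    unfolding h_def by (intro integrable_continuous_real continuous_intros) auto
  have "integral {2..x} (\<lambda>u. zsum J u / of_real (u * (ln u)\<^sup>2))
      = integral {2..x} (\<lambda>u. \<Sum>\<rho>\<in>Z J. of_nat (B \<rho>) / \<rho> * h \<rho> u)"
    by (simp add: zsum_def h_def sum_divide_distrib mult_ac)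
  also have "\<dots> = (\<Sum>\<rho>\<in>Z J. of_nat (B \<rho>) / \<rho> * integral {2..x} (h \<rho>))"
    by (subst integral_sum[OF finite_Z integrable_on_mult_right[OF hi]]) (simp only: integral_mult_right)
  finally have eqI: "integral {2..x} (\<lambda>u. zsum J u / of_real (u * (ln u)\<^sup>2))
      = (\<Sum>\<rho>\<in>Z J. of_nat (B \<rho>) / \<rho> * integral {2..x} (h \<rho>))" .
  have le1: "norm (\<Sum>\<rho>\<in>Z J. of_nat (B \<rho>) / \<rho> * integral {2..x} (h \<rho>))
      \<le> (\<Sum>\<rho>\<in>Z J. real (B \<rho>) * (18 * x powr Re \<rho> / norm \<rho> ^ 2))"
  proof (rule order_trans[OF norm_sum sum_mono])
    fix \<rho> assume "\<rho> \<in> Z J"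
    note z = Z_D[OF this]
    have "norm (integral {2..x} (h \<rho>)) \<le> 18 * x powr Re \<rho> / norm \<rho>"
      unfolding h_def by (rule powr_ln_square_integral_bound) (use z x delta_range in auto)
    hence "norm (of_nat (B \<rho>) / \<rho> * integral {2..x} (h \<rho>)) \<le> real (B \<rho>) / norm \<rho> * (18 * x powr Re \<rho> / norm \<rho>)"
      unfolding norm_mult norm_divide norm_of_nat by (intro mult_left_mono) auto
    thus "norm (of_nat (B \<rho>) / \<rho> * integral {2..x} (h \<rho>)) \<le> real (B \<rho>) * (18 * x powr Re \<rho> / norm \<rho> ^ 2)"
      by (simp add: power2_eq_square)
  qed
  have "(\<Sum>\<rho>\<in>Z J. real (B \<rho>) * (18 * x powr Re \<rho> / norm \<rho> ^ 2))
      = (\<Sum>(j, k)\<in>idx J. real (k * (j ^ 3 + 1 - k)) * (18 * x powr Re (pt j k) / norm (pt j k) ^ 2))"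
    by (rule sum_Z[OF J])
  moreover have "(\<Sum>(j, k)\<in>idx J. real (k * (j ^ 3 + 1 - k)) * (18 * x powr Re (pt j k) / norm (pt j k) ^ 2))
      = (\<Sum>j=j0..J. \<Sum>k=1..j ^ 3. real (k * (j ^ 3 + 1 - k)) * (18 * x powr Re (pt j k) / norm (pt j k) ^ 2))"
    unfolding idx_def by (rule sum.Sigma[symmetric]) auto
  moreover have "(\<Sum>j=j0..J. \<Sum>k=1..j ^ 3. real (k * (j ^ 3 + 1 - k)) * (18 * x powr Re (pt j k) / norm (pt j k) ^ 2)) \<le> (\<Sum>j=j0..J. \<Sum>k=1..j ^ 3. 18432 * (real j ^ 3 * x powr (\<sigma> - d j) / \<gamma> j ^ 2))"
  proof (intro sum_mono)
    fix j k assume jk: "j \<in> {j0..J}" "k \<in> {1..j ^ 3}"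
    have j: "1 \<le> j" using jk j0 by simp
    have g: "0 < \<gamma> j" using gamma_ge[OF j] by simp
    define y where "y = x powr (\<sigma> - d j)"
    have k: "0 < real k" using jk by simp
    have "real (k * (j ^ 3 + 1 - k)) \<le> real k * real j ^ 3"
    proof -
      have "k * (j ^ 3 + 1 - k) \<le> k * j ^ 3" using jk by (intro mult_le_mono) auto
      hence "real (k * (j ^ 3 + 1 - k)) \<le> real (k * j ^ 3)" by (simp only: of_nat_le_iff)
      thus ?thesis by simp
    qed
    moreover have "18 * y / norm (pt j k) ^ 2 \<le> 18 * y / (real k * \<gamma> j / 32) ^ 2"
      using norm_pt_ge(1)[of j k] jk g k by (intro frac_le power_mono) (auto simp: y_def)
    ultimately have "real (k * (j ^ 3 + 1 - k)) * (18 * y / norm (pt j k) ^ 2)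
        \<le> (real k * real j ^ 3) * (18 * y / (real k * \<gamma> j / 32) ^ 2)"
      by (intro mult_mono) (auto simp: y_def)
    also have "\<dots> = 18432 * (real j ^ 3 * y / \<gamma> j ^ 2) / real k"
      using k g by (simp add: field_simps power2_eq_square)
    also have "\<dots> \<le> 18432 * (real j ^ 3 * y / \<gamma> j ^ 2) / 1"
      using jk by (intro divide_left_mono) (auto simp: y_def)
    finally show "real (k * (j ^ 3 + 1 - k)) * (18 * x powr Re (pt j k) / norm (pt j k) ^ 2)
        \<le> 18432 * (real j ^ 3 * x powr (\<sigma> - d j) / \<gamma> j ^ 2)" by (simp add: Re_pt y_def)
  qed
  moreover have "(\<Sum>j=j0..J. \<Sum>k=1..j ^ 3. 18432 * (real j ^ 3 * x powr (\<sigma> - d j) / \<gamma> j ^ 2))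
      = 18432 * (\<Sum>j=j0..J. real j ^ 6 * x powr (\<sigma> - d j) / \<gamma> j ^ 2)"
    unfolding sum_distrib_left by (rule sum.cong) (auto simp: eval_nat_numeral)
  ultimately show ?thesis unfolding eqI using le1 by linarith
qed

lemma log_ge_1: "2 \<le> x \<Longrightarrow> 1 \<le> log 2 x"
  by (simp add: le_log_iff)

lemma error_bound_mono:
  assumes "2 \<le> u" "u \<le> v" "0 \<le> c0" "1 \<le> J" shows "error_bound J c0 u \<le> error_bound J c0 v"
proof -
  have "(sqrt u + 1) * (log 2 u + 1) * ln u \<le> (sqrt v + 1) * (log 2 v + 1) * ln v"
    using assms log_ge_1[of u] log_ge_1[of v] by (intro mult_mono) (auto intro!: mult_nonneg_nonneg)
  moreover have "(1 + real J ^ 10) * (ln (height J)) ^ 2 * u powr c0 \<le> (1 + real J ^ 10) * (ln (height J)) ^ 2 * v powr c0"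
    using assms by (intro mult_left_mono powr_mono2) auto
  ultimately show ?thesis by (simp add: error_bound_def)
qed

text \<open>Partial summation removes the logarithmic weights: the boundary term gives
  \<open>zsum\<close> at x, and the remaining integral is small by
  \<open>zsum_integral_bound\<close>. Multiplying by the logarithm of the integer part, which
  appears in the boundary term, avoids a division.\<close>

lemma race_diff_formula:
  assumes c0: "\<sigma> - \<delta> < c0" "c0 < 1"
  obtains C where "0 < C" "\<And>J x. 1 \<le> J \<Longrightarrow> 2 \<le> x \<Longrightarrow> (x + 1) ^ 3 \<le> height J \<Longrightarrow>
     \<bar>real unit_count * race_diff x * ln (real (nat \<lfloor>x\<rfloor>)) + 2 * Re (cnj (chi a - chi b) * zsum J x)\<bar>
       \<le> C * (1 + ln x) * (error_bound J c0 x + (\<Sum>j=j0..J. real j ^ 6 * x powr (\<sigma> - d j) / \<gamma> j ^ 2))"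
proof (rule race_explicit_formula[OF c0])
  fix C0 :: real assume C0: "0 < C0" "\<And>J t. 1 \<le> J \<Longrightarrow> 2 \<le> t \<Longrightarrow> (t + 1) ^ 3 \<le> height J \<Longrightarrow>
     norm (of_nat unit_count * psi_race (nat \<lfloor>t\<rfloor>) + of_real (2 * Re (cnj (chi a - chi b) * zsum J t)))
       \<le> C0 * (1 + real J ^ 10) * (ln (height J)) ^ 2 * t powr c0"
  define u where "u = real unit_count"
  define c where "c = cnj (chi a - chi b)"
  define C where "C = 3 * (C0 + u + 2 * norm c) + 36864 * norm c"
  have u: "0 < u" using unit_count_pos by (simp add: u_def)
  have c0': "0 \<le> c0" using c0 delta_range by linarith
  show ?thesis
  proof (rule that[of C])
    show "0 < C" unfolding C_def
      by (rule add_pos_nonneg, rule mult_pos_pos, simp, rule add_pos_nonneg) (use C0(1) u in auto)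
    fix J :: nat and x :: real assume J: "1 \<le> J" and x: "2 \<le> x" "(x + 1) ^ 3 \<le> height J"
    define N where "N = nat \<lfloor>x\<rfloor>"
    have N: "2 \<le> N" "real N \<le> x" "x < real N + 1"
      using x(1) by (simp_all add: N_def le_nat_iff le_floor_iff)
    define p where "p = (\<lambda>m. if prime m then race_sign m else 0)"
    define A where "A = (\<lambda>m. \<Sum>i=2..m. p i * ln (real i))"
    define M where "M = (\<lambda>t. - 2 * Re (c * zsum J t))"
    \<comment> \<open>Besides the error at integers, the summand 2 |c| pays for comparing
      \<open>A m\<close> with \<open>M v\<close> throughout the unit interval that starts at
      m.\<close>
    define E where "E = (C0 + u + 2 * norm c) * error_bound J c0 x"
    have eb: "0 \<le> (1 + real J ^ 10) * (ln (height J)) ^ 2 * x powr c0"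
      "0 \<le> (sqrt x + 1) * (log 2 x + 1) * ln x"
      using x(1) log_ge_1[OF x(1)] by (auto intro!: mult_nonneg_nonneg)
    have close1: "\<bar>u * A (nat \<lfloor>t\<rfloor>) - M t\<bar> \<le> (C0 + u) * error_bound J c0 t - C0 * real J ^ 10 - u * real J ^ 10" if t: "2 \<le> t" "t \<le> x" for t
    proof -
      have "(t + 1) ^ 3 \<le> (x + 1) ^ 3" using t by (intro power_mono) auto
      hence t3: "(t + 1) ^ 3 \<le> height J" using x by linarith
      define D1 where "D1 = (1 + real J ^ 10) * (ln (height J)) ^ 2 * t powr c0"
      define D2 where "D2 = (sqrt t + 1) * (log 2 t + 1) * ln t"
      have D: "0 \<le> D1" "0 \<le> D2" using t log_ge_1[OF t(1)] by (auto simp: D1_def D2_def intro!: mult_nonneg_nonneg)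
      have "of_real (u * A (nat \<lfloor>t\<rfloor>) - M t) = (of_real u * psi_race (nat \<lfloor>t\<rfloor>) + of_real (2 * Re (c * zsum J t)))
          - of_real u * (psi_race (nat \<lfloor>t\<rfloor>) - of_real (A (nat \<lfloor>t\<rfloor>)))"
        by (simp add: M_def algebra_simps)
      hence "\<bar>u * A (nat \<lfloor>t\<rfloor>) - M t\<bar> = norm ((of_real u * psi_race (nat \<lfloor>t\<rfloor>) + of_real (2 * Re (c * zsum J t)))
          - of_real u * (psi_race (nat \<lfloor>t\<rfloor>) - of_real (A (nat \<lfloor>t\<rfloor>))))" by (metis norm_of_real)
      also have "\<dots> \<le> C0 * D1 + u * D2"
      proof (rule order_trans[OF norm_triangle_ineq4 add_mono])
        show "norm (of_real u * psi_race (nat \<lfloor>t\<rfloor>) + of_real (2 * Re (c * zsum J t))) \<le> C0 * D1"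
          using C0(2)[OF J t(1) t3] by (simp add: u_def c_def D1_def mult_ac)
        have "norm (psi_race (nat \<lfloor>t\<rfloor>) - of_real (A (nat \<lfloor>t\<rfloor>))) \<le> D2"
          unfolding A_def p_def D2_def by (rule theta_race_approx[OF t(1)])
        thus "norm (of_real u * (psi_race (nat \<lfloor>t\<rfloor>) - of_real (A (nat \<lfloor>t\<rfloor>)))) \<le> u * D2"
          unfolding norm_mult using u by (intro mult_mono) auto
      qed
      also have "\<dots> \<le> (C0 + u) * (D1 + D2)" using D C0(1) u by (simp add: algebra_simps)
      also have "\<dots> = (C0 + u) * error_bound J c0 t - C0 * real J ^ 10 - u * real J ^ 10"
        unfolding error_bound_def D1_def[symmetric] D2_def[symmetric] by (simp add: algebra_simps)
      finally show ?thesis .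
    qed
    have J10: "0 \<le> real J ^ 10" by simp
    have ebJ: "real J ^ 10 \<le> error_bound J c0 x" using eb by (simp add: error_bound_def)
    hence eb0: "0 \<le> error_bound J c0 x" using J10 by linarith
    have e1: "\<bar>u * A (nat \<lfloor>t\<rfloor>) - M t\<bar> \<le> (C0 + u) * error_bound J c0 x" if t: "2 \<le> t" "t \<le> x" for t
    proof -
      have "(C0 + u) * error_bound J c0 t \<le> (C0 + u) * error_bound J c0 x"
        using error_bound_mono[OF t c0' J] C0(1) u by (intro mult_left_mono) auto
      moreover have "0 \<le> C0 * real J ^ 10" "0 \<le> u * real J ^ 10" using C0(1) u by auto
      ultimately show ?thesis using close1[OF t] by linarith
    qed
    have cE: "(C0 + u) * error_bound J c0 x + 2 * (norm c * real J ^ 10) \<le> E"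
      unfolding E_def using mult_left_mono[OF ebJ, of "2 * norm c"] by (simp add: algebra_simps)
    have close: "\<bar>u * A m - M v\<bar> \<le> E" if m: "2 \<le> m" "m < N" "real m \<le> v" "v \<le> real m + 1" for m v
    proof -
      have "real m \<le> x" using m(2) N(2) by linarith
      hence "\<bar>u * A m - M (real m)\<bar> \<le> (C0 + u) * error_bound J c0 x"
        using e1[of "real m"] m(1) by simp
      moreover have "\<bar>M (real m) - M v\<bar> \<le> 2 * (norm c * real J ^ 10)"
      proof -
        have "M (real m) - M v = 2 * Re (c * (zsum J v - zsum J (real m)))" by (simp add: M_def algebra_simps)
        hence "\<bar>M (real m) - M v\<bar> \<le> 2 * norm (c * (zsum J v - zsum J (real m)))"
          using abs_Re_le_cmod[of "c * (zsum J v - zsum J (real m))"] by simp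
        also have "\<dots> \<le> 2 * (norm c * real J ^ 10)"
          unfolding norm_mult by (intro mult_left_mono zsum_diff_le[OF J]) (use m in auto)
        finally show ?thesis .
      qed
      ultimately show ?thesis using cE by linarith
    qed
    have E0: "0 \<le> E" unfolding E_def
      using eb0 C0(1) u by (intro mult_nonneg_nonneg) auto
    have contM: "continuous_on {2..} M"
      unfolding M_def zsum_def by (intro continuous_intros) (use Z_D(6) in force)+
    define Sb where "Sb = (\<Sum>m=2..<N. (u * A m) * (1 / ln (real m) - 1 / ln (real (Suc m))))"
    define I where "I = integral {2..real N} (\<lambda>t. M t / (t * (ln t)\<^sup>2))"
    define Q where "Q = (\<Sum>j=j0..J. real j ^ 6 * x powr (\<sigma> - d j) / \<gamma> j ^ 2)"
    have lnN: "0 < ln (real N)" "ln (real N) \<le> ln x" using N by auto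
    have ln2: "2/3 \<le> ln (2::real)" using ln2_ge_two_thirds by simp
    have "\<bar>Sb - I\<bar> \<le> E * (1 / ln 2 - 1 / ln (real N))"
      unfolding Sb_def I_def by (rule sum_integral_comparison[OF contM N(1) close])
    also have "\<dots> \<le> E * 2"
    proof (rule mult_left_mono[OF _ E0])
      have "1 / ln (2::real) \<le> 2" using ln2 by (simp add: divide_le_eq)
      moreover have "0 \<le> 1 / ln (real N)" using lnN by simp
      ultimately show "1 / ln 2 - 1 / ln (real N) \<le> 2" by linarith
    qed
    finally have SI: "\<bar>Sb - I\<bar> \<le> 2 * E" by simp
    have I: "\<bar>I\<bar> \<le> 36864 * norm c * Q"
    proof -
      have zi: "(\<lambda>t. zsum J t / of_real (t * (ln t)\<^sup>2)) integrable_on {2..real N}"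
        unfolding zsum_def by (intro integrable_continuous_real continuous_intros) (use Z_D(6) in force)+
      have "(\<lambda>t. M t / (t * (ln t)\<^sup>2)) = (\<lambda>t. Re (- 2 * c * (zsum J t / of_real (t * (ln t)\<^sup>2))))"
      proof
        fix t
        have "- 2 * c * (zsum J t / of_real (t * (ln t)\<^sup>2)) = (- 2 * (c * zsum J t)) / of_real (t * (ln t)\<^sup>2)" by simp
        thus "M t / (t * (ln t)\<^sup>2) = Re (- 2 * c * (zsum J t / of_real (t * (ln t)\<^sup>2)))"
          unfolding M_def by (simp only: Re_divide_of_real) simp
      qed
      hence "I = Re (integral {2..real N} (\<lambda>t. - 2 * c * (zsum J t / of_real (t * (ln t)\<^sup>2))))"
        unfolding I_def using integral_linear[OF integrable_on_mult_right[OF zi, of "- 2 * c"] bounded_linear_Re]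
        by (simp add: comp_def)
      also have "integral {2..real N} (\<lambda>t. - 2 * c * (zsum J t / of_real (t * (ln t)\<^sup>2)))
          = - 2 * c * integral {2..real N} (\<lambda>t. zsum J t / of_real (t * (ln t)\<^sup>2))" by (rule integral_mult_right)
      also have "\<bar>Re \<dots>\<bar> \<le> 2 * norm c * norm (integral {2..real N} (\<lambda>t. zsum J t / of_real (t * (ln t)\<^sup>2)))"
        using abs_Re_le_cmod by (rule order_trans) (simp add: norm_mult)
      also have "\<dots> \<le> 2 * norm c * (18432 * (\<Sum>j=j0..J. real j ^ 6 * real N powr (\<sigma> - d j) / \<gamma> j ^ 2))"
        using N by (intro mult_left_mono zsum_integral_bound[OF J]) auto
      also have "\<dots> \<le> 2 * norm c * (18432 * Q)"
        unfolding Q_def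
      proof (intro mult_left_mono sum_mono divide_right_mono powr_mono2)
        fix j assume "j \<in> {j0..J}"
        thus "0 \<le> \<sigma> - d j" using Re_pt_range(1)[of j 1] by (simp add: Re_pt)
      qed (use N in auto)
      finally show ?thesis by simp
    qed
    have Q0: "0 \<le> Q" unfolding Q_def by (intro sum_nonneg) auto
    have "race_diff x = A N / ln (real N) + (\<Sum>m=2..<N. A m * (1 / ln (real m) - 1 / ln (real (Suc m))))"
      unfolding race_diff_eq[OF x(1)] N_def[symmetric] A_def p_def by (rule abel_log_summation[OF N(1)])
    hence "u * race_diff x = u * A N / ln (real N) + Sb"
      by (simp add: Sb_def distrib_left sum_distrib_left mult_ac)
    hence "u * race_diff x * ln (real N) = u * A N + ln (real N) * Sb"
      using lnN by (simp add: field_simps)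
    hence "u * race_diff x * ln (real N) - M x = (u * A N - M x) + ln (real N) * ((Sb - I) + I)" by simp
    moreover have "\<bar>ln (real N) * ((Sb - I) + I)\<bar> \<le> ln x * (2 * E + 36864 * norm c * Q)"
      unfolding abs_mult using lnN SI I by (intro mult_mono) auto
    moreover have "\<bar>u * A N - M x\<bar> \<le> E"
    proof -
      have "0 \<le> norm c * real J ^ 10" by simp
      thus ?thesis using e1[OF x(1) order_refl] cE unfolding N_def by linarith
    qed
    ultimately have "\<bar>u * race_diff x * ln (real N) - M x\<bar> \<le> E + ln x * (2 * E + 36864 * norm c * Q)" by linarith
    also have "\<dots> \<le> (1 + ln x) * (3 * E + 36864 * norm c * Q)"
    proof -
      have "0 \<le> ln x" using x by simp
      hence "0 \<le> ln x * E" "0 \<le> norm c * Q" using E0 Q0 by auto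
      thus ?thesis using E0 by (simp add: algebra_simps)
    qed
    also have "\<dots> \<le> (1 + ln x) * (C * (error_bound J c0 x + Q))"
    proof (rule mult_left_mono)
      have "0 \<le> (C0 + u + 2 * norm c) * Q" "0 \<le> norm c * error_bound J c0 x"
        using C0(1) u Q0 eb0 by (auto intro!: mult_nonneg_nonneg)
      thus "3 * E + 36864 * norm c * Q \<le> C * (error_bound J c0 x + Q)"
        by (simp add: C_def E_def algebra_simps)
    qed (use x in simp)
    finally show "\<bar>real unit_count * race_diff x * ln (real (nat \<lfloor>x\<rfloor>)) + 2 * Re (cnj (chi a - chi b) * zsum J x)\<bar>
       \<le> C * (1 + ln x) * (error_bound J c0 x + (\<Sum>j=j0..J. real j ^ 6 * x powr (\<sigma> - d j) / \<gamma> j ^ 2))"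
      by (simp add: M_def u_def c_def N_def Q_def mult_ac)
  qed
qed

end

section \<open>Resonances and layers\<close>

text \<open>Up to pi/3 the cosine in the mean value theorem is at least 1/2; beyond that the sine
  itself is at least 1/2 while z stays below 2.\<close>

lemma abs_le_4_abs_sin:
  fixes z :: real assumes "\<bar>z\<bar> \<le> pi / 2" shows "\<bar>z\<bar> \<le> 4 * \<bar>sin z\<bar>"
proof -
  have pos: "z \<le> 4 * sin z" if z: "0 \<le> z" "z \<le> pi / 2" for z :: real
  proof (cases "z \<le> pi / 3")
    case True
    show ?thesis
    proof (cases "z = 0")
      case False
      have "\<exists>t>0. t < z \<and> sin z - sin 0 = (z - 0) * cos t"
        by (rule MVT2) (use z False in \<open>auto intro!: derivative_eq_intros\<close>)
      then obtain t where t: "0 < t" "t < z" "sin z = z * cos t" by auto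
      have "cos (pi / 3) \<le> cos t" using t True z by (intro cos_monotone_0_pi_le) auto
      hence "1/2 \<le> cos t" by (simp add: cos_60)
      hence "z * (1/2) \<le> z * cos t" using z by (intro mult_left_mono) auto
      thus ?thesis using t z by simp
    qed simp
  next
    case False
    have "sin (pi / 6) \<le> sin z" using False z by (intro sin_monotone_2pi_le) auto
    hence "1/2 \<le> sin z" by (simp add: sin_30)
    thus ?thesis using z pi_less_4 by linarith
  qed
  show ?thesis
  proof (cases "0 \<le> z")
    case True thus ?thesis using pos[of z] assms by linarith
  next
    case False thus ?thesis using pos[of "- z"] assms by (simp add: abs_if split: if_splits)
  qed
qed

lemma norm_1_minus_cis: "norm (1 - cis t) = 2 * \<bar>sin (t / 2)\<bar>"
  using dist_exp_i_1[of t] by (simp add: cis_conv_exp norm_minus_commute)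

lemma norm_cis_minus_1_le: "norm (cis t - 1) \<le> \<bar>t\<bar>"
  using norm_1_minus_cis[of t] abs_sin_x_le_abs_x[of "t / 2"] by (simp add: norm_minus_commute)

lemma near_multiple_2pi:
  obtains n :: int where "\<bar>t - 2 * pi * of_int n\<bar> \<le> 4 * norm (1 - cis t)" "\<bar>t / (2 * pi) - of_int n\<bar> \<le> 1 / 2"
proof -
  define n where "n = round (t / (2 * pi))"
  have n: "\<bar>t / (2 * pi) - of_int n\<bar> \<le> 1 / 2"
    unfolding n_def using of_int_round_abs_le[of "t / (2 * pi)"] by (simp add: abs_minus_commute)
  define z where "z = (t - 2 * pi * of_int n) / 2"
  have "z = pi * (t / (2 * pi) - of_int n)" by (simp add: z_def field_simps)
  hence "\<bar>z\<bar> = pi * \<bar>t / (2 * pi) - of_int n\<bar>" by (simp add: abs_mult)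
  hence "\<bar>z\<bar> \<le> pi / 2" using mult_left_mono[OF n, of pi] by simp
  hence "\<bar>z\<bar> \<le> 4 * \<bar>sin z\<bar>" by (rule abs_le_4_abs_sin)
  moreover have "norm (1 - cis t) = 2 * \<bar>sin z\<bar>"
  proof -
    have "2 * z + 2 * pi * of_int n = t" by (simp add: z_def field_simps)
    hence "cis t = cis (2 * z) * cis (2 * pi * of_int n)" by (simp only: cis_mult)
    also have "cis (2 * pi * of_int n) = 1"
      using cos_int_2pin[of n] sin_int_2pin[of n] by (simp add: complex_eq_iff)
    finally show ?thesis using norm_1_minus_cis[of "2 * z"] by simp
  qed
  ultimately have "\<bar>t - 2 * pi * of_int n\<bar> \<le> 4 * norm (1 - cis t)" by (simp add: z_def abs_divide)
  thus ?thesis using n that by blast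
qed

lemma resonance_lmeasurable:
  assumes "0 < X" shows "{x \<in> {X..2 * X}. norm (1 - cis (\<gamma> * ln x)) \<le> \<tau>} \<in> lmeasurable"
proof -
  have "continuous_on {X..2 * X} (\<lambda>x. norm (1 - cis (\<gamma> * ln x)))"
    using assms by (intro continuous_intros) auto
  hence "closed {x \<in> {X..2 * X}. norm (1 - cis (\<gamma> * ln x)) \<le> \<tau>}"
    by (intro continuous_on_closed_Collect_le) auto
  moreover have "bounded {x \<in> {X..2 * X}. norm (1 - cis (\<gamma> * ln x)) \<le> \<tau>}"
    by (rule bounded_subset[of "{X..2 * X}"]) auto
  ultimately show ?thesis by (intro lmeasurable_compact) (simp add: compact_eq_bounded_closed)
qed

text \<open>Near each multiple of 2 pi the resonant x lie in an interval of length O(\<tau> X /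
  \<gamma>), and O(\<gamma>) multiples occur as x runs through the window. The product does not
  depend on \<gamma>, so all layers can be treated alike.\<close>

lemma resonance_measure:
  assumes X: "0 < X" and g: "1 \<le> \<gamma>" and \<tau>: "0 \<le> \<tau>"
  shows "measure lebesgue {x \<in> {X..2 * X}. norm (1 - cis (\<gamma> * ln x)) \<le> \<tau>} \<le> 96 * \<tau> * X"
proof -
  define S where "S = {x \<in> {X..2 * X}. norm (1 - cis (\<gamma> * ln x)) \<le> \<tau>}"
  define I where "I = {\<lceil>\<gamma> * ln X / (2 * pi) - 1/2\<rceil>..\<lfloor>\<gamma> * ln (2 * X) / (2 * pi) + 1/2\<rfloor>}"
  define Sn where "Sn = (\<lambda>n::int. {x \<in> {X..2 * X}. \<bar>\<gamma> * ln x - 2 * pi * of_int n\<bar> \<le> 4 * \<tau>})"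
  define h where "h = 16 * X * \<tau> / \<gamma>"
  have h: "0 \<le> h" using X g \<tau> by (simp add: h_def)
  have "\<exists>y. Sn n \<subseteq> {y - h..y + h}" for n
  proof (cases "Sn n = {}")
    case False
    then obtain y where y: "y \<in> Sn n" by blast
    have "\<bar>x - y\<bar> \<le> h" if x: "x \<in> Sn n" for x
    proof -
      have aux: "v - u \<le> 2 * X * (ln v - ln u)" if "X \<le> u" "u \<le> v" "v \<le> 2 * X" for u v
      proof -
        have "ln (u / v) \<le> u / v - 1" using that X by (intro ln_le_minus_one) auto
        hence "(v - u) / v \<le> ln v - ln u" using that X by (simp add: ln_div diff_divide_distrib)
        moreover have "(v - u) / (2 * X) \<le> (v - u) / v" using that X by (intro divide_left_mono) auto
        ultimately have "(v - u) / (2 * X) \<le> ln v - ln u" by linarith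
        thus ?thesis using X by (simp add: divide_le_eq mult.commute)
      qed
      have "\<bar>\<gamma> * ln x - \<gamma> * ln y\<bar> \<le> 8 * \<tau>" using x y unfolding Sn_def by auto
      hence "\<gamma> * \<bar>ln x - ln y\<bar> \<le> 8 * \<tau>" using g by (simp add: abs_mult flip: right_diff_distrib)
      hence l: "\<bar>ln x - ln y\<bar> \<le> 8 * \<tau> / \<gamma>" using g by (simp add: le_divide_eq mult.commute)
      have "\<bar>x - y\<bar> \<le> 2 * X * \<bar>ln x - ln y\<bar>"
      proof (cases "y \<le> x")
        case True
        have "ln y \<le> ln x" using True x y X by (auto simp: Sn_def)
        thus ?thesis using aux[of y x] True x y by (auto simp: Sn_def)
      next
        case False
        have "ln x \<le> ln y" using False x y X by (auto simp: Sn_def)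
        thus ?thesis using aux[of x y] False x y by (auto simp: Sn_def)
      qed
      also have "\<dots> \<le> 2 * X * (8 * \<tau> / \<gamma>)" using l X by (intro mult_left_mono) auto
      finally show ?thesis by (simp add: h_def mult_ac)
    qed
    hence "Sn n \<subseteq> {y - h..y + h}" by (force simp: abs_le_iff)
    thus ?thesis by blast
  qed blast
  then obtain y where y: "\<And>n. Sn n \<subseteq> {y n - h..y n + h}" by metis
  have "S \<subseteq> (\<Union>n\<in>I. {y n - h..y n + h})"
  proof
    fix x assume x: "x \<in> S"
    obtain n :: int where n: "\<bar>\<gamma> * ln x - 2 * pi * of_int n\<bar> \<le> 4 * norm (1 - cis (\<gamma> * ln x))"
      "\<bar>\<gamma> * ln x / (2 * pi) - of_int n\<bar> \<le> 1 / 2" by (rule near_multiple_2pi)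
    have xX: "X \<le> x" "x \<le> 2 * X" "norm (1 - cis (\<gamma> * ln x)) \<le> \<tau>" using x by (auto simp: S_def)
    have "x \<in> Sn n" using n(1) xX by (auto simp: Sn_def)
    moreover have "n \<in> I"
    proof -
      have "ln X \<le> ln x" "ln x \<le> ln (2 * X)" using xX X by auto
      hence "\<gamma> * ln X / (2 * pi) \<le> \<gamma> * ln x / (2 * pi)" "\<gamma> * ln x / (2 * pi) \<le> \<gamma> * ln (2 * X) / (2 * pi)"
        using g by (intro divide_right_mono mult_left_mono; simp)+
      with n(2) have "\<gamma> * ln X / (2 * pi) - 1/2 \<le> of_int n" "of_int n \<le> \<gamma> * ln (2 * X) / (2 * pi) + 1/2"
        by linarith+
      thus ?thesis unfolding I_def by (simp only: atLeastAtMost_iff ceiling_le_iff le_floor_iff simp_thms)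
    qed
    ultimately show "x \<in> (\<Union>n\<in>I. {y n - h..y n + h})" using y[of n] by blast
  qed
  hence "measure lebesgue S \<le> measure lebesgue (\<Union>n\<in>I. {y n - h..y n + h})"
    using resonance_lmeasurable[OF X, of \<gamma> \<tau>] unfolding S_def
    by (intro measure_mono_fmeasurable) (auto simp: I_def intro!: fmeasurable.finite_UN)
  also have "\<dots> \<le> (\<Sum>n\<in>I. measure lebesgue {y n - h..y n + h})"
    by (rule measure_UNION_le) (auto simp: I_def)
  also have "\<dots> = real (card I) * (2 * h)" using h by simp
  also have "\<dots> \<le> (\<gamma> + 2) * (2 * h)"
  proof (rule mult_right_mono)
    define u v where "u = \<gamma> * ln X / (2 * pi) - 1/2" and "v = \<gamma> * ln (2 * X) / (2 * pi) + 1/2"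
    have "v - u = \<gamma> * (ln 2 / (2 * pi)) + 1" using X by (simp add: u_def v_def ln_mult field_simps)
    moreover have "\<gamma> * (ln 2 / (2 * pi)) \<le> \<gamma> * 1"
    proof (rule mult_left_mono)
      have "ln (2::real) \<le> 1" using ln_le_minus_one[of 2] by simp
      thus "ln 2 / (2 * pi) \<le> 1" using pi_gt3 by (simp add: divide_le_eq)
    qed (use g in simp)
    ultimately have vu: "v - u \<le> \<gamma> + 1" by simp
    have "real (card I) = real (nat (\<lfloor>v\<rfloor> - \<lceil>u\<rceil> + 1))" by (simp add: I_def u_def v_def)
    also have "\<dots> \<le> \<gamma> + 2" using vu g by linarith
    finally show "real (card I) \<le> \<gamma> + 2" .
  qed (use h in simp)
  also have "\<dots> \<le> (3 * \<gamma>) * (2 * h)" using g h by (intro mult_right_mono) auto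
  also have "\<dots> = 96 * \<tau> * X" using g by (simp add: h_def)
  finally show ?thesis unfolding S_def .
qed

text \<open>A single dyadic scale next to D already gives 1/D. The sum turns 1/D into indicators of
  resonance sets, whose measures are known.\<close>

lemma inverse_le_dyadic_sum:
  fixes D :: real
  assumes "D \<le> 2" "2 / 2 ^ I < D"
  shows "1 / D \<le> (\<Sum>i\<le>I. 2 ^ i * of_bool (D \<le> 2 / 2 ^ i))"
  using assms(2)
proof (induction I)
  case 0
  thus ?case using assms(1) by simp
next
  case (Suc I)
  have D: "0 < D" using Suc.prems by (meson less_trans divide_pos_pos zero_less_numeral zero_less_power)
  show ?case
  proof (cases "2 / 2 ^ I < D")
    case True
    have "1 / D \<le> (\<Sum>i\<le>I. 2 ^ i * of_bool (D \<le> 2 / 2 ^ i))" using Suc.IH True by blast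
    also have "\<dots> \<le> (\<Sum>i\<le>Suc I. 2 ^ i * of_bool (D \<le> 2 / 2 ^ i))" by (rule sum_mono2) auto
    finally show ?thesis .
  next
    case False
    have "1 / D \<le> 2 ^ I" using Suc.prems D by (simp add: field_simps)
    also have "\<dots> = (\<Sum>i\<in>{I}. 2 ^ i * of_bool (D \<le> 2 / 2 ^ i))" using False by simp
    also have "\<dots> \<le> (\<Sum>i\<le>Suc I. 2 ^ i * of_bool (D \<le> 2 / 2 ^ i))"
      by (rule sum_mono2) auto
    finally show ?thesis .
  qed
qed

text \<open>
  Outside a small set no phase \<open>\<gamma> j * ln x\<close> is extremely close to a multiple of
  \<open>2 * pi\<close>, and the phases are not too close on average; the second part is Markov's inequality.
\<close>
lemma exceptional_set:
  fixes F :: "nat set" and \<gamma> v :: "nat \<Rightarrow> real" and X t :: real and I :: nat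
  assumes F: "finite F" and g: "\<And>j. j \<in> F \<Longrightarrow> 1 \<le> \<gamma> j" and v: "\<And>j. j \<in> F \<Longrightarrow> 0 \<le> v j"
    and X: "0 < X" and t: "0 < t"
  obtains E where "E \<in> lmeasurable"
    "measure lebesgue E \<le> 192 * X * (real (card F) / 2 ^ I + real (I + 1) * (\<Sum>j\<in>F. v j) / t)"
    "\<And>x j. x \<in> {X..2 * X} \<Longrightarrow> x \<notin> E \<Longrightarrow> j \<in> F \<Longrightarrow> 2 / 2 ^ I < norm (1 - cis (\<gamma> j * ln x))"
    "\<And>x. x \<in> {X..2 * X} \<Longrightarrow> x \<notin> E \<Longrightarrow> (\<Sum>j\<in>F. v j / norm (1 - cis (\<gamma> j * ln x))) < t"
proof -
  define S where "S = (\<lambda>j i. {x \<in> {X..2 * X}. norm (1 - cis (\<gamma> j * ln x)) \<le> 2 / 2 ^ i})"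
  have Sm: "S j i \<in> lmeasurable" for j i unfolding S_def by (rule resonance_lmeasurable[OF X])
  have Sb: "measure lebesgue (S j i) \<le> 192 * X / 2 ^ i" if "j \<in> F" for j i
  proof -
    have "(0::real) \<le> 2 / 2 ^ i" by simp
    from resonance_measure[OF X g[OF that] this]
    have "measure lebesgue (S j i) \<le> 96 * (2 / 2 ^ i) * X" unfolding S_def .
    also have "\<dots> = 192 * X / 2 ^ i" by simp
    finally show ?thesis .
  qed
  \<comment> \<open>At scale i the weight 2^i cancels the measure bound 192 X / 2^i, so every scale
    costs the same. The I + 1 scales replace the logarithmic divergence of the mean of 1/D.\<close>
  define Y where "Y = (\<lambda>x. \<Sum>j\<in>F. \<Sum>i\<le>I. v j * 2 ^ i * indicat_real (S j i) x)"
  have ii: "integrable lebesgue (indicat_real (S j i))" for j i using Sm by (simp add: lmeasurable_iff_integrable)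
  have Yi: "integrable lebesgue Y" unfolding Y_def
    by (intro Bochner_Integration.integrable_sum integrable_mult_right ii)
  have Yn: "0 \<le> Y x" for x unfolding Y_def by (intro sum_nonneg mult_nonneg_nonneg v) auto
  have "integral\<^sup>L lebesgue Y
      = (\<Sum>j\<in>F. integral\<^sup>L lebesgue (\<lambda>x. \<Sum>i\<le>I. v j * 2 ^ i * indicat_real (S j i) x))"
    unfolding Y_def
    by (intro Bochner_Integration.integral_sum Bochner_Integration.integrable_sum integrable_mult_right ii)
  also have "\<dots> = (\<Sum>j\<in>F. \<Sum>i\<le>I. integral\<^sup>L lebesgue (\<lambda>x. v j * 2 ^ i * indicat_real (S j i) x))"
    by (intro sum.cong refl Bochner_Integration.integral_sum integrable_mult_right ii)
  also have "\<dots> = (\<Sum>j\<in>F. \<Sum>i\<le>I. v j * 2 ^ i * measure lebesgue (S j i))"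
    by (simp only: integral_mult_right_zero Bochner_Integration.integral_indicator space_completion space_lborel space_borel Int_UNIV_right)
  also have "\<dots> \<le> (\<Sum>j\<in>F. \<Sum>i\<le>I. v j * 2 ^ i * (192 * X / 2 ^ i))"
    by (intro sum_mono mult_left_mono Sb mult_nonneg_nonneg v) auto
  also have "\<dots> = 192 * X * (real (I + 1) * (\<Sum>j\<in>F. v j))"
    by (simp add: sum_distrib_left sum_distrib_right mult_ac)
  finally have Yint: "integral\<^sup>L lebesgue Y \<le> 192 * X * (real (I + 1) * (\<Sum>j\<in>F. v j))" .
  define E1 where "E1 = (\<Union>j\<in>F. S j I)"
  define E2 where "E2 = {x \<in> space lebesgue. t \<le> Y x}"
  have E1: "E1 \<in> lmeasurable" unfolding E1_def using F Sm by (intro fmeasurable.finite_UN) auto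
  have "E2 \<in> sets lebesgue" unfolding E2_def using Yi by measurable
  moreover have "E2 \<subseteq> {X..2 * X}"
  proof
    fix x assume x: "x \<in> E2"
    show "x \<in> {X..2 * X}"
    proof (rule ccontr)
      assume "x \<notin> {X..2 * X}"
      hence "indicat_real (S j i) x = 0" for j i unfolding S_def by (auto simp: indicator_def)
      hence "Y x = 0" unfolding Y_def by (simp only: mult_zero_right sum.neutral_const)
      thus False using x t by (simp add: E2_def)
    qed
  qed
  ultimately have E2: "E2 \<in> lmeasurable" by (rule bounded_set_imp_lmeasurable[rotated, OF _ bounded_subset[OF bounded_closed_interval]])
  have m1: "measure lebesgue E1 \<le> real (card F) * (192 * X / 2 ^ I)"
  proof -
    have "measure lebesgue E1 \<le> (\<Sum>j\<in>F. measure lebesgue (S j I))"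
      unfolding E1_def using F Sm by (intro measure_UNION_le) auto
    also have "\<dots> \<le> (\<Sum>j\<in>F. 192 * X / 2 ^ I)" by (intro sum_mono Sb)
    finally show ?thesis by simp
  qed
  have "measure lebesgue E2 \<le> integral\<^sup>L lebesgue Y / t"
    unfolding E2_def by (rule integral_Markov_inequality_measure[OF Yi sets.top _ t]) (auto simp: Yn)
  also have "\<dots> \<le> 192 * X * (real (I + 1) * (\<Sum>j\<in>F. v j)) / t"
    using Yint t by (intro divide_right_mono) auto
  finally have m2: "measure lebesgue E2 \<le> 192 * X * (real (I + 1) * (\<Sum>j\<in>F. v j)) / t" .
  show ?thesis
  proof (rule that[of "E1 \<union> E2"])
    show "E1 \<union> E2 \<in> lmeasurable" using E1 E2 by (rule fmeasurable.Un)
    have "measure lebesgue (E1 \<union> E2) \<le> measure lebesgue E1 + measure lebesgue E2"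
      using E1 E2 by (intro measure_Un_le) auto
    also have "\<dots> \<le> real (card F) * (192 * X / 2 ^ I) + 192 * X * (real (I + 1) * (\<Sum>j\<in>F. v j)) / t"
      using m1 m2 by (rule add_mono)
    also have "\<dots> = 192 * X * (real (card F) / 2 ^ I + real (I + 1) * (\<Sum>j\<in>F. v j) / t)"
      by (simp add: distrib_left)
    finally show "measure lebesgue (E1 \<union> E2) \<le> 192 * X * (real (card F) / 2 ^ I + real (I + 1) * (\<Sum>j\<in>F. v j) / t)" .
  next
    fix x assume x: "x \<in> {X..2 * X}" "x \<notin> E1 \<union> E2"
    have D: "2 / 2 ^ I < norm (1 - cis (\<gamma> j * ln x))" if "j \<in> F" for j
      using x that by (auto simp: E1_def S_def not_le)
    show "2 / 2 ^ I < norm (1 - cis (\<gamma> j * ln x))" if "j \<in> F" for j using D[OF that] .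
    have "(\<Sum>j\<in>F. v j / norm (1 - cis (\<gamma> j * ln x))) \<le> Y x"
      unfolding Y_def
    proof (rule sum_mono)
      fix j assume j: "j \<in> F"
      define Dj where "Dj = norm (1 - cis (\<gamma> j * ln x))"
      have "Dj \<le> 2" unfolding Dj_def using norm_triangle_ineq4[of 1 "cis (\<gamma> j * ln x)"] by simp
      hence "1 / Dj \<le> (\<Sum>i\<le>I. 2 ^ i * of_bool (Dj \<le> 2 / 2 ^ i))"
        using D[OF j] by (intro inverse_le_dyadic_sum) (auto simp: Dj_def)
      hence "v j * (1 / Dj) \<le> v j * (\<Sum>i\<le>I. 2 ^ i * of_bool (Dj \<le> 2 / 2 ^ i))"
        using v[OF j] by (rule mult_left_mono)
      also have "\<dots> = (\<Sum>i\<le>I. v j * 2 ^ i * indicat_real (S j i) x)"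
        unfolding sum_distrib_left using x by (intro sum.cong) (auto simp: S_def Dj_def indicator_def)
      finally show "v j / norm (1 - cis (\<gamma> j * ln x)) \<le> (\<Sum>i\<le>I. v j * 2 ^ i * indicat_real (S j i) x)"
        by (simp add: Dj_def)
    qed
    also have "Y x < t" using x by (auto simp: E2_def not_le)
    finally show "(\<Sum>j\<in>F. v j / norm (1 - cis (\<gamma> j * ln x))) < t" .
  qed
qed

section \<open>The contribution of a single layer\<close>

context barrier_race
begin

definition layer :: "nat \<Rightarrow> real \<Rightarrow> complex" where
  "layer j x = (\<Sum>k=1..j ^ 3. of_nat (k * (j ^ 3 + 1 - k)) * (of_real x powr pt j k / pt j k))"

lemma zsum_layers: assumes "1 \<le> J" shows "zsum J x = (\<Sum>j=j0..J. layer j x)"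
proof -
  have "zsum J x = (\<Sum>(j, k)\<in>idx J. of_nat (k * (j ^ 3 + 1 - k)) * (of_real x powr pt j k / pt j k))"
    unfolding zsum_def by (rule sum_Z[OF assms])
  moreover have "\<dots> = (\<Sum>j=j0..J. \<Sum>k=1..j ^ 3. of_nat (k * (j ^ 3 + 1 - k)) * (of_real x powr pt j k / pt j k))"
    unfolding idx_def by (rule sum.Sigma[symmetric]) auto
  ultimately show ?thesis by (simp add: layer_def)
qed

abbreviation r :: real where "r \<equiv> norm (chi a - chi b)"

definition amp :: "nat \<Rightarrow> real \<Rightarrow> real" where "amp j x = x powr (\<sigma> - d j) / \<gamma> j"

text \<open>The tuned value of \<open>\<theta> j\<close> is (\<xi> - pi/2) / j^16, so the phase
  nearly vanishes when ln x is close to j^16.\<close>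

definition phase :: "nat \<Rightarrow> real \<Rightarrow> real" where "phase j x = \<theta> j * ln x - (\<xi> - pi / 2)"

lemma r_pos: "0 < r" using chi by simp

text \<open>With 1/\<rho> replaced by 1 / (i k \<gamma>) the factor k of the multiplicity cancels,
  and j^3 + 1 - k remains as Fejer coefficient. Each of the j^3 replacements costs at most 256 j^3 /
  \<gamma>^2 times the power of x, which doubles to the 512 in the bound.\<close>

lemma layer_main_term:
  assumes j: "j0 \<le> j" and x: "1 \<le> x"
  shows "\<bar>- 2 * Re (cnj (chi a - chi b) * layer j x)
           - 2 * r * amp j x * Re (cis (phase j x) * fejer_kernel (j ^ 3) (cis (\<gamma> j * ln x)))\<bar>
         \<le> r * amp j x * (512 * real j ^ 6 / \<gamma> j)"
proof -
  define u where "u = ln x"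
  define \<beta> where "\<beta> = \<sigma> - d j"
  define y where "y = x powr \<beta>"
  define c where "c = cnj (chi a - chi b)"
  define m where "m = (\<lambda>k. k * (j ^ 3 + 1 - k))"
  define g where "g = (\<lambda>k. real k * \<gamma> j)"
  have j1: "1 \<le> j" using j j0 by simp
  have g0: "0 < \<gamma> j" using gamma_ge[OF j1] by simp
  have y0: "0 < y" using x by (simp add: y_def)
  have c: "c = of_real r * cis (- \<xi>)"
  proof -
    have "chi a - chi b = of_real r * cis \<xi>" unfolding cis_conv_exp xi by (rule Arg2pi_eq)
    from arg_cong[OF this, of cnj] show ?thesis
      by (simp only: c_def complex_cnj_mult complex_cnj_complex_of_real cis_cnj)
  qed
  have pw: "of_real x powr pt j k = of_real y * cis ((g k + \<theta> j) * u)" for k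
  proof -
    have "of_real x powr pt j k = exp (pt j k * of_real u)" using x by (simp add: powr_def Ln_of_real u_def mult.commute)
    also have "pt j k * of_real u = of_real (\<beta> * u) + \<i> * of_real ((g k + \<theta> j) * u)"
      by (simp add: complex_eq_iff Re_pt Im_pt \<beta>_def g_def)
    also have "exp \<dots> = of_real (exp (\<beta> * u)) * cis ((g k + \<theta> j) * u)"
      by (simp only: exp_add exp_of_real cis_conv_exp)
    also have "exp (\<beta> * u) = y" using x by (simp add: y_def powr_def u_def)
    finally show ?thesis .
  qed
  define M1 where "M1 = (\<Sum>k=1..j ^ 3. of_nat (m k) * (of_real x powr pt j k * (1 / (\<i> * of_real (g k)))))"
  define M2 where "M2 = (\<Sum>k=1..j ^ 3. of_nat (m k) * (of_real x powr pt j k * (1 / pt j k - 1 / (\<i> * of_real (g k)))))"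
  have split: "layer j x = M1 + M2"
    unfolding layer_def M1_def M2_def sum.distrib[symmetric] by (rule sum.cong) (auto simp: m_def algebra_simps)
  have "M1 = (\<Sum>k=1..j ^ 3. (of_real (y / \<gamma> j) * cis (\<theta> j * u - pi / 2)) * (of_nat (j ^ 3 + 1 - k) * cis (\<gamma> j * u) ^ k))"
    unfolding M1_def
  proof (rule sum.cong[OF refl])
    fix k assume k: "k \<in> {1..j ^ 3}"
    have "cis ((g k + \<theta> j) * u) = cis (\<theta> j * u) * cis (\<gamma> j * u) ^ k"
      by (simp add: Complex.DeMoivre cis_mult g_def algebra_simps)
    moreover have "cis (\<theta> j * u - pi / 2) = cis (\<theta> j * u) * (- \<i>)"
      by (simp add: complex_eq_iff cos_diff sin_diff)
    moreover have "1 / (\<i> * of_real (g k)) = - \<i> / of_real (g k)" by (simp add: divide_inverse inverse_mult_distrib)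
    moreover have "of_nat (m k) = (of_nat k * of_nat (j ^ 3 + 1 - k) :: complex)" by (simp only: m_def of_nat_mult)
    ultimately have "of_nat (m k) * (of_real x powr pt j k * (1 / (\<i> * of_real (g k))))
        = (of_nat k / of_real (g k)) * of_real y * (cis (\<theta> j * u) * (- \<i>)) * (of_nat (j ^ 3 + 1 - k) * cis (\<gamma> j * u) ^ k)"
      by (simp only: pw) (simp add: mult_ac)
    also have "of_nat k / of_real (g k) = (1 / of_real (\<gamma> j) :: complex)" using k g0 by (simp add: g_def)
    finally show "of_nat (m k) * (of_real x powr pt j k * (1 / (\<i> * of_real (g k))))
        = (of_real (y / \<gamma> j) * cis (\<theta> j * u - pi / 2)) * (of_nat (j ^ 3 + 1 - k) * cis (\<gamma> j * u) ^ k)"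
      unfolding \<open>cis (\<theta> j * u - pi / 2) = _\<close> by (simp add: mult_ac)
  qed
  also have "\<dots> = of_real (y / \<gamma> j) * cis (\<theta> j * u - pi / 2) * fejer_kernel (j ^ 3) (cis (\<gamma> j * u))"
    unfolding fejer_kernel_def sum_distrib_left ..
  finally have "c * M1 = of_real (r * (y / \<gamma> j)) * (cis (- \<xi>) * cis (\<theta> j * u - pi / 2)) * fejer_kernel (j ^ 3) (cis (\<gamma> j * u))"
    unfolding c by (simp add: mult_ac)
  \<comment> \<open>The extra half turn is the reason for aiming \<theta> at \<xi> - pi/2: its minus
    sign cancels that of the explicit formula, so the kernel enters the race with a positive
    coefficient and its negative real part favours b.\<close>
  also have "cis (- \<xi>) * cis (\<theta> j * u - pi / 2) = cis (phase j x - pi)"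
    by (simp add: cis_mult phase_def u_def algebra_simps)
  also have "cis (phase j x - pi) = - cis (phase j x)" by (simp add: complex_eq_iff)
  finally have "c * M1 = of_real (- (r * (y / \<gamma> j))) * (cis (phase j x) * fejer_kernel (j ^ 3) (cis (\<gamma> j * u)))"
    by simp
  moreover have "Re (of_real v * z) = v * Re z" for v z by simp
  ultimately have "Re (c * M1) = - (r * (y / \<gamma> j)) * Re (cis (phase j x) * fejer_kernel (j ^ 3) (cis (\<gamma> j * u)))"
    by (simp only:)
  hence main: "- 2 * Re (c * M1) = 2 * r * amp j x * Re (cis (phase j x) * fejer_kernel (j ^ 3) (cis (\<gamma> j * u)))"
    by (simp add: amp_def y_def \<beta>_def)
  have "norm M2 \<le> (\<Sum>k=1..j ^ 3. real j ^ 3 * (y * (256 / \<gamma> j ^ 2)))"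
    unfolding M2_def
  proof (rule order_trans[OF norm_sum sum_mono])
    fix k assume k: "k \<in> {1..j ^ 3}"
    have k1: "1 \<le> real k" using k by simp
    have "norm (of_nat (m k) * (of_real x powr pt j k * (1 / pt j k - 1 / (\<i> * of_real (g k)))))
        \<le> real (m k) * (y * (256 / g k ^ 2))"
      unfolding norm_mult norm_of_nat using norm_inverse_pt[OF j, of k] k y0
      by (intro mult_left_mono mult_mono) (auto simp: pw norm_mult g_def)
    also have "\<dots> = (real (m k) / real k ^ 2) * (y * (256 / \<gamma> j ^ 2))" by (simp add: g_def power_mult_distrib)
    also have "\<dots> \<le> real j ^ 3 * (y * (256 / \<gamma> j ^ 2))"
    proof (rule mult_right_mono)
      have "m k \<le> k * j ^ 3" using k by (auto simp: m_def)
      hence "real (m k) \<le> real (k * j ^ 3)" by (simp only: of_nat_le_iff)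
      hence "real (m k) / real k ^ 2 \<le> real j ^ 3 / real k" using k1 by (simp add: divide_le_eq power2_eq_square mult.commute)
      also have "\<dots> \<le> real j ^ 3 / 1" using k1 by (intro divide_left_mono) auto
      finally show "real (m k) / real k ^ 2 \<le> real j ^ 3" by simp
    qed (use y0 in simp)
    finally show "norm (of_nat (m k) * (of_real x powr pt j k * (1 / pt j k - 1 / (\<i> * of_real (g k)))))
        \<le> real j ^ 3 * (y * (256 / \<gamma> j ^ 2))" .
  qed
  also have "\<dots> = amp j x * (256 * real j ^ 6 / \<gamma> j)"
    using g0 by (simp add: amp_def y_def \<beta>_def eval_nat_numeral)
  finally have "norm (c * M2) \<le> r * (amp j x * (256 * real j ^ 6 / \<gamma> j))"
    unfolding norm_mult c_def complex_mod_cnj by (rule mult_left_mono) simp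
  hence b: "\<bar>Re (c * M2)\<bar> \<le> r * (amp j x * (256 * real j ^ 6 / \<gamma> j))"
    using abs_Re_le_cmod order_trans by blast
  have "- 2 * Re (c * layer j x) - (- 2 * Re (c * M1)) = - 2 * Re (c * M2)"
    unfolding split by (simp add: algebra_simps)
  hence "- 2 * Re (c * layer j x) - 2 * r * amp j x * Re (cis (phase j x) * fejer_kernel (j ^ 3) (cis (\<gamma> j * u)))
      = - 2 * Re (c * M2)" (is "?l = _") unfolding main .
  hence "\<bar>?l\<bar> = 2 * \<bar>Re (c * M2)\<bar>" by (simp only: abs_mult abs_minus abs_numeral)
  also have "\<dots> \<le> 2 * (r * (amp j x * (256 * real j ^ 6 / \<gamma> j)))" using b by simp
  also have "\<dots> = r * amp j x * (512 * real j ^ 6 / \<gamma> j)" by simp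
  finally show ?thesis unfolding c_def[symmetric] u_def[symmetric] .
qed

lemma amp_nonneg: "j0 \<le> j \<Longrightarrow> 0 \<le> amp j x"
  using gamma_ge[of j] j0 by (simp add: amp_def)

lemma layer_trivial_bound:
  assumes j: "j0 \<le> j" and x: "1 \<le> x"
  shows "- 2 * Re (cnj (chi a - chi b) * layer j x) \<le> r * amp j x * (514 * real j ^ 6)"
proof -
  define K where "K = fejer_kernel (j ^ 3) (cis (\<gamma> j * ln x))"
  have j1: "1 \<le> j" using j j0 by simp
  have "Re (cis (phase j x) * K) \<le> norm (cis (phase j x) * K)" by (rule complex_Re_le_cmod)
  also have "\<dots> \<le> real (j ^ 3) ^ 2"
    unfolding norm_mult K_def using fejer_kernel_trivial_bound[of "cis (\<gamma> j * ln x)" "j ^ 3"] by simp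
  also have "\<dots> = real j ^ 6" by (simp flip: power_mult)
  finally have "2 * r * amp j x * Re (cis (phase j x) * K) \<le> 2 * r * amp j x * real j ^ 6"
    using amp_nonneg[OF j] by (intro mult_left_mono) auto
  moreover have "r * amp j x * (512 * real j ^ 6 / \<gamma> j) \<le> r * amp j x * (512 * real j ^ 6 / 1)"
    using amp_nonneg[OF j] gamma_ge[OF j1] by (intro mult_left_mono divide_left_mono) auto
  ultimately show ?thesis using layer_main_term[OF j x] unfolding K_def[symmetric]
    by (simp add: algebra_simps abs_le_iff)
qed

text \<open>The phase factor is split as 1 plus an error of size at most |phase|. The part with 1
  has the negative real part of the kernel, the error is paired with the linear bound 2 N /
  D.\<close>

lemma layer_upper_bound:
  assumes j: "j0 \<le> j" and x: "1 \<le> x" and D: "D = norm (1 - cis (\<gamma> j * ln x))" "0 < D"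
  shows "- 2 * Re (cnj (chi a - chi b) * layer j x)
     \<le> r * amp j x * (4 / D ^ 2 - real j ^ 3 + 4 * \<bar>phase j x\<bar> * real j ^ 3 / D + 512 * real j ^ 6 / \<gamma> j)"
proof -
  define z where "z = cis (\<gamma> j * ln x)"
  define K where "K = fejer_kernel (j ^ 3) z"
  have z: "norm z = 1" "z \<noteq> 1" using D by (auto simp: z_def)
  have "2 * Re (cis (phase j x) * K) = 2 * Re K + 2 * Re ((cis (phase j x) - 1) * K)"
    by (simp add: algebra_simps)
  also have "2 * Re K \<le> 4 / D ^ 2 - real (j ^ 3)"
    unfolding K_def D(1) z_def[symmetric] by (rule Re_fejer_kernel_le[OF z])
  also have "Re ((cis (phase j x) - 1) * K) \<le> norm ((cis (phase j x) - 1) * K)" by (rule complex_Re_le_cmod)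
  also have "\<dots> \<le> \<bar>phase j x\<bar> * (2 * real (j ^ 3) / D)"
    unfolding norm_mult K_def D(1) z_def[symmetric]
    by (intro mult_mono norm_cis_minus_1_le norm_fejer_kernel_le z) auto
  finally have "2 * Re (cis (phase j x) * K) \<le> 4 / D ^ 2 - real j ^ 3 + 4 * \<bar>phase j x\<bar> * real j ^ 3 / D"
    by (simp add: algebra_simps)
  hence "r * amp j x * (2 * Re (cis (phase j x) * K)) \<le> r * amp j x * (4 / D ^ 2 - real j ^ 3 + 4 * \<bar>phase j x\<bar> * real j ^ 3 / D)"
    using amp_nonneg[OF j] by (intro mult_left_mono) auto
  moreover have "- 2 * Re (cnj (chi a - chi b) * layer j x)
      \<le> r * amp j x * (2 * Re (cis (phase j x) * K)) + r * amp j x * (512 * real j ^ 6 / \<gamma> j)"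
    using layer_main_term[OF j x] unfolding K_def[symmetric] z_def[symmetric] by (simp add: abs_le_iff algebra_simps)
  ultimately show ?thesis by (simp only: distrib_left)
qed

end

section \<open>The dominant layers\<close>

context barrier_race
begin

text \<open>The loss of layer j against x^\<sigma> on the logarithmic scale, about L / j^8 + j^8. By
  the inequality of the means it is smallest at j^16 = L, with value 2 sqrt L, which is 2 P^32 for L
  = P^64.\<close>

definition decay :: "nat \<Rightarrow> real \<Rightarrow> real" where "decay j L = L * d j + ln (\<gamma> j)"

lemma amp_eq: assumes "j0 \<le> j" shows "amp j (exp L) = exp (\<sigma> * L) * exp (- decay j L)"
proof -
  have g: "0 < \<gamma> j" using gamma_ge[of j] assms j0 by simp
  have "amp j (exp L) = exp ((\<sigma> - d j) * L) / exp (ln (\<gamma> j))" using g by (simp add: amp_def powr_def)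
  also have "\<dots> = exp ((\<sigma> - d j) * L - ln (\<gamma> j))" by (simp only: exp_diff)
  also have "(\<sigma> - d j) * L - ln (\<gamma> j) = \<sigma> * L + (- decay j L)" by (simp add: decay_def algebra_simps)
  finally show ?thesis by (simp only: exp_add)
qed

lemma amp_range:
  assumes "j0 \<le> j" "0 < X" "X \<le> x" "x \<le> 2 * X"
  shows "amp j X \<le> amp j x" "amp j x \<le> 2 * amp j X"
proof -
  have s: "0 < \<sigma> - d j" "\<sigma> - d j < 1" using Re_pt_range[OF assms(1), of 1] sigma_range by (auto simp: Re_pt)
  have g: "0 < \<gamma> j" using gamma_ge[of j] assms j0 by simp
  show "amp j X \<le> amp j x" using s g assms by (auto simp: amp_def intro!: divide_right_mono powr_mono2)
  have "x powr (\<sigma> - d j) \<le> (2 * X) powr (\<sigma> - d j)" using s assms by (intro powr_mono2) auto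
  also have "\<dots> = 2 powr (\<sigma> - d j) * X powr (\<sigma> - d j)" using assms by (simp add: powr_mult)
  also have "\<dots> \<le> 2 powr 1 * X powr (\<sigma> - d j)" using s by (intro mult_right_mono powr_mono) auto
  finally show "amp j x \<le> 2 * amp j X" using g by (simp add: amp_def divide_right_mono)
qed

lemma ln_gamma_range:
  assumes "1 \<le> j" shows "real j ^ 8 \<le> ln (\<gamma> j)" "ln (\<gamma> j) \<le> 1 + real j ^ 8"
proof -
  have g: "0 < \<gamma> j" using gamma_ge[OF assms] by simp
  show "real j ^ 8 \<le> ln (\<gamma> j)" using gamma_bounds(1)[OF assms] g by (subst ln_ge_iff) auto
  have "ln (\<gamma> j) \<le> ln (2 * exp (real j ^ 8))" using gamma_bounds(2)[OF assms] g by simp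
  also have "\<dots> = ln 2 + real j ^ 8" by (simp add: ln_mult)
  also have "ln (2::real) \<le> 1" using ln_le_minus_one[of 2] by simp
  finally show "ln (\<gamma> j) \<le> 1 + real j ^ 8" by simp
qed

text \<open>With R = P^4 the tolerance of \<open>d j\<close> costs R^7, rounding j up by at most 1
  costs 255 R^7 in j^8 (the binomial coefficients other than the leading one sum to 255), and the
  factor 2 allowed in \<gamma> costs another 1; altogether 257 R^7.\<close>

lemma decay_dominant_upper:
  fixes P :: real
  assumes P: "1 \<le> P" and j: "j0 \<le> j" "P ^ 4 \<le> real j" "real j \<le> P ^ 4 + 1"
  shows "decay j (P ^ 64) \<le> 2 * P ^ 32 + 257 * P ^ 28"
proof -
  define R where "R = P ^ 4"
  have R: "1 \<le> R" using P by (simp add: R_def)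
  have Rp: "R ^ 7 = P ^ 28" "R ^ 8 = P ^ 32" "R ^ 16 = P ^ 64" by (simp_all add: R_def flip: power_mult)
  have j1: "1 \<le> j" using j j0 by simp
  have Rj: "R \<le> real j" "real j \<le> R + 1" using j by (simp_all add: R_def)
  have "d j \<le> 1 / real j ^ 8 + 1 / real j ^ 9" using d_bound[OF j1] by (simp add: abs_le_iff)
  also have "\<dots> \<le> 1 / R ^ 8 + 1 / R ^ 9"
    using Rj R by (intro add_mono divide_left_mono power_mono mult_pos_pos) auto
  finally have "R ^ 16 * d j \<le> R ^ 16 * (1 / R ^ 8 + 1 / R ^ 9)" using R by (intro mult_left_mono) auto
  also have "\<dots> = R ^ 8 + R ^ 7"
    using power_diff[of R 8 16] power_diff[of R 9 16] R by (simp add: distrib_left)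
  finally have 1: "R ^ 16 * d j \<le> R ^ 8 + R ^ 7" .
  have "real j ^ 8 \<le> (R + 1) ^ 8" using Rj by (intro power_mono) auto
  also have "(R + 1) ^ 8 = R ^ 8 + 8 * R ^ 7 + 28 * R ^ 6 + 56 * R ^ 5 + 70 * R ^ 4 + 56 * R ^ 3 + 28 * R ^ 2 + 8 * R + 1"
    by (simp add: eval_nat_numeral algebra_simps)
  also have "\<dots> \<le> R ^ 8 + 255 * R ^ 7"
  proof -
    have "R ^ n \<le> R ^ 7" if "n \<le> 7" for n using that R by (intro power_increasing) auto
    from this[of 6] this[of 5] this[of 4] this[of 3] this[of 2] this[of 1] this[of 0] show ?thesis by simp
  qed
  finally have 2: "ln (\<gamma> j) \<le> 1 + R ^ 8 + 255 * R ^ 7" using ln_gamma_range(2)[OF j1] by linarith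
  have "1 \<le> R ^ 7" using R by (rule one_le_power)
  thus ?thesis using 1 2 unfolding decay_def Rp[symmetric] by linarith
qed

text \<open>With v = (j/R)^8 the loss is about R^8 (1/v + v), and 1/v + v exceeds 2 by (1 - v)^2 /
  v. Outside the window |1 - v| is at least 1 / (12 P), so the excess is at least R^7 P^2 / 288. For
  P >= 300 this covers both the 4 R^7 lost to the tolerance of \<open>d j\<close> and the required
  258 R^7.\<close>

lemma decay_far_lower:
  fixes P :: real
  assumes P: "300 \<le> P" and j: "10 \<le> j" "1 / P < \<bar>P ^ 64 / real j ^ 16 - 1\<bar>"
  shows "2 * P ^ 32 + 258 * P ^ 28 \<le> decay j (P ^ 64)"
proof -
  define R where "R = P ^ 4"
  have PP: "300 * 300 \<le> P * P" using P by (intro mult_mono) auto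
  have "90000 * 1 \<le> P ^ 2 * P ^ 2" using PP P by (intro mult_mono) (auto simp: power2_eq_square)
  hence R: "90000 \<le> R" by (simp add: R_def flip: power_add)
  have Rp: "R ^ 7 = P ^ 28" "R ^ 8 = P ^ 32" "R ^ 16 = P ^ 64" by (simp_all add: R_def flip: power_mult)
  have R87: "90000 * R ^ 7 \<le> R ^ 8"
  proof -
    have "R ^ 8 = R * R ^ 7" by (simp flip: power_Suc)
    thus ?thesis using R by simp
  qed
  define y where "y = real j"
  have y: "10 \<le> y" using j by (simp add: y_def)
  define v where "v = y ^ 8 / R ^ 8"
  have v: "0 < v" using y R by (simp add: v_def)
  have j1: "1 \<le> j" using j by simp
  have yv: "y ^ 8 = v * R ^ 8" using R by (simp add: v_def)
  have "1 / y ^ 8 - 1 / y ^ 9 \<le> d j" using d_bound[OF j1] by (simp add: abs_le_iff y_def)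
  moreover have "1 / y ^ 8 - 1 / y ^ 9 = (1 - 1 / y) / y ^ 8"
    using y by (simp add: field_simps eval_nat_numeral)
  ultimately have "R ^ 16 * ((1 - 1 / y) / y ^ 8) \<le> R ^ 16 * d j" using R by (intro mult_left_mono) auto
  moreover have "R ^ 16 * ((1 - 1 / y) / y ^ 8) = R ^ 8 * ((1 - 1 / y) / v)"
  proof -
    have "R ^ 16 = R ^ 8 * R ^ 8" by (simp flip: power_add)
    thus ?thesis using R v by (simp only: yv) (simp add: field_simps)
  qed
  moreover have "v * R ^ 8 \<le> ln (\<gamma> j)" using ln_gamma_range(1)[OF j1] yv by (simp add: y_def)
  ultimately have low: "R ^ 8 * ((1 - 1 / y) / v + v) \<le> decay j (P ^ 64)"
    unfolding decay_def Rp[symmetric] by (simp add: algebra_simps)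
  have crude: ?thesis if "23/10 \<le> (1 - 1 / y) / v + v"
  proof -
    have "R ^ 8 * (23/10) \<le> R ^ 8 * ((1 - 1 / y) / v + v)" using that R by (intro mult_left_mono) auto
    moreover have "0 \<le> R ^ 7" using R by simp
    ultimately show ?thesis using low R87 unfolding Rp[symmetric] by linarith
  qed
  have y9: "9/10 \<le> 1 - 1 / y" using y by (simp add: field_simps)
  have "(9/10) / v \<le> (1 - 1 / y) / v" using y9 v by (intro divide_right_mono) auto
  hence half: ?thesis if "23/10 * v \<le> 9/10 + v * v"
  proof -
    have "23/10 \<le> (9/10 + v * v) / v" using that v by (simp add: le_divide_eq)
    also have "\<dots> = (9/10) / v + v" using v by (simp add: add_divide_distrib)
    finally show ?thesis using crude \<open>(9/10) / v \<le> (1 - 1 / y) / v\<close> by linarith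
  qed
  \<comment> \<open>Outside [1/2, 2] the value 23/10 is reached. The surplus 3/10 over the minimum 2
    is worth far more than 258 R^7, since R is at least 90000.\<close>
  consider "v < 1/2" | "2 < v" | "1/2 \<le> v" "v \<le> 2" by linarith
  thus ?thesis
  proof cases
    case 1
    have "0 \<le> (1/2 - v) * (9/5 - v)" using 1 by (intro mult_nonneg_nonneg) auto
    moreover have "(1/2 - v) * (9/5 - v) = 9/10 + v * v - 23/10 * v" by (simp add: field_simps)
    ultimately show ?thesis by (intro half) linarith
  next
    case 2
    have "0 \<le> (v - 2) * (v - 3/10)" using 2 by (intro mult_nonneg_nonneg) auto
    moreover have "(v - 2) * (v - 3/10) = 6/10 + v * v - 23/10 * v" by (simp add: field_simps)
    ultimately show ?thesis by (intro half) linarith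
  next
    case 3
    have "(R / 2) ^ 8 \<le> y ^ 8"
    proof -
      have "R ^ 8 / 256 \<le> R ^ 8 * v" using 3 R mult_left_mono[of "1/256" v "R ^ 8"] by simp
      thus ?thesis by (simp add: yv power_divide mult.commute)
    qed
    hence yR: "R / 2 \<le> y" by (rule power_mono_iff[THEN iffD1, rotated 3]) (use y R in auto)
    have "1 / (y * v) \<le> 1 / ((R / 2) * (1/2))" using yR 3 R y by (intro divide_left_mono mult_mono mult_pos_pos) auto
    hence s: "(1 - 1 / y) / v \<ge> 1 / v - 4 / R" by (simp add: diff_divide_distrib)
    have "P ^ 64 / real j ^ 16 = 1 / v\<^sup>2"
    proof -
      have "real j ^ 16 = (y ^ 8)\<^sup>2" by (simp add: y_def flip: power_mult)
      also have "\<dots> = v\<^sup>2 * R ^ 16" by (simp add: yv power_mult_distrib flip: power_mult)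
      finally show ?thesis using R by (simp add: Rp(3)[symmetric])
    qed
    hence far: "1 / P < \<bar>1 / v\<^sup>2 - 1\<bar>" using j(2) by simp
    have "1 / v\<^sup>2 - 1 = (1 - v) * ((1 + v) / v\<^sup>2)" using v by (simp add: field_simps power2_eq_square)
    hence "\<bar>1 / v\<^sup>2 - 1\<bar> = \<bar>1 - v\<bar> * ((1 + v) / v\<^sup>2)" using v by (simp add: abs_mult)
    also have "\<dots> \<le> \<bar>1 - v\<bar> * (3 / (1/2)\<^sup>2)" using 3 by (intro mult_left_mono frac_le power_mono) auto
    finally have "1 / P < 12 * \<bar>1 - v\<bar>" using far by (simp add: power2_eq_square)
    hence "1 / (12 * P) \<le> \<bar>1 - v\<bar>" by simp
    hence "(1 / (12 * P))\<^sup>2 \<le> \<bar>1 - v\<bar>\<^sup>2" using P by (intro power_mono) auto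
    hence sq: "1 / (144 * P\<^sup>2) \<le> (1 - v)\<^sup>2" by (simp add: power_divide power_mult_distrib)
    have "1 / v + v = 2 + (1 - v)\<^sup>2 / v" using v by (simp add: field_simps power2_eq_square)
    moreover have "(1 - v)\<^sup>2 / 2 \<le> (1 - v)\<^sup>2 / v" using 3 v by (intro divide_left_mono) auto
    ultimately have "2 + 1 / (288 * P\<^sup>2) - 4 / R \<le> (1 - 1 / y) / v + v" using sq s by simp
    hence "R ^ 8 * (2 + 1 / (288 * P\<^sup>2) - 4 / R) \<le> R ^ 8 * ((1 - 1 / y) / v + v)" using R by (intro mult_left_mono) auto
    moreover have "R ^ 8 * (2 + 1 / (288 * P\<^sup>2) - 4 / R) = 2 * R ^ 8 + R ^ 7 * (P\<^sup>2 / 288) - 4 * R ^ 7"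
    proof -
      have "R / (288 * P\<^sup>2) = P\<^sup>2 / 288" using P power_diff[of P 2 4] by (simp add: R_def)
      hence "R * (2 + 1 / (288 * P\<^sup>2) - 4 / R) = 2 * R + P\<^sup>2 / 288 - 4"
        using R by (simp add: right_diff_distrib distrib_left)
      moreover have R8: "R ^ 8 = R ^ 7 * R" by (simp add: eval_nat_numeral)
      ultimately have "R ^ 8 * (2 + 1 / (288 * P\<^sup>2) - 4 / R) = R ^ 7 * (2 * R + P\<^sup>2 / 288 - 4)"
        by (simp only: mult.assoc)
      thus ?thesis unfolding R8 by (simp only: right_diff_distrib distrib_left mult_ac)
    qed
    moreover have "R ^ 7 * 262 \<le> R ^ 7 * (P\<^sup>2 / 288)"
      using PP R by (intro mult_left_mono) (auto simp: power2_eq_square)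
    ultimately show ?thesis using low unfolding Rp[symmetric] by linarith
  qed
qed

text \<open>For small j the estimate of \<open>d j\<close> from its tolerance is too weak, and for j
  = 1 it gives only 0. These finitely many indices have a positive minimal \<open>d j\<close>, which
  makes their loss linear in P^64.\<close>

lemma eventually_far_gap:
  "eventually (\<lambda>P. \<forall>j\<ge>j0. 1 / P < \<bar>P ^ 64 / real j ^ 16 - 1\<bar> \<longrightarrow>
      2 * P ^ 32 + 258 * P ^ 28 \<le> decay j (P ^ 64)) at_top"
proof -
  \<comment> \<open>The inserted 1 is a default value that keeps the set nonempty when
    \<open>j0\<close> is 10 or more.\<close>
  define dm where "dm = Min (insert 1 (d ` {j0..<10}))"
  have dm: "0 < dm" unfolding dm_def by (subst Min_gr_iff) (use d_range in auto)
  have dle: "dm \<le> d j" if "j0 \<le> j" "j < 10" for j unfolding dm_def using that by (intro Min_le) auto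
  have "eventually (\<lambda>P::real. 2 * P ^ 32 + 258 * P ^ 28 \<le> P ^ 64 * dm) at_top"
    using dm by real_asymp
  moreover have "eventually (\<lambda>P::real. 300 \<le> P) at_top" by (rule eventually_ge_at_top)
  ultimately show ?thesis
  proof eventually_elim
    case (elim P)
    show ?case
    proof (intro allI impI)
      fix j assume j: "j0 \<le> j" "1 / P < \<bar>P ^ 64 / real j ^ 16 - 1\<bar>"
      show "2 * P ^ 32 + 258 * P ^ 28 \<le> decay j (P ^ 64)"
      proof (cases "10 \<le> j")
        case True thus ?thesis using decay_far_lower elim j by blast
      next
        case False
        have j1: "1 \<le> j" using j j0 by simp
        have "P ^ 64 * dm \<le> P ^ 64 * d j" using dle[of j] j False elim by (intro mult_left_mono) auto
        moreover have "0 \<le> ln (\<gamma> j)" using ln_gamma_range(1)[OF j1] by (rule order_trans[rotated]) simp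
        ultimately show ?thesis using elim(1) unfolding decay_def by linarith
      qed
    qed
  qed
qed

lemma dominant_index_near:
  fixes P :: real
  assumes P: "300 \<le> P" and j: "P ^ 4 \<le> real j" "real j \<le> P ^ 4 + 1"
  shows "\<bar>P ^ 64 / real j ^ 16 - 1\<bar> \<le> 1 / P"
proof -
  define R where "R = P ^ 4"
  have R: "P \<le> R" using P by (simp add: R_def self_le_power)
  have R0: "0 < R" "0 < real j" using R P j by (auto simp: R_def intro: less_le_trans)
  define z where "z = R / real j"
  have z1: "z \<le> 1" "0 \<le> z" using j R0 by (simp_all add: z_def R_def)
  have zb: "1 - 1 / R \<le> z"
  proof -
    have "R / (R + 1) \<le> z" unfolding z_def using j R0 by (intro divide_left_mono) (auto simp: R_def)
    moreover have "1 - 1 / R \<le> R / (R + 1)" using R0 by (simp add: field_simps)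
    ultimately show ?thesis by linarith
  qed
  have R1: "1 / R \<le> 1" using R P by simp
  have "1 + real 16 * (- (1 / R)) \<le> (1 + - (1 / R)) ^ 16" by (rule Bernoulli_inequality) (use R1 in simp)
  also have "\<dots> \<le> z ^ 16" using zb R1 by (intro power_mono) auto
  finally have "1 - 16 / R \<le> z ^ 16" by simp
  moreover have "16 / R \<le> 1 / P"
  proof -
    have "16 * P \<le> P ^ 3 * P" using P power_increasing[of 1 3 P] by (intro mult_right_mono) auto
    also have "P ^ 3 * P = R" by (simp add: R_def eval_nat_numeral)
    finally show ?thesis using P R0 by (simp add: field_simps)
  qed
  moreover have "z ^ 16 \<le> 1" using z1 by (simp add: power_le_one)
  moreover have "P ^ 64 / real j ^ 16 = z ^ 16" by (simp add: z_def R_def power_divide flip: power_mult)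
  ultimately show ?thesis by (simp add: abs_le_iff)
qed

lemma near_index_range:
  fixes P :: real
  assumes P: "300 \<le> P" and j: "1 \<le> j" "\<bar>P ^ 64 / real j ^ 16 - 1\<bar> \<le> 1 / P"
  shows "P ^ 4 / 2 \<le> real j" "real j \<le> 2 * P ^ 4"
proof -
  have j16: "0 < real j ^ 16" using j by simp
  have "1 / P \<le> 1 / 2" using P by simp
  hence b: "1/2 \<le> P ^ 64 / real j ^ 16" "P ^ 64 / real j ^ 16 \<le> 3/2" using j(2) by linarith+
  have "(P ^ 4 / 2) ^ 16 \<le> real j ^ 16"
  proof -
    have "P ^ 64 \<le> 3/2 * real j ^ 16" using b(2) j16 by (simp add: divide_le_eq)
    hence "P ^ 64 / 65536 \<le> real j ^ 16" using j16 by linarith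
    thus ?thesis by (simp add: power_divide flip: power_mult)
  qed
  thus "P ^ 4 / 2 \<le> real j" by (rule power_le_imp_le_base[of _ 15, simplified]) simp
  have "real j ^ 16 \<le> (2 * P ^ 4) ^ 16"
  proof -
    have "real j ^ 16 \<le> 2 * P ^ 64" using b(1) j16 by (simp add: le_divide_eq)
    also have "\<dots> \<le> 65536 * P ^ 64" by simp
    finally show ?thesis by (simp add: power_mult_distrib flip: power_mult)
  qed
  thus "real j \<le> 2 * P ^ 4" by (rule power_le_imp_le_base[of _ 15, simplified]) simp
qed

text \<open>The tolerance j^-17 of \<theta> times ln x, which is at most about 2 j^16, is O(1/j).
  The tuned part of \<theta> misses its target by at most 5 times the relative width of the window.
  Since j exceeds P, the total is at most 13/P.\<close>

lemma near_phase_bound: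
  fixes P :: real
  assumes P: "300 \<le> P" and j: "j0 \<le> j" "\<bar>P ^ 64 / real j ^ 16 - 1\<bar> \<le> 1 / P"
    and x: "exp (P ^ 64) \<le> x" "x \<le> 2 * exp (P ^ 64)"
  shows "\<bar>phase j x\<bar> \<le> 20 / P"
proof -
  have j1: "1 \<le> j" using j j0 by simp
  define w where "w = \<xi> - pi / 2"
  have w: "\<bar>w\<bar> \<le> 5" unfolding w_def using xi_range pi_less_16_5 by (auto simp: abs_le_iff)
  define L where "L = P ^ 64"
  have x0: "0 < x" using x(1) exp_gt_zero less_le_trans by blast
  have lx: "L \<le> ln x" "ln x \<le> L + 1"
  proof -
    show "L \<le> ln x" using x x0 by (subst ln_ge_iff) (auto simp: L_def)
    have "ln x \<le> ln (2 * exp L)" using x x0 by (simp add: L_def)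
    also have "\<dots> = ln 2 + L" by (simp add: ln_mult)
    finally show "ln x \<le> L + 1" using ln_le_minus_one[of 2] by simp
  qed
  have L0: "0 \<le> L" using P by (simp add: L_def)
  have jP: "P \<le> real j"
  proof -
    have "P * 2 \<le> P * P ^ 3" using P power_increasing[of 1 3 P] by (intro mult_left_mono) auto
    also have "P * P ^ 3 = P ^ 4" by (simp add: eval_nat_numeral)
    finally show ?thesis using near_index_range(1)[OF P j1 j(2)] by linarith
  qed
  have jr: "1 \<le> real j" using j1 by simp
  have small: "1 / real j ^ n \<le> 1 / P" if "1 \<le> n" for n
  proof -
    have "P \<le> real j ^ n" using jP power_increasing[OF that jr] by (simp only: power_one_right)
    thus ?thesis using P jr by (intro divide_left_mono) auto
  qed
  have j16: "0 < real j ^ 16" using j1 by simp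
  have L16: "L / real j ^ 16 \<le> 2"
    using j(2) P unfolding L_def abs_le_iff by (smt (verit) divide_le_eq_1_pos)
  have "phase j x = (\<theta> j - w / real j ^ 16) * ln x + w * (ln x / real j ^ 16 - 1)"
    by (simp add: phase_def w_def algebra_simps)
  also have "\<bar>\<dots>\<bar> \<le> 1 / real j ^ 17 * (L + 1) + 5 * (1 / P + 1 / real j ^ 16)"
  proof (rule order_trans[OF abs_triangle_ineq add_mono])
    show "\<bar>(\<theta> j - w / real j ^ 16) * ln x\<bar> \<le> 1 / real j ^ 17 * (L + 1)"
      unfolding abs_mult using theta_bound[OF j1] lx L0 by (intro mult_mono) (auto simp: w_def)
    have "L / real j ^ 16 \<le> ln x / real j ^ 16" "ln x / real j ^ 16 \<le> (L + 1) / real j ^ 16"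
      using lx by (auto intro!: divide_right_mono)
    hence "\<bar>ln x / real j ^ 16 - 1\<bar> \<le> 1 / P + 1 / real j ^ 16"
      using j(2) j16 unfolding L_def[symmetric] abs_le_iff by (auto simp: add_divide_distrib)
    thus "\<bar>w * (ln x / real j ^ 16 - 1)\<bar> \<le> 5 * (1 / P + 1 / real j ^ 16)"
      unfolding abs_mult using w by (intro mult_mono) auto
  qed
  also have "1 / real j ^ 17 * (L + 1) = L / real j ^ 16 * (1 / real j ^ 1) + 1 / real j ^ 17"
    using j1 by (simp add: field_simps eval_nat_numeral)
  also have "L / real j ^ 16 * (1 / real j ^ 1) \<le> 2 * (1 / P)"
    using L16 small[of 1] L0 by (intro mult_mono) auto
  finally have "\<bar>phase j x\<bar> \<le> 2 * (1 / P) + 1 / real j ^ 17 + 5 * (1 / P + 1 / real j ^ 16)" by simp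
  also have "\<dots> \<le> 2 * (1 / P) + 1 / P + 5 * (1 / P + 1 / P)"
    using small[of 17] small[of 16] by (intro add_mono mult_left_mono) auto
  also have "\<dots> \<le> 20 / P" using P by (simp add: field_simps)
  finally show ?thesis .
qed

end

lemma ln_le_on_window:
  fixes x L :: real
  assumes "exp L \<le> x" "x \<le> 2 * exp L"
  shows "ln x \<le> L + 1" "L \<le> ln x"
proof -
  have x0: "0 < x" using assms(1) exp_gt_zero less_le_trans by blast
  show "L \<le> ln x" using assms x0 by (subst ln_ge_iff) auto
  have "ln x \<le> ln (2 * exp L)" using assms x0 by simp
  also have "\<dots> = ln 2 + L" by (simp add: ln_mult)
  finally show "ln x \<le> L + 1" using ln_le_minus_one[of 2] by simp
qed

section \<open>Negativity outside the exceptional set\<close>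

context barrier_race
begin

text \<open>With \<open>ln x = P ^ 64\<close> the amplitude \<open>amp j x\<close> is maximal for j around \<open>P ^ 4\<close>, where it is at
  least \<open>peak P\<close>.\<close>
definition near :: "real \<Rightarrow> nat \<Rightarrow> nat set" where
  "near P J = {j \<in> {j0..J}. \<bar>P ^ 64 / real j ^ 16 - 1\<bar> \<le> 1 / P}"

definition peak :: "real \<Rightarrow> real" where
  "peak P = exp (\<sigma> * P ^ 64 - (2 * P ^ 32 + 257 * P ^ 28))"

text \<open>The balance in units of r S: of the main term -1, resonance may take 1/8 and the
  corrections by 1/\<gamma> another 1/16, leaving -13/16. The phase errors take 160/1280 = 1/8,
  which leaves -11/16. Far layers and the error term take 1/16 each. The sum S is taken at X and not
  at x, so that the weights in Markov's inequality are constants; amplitudes grow at most by a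
  factor 2 on the window, which turns 80 into 160.\<close>

lemma race_diff_negative:
  fixes P C x X :: real
  assumes P: "1 \<le> P" and C: "0 < C" and X: "0 < X" and x: "X \<le> x" "x \<le> 2 * X" "2 \<le> x"
    and F: "F \<subseteq> {j0..J}"
    and formula: "\<bar>real unit_count * race_diff x * ln (real (nat \<lfloor>x\<rfloor>)) + 2 * Re (cnj (chi a - chi b) * zsum J x)\<bar>
       \<le> C * (1 + ln x) * (error_bound J c0 x + (\<Sum>j=j0..J. real j ^ 6 * x powr (\<sigma> - d j) / \<gamma> j ^ 2))"
    and J: "1 \<le> J"
    and D: "\<And>j. j \<in> F \<Longrightarrow> 2 / 2 ^ I < norm (1 - cis (\<gamma> j * ln x))"
    and I: "\<And>j. j \<in> F \<Longrightarrow> 8 * 4 ^ I \<le> real j ^ 3"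
    and phase: "\<And>j. j \<in> F \<Longrightarrow> \<bar>phase j x\<bar> \<le> 20 / P"
    and corr: "\<And>j. j \<in> F \<Longrightarrow> 16 * (512 * r + C * (1 + ln x)) * real j ^ 3 / \<gamma> j \<le> r"
    and S: "0 < S" "S = (\<Sum>j\<in>F. amp j X * real j ^ 3)"
    and avg: "(\<Sum>j\<in>F. amp j X * real j ^ 3 / norm (1 - cis (\<gamma> j * ln x))) < P * S / 1280"
    and far: "(\<Sum>j\<in>{j0..J} - F. amp j x * real j ^ 6 * (514 * r + C * (1 + ln x))) \<le> r / 16 * S"
    and err: "C * (1 + ln x) * error_bound J c0 x \<le> r / 16 * S"
  shows "race_diff x < 0"
proof -
  define c where "c = cnj (chi a - chi b)"
  define W where "W = C * (1 + ln x)"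
  have W: "0 < W" using C x(3) unfolding W_def by (intro mult_pos_pos add_pos_pos ln_gt_zero) auto
  define b where "b = (\<lambda>j. - 2 * Re (c * layer j x) + W * (real j ^ 6 * amp j x / \<gamma> j))"
  define Dn where "Dn = (\<lambda>j. norm (1 - cis (\<gamma> j * ln x)))"
  have r0: "0 < r" by (rule r_pos)
  have "c * zsum J x = (\<Sum>j=j0..J. c * layer j x)" unfolding zsum_layers[OF J] sum_distrib_left ..
  hence "- 2 * Re (c * zsum J x) = (\<Sum>j=j0..J. - 2 * Re (c * layer j x))"
    by (simp only: Re_sum sum_distrib_left)
  moreover have "W * (\<Sum>j=j0..J. real j ^ 6 * x powr (\<sigma> - d j) / \<gamma> j ^ 2)
      = (\<Sum>j=j0..J. W * (real j ^ 6 * amp j x / \<gamma> j))"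
    unfolding sum_distrib_left by (simp add: amp_def power2_eq_square)
  ultimately have "- 2 * Re (c * zsum J x) + W * (\<Sum>j=j0..J. real j ^ 6 * x powr (\<sigma> - d j) / \<gamma> j ^ 2)
      = sum b {j0..J}" unfolding b_def sum.distrib by simp
  moreover have "sum b {j0..J} = sum b ({j0..J} - F) + sum b F" by (rule sum.subset_diff) (use F in auto)
  moreover have "real unit_count * race_diff x * ln (real (nat \<lfloor>x\<rfloor>))
      \<le> - 2 * Re (c * zsum J x) + W * (\<Sum>j=j0..J. real j ^ 6 * x powr (\<sigma> - d j) / \<gamma> j ^ 2) + W * error_bound J c0 x"
  proof -
    have aux: "\<bar>u + 2 * z\<bar> \<le> W * (e + s) \<Longrightarrow> u \<le> - 2 * z + W * s + W * e" for u z e s :: real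
      by (simp add: abs_le_iff distrib_left)
    show ?thesis using formula unfolding W_def[symmetric] c_def[symmetric] by (rule aux)
  qed
  ultimately have total: "real unit_count * race_diff x * ln (real (nat \<lfloor>x\<rfloor>))
      \<le> sum b ({j0..J} - F) + sum b F + r / 16 * S" using err unfolding W_def[symmetric] by simp
  have "sum b ({j0..J} - F) \<le> (\<Sum>j\<in>{j0..J} - F. amp j x * real j ^ 6 * (514 * r + W))"
  proof (rule sum_mono)
    fix j assume j: "j \<in> {j0..J} - F"
    hence j': "j0 \<le> j" by simp
    have g: "1 \<le> \<gamma> j" using gamma_ge[of j] j' j0 by simp
    have "real j ^ 6 * amp j x / \<gamma> j \<le> real j ^ 6 * amp j x / 1"
      using g amp_nonneg[OF j'] by (intro divide_left_mono) auto
    hence "W * (real j ^ 6 * amp j x / \<gamma> j) \<le> W * (real j ^ 6 * amp j x / 1)"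
      using W by (intro mult_left_mono) auto
    moreover have "- 2 * Re (c * layer j x) \<le> r * amp j x * (514 * real j ^ 6)"
      unfolding c_def by (rule layer_trivial_bound[OF j']) (use x in simp)
    ultimately show "b j \<le> amp j x * real j ^ 6 * (514 * r + W)" unfolding b_def by (simp add: algebra_simps)
  qed
  hence far': "sum b ({j0..J} - F) \<le> r / 16 * S" using far unfolding W_def[symmetric] by linarith
  have "sum b F \<le> (\<Sum>j\<in>F. (160 * r / P) * (amp j X * real j ^ 3 / Dn j) - 13 / 16 * r * (amp j X * real j ^ 3))"
  proof (rule sum_mono)
    fix j assume j: "j \<in> F"
    hence j': "j0 \<le> j" using F by auto
    have g: "0 < \<gamma> j" using gamma_ge[of j] j' j0 by simp
    have Dj: "2 / 2 ^ I < Dn j" using D[OF j] by (simp add: Dn_def)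
    have D0: "0 < Dn j" using Dj by (rule order.strict_trans[rotated]) simp
    have "4 / Dn j ^ 2 \<le> 4 / (2 / 2 ^ I) ^ 2" using Dj D0 by (intro divide_left_mono power_mono mult_pos_pos) auto
    also have "\<dots> = 4 ^ I" by (simp add: power_divide power2_eq_square flip: power_mult_distrib)
    finally have 1: "4 / Dn j ^ 2 \<le> real j ^ 3 / 8" using I[OF j] by simp
    have "4 * \<bar>phase j x\<bar> * (real j ^ 3 / Dn j) \<le> 4 * (20 / P) * (real j ^ 3 / Dn j)"
      using phase[OF j] D0 by (intro mult_right_mono mult_left_mono) auto
    hence 2: "4 * \<bar>phase j x\<bar> * real j ^ 3 / Dn j \<le> 80 / P * (real j ^ 3 / Dn j)" by simp
    have 3: "(512 * r + W) * real j ^ 3 / \<gamma> j \<le> r / 16"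
    proof -
      have "16 * (512 * r + W) * real j ^ 3 / \<gamma> j = 16 * ((512 * r + W) * real j ^ 3 / \<gamma> j)"
        by (simp only: mult.assoc times_divide_eq_right)
      thus ?thesis using corr[OF j] unfolding W_def[symmetric] by linarith
    qed
    have "(512 * r + W) * real j ^ 3 / \<gamma> j * real j ^ 3 \<le> r / 16 * real j ^ 3"
      using 3 by (rule mult_right_mono) simp
    moreover have "(512 * r + W) * real j ^ 3 / \<gamma> j * real j ^ 3 = r * (512 * real j ^ 6 / \<gamma> j) + W * (real j ^ 6 / \<gamma> j)"
      by (simp add: algebra_simps add_divide_distrib eval_nat_numeral)
    ultimately have 4: "r * (512 * real j ^ 6 / \<gamma> j) + W * (real j ^ 6 / \<gamma> j) \<le> r / 16 * real j ^ 3" by (simp only:)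
    have "b j \<le> r * amp j x * (4 / Dn j ^ 2 - real j ^ 3 + 4 * \<bar>phase j x\<bar> * real j ^ 3 / Dn j + 512 * real j ^ 6 / \<gamma> j)
        + W * (real j ^ 6 * amp j x / \<gamma> j)"
      unfolding b_def c_def by (rule add_right_mono, rule layer_upper_bound[OF j']) (use x D0 in \<open>auto simp: Dn_def\<close>)
    also have "\<dots> = amp j x * (r * (4 / Dn j ^ 2 - real j ^ 3 + 4 * \<bar>phase j x\<bar> * real j ^ 3 / Dn j)
        + (r * (512 * real j ^ 6 / \<gamma> j) + W * (real j ^ 6 / \<gamma> j)))" by (simp add: algebra_simps)
    also have "\<dots> \<le> amp j x * (r * (real j ^ 3 / 8 - real j ^ 3 + 80 / P * (real j ^ 3 / Dn j)) + r / 16 * real j ^ 3)"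
      using 1 2 4 r0 amp_nonneg[OF j'] by (intro mult_left_mono add_mono diff_mono) auto
    also have "\<dots> = 80 * r / P * (real j ^ 3 / Dn j) * amp j x - 13 / 16 * r * real j ^ 3 * amp j x"
      by (simp add: algebra_simps)
    also have "\<dots> \<le> 80 * r / P * (real j ^ 3 / Dn j) * (2 * amp j X) - 13 / 16 * r * real j ^ 3 * amp j X"
      using amp_range[OF j' X x(1,2)] r0 P D0 by (intro diff_mono mult_left_mono) auto
    finally show "b j \<le> (160 * r / P) * (amp j X * real j ^ 3 / Dn j) - 13 / 16 * r * (amp j X * real j ^ 3)"
      by (simp add: mult_ac)
  qed
  also have "\<dots> = (160 * r / P) * (\<Sum>j\<in>F. amp j X * real j ^ 3 / Dn j) - 13 / 16 * r * S"
    unfolding sum_subtractf S(2) sum_distrib_left ..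
  also have "\<dots> \<le> (160 * r / P) * (P * S / 1280) - 13 / 16 * r * S"
    using avg r0 P unfolding Dn_def by (intro diff_right_mono mult_left_mono) auto
  also have "\<dots> = - (11 / 16) * (r * S)" using P by simp
  finally have near': "sum b F \<le> - (11 / 16) * (r * S)" .
  have "0 < r * S" using r0 S by simp
  moreover have "r / 16 * S = (1/16) * (r * S)" by simp
  ultimately have neg: "real unit_count * race_diff x * ln (real (nat \<lfloor>x\<rfloor>)) < 0" using total near' far' by linarith
  have "2 \<le> nat \<lfloor>x\<rfloor>" using x(3) by (simp add: le_nat_iff le_floor_iff)
  hence "0 < real unit_count * ln (real (nat \<lfloor>x\<rfloor>))" using unit_count_pos x(3) by (intro mult_pos_pos ln_gt_zero) auto
  thus ?thesis using neg by (metis mult.commute mult.left_commute mult_less_0_iff not_less_iff_gr_or_eq)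
qed

lemma peak_le_amp:
  assumes "1 \<le> P" "j0 \<le> j" "P ^ 4 \<le> real j" "real j \<le> P ^ 4 + 1"
  shows "peak P \<le> amp j (exp (P ^ 64))"
proof -
  have "peak P = exp (\<sigma> * P ^ 64) * exp (- (2 * P ^ 32 + 257 * P ^ 28))"
    unfolding peak_def exp_add[symmetric] by simp
  also have "\<dots> \<le> amp j (exp (P ^ 64))" unfolding amp_eq[OF assms(2)]
    using decay_dominant_upper[OF assms] by (intro mult_left_mono) auto
  finally show ?thesis .
qed

text \<open>The step from 257 to 258 in the exponents is a factor exp (-P^28), which beats the
  number of layers, the factor j^6 and the logarithm of x.\<close>

lemma eventually_far_layers_small:
  assumes C: "0 < C"
  shows "eventually (\<lambda>P. \<forall>J x. real J \<le> 3 * P ^ 8 \<longrightarrow> exp (P ^ 64) \<le> x \<longrightarrow> x \<le> 2 * exp (P ^ 64) \<longrightarrow>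
    (\<Sum>j\<in>{j0..J} - near P J. amp j x * real j ^ 6 * (514 * r + C * (1 + ln x))) \<le> r / 16 * peak P) at_top"
proof -
  define R where "R = r"
  have R: "0 < R" using r_pos by (simp add: R_def)
  have "eventually (\<lambda>P::real. (3 * P ^ 8 + 1) * (2 * (3 * P ^ 8) ^ 6 * (514 * R + C * (2 + P ^ 64))) * exp (- (P ^ 28)) \<le> R / 16) at_top"
    using R C by real_asymp
  moreover have "eventually (\<lambda>P::real. 1 \<le> P) at_top" by (rule eventually_ge_at_top)
  ultimately show ?thesis using eventually_far_gap
  proof eventually_elim
    case (elim P)
    show ?case
    proof (intro allI impI)
      fix J x assume J: "real J \<le> 3 * P ^ 8" and x: "exp (P ^ 64) \<le> x" "x \<le> 2 * exp (P ^ 64)"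
      define X where "X = exp (P ^ 64)"
      define e where "e = exp (\<sigma> * P ^ 64) * exp (- (2 * P ^ 32 + 258 * P ^ 28))"
      have e0: "0 < e" by (simp add: e_def)
      have lx: "ln x \<le> P ^ 64 + 1" "P ^ 64 \<le> ln x" using ln_le_on_window[OF x] by auto
      have P0: "0 \<le> P" "0 \<le> P ^ 64" using elim(2) by auto
      define w where "w = 2 * (3 * P ^ 8) ^ 6 * (514 * R + C * (2 + P ^ 64))"
      have w0: "0 \<le> w" unfolding w_def using P0 R C by simp
      have "(\<Sum>j\<in>{j0..J} - near P J. amp j x * real j ^ 6 * (514 * r + C * (1 + ln x)))
          \<le> (\<Sum>j\<in>{j0..J} - near P J. e * w)"
      proof (rule sum_mono)
        fix j assume j: "j \<in> {j0..J} - near P J"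
        hence j': "j0 \<le> j" "j \<le> J" by auto
        have "2 * P ^ 32 + 258 * P ^ 28 \<le> decay j (P ^ 64)"
          using elim(3) j by (auto simp: near_def)
        hence "amp j X \<le> e" unfolding X_def amp_eq[OF j'(1)] e_def by (intro mult_left_mono) auto
        hence "amp j x \<le> 2 * e" using amp_range(2)[OF j'(1), of X x] x by (simp add: X_def)
        moreover have "real j ^ 6 \<le> (3 * P ^ 8) ^ 6" using j' J by (intro power_mono) auto
        moreover have "514 * r + C * (1 + ln x) \<le> 514 * R + C * (2 + P ^ 64)"
          unfolding R_def using lx C by (intro add_left_mono mult_left_mono) auto
        moreover have "0 \<le> ln x" using lx P0 by linarith
        ultimately have "amp j x * real j ^ 6 * (514 * r + C * (1 + ln x))
            \<le> 2 * e * (3 * P ^ 8) ^ 6 * (514 * R + C * (2 + P ^ 64))"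
          using e0 C R P0 by (intro mult_mono mult_nonneg_nonneg add_nonneg_nonneg amp_nonneg j'(1)) auto
        thus "amp j x * real j ^ 6 * (514 * r + C * (1 + ln x)) \<le> e * w" by (simp add: w_def mult_ac)
      qed
      also have "\<dots> = real (card ({j0..J} - near P J)) * (e * w)" by simp
      also have "\<dots> \<le> (3 * P ^ 8 + 1) * (e * w)"
      proof (rule mult_right_mono)
        have "card ({j0..J} - near P J) \<le> card {0..J}" by (intro card_mono) auto
        thus "real (card ({j0..J} - near P J)) \<le> 3 * P ^ 8 + 1" using J by simp
      qed (use e0 w0 in simp)
      also have "\<dots> = (3 * P ^ 8 + 1) * w * exp (- (P ^ 28)) * peak P"
      proof -
        have "e = exp (- (P ^ 28)) * peak P" unfolding e_def peak_def exp_add[symmetric] by simp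
        thus ?thesis by simp
      qed
      also have "\<dots> \<le> R / 16 * peak P" using elim(1) unfolding w_def[symmetric]
        by (intro mult_right_mono) (auto simp: peak_def)
      finally show "(\<Sum>j\<in>{j0..J} - near P J. amp j x * real j ^ 6 * (514 * r + C * (1 + ln x))) \<le> r / 16 * peak P"
        by (simp add: R_def)
    qed
  qed
qed

text \<open>Passing from exponent \<sigma> to c0 saves a fixed multiple of P^64 in the exponent,
  whereas the peak loses only 2 P^32 + 257 P^28. As c0 is at least 1/2, the root from the prime
  powers is absorbed as well.\<close>

lemma eventually_error_small:
  assumes C: "0 < C" and c0: "1/2 \<le> c0" "c0 < \<sigma>"
  shows "eventually (\<lambda>P. \<forall>J x. 1 \<le> J \<longrightarrow> real J \<le> 3 * P ^ 8 \<longrightarrow> exp (P ^ 64) \<le> x \<longrightarrow> x \<le> 2 * exp (P ^ 64) \<longrightarrow>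
    C * (1 + ln x) * error_bound J c0 x \<le> r / 16 * peak P) at_top"
proof -
  define R where "R = r"
  have R: "0 < R" using r_pos by (simp add: R_def)
  define h where "h = \<sigma> - c0"
  have h: "0 < h" using c0 by (simp add: h_def)
  define Q where "Q = (\<lambda>P::real. C * (2 + P ^ 64) * ((1 + (3 * P ^ 8) ^ 10) * (20 + 9 * P ^ 8 + (3 * P ^ 8) ^ 8) ^ 2 * 2
      + 3 * (2 * (P ^ 64 + 1) + 1) * (P ^ 64 + 1) + (3 * P ^ 8) ^ 10))"
  have "eventually (\<lambda>P. Q P * exp (2 * P ^ 32 + 257 * P ^ 28 - h * P ^ 64) \<le> R / 16) at_top"
    unfolding Q_def using R C h by real_asymp
  moreover have "eventually (\<lambda>P::real. 1 \<le> P) at_top" by (rule eventually_ge_at_top)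
  ultimately show ?thesis
  proof eventually_elim
    case (elim P)
    show ?case
    proof (intro allI impI)
      fix J x assume J: "1 \<le> J" "real J \<le> 3 * P ^ 8" and x: "exp (P ^ 64) \<le> x" "x \<le> 2 * exp (P ^ 64)"
      define L where "L = P ^ 64"
      define K where "K = 3 * P ^ 8"
      have K: "1 \<le> K" "real J \<le> K" using J by (auto simp: K_def)
      have L1: "1 \<le> L" unfolding L_def using elim(2) by (rule one_le_power)
      have lx: "ln x \<le> L + 1" "L \<le> ln x" using ln_le_on_window[OF x] by (auto simp: L_def)
      have x0: "0 < x" using x(1) exp_gt_zero less_le_trans by blast
      have x1: "1 \<le> x" using x(1) L1 one_le_exp_iff[of "P ^ 64"] unfolding L_def by linarith
      have J0: "0 < real J" using J by simp
      have "ln (height J) = ln 16 + 3 * ln (real J) + real J ^ 8"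
        using J0 by (simp add: height_def ln_mult ln_realpow)
      also have "\<dots> \<le> 16 + 3 * K + K ^ 8"
        using ln_le_minus_one[of 16] ln_le_minus_one[of "real J"] J0 K
        by (intro add_mono mult_left_mono power_mono) auto
      finally have h2: "ln (height J) \<le> 20 + 3 * K + K ^ 8" by simp
      have h1: "0 \<le> ln (height J)"
      proof -
        have "1 * 1 * 1 \<le> 16 * real J ^ 3 * exp (real J ^ 8)" using J by (intro mult_mono) (auto simp: one_le_power)
        thus ?thesis by (simp add: height_def)
      qed
      define y where "y = exp (c0 * L)"
      have y1: "1 \<le> y" using L1 c0 by (simp add: y_def)
      have xc: "x powr c0 \<le> 2 * y"
      proof -
        have "x powr c0 \<le> (2 * exp L) powr c0" using x x0 c0 by (intro powr_mono2) (auto simp: L_def)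
        also have "\<dots> = 2 powr c0 * y" by (simp add: powr_mult exp_powr_real y_def mult.commute)
        also have "\<dots> \<le> 2 powr 1 * y" using c0 sigma_range y1 by (intro mult_right_mono powr_mono) auto
        finally show ?thesis by simp
      qed
      have "sqrt x = x powr (1/2)" using x0 by (simp add: powr_half_sqrt)
      also have "\<dots> \<le> x powr c0" using x1 c0 by (intro powr_mono) auto
      finally have sx: "sqrt x + 1 \<le> 3 * y" using xc y1 by linarith
      have lg: "log 2 x \<le> 2 * (L + 1)"
      proof -
        have "log 2 x = ln x / ln 2" by (simp add: log_def)
        also have "\<dots> \<le> ln x / (1/2)" using ln_le_minus_one[of "1/2"] lx L1 by (intro divide_left_mono) (auto simp: ln_div)
        finally show ?thesis using lx by simp
      qed
      have lg0: "0 \<le> log 2 x" using x1 by simp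
      have "error_bound J c0 x \<le> (1 + K ^ 10) * (20 + 3 * K + K ^ 8) ^ 2 * (2 * y)
          + 3 * y * (2 * (L + 1) + 1) * (L + 1) + K ^ 10 * y"
        unfolding error_bound_def
      proof (intro add_mono)
        show "(1 + real J ^ 10) * (ln (height J))\<^sup>2 * x powr c0 \<le> (1 + K ^ 10) * (20 + 3 * K + K ^ 8) ^ 2 * (2 * y)"
          using K h1 h2 xc by (intro mult_mono add_mono power_mono) auto
        show "(sqrt x + 1) * (log 2 x + 1) * ln x \<le> 3 * y * (2 * (L + 1) + 1) * (L + 1)"
          using sx lg lg0 lx L1 y1 x0 by (intro mult_mono) auto
        have "real J ^ 10 * 1 \<le> K ^ 10 * y" using K y1 by (intro mult_mono power_mono) auto
        thus "real J ^ 10 \<le> K ^ 10 * y" by simp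
      qed
      also have "\<dots> = ((1 + K ^ 10) * (20 + 3 * K + K ^ 8) ^ 2 * 2 + 3 * (2 * (L + 1) + 1) * (L + 1) + K ^ 10) * y"
        by (simp add: algebra_simps)
      finally have "C * (1 + ln x) * error_bound J c0 x \<le> C * (2 + L) *
          (((1 + K ^ 10) * (20 + 3 * K + K ^ 8) ^ 2 * 2 + 3 * (2 * (L + 1) + 1) * (L + 1) + K ^ 10) * y)"
        using C lx L1 K y1 by (intro mult_mono) (auto intro!: add_nonneg_nonneg mult_nonneg_nonneg simp: error_bound_def x0 less_imp_le x1)
      also have "\<dots> = Q P * y" unfolding Q_def L_def K_def by simp
      also have "y = exp (2 * P ^ 32 + 257 * P ^ 28 - h * P ^ 64) * peak P"
        unfolding y_def peak_def exp_add[symmetric] L_def h_def by (simp add: algebra_simps)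
      also have "Q P * (exp (2 * P ^ 32 + 257 * P ^ 28 - h * P ^ 64) * peak P) \<le> R / 16 * peak P"
        unfolding mult.assoc[symmetric] using elim(1) by (intro mult_right_mono) (auto simp: peak_def)
      finally show "C * (1 + ln x) * error_bound J c0 x \<le> r / 16 * peak P" by (simp add: R_def)
    qed
  qed
qed

text \<open>Near layers have j at least P^4 / 2, so \<gamma> j is at least exp (P^32 / 256), against
  polynomial factors in P.\<close>

lemma eventually_near_correction_small:
  assumes C: "0 < C"
  shows "eventually (\<lambda>P. \<forall>j x. j0 \<le> j \<longrightarrow> P ^ 4 / 2 \<le> real j \<longrightarrow> real j \<le> 2 * P ^ 4 \<longrightarrow>
    exp (P ^ 64) \<le> x \<longrightarrow> x \<le> 2 * exp (P ^ 64) \<longrightarrow>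
    16 * (512 * r + C * (1 + ln x)) * real j ^ 3 / \<gamma> j \<le> r) at_top"
proof -
  define R where "R = r"
  have R: "0 < R" using r_pos by (simp add: R_def)
  have "eventually (\<lambda>P::real. 16 * (512 * R + C * (2 + P ^ 64)) * (2 * P ^ 4) ^ 3 / exp ((P ^ 4 / 2) ^ 8) \<le> R) at_top"
    using R C by real_asymp
  moreover have "eventually (\<lambda>P::real. 1 \<le> P) at_top" by (rule eventually_ge_at_top)
  ultimately show ?thesis
  proof eventually_elim
    case (elim P)
    show ?case
    proof (intro allI impI)
      fix j x assume j: "j0 \<le> j" "P ^ 4 / 2 \<le> real j" "real j \<le> 2 * P ^ 4"
        and x: "exp (P ^ 64) \<le> x" "x \<le> 2 * exp (P ^ 64)"
      have lx: "ln x \<le> P ^ 64 + 1" "P ^ 64 \<le> ln x" using ln_le_on_window[OF x] by auto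
      have P0: "0 \<le> P" "0 \<le> P ^ 64" using elim(2) by auto
      have "exp ((P ^ 4 / 2) ^ 8) \<le> exp (real j ^ 8)" using j P0 by (subst exp_le_cancel_iff, intro power_mono) auto
      also have "\<dots> \<le> \<gamma> j" using gamma_bounds(1)[of j] j j0 by simp
      finally have g: "exp ((P ^ 4 / 2) ^ 8) \<le> \<gamma> j" .
      have l1: "0 \<le> 1 + ln x" using lx P0 by linarith
      have "16 * (512 * r + C * (1 + ln x)) * real j ^ 3 / \<gamma> j
          \<le> 16 * (512 * R + C * (2 + P ^ 64)) * (2 * P ^ 4) ^ 3 / exp ((P ^ 4 / 2) ^ 8)"
      proof -
        have 1: "512 * r + C * (1 + ln x) \<le> 512 * R + C * (2 + P ^ 64)"
          unfolding R_def using lx C by (intro add_left_mono mult_left_mono) auto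
        have 2: "0 \<le> 512 * r + C * (1 + ln x)" using l1 C by simp
        hence 3: "0 \<le> 512 * R + C * (2 + P ^ 64)" using 1 by linarith
        have "16 * (512 * r + C * (1 + ln x)) * real j ^ 3 \<le> 16 * (512 * R + C * (2 + P ^ 64)) * (2 * P ^ 4) ^ 3"
          using 1 3 j by (intro mult_mono power_mono mult_left_mono) auto
        thus ?thesis using g 3 P0 by (intro frac_le) auto
      qed
      thus "16 * (512 * r + C * (1 + ln x)) * real j ^ 3 / \<gamma> j \<le> r" using elim(1) by (simp add: R_def)
    qed
  qed
qed

end

section \<open>Density\<close>

lemma primes_pi_mono: "x \<le> y \<Longrightarrow> primes_pi x q a \<le> primes_pi y q a"
  unfolding primes_pi_def
proof (rule card_mono)
  have "{p. prime p \<and> real p \<le> y \<and> [p = a] (mod q)} \<subseteq> {..nat \<lfloor>y\<rfloor>}" by (auto simp: le_nat_floor)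
  thus "finite {p. prime p \<and> real p \<le> y \<and> [p = a] (mod q)}" by (rule finite_subset) simp
qed auto

lemma race_set_lmeasurable: "race_set q a b \<inter> {x..y} \<in> lmeasurable"
proof -
  have m: "(\<lambda>x. real (primes_pi x q c)) \<in> borel_measurable borel" for c
    by (intro borel_measurable_mono monoI) (simp add: primes_pi_mono)
  have "race_set q a b = {2..} \<inter> {x. real (primes_pi x q b) < real (primes_pi x q a)}"
    by (auto simp: race_set_def)
  also have "\<dots> \<in> sets borel"
    using borel_measurable_less[OF m m] by (intro sets.Int) auto
  finally have "race_set q a b \<in> sets lebesgue" by simp
  hence "race_set q a b \<inter> {x..y} \<in> sets lebesgue" by (intro sets.Int) auto
  thus ?thesis by (intro bounded_set_imp_lmeasurable bounded_subset[OF bounded_closed_interval, of _ x y]) auto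
qed

text \<open>Halving the interval repeatedly covers it by windows [Y, 2Y]. A bound e/4 Y for each
  reproduces the bound e/4 X after doubling, so the induction loses nothing; the initial part up to
  2 X0 contributes a constant.\<close>

lemma density_zero_of_dyadic_windows:
  fixes S :: "real set"
  assumes S: "\<And>x y. S \<inter> {x..y} \<in> lmeasurable"
    and small: "\<And>\<epsilon>. 0 < \<epsilon> \<Longrightarrow> eventually (\<lambda>X. measure lebesgue (S \<inter> {X..2 * X}) \<le> \<epsilon> * X) at_top"
  shows "((\<lambda>X. measure lebesgue (S \<inter> {c..X}) / X) \<longlongrightarrow> 0) at_top"
proof (rule tendstoI)
  fix e :: real assume e: "0 < e"
  obtain X0 where X0: "max 1 \<bar>c\<bar> \<le> X0" "\<And>X. X0 \<le> X \<Longrightarrow> measure lebesgue (S \<inter> {X..2 * X}) \<le> e / 4 * X"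
  proof -
    have "0 < e / 4" using e by simp
    from eventually_conj[OF small[OF this] eventually_ge_at_top[of "max 1 \<bar>c\<bar>"]]
    obtain N where N: "\<And>X. N \<le> X \<Longrightarrow> measure lebesgue (S \<inter> {X..2 * X}) \<le> e / 4 * X \<and> max 1 \<bar>c\<bar> \<le> X"
      unfolding eventually_at_top_linorder by blast
    show thesis by (rule that[of N]) (use N in auto)
  qed
  have X0': "1 \<le> X0" "- X0 \<le> c" using X0(1) by auto
  have base: "measure lebesgue (S \<inter> {c..X}) \<le> 3 * X0 + e / 4 * X" if "0 \<le> X" "X \<le> 2 * X0" for X
  proof -
    have "measure lebesgue (S \<inter> {c..X}) \<le> measure lebesgue {c..X}"
      using S by (intro measure_mono_fmeasurable) (auto dest: fmeasurableD)
    also have "\<dots> \<le> 3 * X0" using that X0' by (cases "c \<le> X") auto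
    finally show ?thesis using that e by (simp add: add_increasing2)
  qed
  have bound: "measure lebesgue (S \<inter> {c..X}) \<le> 3 * X0 + e / 4 * X" if "0 \<le> X" "X \<le> 2 ^ n * (2 * X0)" for n X
    using that
  proof (induction n arbitrary: X)
    case 0
    thus ?case using base by simp
  next
    case (Suc n)
    show ?case
    proof (cases "X \<le> 2 * X0")
      case True
      thus ?thesis using base Suc.prems by simp
    next
      case False
      define Y where "Y = X / 2"
      have Y: "X = 2 * Y" "X0 \<le> Y" "Y \<le> 2 ^ n * (2 * X0)" using False Suc.prems by (auto simp: Y_def)
      have "measure lebesgue (S \<inter> {c..X}) \<le> measure lebesgue (S \<inter> {c..Y} \<union> S \<inter> {Y..2 * Y})"
        using S by (intro measure_mono_fmeasurable fmeasurable.Un) (auto dest: fmeasurableD simp: Y(1))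
      also have "\<dots> \<le> measure lebesgue (S \<inter> {c..Y}) + measure lebesgue (S \<inter> {Y..2 * Y})"
        using S by (intro measure_Un_le) (auto dest: fmeasurableD)
      also have "\<dots> \<le> (3 * X0 + e / 4 * Y) + e / 4 * Y"
        using Suc.IH[of Y] Y X0' X0(2)[of Y] by (intro add_mono) auto
      finally show ?thesis by (simp add: Y(1))
    qed
  qed
  have "eventually (\<lambda>X. max 1 (12 * X0 / e) \<le> X) at_top" by (rule eventually_ge_at_top)
  thus "eventually (\<lambda>X. dist (measure lebesgue (S \<inter> {c..X}) / X) 0 < e) at_top"
  proof eventually_elim
    case (elim X)
    have X1: "1 \<le> X" "12 * X0 / e \<le> X" using elim by auto
    obtain n where "X < 2 ^ n" using real_arch_pow[of 2 X] by auto
    moreover have "2 ^ n * 1 \<le> 2 ^ n * (2 * X0)" using X0' by (intro mult_left_mono) auto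
    ultimately have "X \<le> 2 ^ n * (2 * X0)" by linarith
    hence "measure lebesgue (S \<inter> {c..X}) \<le> 3 * X0 + e / 4 * X" using X1 by (intro bound[of X n]) auto
    also have "3 * X0 \<le> e / 4 * X" using X1 e by (simp add: divide_le_eq mult.commute)
    also have "e / 4 * X + e / 4 * X < e * X" using e X1 by simp
    finally have "measure lebesgue (S \<inter> {c..X}) / X < e" using X1 by (simp add: divide_less_eq)
    thus ?case using X1 by simp
  qed
qed

context barrier_race
begin

text \<open>The exceptional set takes up a proportion O(ln P / P) of the window: O(1/P) for the
  narrow resonances, and the O(ln P) dyadic scales divided by the factor P in the threshold for the
  averages.\<close>

lemma eventually_race_diff_negative:
  assumes \<epsilon>: "0 < \<epsilon>"
  shows "eventually (\<lambda>P. \<exists>E\<in>lmeasurable. measure lebesgue E \<le> \<epsilon> * exp (P ^ 64) \<and>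
           (\<forall>x\<in>{exp (P ^ 64)..2 * exp (P ^ 64)} - E. race_diff x < 0)) at_top"
proof -
  \<comment> \<open>The abscissa of the moved contour must lie right of the zero-free boundary
    \<sigma> - \<delta> and strictly left of \<sigma>, where the layers live asymptotically.\<close>
  define c0 where "c0 = \<sigma> - \<delta> / 2"
  have c0: "\<sigma> - \<delta> < c0" "c0 < 1" "1/2 \<le> c0" "c0 < \<sigma>"
    unfolding c0_def using sigma_range delta_range by auto
  show ?thesis
  proof (rule race_diff_formula[OF c0(1,2)])
    fix C :: real
    assume C: "0 < C" and formula: "\<And>J x. 1 \<le> J \<Longrightarrow> 2 \<le> x \<Longrightarrow> (x + 1) ^ 3 \<le> height J \<Longrightarrow>
     \<bar>real unit_count * race_diff x * ln (real (nat \<lfloor>x\<rfloor>)) + 2 * Re (cnj (chi a - chi b) * zsum J x)\<bar>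
       \<le> C * (1 + ln x) * (error_bound J c0 x + (\<Sum>j=j0..J. real j ^ 6 * x powr (\<sigma> - d j) / \<gamma> j ^ 2))"
    have "eventually (\<lambda>P. 300 \<le> P \<and> 192 * (2 / P + (5 * ln P / ln 2 + 2) * 1280 / P) \<le> \<epsilon>
      \<and> real j0 \<le> P ^ 4 \<and> 27 * exp (3 * P ^ 64) \<le> exp ((2 * P ^ 8) ^ 8)
      \<and> 2 * P ^ 8 + 1 \<le> 3 * P ^ 8 \<and> P ^ 4 + 1 \<le> 2 * P ^ 8 \<and> 256 * P ^ 10 \<le> P ^ 12) at_top"
    proof (intro eventually_conj)
      show "eventually (\<lambda>P::real. 300 \<le> P) at_top" by (rule eventually_ge_at_top)
      show "eventually (\<lambda>P::real. 192 * (2 / P + (5 * ln P / ln 2 + 2) * 1280 / P) \<le> \<epsilon>) at_top"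
        using \<epsilon> by real_asymp
    qed real_asymp+
    moreover note eventually_far_layers_small[OF C] eventually_error_small[OF C c0(3,4)]
      eventually_near_correction_small[OF C]
    ultimately show ?thesis
    proof eventually_elim
      case (elim P)
      have P: "300 \<le> P" using elim by blast
      have P4: "1 \<le> P ^ 4" using P by (intro one_le_power) auto
      define X where "X = exp (P ^ 64)"
      have X0: "0 < X" by (simp add: X_def)
      have X1: "2 \<le> X" using exp_ge_add_one_self[of "P ^ 64"] one_le_power[of P 64] P unfolding X_def by linarith
      \<comment> \<open>Truncation far beyond the dominant layers: the height is then at least exp
        (256 P^64), more than the cube of x + 1 that the explicit formula asks for.\<close>
      define J where "J = nat \<lceil>2 * P ^ 8\<rceil>"
      \<comment> \<open>The first integer not below P^4 is a near-optimal layer; it alone shows that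
        the weighted sum \<open>S\<close> is at least the peak.\<close>
      define m where "m = nat \<lceil>P ^ 4\<rceil>"
      have J: "2 * P ^ 8 \<le> real J" "real J \<le> 3 * P ^ 8" using elim(1) P unfolding J_def by linarith+
      have m: "P ^ 4 \<le> real m" "real m \<le> P ^ 4 + 1" using P4 unfolding m_def by linarith+
      have mj: "j0 \<le> m" "m \<le> J" using elim(1) m J by linarith+
      have J1: "1 \<le> J" using mj j0 by simp
      define F where "F = near P J"
      have Fs: "F \<subseteq> {j0..J}" by (auto simp: F_def near_def)
      have fin: "finite F" using Fs by (rule finite_subset) simp
      have Fj: "j0 \<le> j" "1 \<le> j" "\<bar>P ^ 64 / real j ^ 16 - 1\<bar> \<le> 1 / P" if "j \<in> F" for j
        using that j0 by (auto simp: F_def near_def)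
      have Fr: "P ^ 4 / 2 \<le> real j" "real j \<le> 2 * P ^ 4" if "j \<in> F" for j
        using near_index_range[OF P Fj(2,3)[OF that]] by auto
      have mF: "m \<in> F" using dominant_index_near[OF P m] mj by (simp add: F_def near_def)
      define v where "v = (\<lambda>j. amp j X * real j ^ 3)"
      define S where "S = sum v F"
      have v0: "0 \<le> v j" if "j \<in> F" for j unfolding v_def using amp_nonneg[OF Fj(1)[OF that]] by simp
      have "peak P \<le> amp m X * 1"
        unfolding X_def using peak_le_amp[OF _ mj(1) m] P by simp
      also have "\<dots> \<le> v m" unfolding v_def
        using amp_nonneg[OF mj(1)] mj j0 by (intro mult_left_mono one_le_power) auto
      also have "\<dots> \<le> S" unfolding S_def using fin mF v0 by (intro member_le_sum) auto
      finally have pS: "peak P \<le> S" .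
      have "0 < peak P" by (simp add: peak_def)
      hence S0: "0 < S" using pS by linarith
      define t where "t = P * S / 1280"
      have t0: "0 < t" using S0 P by (simp add: t_def)
      \<comment> \<open>The choice 2^I of size P^5 balances two demands: at most 2 P^4 near layers
        must have resonances of total proportion O(1/P), and 4^I, of size P^10, must stay below j^3,
        which is at least P^12 / 8.\<close>
      define I where "I = nat \<lceil>log 2 (P ^ 5)\<rceil>"
      have lg: "log 2 (P ^ 5) = 5 * ln P / ln 2" using P by (simp add: log_def ln_realpow)
      have lg0: "0 \<le> log 2 (P ^ 5)" using one_le_power[of P 5] P by simp
      have I: "log 2 (P ^ 5) \<le> real I" "real I \<le> log 2 (P ^ 5) + 1" using lg0 unfolding I_def by linarith+
      have I2: "P ^ 5 \<le> 2 ^ I" "2 ^ I \<le> 2 * P ^ 5"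
      proof -
        have e: "2 powr log 2 (P ^ 5) = P ^ 5" using P by simp
        have "2 powr log 2 (P ^ 5) \<le> 2 powr real I" using I by (intro powr_mono) auto
        thus "P ^ 5 \<le> 2 ^ I" unfolding e by (simp add: powr_realpow)
        have "2 powr real I \<le> 2 powr (log 2 (P ^ 5) + 1)" using I by (intro powr_mono) auto
        thus "2 ^ I \<le> 2 * P ^ 5" unfolding powr_add e by (simp add: powr_realpow)
      qed
      have I4: "8 * 4 ^ I \<le> real j ^ 3" if "j \<in> F" for j
      proof -
        have "(2::real) ^ I * 2 ^ I \<le> (2 * P ^ 5) * (2 * P ^ 5)" using I2 P by (intro mult_mono) auto
        moreover have "(2::real) ^ I * 2 ^ I = 4 ^ I" "(2 * P ^ 5) * (2 * P ^ 5) = 4 * P ^ 10"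
          by (simp_all flip: power_mult_distrib) (simp add: eval_nat_numeral)
        ultimately have "8 * 4 ^ I \<le> 32 * P ^ 10" by linarith
        also have "\<dots> \<le> (P ^ 4 / 2) ^ 3" using elim(1) by (simp add: power_divide flip: power_mult)
        also have "\<dots> \<le> real j ^ 3" using Fr(1)[OF that] P by (intro power_mono) auto
        finally show ?thesis .
      qed
      have cardF: "real (card F) \<le> 2 * P ^ 4"
      proof -
        have "F \<subseteq> {1..nat \<lfloor>2 * P ^ 4\<rfloor>}"
        proof
          fix j assume j: "j \<in> F"
          thus "j \<in> {1..nat \<lfloor>2 * P ^ 4\<rfloor>}" using Fr(2)[OF j] Fj(2)[OF j] by (simp add: le_nat_floor)
        qed
        hence "card F \<le> card {1..nat \<lfloor>2 * P ^ 4\<rfloor>}" by (intro card_mono) auto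
        thus ?thesis using P4 by (simp add: le_nat_floor) linarith
      qed
      have g1: "1 \<le> \<gamma> j" if "j \<in> F" for j using gamma_ge[OF Fj(2)[OF that]] by simp
      show ?case
      proof (rule exceptional_set[of F \<gamma> v X t I, OF fin g1 v0 X0 t0])
        fix E
        assume E: "E \<in> lmeasurable"
          "measure lebesgue E \<le> 192 * X * (real (card F) / 2 ^ I + real (I + 1) * sum v F / t)"
          "\<And>x j. x \<in> {X..2 * X} \<Longrightarrow> x \<notin> E \<Longrightarrow> j \<in> F \<Longrightarrow> 2 / 2 ^ I < norm (1 - cis (\<gamma> j * ln x))"
          "\<And>x. x \<in> {X..2 * X} \<Longrightarrow> x \<notin> E \<Longrightarrow> (\<Sum>j\<in>F. v j / norm (1 - cis (\<gamma> j * ln x))) < t"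
        have "real (card F) / 2 ^ I \<le> 2 * P ^ 4 / P ^ 5" using cardF I2 P by (intro frac_le) auto
        also have "\<dots> = 2 / P" using P by (simp add: eval_nat_numeral)
        finally have e1: "real (card F) / 2 ^ I \<le> 2 / P" .
        have "real (I + 1) * sum v F / t = real (I + 1) * 1280 / P"
          unfolding S_def[symmetric] t_def using S0 P by simp
        also have "\<dots> \<le> (5 * ln P / ln 2 + 2) * 1280 / P"
          using I P unfolding lg by (intro divide_right_mono mult_right_mono) auto
        finally have "192 * (real (card F) / 2 ^ I + real (I + 1) * sum v F / t)
            \<le> 192 * (2 / P + (5 * ln P / ln 2 + 2) * 1280 / P)" using e1 by (intro mult_left_mono add_mono) auto
        also have "\<dots> \<le> \<epsilon>" using elim(1) by blast
        finally have "192 * (real (card F) / 2 ^ I + real (I + 1) * sum v F / t) * X \<le> \<epsilon> * X"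
          using X0 by (intro mult_right_mono) auto
        hence mE: "measure lebesgue E \<le> \<epsilon> * X" using E(2) by (simp add: mult_ac)
        have "race_diff x < 0" if x: "x \<in> {X..2 * X}" "x \<notin> E" for x
        proof (rule race_diff_negative[of P C X x F J c0 I S])
          have xx: "exp (P ^ 64) \<le> x" "x \<le> 2 * exp (P ^ 64)" using x by (simp_all add: X_def)
          show "1 \<le> P" using P by simp
          show "0 < C" "0 < X" "F \<subseteq> {j0..J}" "1 \<le> J" "0 < S" by fact+
          show "X \<le> x" "x \<le> 2 * X" using x by auto
          show x2: "2 \<le> x" using x X1 by simp
          have "(x + 1) ^ 3 \<le> (3 * X) ^ 3" using x X1 by (intro power_mono) auto
          also have "\<dots> = 27 * exp (3 * P ^ 64)"
            by (simp add: X_def power_mult_distrib exp_of_nat_mult[symmetric])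
          also have "\<dots> \<le> exp ((2 * P ^ 8) ^ 8)" using elim(1) by blast
          also have "\<dots> \<le> exp (real J ^ 8)" using J P by (subst exp_le_cancel_iff, intro power_mono) auto
          also have "\<dots> \<le> height J"
          proof -
            have "1 \<le> real J ^ 3" using J1 by (intro one_le_power) auto
            hence "1 \<le> 16 * real J ^ 3" by linarith
            hence "1 * exp (real J ^ 8) \<le> 16 * real J ^ 3 * exp (real J ^ 8)" by (intro mult_right_mono) auto
            thus ?thesis by (simp add: height_def)
          qed
          finally show "\<bar>real unit_count * race_diff x * ln (real (nat \<lfloor>x\<rfloor>)) + 2 * Re (cnj (chi a - chi b) * zsum J x)\<bar>
             \<le> C * (1 + ln x) * (error_bound J c0 x + (\<Sum>j=j0..J. real j ^ 6 * x powr (\<sigma> - d j) / \<gamma> j ^ 2))"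
            by (rule formula[OF J1 x2])
          fix j assume j: "j \<in> F"
          show "2 / 2 ^ I < norm (1 - cis (\<gamma> j * ln x))" using E(3)[OF x j] .
          show "8 * 4 ^ I \<le> real j ^ 3" using I4[OF j] .
          show "\<bar>phase j x\<bar> \<le> 20 / P" by (rule near_phase_bound[OF P Fj(1,3)[OF j] xx])
          show "16 * (512 * r + C * (1 + ln x)) * real j ^ 3 / \<gamma> j \<le> r"
            using elim(4) Fj(1)[OF j] Fr[OF j] xx by blast
        next
          have xx: "exp (P ^ 64) \<le> x" "x \<le> 2 * exp (P ^ 64)" using x by (simp_all add: X_def)
          show "S = (\<Sum>j\<in>F. amp j X * real j ^ 3)" by (simp add: S_def v_def)
          show "(\<Sum>j\<in>F. amp j X * real j ^ 3 / norm (1 - cis (\<gamma> j * ln x))) < P * S / 1280"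
            using E(4)[OF x] by (simp add: v_def t_def)
          have rS: "r / 16 * peak P \<le> r / 16 * S" using pS by (intro mult_left_mono) auto
          show "(\<Sum>j\<in>{j0..J} - F. amp j x * real j ^ 6 * (514 * r + C * (1 + ln x))) \<le> r / 16 * S"
            unfolding F_def using elim(2) J(2) xx rS order_trans by blast
          show "C * (1 + ln x) * error_bound J c0 x \<le> r / 16 * S"
            using elim(3) J1 J(2) xx rS order_trans by blast
        qed
        thus "\<exists>E\<in>lmeasurable. measure lebesgue E \<le> \<epsilon> * exp (P ^ 64) \<and>
           (\<forall>x\<in>{exp (P ^ 64)..2 * exp (P ^ 64)} - E. race_diff x < 0)"
          using E(1) mE unfolding X_def by blast
      qed
    qed
  qed
qed

lemma eventually_race_set_window_small:
  assumes \<epsilon>: "0 < \<epsilon>"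
  shows "eventually (\<lambda>X. measure lebesgue (race_set q a b \<inter> {X..2 * X}) \<le> \<epsilon> * X) at_top"
proof -
  \<comment> \<open>The estimates are stated for windows starting at exp (P^64); every large X has
    this form with P = (ln X)^(1/64), so all real windows are reached.\<close>
  have "filterlim (\<lambda>X::real. ln X powr (1/64)) at_top at_top" by real_asymp
  from eventually_compose_filterlim[OF eventually_race_diff_negative[OF \<epsilon>] this] eventually_gt_at_top[of 1]
  show ?thesis
  proof eventually_elim
    case (elim X)
    have "0 < ln X" using elim by simp
    hence "(ln X powr (1/64)) ^ 64 = ln X" by (simp flip: powr_realpow add: powr_powr)
    hence X: "exp ((ln X powr (1/64)) ^ 64) = X" using elim by simp
    from elim(1) obtain E where E: "E \<in> lmeasurable" "measure lebesgue E \<le> \<epsilon> * X"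
        "\<And>x. x \<in> {X..2 * X} - E \<Longrightarrow> race_diff x < 0" unfolding X by blast
    have "race_set q a b \<inter> {X..2 * X} \<subseteq> E"
      using E(3) by (force simp: race_set_def race_diff_def)
    hence "measure lebesgue (race_set q a b \<inter> {X..2 * X}) \<le> measure lebesgue E"
      using race_set_lmeasurable E(1) by (intro measure_mono_fmeasurable) (auto dest: fmeasurableD)
    thus ?case using E(2) by linarith
  qed
qed

end

theorem theorem1p1:
  fixes q a b :: nat and chi :: "nat \<Rightarrow> complex" and \<xi> \<sigma> \<delta> A :: real
    and B :: "complex \<Rightarrow> nat"
  assumes "3 \<le> q"
    and "coprime a q" and "coprime b q" and "\<not> [a = b] (mod q)"
    and "dirichlet_character q chi" and "chi \<noteq> principal_character q" and "chi a \<noteq> chi b"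
    and "\<xi> = Arg2pi (chi a - chi b)"
    and "1 / 2 < \<sigma>" and "\<sigma> < 1" and "0 < \<delta>" and "\<delta> < \<sigma> - 1 / 2" and "0 < A"
    and "is_barrier \<xi> \<sigma> \<delta> A B"
    and "\<And>\<rho>. 0 < B \<rho> \<Longrightarrow> dirichlet_L q chi \<rho> = 0 \<and> zorder (dirichlet_L q chi) \<rho> = int (B \<rho>)"
    and "\<And>s. \<lbrakk>\<sigma> - \<delta> \<le> Re s; 0 \<le> Im s; B s = 0\<rbrakk> \<Longrightarrow> dirichlet_L q chi s \<noteq> 0"
    and "\<And>chi' s. \<lbrakk>dirichlet_character q chi'; chi' \<noteq> principal_character q; chi' \<noteq> chi;
                 \<sigma> - \<delta> \<le> Re s; 0 \<le> Im s\<rbrakk> \<Longrightarrow> dirichlet_L q chi' s \<noteq> 0"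
  shows "((\<lambda>X. measure lebesgue (race_set q a b \<inter> {2..X}) / X) \<longlongrightarrow> 0) at_top"
proof -
  from assms(14) obtain \<gamma> d \<theta> j0 where bar: "barrier_parameters \<xi> \<gamma> d \<theta>" "1 \<le> j0"
      "\<And>j. j0 \<le> j \<Longrightarrow> A < \<gamma> j \<and> 0 < d j \<and> d j \<le> \<delta>" and B: "B = barrier_multiplicity \<sigma> \<gamma> d \<theta> j0"
    unfolding is_barrier_def by blast
  interpret barrier_race \<xi> \<sigma> \<delta> \<gamma> d \<theta> j0 q a b chi
    by unfold_locales (use assms bar Arg2pi[of "chi a - chi b"] in \<open>auto simp: B\<close>)
  show ?thesis
    by (rule density_zero_of_dyadic_windows[OF race_set_lmeasurable eventually_race_set_window_small])
qed

end
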